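(* Let $(\mathcal{S},D_{\mathcal{S}})$ be a normally inductive arrangement (NI arrangement) of circles, let $i\in\{1,2\}$, and consider the Poincaré-Reeb V-digraph $G_{D_{\mathcal{S}},i}$ of $(\mathcal{S},D_{\mathcal{S}})$ for $\pi_{2,1,i}$, with quotient map $q_{D_{\mathcal{S}},i}$. Then one can define a map $l_{(\mathcal{S},D_{\mathcal{S}}),i}$ on the disjoint union of the vertex set and the edge set of this graph, whose value at each element $s$ is a sequence of finite length of finite sets of $(j,j+1)\frac{\pi}{4}$-arcs of some circles of $\mathcal{S}$ intersecting $q_{D_{\mathcal{S}},i}^{-1}(s)$, with the following properties. (For a point $x$ and a circle $S\ni x$ the arcs of $S$ "at $x$" are the $(j,j+1)\frac{\pi}{4}$-arcs of $S$ containing $x$. Put $P_1=\{(0,1),(1,2),(2,3),(4,5),(5,6),(6,7)\}$ and $P_2=\{(0,1),(2,3),(3,4),(4,5),(6,7),(7,0)\}$; a pair $(a,b)$ stands for the pair consisting of the $(a,a+1)\frac{\pi}{4}$-arc and the $(b,b+1)\frac{\pi}{4}$-arc of one circle.) (1) For each edge $e$, $l_{(\mathcal{S},D_{\mathcal{S}}),i}(e)$ is a sequence of length $2$ of finite sets, each of size at most $4$, of $(j,j+1)\frac{\pi}{4}$-arcs of circles of $\mathcal{S}$ intersecting $q_{D_{\mathcal{S}},i}^{-1}(e)$, namely the arcs of $S_{e,1}$ intersecting $C_{e,1}$ and the arcs of $S_{e,2}$ intersecting $C_{e,2}$. For each of the two sets the circle containing its arcs is unique ($S_{e,1}$ for the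 first, $S_{e,2}$ for the second, $S_{e,1}=S_{e,2}$ being allowed). The union of all arcs of each of the two sets is a connected smooth curve. If $i=1$, neither set contains both the $(3,4)\frac{\pi}{4}$-arc and the $(4,5)\frac{\pi}{4}$-arc, nor both the $(7,8)\frac{\pi}{4}$-arc and the $(0,1)\frac{\pi}{4}$-arc, of its circle; if moreover $S_{e,1}=S_{e,2}$, the first set consists only of arcs with $j=4,5,6,7$ and the second only of arcs with $j=0,1,2,3$. If $i=2$, neither set contains both the $(j,j+1)\frac{\pi}{4}$-arc and the $(j+1,j+2)\frac{\pi}{4}$-arc of its circle for $j=1$ or $j=5$; if moreover $S_{e,1}=S_{e,2}$, the first set consists only of arcs with $j=2,3,4,5$ and the second only of arcs with $j=0,1,6,7$. (2) For each vertex $v_1$ of degree $1$, the set $q_{D_{\mathcal{S}},i}^{-1}(v_1)$ is a one-point set $\{x\}$, the sequence $l_{(\mathcal{S},D_{\mathcal{S}}),i}(v_1)$ has length one, and one of the following holds. (2a) $x$ lies in a unique circle of $\mathcal{S}$ and is the $(j,\frac{\pi}{4})$-pole of it with $j\in\{0,4\}$ if $i=1$ ($j\in\{2,6\}$ if $i=2$). The finite set consists of the two arcs of this circle containing $x$, i.e. the $(j,j+1)\frac{\pi}{4}$-arcs with $j=0,7$ or with $j=3,4$ if $i=1$, and with $j=1,2$ or with $j=5,6$ if $i=2$. (2b) $x$ lies in exactly two circles $S_1,S_2$ of $\mathcal{S}$. Writing $(t_{1,1},t_{1,2}),(t_{2,1},t_{2,2})$ for the directions of a tangent segment pair at $(\overline{D_{\mathcal{S}}},x)$,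 one has $t_{1,i}t_{2,i}\ge 0$ and $(t_{1,i},t_{2,i})\neq(0,0)$, and: (2b-i) if $t_{1,i}t_{2,i}>0$, the finite set consists of one or two arcs of $S_1$ at $x$ and one or two arcs of $S_2$ at $x$; whenever two arcs of the same circle $S_{j'}$ are contained in it, they form a pair in $P_i$; (2b-ii) if $t_{1,i}t_{2,i}=0$, then for example when $t_{1,i}>0$ and $t_{2,i}=0$ the finite set consists of one or two arcs of $S_1$ at $x$ (forming a pair in $P_i$ if there are two) together with the $(3,4)\frac{\pi}{4}$-arc and the $(4,5)\frac{\pi}{4}$-arc of $S_2$ if $i=1$, respectively together with the $(5,6)\frac{\pi}{4}$-arc and the $(6,7)\frac{\pi}{4}$-arc of $S_2$ if $i=2$. (3) For each vertex $v_2$ of degree $2$, $q_{D_{\mathcal{S}},i}^{-1}(v_2)$ contains exactly two points contained in some circle of $\mathcal{S}$, denoted $x_{1},x_{2}$ with $x_2$ above (if $i=1$), respectively in the right of (if $i=2$), $x_1$; and $l_{(\mathcal{S},D_{\mathcal{S}}),i}(v_2)$ is a sequence of length two whose $k$-th finite set is determined by $x_k$ ($k=1,2$) as follows. (3a) If $x_k$ lies in a unique circle of $\mathcal{S}$, the set is the set of arcs of this circle at $x_k$, and it obeys the rule of (1): the union of its arcs is a connected smooth curve; if $i=1$ it does not contain both the $(3,4)\frac{\pi}{4}$- and $(4,5)\frac{\pi}{4}$-arcs, nor both the $(7,8)\frac{\pi}{4}$- and $(0,1)\frac{\pi}{4}$-arcs; if $i=2$ it does not contain both the $(j,j+1)\frac{\pi}{4}$-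 and $(j+1,j+2)\frac{\pi}{4}$-arcs for $j=1$ or $j=5$. (3b) If $x_k$ lies in exactly two circles $S_1,S_2$ of $\mathcal{S}$, with directions $(t_{1,1},t_{1,2}),(t_{2,1},t_{2,2})$ of a tangent segment pair at $(\overline{D_{\mathcal{S}}},x_k)$, then $t_{1,i}t_{2,i}\le 0$ and $(t_{1,i},t_{2,i})\ne(0,0)$, and: (3b-i) if $t_{1,i}t_{2,i}<0$, the set consists of one or two arcs of $S_1$ at $x_k$ and one or two arcs of $S_2$ at $x_k$; whenever two arcs of the same circle are contained in it they form a pair in $P_i$; (3b-ii) if $t_{1,i}t_{2,i}=0$, with the circles numbered so that $t_{2,i}=0$, the set consists of one or two arcs of $S_1$ at $x_k$ (forming a pair in $P_i$ if there are two) together with the following two arcs of $S_2$: the $(0,1)\frac{\pi}{4}$- and $(7,8)\frac{\pi}{4}$-arcs if $i=1$ and $t_{1,1}>0$; the $(3,4)\frac{\pi}{4}$- and $(4,5)\frac{\pi}{4}$-arcs if $i=1$ and $t_{1,1}<0$; the $(1,2)\frac{\pi}{4}$- and $(2,3)\frac{\pi}{4}$-arcs if $i=2$ and $t_{1,2}>0$; the $(5,6)\frac{\pi}{4}$- and $(6,7)\frac{\pi}{4}$-arcs if $i=2$ and $t_{1,2}<0$. Moreover, if the first finite set is as in (3a), then the second is not as in (3a). (4) For each vertex $v$ of degree at least $3$, let $k_{v,+}$ (resp. $k_{v,-}$) be the number of oriented edges departing from (resp. entering) $v$. The set $q_{D_{\mathcal{S}},i}^{-1}(v)$ has exactly $k_{v,+}+k_{v,-}>2$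 points contained in some circles of $\mathcal{S}$, denoted $x_{v_{0,j}}$ ($1\le j\le k_{v,+}+k_{v,-}$), with $x_{v_{0,j+1}}$ above (if $i=1$), respectively in the right of (if $i=2$), $x_{v_{0,j}}$; and $l_{(\mathcal{S},D_{\mathcal{S}}),i}(v)$ is a sequence of $k_{v,+}+k_{v,-}$ finite sets such that: (4a) the first and the last sets are determined by $x_{v_{0,1}}$ and $x_{v_{0,k_{v,+}+k_{v,-}}}$ respectively, in the way described in (3a) and (3b), where now both may be as in (3a); (4b) for $2\le k\le k_{v,+}+k_{v,-}-1$ the $k$-th set depends on $x_{v_{0,k}}$. If $i=1$, it is either the two-element set of the $(3,4)\frac{\pi}{4}$- and $(4,5)\frac{\pi}{4}$-arcs of a uniquely chosen circle or the two-element set of the $(0,1)\frac{\pi}{4}$- and $(7,8)\frac{\pi}{4}$-arcs of a uniquely chosen circle; exactly $k_{v,+}-1$ of these sets are of the former type and $k_{v,-}-1$ of the latter type. If $i=2$, it is either the two-element set of the $(1,2)\frac{\pi}{4}$- and $(2,3)\frac{\pi}{4}$-arcs of a uniquely chosen circle or the two-element set of the $(5,6)\frac{\pi}{4}$- and $(6,7)\frac{\pi}{4}$-arcs of a uniquely chosen circle; exactly $k_{v,+}-1$ are of the latter type and $k_{v,-}-1$ of the former type. The $k_{v,+}+k_{v,-}-2\ge 1$ circles so chosen are mutually distinct and different from the circles of $\mathcal{S}$ containing $x_{v_{0,1}}$ or $x_{v_{0,k_{v,+}+k_{v,-}}}$. (5) Let $s$ be a vertex or an edge, and suppose that some $(j,j+1)\frac{\pi}{4}$-arcs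 of a single circle $S_s$ appear both in the $j_1$-th finite set $\mathcal{F}_{s,1}$ and in the $j_2$-th finite set $\mathcal{F}_{s,2}$ of the sequence $l_{(\mathcal{S},D_{\mathcal{S}}),i}(s)$ with $j_1<j_2$. If $i=1$, those arcs of $S_s$ in $\mathcal{F}_{s,1}$ have $j\in\{4,5,6,7\}$ only and those in $\mathcal{F}_{s,2}$ have $j\in\{0,1,2,3\}$ only. If $i=2$, those arcs of $S_s$ in $\mathcal{F}_{s,1}$ have $j\in\{2,3,4,5\}$ only and those in $\mathcal{F}_{s,2}$ have $j\in\{0,1,6,7\}$ only. Furthermore, in these situations $j_1=1$ and $j_2$ is the length of the sequence $l_{(\mathcal{S},D_{\mathcal{S}}),i}(s)$.
   Context: Projections: $\pi_{2,1,i}:\mathbb{R}^2\to\mathbb{R}$, $\pi_{2,1,i}(x_1,x_2)=x_i$ for $i=1,2$. $\overline{Y}$, $Y^{\circ}$ denote closure and interior in $\mathbb{R}^2$, $\partial$ the boundary. Circles, poles, arcs: a circle is $S_{x_0,r}=\{x\in\mathbb{R}^2 : \|x-x_0\|=r\}$, $r>0$, $x_0=(x_{0,1},x_{0,2})$. Its $(j,\frac{\pi}{4})$-pole is $(x_{0,1}+r\cos\frac{j\pi}{4},x_{0,2}+r\sin\frac{j\pi}{4})$, $j=0,\dots,7$. These eight points divide the circle into eight arcs; the $(j,j+1)\frac{\pi}{4}$-arc is the one (endpoints included) connecting the points at angles $\frac{j\pi}{4}$ and $\frac{(j+1)\pi}{4}$, $j=0,\dots,7$. NI arrangement: a pair $(\mathcal{S},D_{\mathcal{S}})$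 of a set $\mathcal{S}$ of circles and a bounded connected component $D_{\mathcal{S}}$ of $\mathbb{R}^2-\bigcup_{S\in\mathcal{S}}S$ is a normally inductive (NI) arrangement of circles if it is obtained inductively as follows. Start: a non-empty set $\mathcal{S}_0$ of mutually disjoint circles and a bounded connected component $D_{\mathcal{S}_0}$ of the complement of their union with $\partial\overline{D_{\mathcal{S}_0}}=\bigsqcup_{S\in\mathcal{S}_0}S$. Step: given $(\mathcal{S},D_{\mathcal{S}})$, choose a new circle $S_{x',r'}$ intersecting at least one circle of $\mathcal{S}$, such that at every point $p\in\overline{D_{\mathcal{S}}}$ where $S_{x',r'}$ meets a (distinct) circle $S\in\mathcal{S}$ the tangent spaces of the two circles at $p$ span $T_p\mathbb{R}^2$, and such that no point of $\overline{D_{\mathcal{S}}}$ lies on $S_{x',r'}$ and on two distinct circles of $\mathcal{S}$. Put $\mathcal{S}'=\mathcal{S}\sqcup\{S_{x',r'}\}$ and $D_{\mathcal{S}'}=D_{\mathcal{S}}\cap E$, where $E$ is either the open disk bounded by $S_{x',r'}$ or the complement of the closed disk bounded by $S_{x',r'}$; it is required that $\overline{D_{\mathcal{S}'}}\cap S\neq\emptyset$ for all $S\in\mathcal{S}'$. Replace $(\mathcal{S},D_{\mathcal{S}})$ by $(\mathcal{S}',D_{\mathcal{S}'})$ and repeat. Poincaré-Reeb V-digraph: $G_{D_{\mathcal{S}},i}$ is the set of all connected components of preimages of single points under $\pi_{2,1,i}|_{\overline{D_{\mathcal{S}}}}$ with the quotient topology, and $q_{D_{\mathcal{S}},i}:\overline{D_{\mathcal{S}}}\to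 G_{D_{\mathcal{S}},i}$ is the quotient map. It is a graph whose vertices are the components containing (points of $\overline{D_{\mathcal{S}}}$ that are) $(j,\frac{\pi}{4})$-poles with $j=0,4$ if $i=1$ (with $j=2,6$ if $i=2$) of some circles of $\mathcal{S}$, or points lying in exactly two distinct circles of $\mathcal{S}$. Edges are open ($1$-cells). There is a unique $V_{D_{\mathcal{S}},i}:G_{D_{\mathcal{S}},i}\to\mathbb{R}$ with $\pi_{2,1,i}|_{\overline{D_{\mathcal{S}}}}=V_{D_{\mathcal{S}},i}\circ q_{D_{\mathcal{S}},i}$; each edge is oriented from its endpoint with smaller value of $V_{D_{\mathcal{S}},i}$ to the one with larger value. The degree of a vertex is the number of edges containing it. Above / in the right of: for subsets $A_1,A_2\subset\mathbb{R}^2$ on which $\pi_{2,1,1}$ is injective with the same image, $A_1$ is above $A_2$ if $(a,b_1)\in A_1$, $(a,b_2)\in A_2$ imply $b_1>b_2$. If $\pi_{2,1,2}$ is injective on both with the same image, $A_1$ is in the right of $A_2$ if $(a_1,b)\in A_1$, $(a_2,b)\in A_2$ imply $a_1>a_2$. Edge data: for each edge $e$, $q_{D_{\mathcal{S}},i}^{-1}(e)\cap\partial\overline{D_{\mathcal{S}}}$ consists of two smooth connected curves $C_{e,1},C_{e,2}$ on which $\pi_{2,1,i}$ is injective without singular points, numbered so that $C_{e,2}$ is above (if $i=1$), respectively in the right of (if $i=2$), $C_{e,1}$. $S_{e,k}$ denotes the unique circle of $\mathcal{S}$ containing $C_{e,k}$. Tangent segment pair: let $x\in\overline{D_{\mathcal{S}}}$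 lie in exactly two circles $S_1,S_2$ of $\mathcal{S}$. Take a circle $S_{x,\epsilon}$ with $\epsilon>0$ sufficiently small. For $j'=1,2$ let $y_{j'}$ be the unique point of the intersection of $S_{x,\epsilon}$ with the tangent line of $S_{j'}$ at $x$ which is either contained in $\overline{D_{\mathcal{S}}}\cap S_{x,\epsilon}$ or closer (than the other intersection point) to $\overline{D_{\mathcal{S}}}\cap S_{x,\epsilon}$ in the induced metric of $S_{x,\epsilon}$. The pair of segments from $x$ to $y_1$ and $y_2$ is a tangent segment pair at $(\overline{D_{\mathcal{S}}},x)$; their directions are written $(t_{j',1},t_{j',2})$, $j'=1,2$. The signs (or vanishing) of the components do not depend on the chosen tangent segment pair. *)

theory Defs
  imports "HOL-Analysis.Analysis"
begin

text \<open>
  The plane is \<^typ>\<open>real^2\<close> and the projection \<open>\<pi>\<^bsub>2,1,i\<^esub>\<close> is \<open>\<lambda>x. x $ i\<close>, where \<open>i :: 2\<close>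
  ranges over exactly the two indices 1 and 2.
  (In the type \<^typ>\<open>2\<close>, the index 2 is the same element as 0.)
\<close>

definition other_index :: "2 \<Rightarrow> 2" where
  "other_index i = (if i = 1 then 2 else 1)"


section \<open>Circles, poles and arcs\<close>

text \<open>
  A circle is encoded by its centre and radius; positivity of the radius is required in
  \<open>NI_arrangement\<close> below. For positive radii the point set determines the pair.
\<close>

type_synonym circle = "(real^2) \<times> real"

definition circ :: "circle \<Rightarrow> (real^2) set" where
  "circ S = sphere (fst S) (snd S)"

definition circle_point :: "circle \<Rightarrow> real \<Rightarrow> real^2" where
  "circle_point S \<theta> = fst S + snd S *\<^sub>R vector [cos \<theta>, sin \<theta>]"

definition pole :: "circle \<Rightarrow> nat \<Rightarrow> real^2" where
  "pole S j = circle_point S (real j * pi / 4)"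

text \<open>The \<open>(j,j+1)\<pi>/4\<close>-arc, as a set of points. The arc written \<open>(7,8)\<close> or \<open>(7,0)\<close> is \<open>arc8 S 7\<close>.\<close>

definition arc8 :: "circle \<Rightarrow> nat \<Rightarrow> (real^2) set" where
  "arc8 S j = circle_point S ` {real j * pi / 4 .. real (Suc j) * pi / 4}"

definition arcs_meeting :: "circle \<Rightarrow> (real^2) set \<Rightarrow> (real^2) set set" where
  "arcs_meeting S C = {A. \<exists>j<8. A = arc8 S j \<and> A \<inter> C \<noteq> {}}"

definition arcs_at :: "circle \<Rightarrow> real^2 \<Rightarrow> (real^2) set set" where
  "arcs_at S x = {A. \<exists>j<8. A = arc8 S j \<and> x \<in> A}"

definition circles_through :: "circle set \<Rightarrow> real^2 \<Rightarrow> circle set" where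
  "circles_through \<S> x = {S \<in> \<S>. x \<in> circ S}"

text \<open>\<open>carriers \<S> \<F>\<close>: the circles of the family that contain all arcs in \<open>\<F>\<close>.\<close>

definition carriers :: "circle set \<Rightarrow> (real^2) set set \<Rightarrow> circle set" where
  "carriers \<S> \<F> = {S \<in> \<S>. \<forall>A\<in>\<F>. A \<subseteq> circ S}"


section \<open>Normally inductive arrangements\<close>

definition tangent_space :: "circle \<Rightarrow> real^2 \<Rightarrow> (real^2) set" where
  "tangent_space S p = {v. v \<bullet> (p - fst S) = 0}"

text \<open>
  The initial family is finite: the frontier of the closure of the bounded set \<open>D\<close> is compact
  and is the topological disjoint union of the circles of the family.
\<close>

inductive NI_arrangement :: "circle set \<Rightarrow> (real^2) set \<Rightarrow> bool" where
  start: "NI_arrangement \<S> D"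
    if "\<S> \<noteq> {}" "finite \<S>" "\<forall>S\<in>\<S>. snd S > 0"
      "\<forall>S\<in>\<S>. \<forall>T\<in>\<S>. S \<noteq> T \<longrightarrow> circ S \<inter> circ T = {}"
      "D \<in> components (- (\<Union>S\<in>\<S>. circ S))" "bounded D"
      "frontier (closure D) = (\<Union>S\<in>\<S>. circ S)"
| step: "NI_arrangement (insert S' \<S>) (D \<inter> E)"
    if "NI_arrangement \<S> D"
      "snd S' > 0" "S' \<notin> \<S>" "\<exists>S\<in>\<S>. circ S' \<inter> circ S \<noteq> {}"
      "\<forall>S\<in>\<S>. \<forall>p \<in> closure D \<inter> circ S' \<inter> circ S.
         span (tangent_space S' p \<union> tangent_space S p) = UNIV"
      "\<not> (\<exists>p\<in>closure D. p \<in> circ S' \<and>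
           (\<exists>S\<in>\<S>. \<exists>T\<in>\<S>. S \<noteq> T \<and> p \<in> circ S \<and> p \<in> circ T))"
      "E = ball (fst S') (snd S') \<or> E = - cball (fst S') (snd S')"
      "D \<inter> E \<in> components (- (\<Union>S\<in>insert S' \<S>. circ S))"
      "\<forall>S\<in>insert S' \<S>. closure (D \<inter> E) \<inter> circ S \<noteq> {}"


section \<open>The Poincare-Reeb V-digraph\<close>

definition reeb_map :: "(real^2) set \<Rightarrow> 2 \<Rightarrow> real^2 \<Rightarrow> (real^2) set" where
  "reeb_map D i x = connected_component_set {y \<in> closure D. y $ i = x $ i} x"

definition reeb_space :: "(real^2) set \<Rightarrow> 2 \<Rightarrow> (real^2) set set" where
  "reeb_space D i = reeb_map D i ` closure D"

definition reeb_topology :: "(real^2) set \<Rightarrow> 2 \<Rightarrow> (real^2) set topology" where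
  "reeb_topology D i = topology (\<lambda>U. U \<subseteq> reeb_space D i \<and>
     openin (top_of_set (closure D)) {x \<in> closure D. reeb_map D i x \<in> U})"

lemma openin_reeb_topology:
  "openin (reeb_topology D i) U \<longleftrightarrow> U \<subseteq> reeb_space D i \<and>
     openin (top_of_set (closure D)) {x \<in> closure D. reeb_map D i x \<in> U}"
proof -
  have "istopology (\<lambda>U. U \<subseteq> reeb_space D i \<and>
     openin (top_of_set (closure D)) {x \<in> closure D. reeb_map D i x \<in> U})"
    unfolding istopology_def
  proof (intro conjI allI impI)
    fix S T
    assume S: "S \<subseteq> reeb_space D i \<and>
        openin (top_of_set (closure D)) {x \<in> closure D. reeb_map D i x \<in> S}"
      and T: "T \<subseteq> reeb_space D i \<and>
        openin (top_of_set (closure D)) {x \<in> closure D. reeb_map D i x \<in> T}"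
    show "S \<inter> T \<subseteq> reeb_space D i" using S by blast
    have "{x \<in> closure D. reeb_map D i x \<in> S \<inter> T} =
      {x \<in> closure D. reeb_map D i x \<in> S} \<inter> {x \<in> closure D. reeb_map D i x \<in> T}" by blast
    then show "openin (top_of_set (closure D)) {x \<in> closure D. reeb_map D i x \<in> S \<inter> T}"
      using S T by (simp only: openin_Int)
  next
    fix K
    assume K: "\<forall>S\<in>K. S \<subseteq> reeb_space D i \<and>
        openin (top_of_set (closure D)) {x \<in> closure D. reeb_map D i x \<in> S}"
    show "\<Union>K \<subseteq> reeb_space D i" using K by blast
    have "{x \<in> closure D. reeb_map D i x \<in> \<Union>K} =
      (\<Union>S\<in>K. {x \<in> closure D. reeb_map D i x \<in> S})" by blast
    then show "openin (top_of_set (closure D)) {x \<in> closure D. reeb_map D i x \<in> \<Union>K}"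
      using K by (simp only:) (intro openin_Union; blast)
  qed
  then show ?thesis
    by (simp add: reeb_topology_def topology_inverse')
qed

lemma quotient_map_reeb_map:
  "quotient_map (top_of_set (closure D)) (reeb_topology D i) (reeb_map D i)"
proof -
  have "{x \<in> closure D. reeb_map D i x \<in> reeb_space D i} = closure D"
    by (auto simp: reeb_space_def)
  then have "openin (reeb_topology D i) (reeb_space D i)"
    by (simp add: openin_reeb_topology)
  then have "topspace (reeb_topology D i) = reeb_space D i"
    by (auto simp: topspace_def openin_reeb_topology)
  then show ?thesis
    by (auto simp: quotient_map_def openin_reeb_topology reeb_space_def)
qed

definition reeb_value :: "2 \<Rightarrow> (real^2) set \<Rightarrow> real" where
  "reeb_value i c = (THE a. \<forall>x\<in>c. x $ i = a)"

definition pole_indices :: "2 \<Rightarrow> nat set" where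
  "pole_indices i = (if i = 1 then {0,4} else {2,6})"

definition reeb_vertices :: "circle set \<Rightarrow> (real^2) set \<Rightarrow> 2 \<Rightarrow> (real^2) set set" where
  "reeb_vertices \<S> D i = reeb_map D i ` {x \<in> closure D.
     (\<exists>S\<in>\<S>. \<exists>j\<in>pole_indices i. x = pole S j) \<or> card (circles_through \<S> x) = 2}"

text \<open>The open 1-cells of the graph are the connected components of the complement of the vertices.\<close>

definition reeb_edges :: "circle set \<Rightarrow> (real^2) set \<Rightarrow> 2 \<Rightarrow> (real^2) set set set" where
  "reeb_edges \<S> D i = connected_components_of
     (subtopology (reeb_topology D i) (reeb_space D i - reeb_vertices \<S> D i))"

definition endpoints :: "(real^2) set \<Rightarrow> 2 \<Rightarrow> (real^2) set set \<Rightarrow> (real^2) set set" where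
  "endpoints D i e = (reeb_topology D i closure_of e) - e"

definition reeb_degree :: "circle set \<Rightarrow> (real^2) set \<Rightarrow> 2 \<Rightarrow> (real^2) set \<Rightarrow> nat" where
  "reeb_degree \<S> D i v = card {e \<in> reeb_edges \<S> D i. v \<in> endpoints D i e}"

definition out_degree :: "circle set \<Rightarrow> (real^2) set \<Rightarrow> 2 \<Rightarrow> (real^2) set \<Rightarrow> nat" where
  "out_degree \<S> D i v = card {e \<in> reeb_edges \<S> D i. v \<in> endpoints D i e \<and>
     (\<exists>w\<in>endpoints D i e. reeb_value i v < reeb_value i w)}"

definition in_degree :: "circle set \<Rightarrow> (real^2) set \<Rightarrow> 2 \<Rightarrow> (real^2) set \<Rightarrow> nat" where
  "in_degree \<S> D i v = card {e \<in> reeb_edges \<S> D i. v \<in> endpoints D i e \<and>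
     (\<exists>w\<in>endpoints D i e. reeb_value i w < reeb_value i v)}"

text \<open>Preimage under the quotient map of a vertex \<open>Inl v\<close> (a single point of the graph)
  or of an edge \<open>Inr e\<close> (a set of points of the graph).\<close>

definition reeb_preimage ::
  "(real^2) set \<Rightarrow> 2 \<Rightarrow> (real^2) set + (real^2) set set \<Rightarrow> (real^2) set" where
  "reeb_preimage D i s = {x \<in> closure D. reeb_map D i x \<in> (case s of Inl v \<Rightarrow> {v} | Inr e \<Rightarrow> e)}"


section \<open>Curves and their relative position\<close>

text \<open>\<open>A\<close> is the embedded image of a nondegenerate interval under a smooth regular map;
  \<open>G k\<close> is the \<open>k\<close>-th derivative of the parametrization \<open>G 0\<close>.\<close>

definition regular_parametrization ::
  "real set \<Rightarrow> (nat \<Rightarrow> real \<Rightarrow> real^2) \<Rightarrow> (real^2) set \<Rightarrow> bool" where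
  "regular_parametrization I G A \<longleftrightarrow>
     is_interval I \<and> (\<exists>a\<in>I. \<exists>b\<in>I. a < b) \<and>
     (\<exists>h. homeomorphism I A (G 0) h) \<and>
     (\<forall>k. \<forall>t\<in>I. (G k has_vector_derivative G (Suc k) t) (at t within I)) \<and>
     (\<forall>t\<in>I. G 1 t \<noteq> 0)"

definition smooth_curve :: "(real^2) set \<Rightarrow> bool" where
  "smooth_curve A \<longleftrightarrow> (\<exists>I G. regular_parametrization I G A)"

definition projects_regularly :: "2 \<Rightarrow> (real^2) set \<Rightarrow> bool" where
  "projects_regularly i A \<longleftrightarrow> inj_on (\<lambda>x. x $ i) A \<and>
     (\<exists>I G. regular_parametrization I G A \<and> (\<forall>t\<in>I. G 1 t $ i \<noteq> 0))"

text \<open>\<open>A\<close> is above \<open>B\<close> (for \<open>i = 1\<close>), respectively in the right of \<open>B\<close> (for \<open>i = 2\<close>).\<close>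

definition lies_beyond :: "2 \<Rightarrow> (real^2) set \<Rightarrow> (real^2) set \<Rightarrow> bool" where
  "lies_beyond i A B \<longleftrightarrow>
     inj_on (\<lambda>x. x $ i) A \<and> inj_on (\<lambda>x. x $ i) B \<and> (\<lambda>x. x $ i) ` A = (\<lambda>x. x $ i) ` B \<and>
     (\<forall>a\<in>A. \<forall>b\<in>B. a $ i = b $ i \<longrightarrow> a $ other_index i > b $ other_index i)"

definition edge_curves ::
  "circle set \<Rightarrow> (real^2) set \<Rightarrow> 2 \<Rightarrow> (real^2) set set \<Rightarrow>
   (real^2) set \<Rightarrow> (real^2) set \<Rightarrow> circle \<Rightarrow> circle \<Rightarrow> bool" where
  "edge_curves \<S> D i e C1 C2 S1 S2 \<longleftrightarrow>
     reeb_preimage D i (Inr e) \<inter> frontier (closure D) = C1 \<union> C2 \<and> C1 \<inter> C2 = {} \<and>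
     projects_regularly i C1 \<and> projects_regularly i C2 \<and> lies_beyond i C2 C1 \<and>
     {S \<in> \<S>. C1 \<subseteq> circ S} = {S1} \<and> {S \<in> \<S>. C2 \<subseteq> circ S} = {S2}"

text \<open>\<open>xs\<close> lists the points of \<open>P\<close> from bottom to top (\<open>i = 1\<close>) or from left to right (\<open>i = 2\<close>).\<close>

definition lists_in_order :: "2 \<Rightarrow> (real^2) set \<Rightarrow> (real^2) list \<Rightarrow> bool" where
  "lists_in_order i P xs \<longleftrightarrow> set xs = P \<and> distinct xs \<and>
     sorted_wrt (\<lambda>x y. lies_beyond i {y} {x}) xs"

definition circle_points_over :: "circle set \<Rightarrow> (real^2) set \<Rightarrow> 2 \<Rightarrow> (real^2) set \<Rightarrow> (real^2) set" where
  "circle_points_over \<S> D i v = {x \<in> reeb_preimage D i (Inl v). \<exists>S\<in>\<S>. x \<in> circ S}"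


section \<open>Tangent segment pairs\<close>

text \<open>The endpoint of the tangent segment on the tangent line of \<open>S\<close> at \<open>x\<close>, for the auxiliary
  circle of radius \<open>\<epsilon>\<close> around \<open>x\<close>; the other intersection point is \<open>2 *\<^sub>R x - y\<close>.\<close>

definition tangent_endpoint :: "(real^2) set \<Rightarrow> real^2 \<Rightarrow> real \<Rightarrow> circle \<Rightarrow> real^2 \<Rightarrow> bool" where
  "tangent_endpoint D x \<epsilon> S y \<longleftrightarrow> y \<in> sphere x \<epsilon> \<and> y - x \<in> tangent_space S x \<and>
     (y \<in> closure D \<inter> sphere x \<epsilon> \<or>
      infdist y (closure D \<inter> sphere x \<epsilon>) < infdist (2 *\<^sub>R x - y) (closure D \<inter> sphere x \<epsilon>))"

text \<open>Directions are normalized to unit length, so that they do not depend on the small \<open>\<epsilon>\<close>.\<close>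

definition tangent_direction :: "(real^2) set \<Rightarrow> real^2 \<Rightarrow> circle \<Rightarrow> real^2 \<Rightarrow> bool" where
  "tangent_direction D x S t \<longleftrightarrow> norm t = 1 \<and>
     (\<forall>\<^sub>F \<epsilon> in at_right 0. {y. tangent_endpoint D x \<epsilon> S y} = {x + \<epsilon> *\<^sub>R t})"


section \<open>Rules for the finite sets of arcs\<close>

definition pole_free_pairs :: "2 \<Rightarrow> (nat \<times> nat) set" where
  "pole_free_pairs i = (if i = 1
     then {(0,1), (1,2), (2,3), (4,5), (5,6), (6,7)}
     else {(0,1), (2,3), (3,4), (4,5), (6,7), (7,0)})"

text \<open>The two arcs of \<open>S\<close> at the point where the \<open>i\<close>-th coordinate is minimal, respectively maximal.\<close>

definition min_arcs :: "2 \<Rightarrow> circle \<Rightarrow> (real^2) set set" where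
  "min_arcs i S = (if i = 1 then {arc8 S 3, arc8 S 4} else {arc8 S 5, arc8 S 6})"

definition max_arcs :: "2 \<Rightarrow> circle \<Rightarrow> (real^2) set set" where
  "max_arcs i S = (if i = 1 then {arc8 S 0, arc8 S 7} else {arc8 S 1, arc8 S 2})"

text \<open>Indices of the arcs in the lower and upper (\<open>i = 1\<close>), respectively left and right
  (\<open>i = 2\<close>) half of a circle.\<close>

definition first_half :: "2 \<Rightarrow> nat set" where
  "first_half i = (if i = 1 then {4,5,6,7} else {2,3,4,5})"

definition second_half :: "2 \<Rightarrow> nat set" where
  "second_half i = (if i = 1 then {0,1,2,3} else {0,1,6,7})"

definition arc_rule :: "2 \<Rightarrow> circle \<Rightarrow> (real^2) set set \<Rightarrow> bool" where
  "arc_rule i S \<F> \<longleftrightarrow> smooth_curve (\<Union>\<F>) \<and> \<not> min_arcs i S \<subseteq> \<F> \<and> \<not> max_arcs i S \<subseteq> \<F>"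

definition one_or_two_arcs :: "2 \<Rightarrow> circle \<Rightarrow> real^2 \<Rightarrow> (real^2) set set \<Rightarrow> bool" where
  "one_or_two_arcs i S x \<F> \<longleftrightarrow> \<F> \<subseteq> arcs_at S x \<and> (card \<F> = 1 \<or> card \<F> = 2) \<and>
     (\<forall>a<8. \<forall>b<8. a \<noteq> b \<and> arc8 S a \<in> \<F> \<and> arc8 S b \<in> \<F> \<longrightarrow>
        (a, b) \<in> pole_free_pairs i \<or> (b, a) \<in> pole_free_pairs i)"

definition simple_end :: "circle set \<Rightarrow> 2 \<Rightarrow> real^2 \<Rightarrow> (real^2) set set \<Rightarrow> bool" where
  "simple_end \<S> i x \<F> \<longleftrightarrow>
     (\<exists>S. circles_through \<S> x = {S} \<and> \<F> = arcs_at S x \<and> arc_rule i S \<F>)"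

text \<open>The quantification over \<open>S1\<close> and \<open>S2\<close> covers both numberings of the two circles, so the clause
  for \<open>t2 $ i = 0\<close> also treats the case where the other tangent direction has vanishing component.\<close>

definition corner_end :: "circle set \<Rightarrow> (real^2) set \<Rightarrow> 2 \<Rightarrow> real^2 \<Rightarrow> (real^2) set set \<Rightarrow> bool" where
  "corner_end \<S> D i x \<F> \<longleftrightarrow> card (circles_through \<S> x) = 2 \<and>
     (\<forall>S1 S2. circles_through \<S> x = {S1, S2} \<longrightarrow>
       (\<exists>t1 t2. tangent_direction D x S1 t1 \<and> tangent_direction D x S2 t2 \<and>
          t1 $ i * t2 $ i \<le> 0 \<and> (t1 $ i, t2 $ i) \<noteq> (0, 0) \<and>
          (t1 $ i * t2 $ i < 0 \<longrightarrow>
             (\<exists>\<F>1 \<F>2. \<F> = \<F>1 \<union> \<F>2 \<and> one_or_two_arcs i S1 x \<F>1 \<and> one_or_two_arcs i S2 x \<F>2)) \<and>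
          (t2 $ i = 0 \<longrightarrow>
             (\<exists>\<F>1. one_or_two_arcs i S1 x \<F>1 \<and>
                \<F> = \<F>1 \<union> (if t1 $ i > 0 then max_arcs i S2 else min_arcs i S2)))))"

definition extremal_end :: "circle set \<Rightarrow> 2 \<Rightarrow> real^2 \<Rightarrow> (real^2) set set \<Rightarrow> bool" where
  "extremal_end \<S> i x \<F> \<longleftrightarrow>
     (\<exists>S. circles_through \<S> x = {S} \<and> (\<exists>j\<in>pole_indices i. x = pole S j) \<and>
        \<F> = arcs_at S x \<and> (\<F> = min_arcs i S \<or> \<F> = max_arcs i S))"

definition extremal_corner ::
  "circle set \<Rightarrow> (real^2) set \<Rightarrow> 2 \<Rightarrow> real^2 \<Rightarrow> (real^2) set set \<Rightarrow> bool" where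
  "extremal_corner \<S> D i x \<F> \<longleftrightarrow> card (circles_through \<S> x) = 2 \<and>
     (\<forall>S1 S2. circles_through \<S> x = {S1, S2} \<longrightarrow>
       (\<exists>t1 t2. tangent_direction D x S1 t1 \<and> tangent_direction D x S2 t2 \<and>
          t1 $ i * t2 $ i \<ge> 0 \<and> (t1 $ i, t2 $ i) \<noteq> (0, 0) \<and>
          (t1 $ i * t2 $ i > 0 \<longrightarrow>
             (\<exists>\<F>1 \<F>2. \<F> = \<F>1 \<union> \<F>2 \<and> one_or_two_arcs i S1 x \<F>1 \<and> one_or_two_arcs i S2 x \<F>2)) \<and>
          (t2 $ i = 0 \<longrightarrow>
             (\<exists>\<F>1. one_or_two_arcs i S1 x \<F>1 \<and>
                \<F> = \<F>1 \<union> (if t1 $ i > 0 then min_arcs i S2 else max_arcs i S2)))))"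

end

theory Submission
  imports Defs
begin

text \<open>
  Near a point of its closure the domain is cut out by the sides of the at most two, transversal,
  circles through that point. Hence a fibre of the projection that is not a vertex is a segment
  between two circles, and it continues along the same two circles until one reaches a vertex;
  these maximal strips are the edges. A vertex fibre is a segment whose inner circle points are
  poles of circles lying outside the domain, each splitting the strips on one side, so the degrees
  are counted by the lower ends of the strips leaving the fibre. The label of a vertex collects, for
  every circle point of its fibre, all arcs at that point; which arcs these are at a corner is
  decided by whether the domain extends vertically from it.
\<close>

section \<open>Coordinates in the plane\<close>

text \<open>The graph is given only as a quotient space, so its edges have to be recognised as
  components: strip images are connected and clopen off the vertices. Of the inductive construction
  only local data survive: a sign for each circle, at most two circles through a point of the
  closure, and independent radius vectors at a double point. The delicate point of the degree count
  is that two strips might leave a vertex fibre on the same side with a common lower end. Each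
  boundary curve would have to stay on the right side of the other circle, which is refuted at once
  unless the common end is a pole; there a square root growing against a linear bound decides. Each
  side of a nondegenerate fibre therefore has one strip starting at its bottom and one for every
  inner pole whose circle lies on that side. This is the origin of the summand 1 in the counts, and
  the two extra strips match the two ends of the fibre, so the degree is the number of circle
  points. The signs of the tangent directions come from expanding the vertical unit vector in the
  basis of the two tangent vectors.\<close>

lemma other_index_neq [simp]: "other_index i \<noteq> i" "i \<noteq> other_index i"
  using exhaust_2[of i] by (auto simp: other_index_def)

lemma UNIV_index: "(UNIV :: 2 set) = {i, other_index i}"
  using exhaust_2[of i] by (auto simp: other_index_def UNIV_2)

lemma sum_index: "(\<Sum>k\<in>UNIV. f k) = f i + f (other_index i)"
  by (subst UNIV_index[of i]) simp

lemma vec2_eqI: "x $ i = y $ i \<Longrightarrow> x $ other_index i = y $ other_index i \<Longrightarrow> x = y"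
  using UNIV_index[of i] UNIV_I unfolding vec_eq_iff by auto

lemma inner_index: "x \<bullet> y = x $ i * y $ i + x $ other_index i * y $ other_index i"
  for x y :: "real^2"
  by (simp add: inner_vec_def sum_index[of _ i])

lemma dist_index: "(dist x y)\<^sup>2 = (x $ i - y $ i)\<^sup>2 + (x $ other_index i - y $ other_index i)\<^sup>2"
  for x y :: "real^2"
  by (simp only: dist_norm power2_norm_eq_inner inner_index[of _ _ i])
    (simp add: power2_eq_square)

lemma norm_index: "(norm x)\<^sup>2 = (x $ i)\<^sup>2 + (x $ other_index i)\<^sup>2" for x :: "real^2"
  by (simp only: power2_norm_eq_inner inner_index[of _ _ i]) (simp add: power2_eq_square)

lemma circ_iff_index:
  assumes "snd S > 0"
  shows "x \<in> circ S \<longleftrightarrow>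
    (x $ i - fst S $ i)\<^sup>2 + (x $ other_index i - fst S $ other_index i)\<^sup>2 = (snd S)\<^sup>2"
proof -
  have "x \<in> circ S \<longleftrightarrow> (dist x (fst S))\<^sup>2 = (snd S)\<^sup>2"
    using assms by (auto simp: circ_def dist_commute power2_eq_iff_nonneg)
  then show ?thesis by (simp add: dist_index[of _ _ i])
qed

section \<open>Arcs of a circle\<close>

lemma circle_point_nth [simp]:
  "circle_point S \<theta> $ 1 = fst S $ 1 + snd S * cos \<theta>"
  "circle_point S \<theta> $ 2 = fst S $ 2 + snd S * sin \<theta>"
  by (simp_all add: circle_point_def)

lemma circle_point_in_circ: "snd S > 0 \<Longrightarrow> circle_point S \<theta> \<in> circ S"
  by (simp add: circ_iff_index[of _ _ 1] other_index_def power_mult_distrib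
      distrib_left[symmetric])

lemma circle_point_eq_iff:
  assumes "snd S > 0"
  shows "circle_point S \<theta> = circle_point S \<phi> \<longleftrightarrow> (\<exists>n::int. \<theta> = \<phi> + 2 * of_int n * pi)"
proof -
  have "circle_point S \<theta> = circle_point S \<phi> \<longleftrightarrow> sin \<theta> = sin \<phi> \<and> cos \<theta> = cos \<phi>"
    using assms by (auto simp: vec_eq_iff forall_2)
  also have "\<dots> \<longleftrightarrow> (\<exists>n::int. \<theta> = \<phi> + 2 * of_int n * pi)"
    by (auto simp: sin_cos_eq_iff mult.commute mult.left_commute)
  finally show ?thesis .
qed

lemma arc8_subset_circ: "snd S > 0 \<Longrightarrow> arc8 S j \<subseteq> circ S"
  by (auto simp: arc8_def circle_point_in_circ)

text \<open>Runs of consecutive arcs may pass the angle \<open>2 * pi\<close>. Reducing only the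
  index, and not the angles, lets such a run be described by one interval of angles.\<close>

lemma arc8_mod: "arc8 S (n mod 8) = circle_point S ` {real n * pi / 4 .. real (Suc n) * pi / 4}"
proof -
  define q where "q = n div 8"
  have n: "real n = real (n mod 8) + 8 * real q"
    unfolding q_def by (metis div_mult_mod_eq mult.commute add.commute of_nat_add of_nat_mult of_nat_numeral)
  have shift: "circle_point S (\<theta> + 2 * real q * pi) = circle_point S \<theta>" for \<theta>
    using sin_cos_eq_iff[of "\<theta> + 2 * real q * pi" \<theta>]
    by (auto simp: vec_eq_iff forall_2 intro!: exI[of _ "int q"])
  have "{real n * pi / 4 .. real (Suc n) * pi / 4}
      = (\<lambda>\<theta>. \<theta> + 2 * real q * pi) ` {real (n mod 8) * pi / 4 .. real (Suc (n mod 8)) * pi / 4}"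
    by (subst image_add_atLeastAtMost') (simp only: of_nat_Suc n, simp add: ring_distribs add_divide_distrib)
  then show ?thesis
    unfolding arc8_def by (simp only: image_image shift)
qed

text \<open>An offset strictly between 0 and \<open>pi\<close> from the grid angle \<open>m\<close>
  can only fall into the four arcs following \<open>m\<close>; this turns membership in arcs into a
  question about the offset alone.\<close>

lemma circle_point_in_arc8_iff:
  assumes S: "snd S > 0" and \<phi>: "0 < \<phi>" "\<phi> < pi" and j: "j < 8"
  shows "circle_point S (real m * pi / 4 + \<phi>) \<in> arc8 S j \<longleftrightarrow>
    (\<exists>k<4. j = (m + k) mod 8 \<and> real k * pi / 4 \<le> \<phi> \<and> \<phi> \<le> real (Suc k) * pi / 4)"
    (is "?L \<longleftrightarrow> ?R")
proof
  assume ?L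
  then obtain \<theta> where \<theta>: "real j * pi / 4 \<le> \<theta>" "\<theta> \<le> real (Suc j) * pi / 4"
    and eq: "circle_point S (real m * pi / 4 + \<phi>) = circle_point S \<theta>"
    by (auto simp: arc8_def)
  then obtain n :: int where n: "real m * pi / 4 + \<phi> = \<theta> + 2 * of_int n * pi"
    using circle_point_eq_iff[OF S] by blast
  \<comment> \<open>The offset of arc \<open>j\<close> from the grid index \<open>m\<close>, after
    undoing \<open>n\<close> full turns; the bounds on \<phi> leave only 0 to 3.\<close>
  define l :: int where "l = int j - int m + 8 * n"
  have l: "real_of_int l * pi / 4 \<le> \<phi>" "\<phi> \<le> (real_of_int l + 1) * pi / 4"
    using \<theta> n by (simp_all add: l_def field_simps)
  have "(real_of_int l + 1) * pi > 0"
    using l(2) \<phi>(1) by linarith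
  then have "l \<ge> 0"
    by (simp add: zero_less_mult_iff)
  moreover have "real_of_int l * pi < 4 * pi"
    using l(1) \<phi>(2) by linarith
  then have "l < 4" by simp
  ultimately obtain k where k: "l = int k" "k < 4"
    by (metis nonneg_int_cases of_nat_less_iff of_nat_numeral)
  have "int m + int k = int j + 8 * n"
    using k by (simp add: l_def)
  then have "int ((m + k) mod 8) = int j"
    using j by (simp add: zmod_int)
  then have "j = (m + k) mod 8" by simp
  then show ?R using k l by (auto intro!: exI[of _ k] simp: add.commute)
next
  assume ?R
  then show ?L
    by (auto simp: arc8_mod field_simps intro!: imageI)
qed

text \<open>The equation of \<open>T\<close>, expanded along \<open>S\<close>, leaves a combination
  of cosine and sine that is constant on the arc. Its sum and its difference at the two ends of the
  arc force the combination and its quarter-turn partner to vanish at the midpoint, so the centres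
  agree, and the constant term then equates the radii.\<close>

lemma circle_eq_if_arc8_subset:
  assumes S: "snd S > 0" and T: "snd T > 0" and sub: "arc8 S j \<subseteq> circ T"
  shows "S = T"
proof -
  define a where "a = fst S $ 1 - fst T $ 1"
  define b where "b = fst S $ 2 - fst T $ 2"
  \<comment> \<open>Half of the angle of an arc: \<theta> is the midpoint of the arc and
    \<open>\<theta> - \<delta>\<close>, \<open>\<theta> + \<delta>\<close> are its ends.\<close>
  define \<delta> where "\<delta> = pi / 8"
  define \<theta> where "\<theta> = real j * pi / 4 + \<delta>"
  define f where "f t = 2 * snd S * (a * cos t + b * sin t)" for t
  have cs: "f t = (snd T)\<^sup>2 - (snd S)\<^sup>2 - a\<^sup>2 - b\<^sup>2" if "\<bar>t - \<theta>\<bar> \<le> \<delta>" for t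
  proof -
    have "circle_point S t \<in> arc8 S j"
      using that by (auto simp: arc8_def \<theta>_def \<delta>_def abs_le_iff field_simps intro!: imageI)
    then have "circle_point S t \<in> circ T" using sub by blast
    then have "(a + snd S * cos t)\<^sup>2 + (b + snd S * sin t)\<^sup>2 = (snd T)\<^sup>2"
      using T by (simp add: circ_iff_index[of _ _ 1] other_index_def a_def b_def algebra_simps)
    moreover have "(a + r * c)\<^sup>2 + (b + r * s)\<^sup>2
        = a\<^sup>2 + b\<^sup>2 + 2 * r * (a * c + b * s) + r\<^sup>2 * (c\<^sup>2 + s\<^sup>2)" for r c s
      by (simp add: power2_eq_square algebra_simps)
    from this[of "snd S" "cos t" "sin t"]
    have "(a + snd S * cos t)\<^sup>2 + (b + snd S * sin t)\<^sup>2 = a\<^sup>2 + b\<^sup>2 + f t + (snd S)\<^sup>2"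
      by (simp add: f_def)
    ultimately show ?thesis by simp
  qed
  have \<delta>: "0 < \<delta>" "\<delta> < pi / 2" "\<delta> < pi" by (auto simp: \<delta>_def)
  have f3: "f (\<theta> + \<delta>) = f \<theta>" "f (\<theta> - \<delta>) = f \<theta>"
    using cs[of "\<theta> + \<delta>"] cs[of "\<theta> - \<delta>"] cs[of \<theta>] \<delta> by auto
  have "cos \<delta> < 1" using cos_monotone_0_pi[of 0 \<delta>] \<delta> by simp
  have "sin \<delta> > 0" using \<delta> by (simp add: sin_gt_zero)
  have "f (\<theta> + \<delta>) + f (\<theta> - \<delta>) = 2 * cos \<delta> * f \<theta>"
    by (simp add: f_def cos_add sin_add cos_diff sin_diff algebra_simps)
  then have "f \<theta> * (1 - cos \<delta>) = 0" using f3 by (simp add: algebra_simps)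
  then have f0: "f \<theta> = 0" using \<open>cos \<delta> < 1\<close> by simp
  then have e1: "a * cos \<theta> + b * sin \<theta> = 0" using S by (simp add: f_def)
  have "f (\<theta> + \<delta>) - f (\<theta> - \<delta>) = 4 * snd S * sin \<delta> * (b * cos \<theta> - a * sin \<theta>)"
    by (simp add: f_def cos_add sin_add cos_diff sin_diff algebra_simps)
  then have e2: "b * cos \<theta> - a * sin \<theta> = 0" using f3 S \<open>sin \<delta> > 0\<close> by simp
  have "(a\<^sup>2 + b\<^sup>2) * (s\<^sup>2 + c\<^sup>2) = (a * c + b * s)\<^sup>2 + (b * c - a * s)\<^sup>2" for s c
    by (simp add: power2_eq_square algebra_simps)
  from this[of "sin \<theta>" "cos \<theta>"]
  have "a\<^sup>2 + b\<^sup>2 = (a * cos \<theta> + b * sin \<theta>)\<^sup>2 + (b * cos \<theta> - a * sin \<theta>)\<^sup>2"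
    by simp
  then have "a\<^sup>2 + b\<^sup>2 = 0" using e1 e2 by simp
  then have ab: "a = 0" "b = 0" by (auto simp: sum_power2_eq_zero_iff)
  then have "(snd T)\<^sup>2 = (snd S)\<^sup>2" using cs[of \<theta>] f0 \<delta> by simp
  then have "snd S = snd T" using S T by (simp add: power2_eq_iff_nonneg)
  moreover have "fst S = fst T" using ab by (simp add: vec_eq_iff forall_2 a_def b_def)
  ultimately show ?thesis by (simp add: prod_eq_iff)
qed

text \<open>The labels consist of arcs as point sets, so circle and index must be recoverable from
  the set. The circle is recovered because an arc lies on no other circle, the index because the
  midpoint of an arc lies in no other arc of its circle.\<close>

lemma arc8_eq_iff:
  assumes S: "snd S > 0" and T: "snd T > 0" and ab: "a < 8" "b < 8"
  shows "arc8 S a = arc8 T b \<longleftrightarrow> S = T \<and> a = b"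
proof
  assume eq: "arc8 S a = arc8 T b"
  then have ST: "S = T"
    using circle_eq_if_arc8_subset[OF S T] arc8_subset_circ[OF T] by metis
  have p: "0 < pi / 8" "pi / 8 < pi" by auto
  have "circle_point S (real a * pi / 4 + pi / 8) \<in> arc8 S a"
    by (auto simp: arc8_def field_simps intro!: imageI)
  then have "circle_point S (real a * pi / 4 + pi / 8) \<in> arc8 S b" using eq ST by simp
  then obtain k where k: "k < 4" "b = (a + k) mod 8" "real k * pi / 4 \<le> pi / 8"
    using circle_point_in_arc8_iff[OF S p ab(2)] by blast
  from k(3) have "real k * pi \<le> (1/2) * pi" by simp
  then have "real k \<le> 1/2" by (simp only: mult_le_cancel_right_pos pi_gt_zero)
  then have "k = 0" by linarith
  then show "S = T \<and> a = b" using ST k ab by simp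
qed auto

lemma arcs_at_eq_arcs_meeting: "arcs_at S x = arcs_meeting S {x}"
  by (auto simp: arcs_at_def arcs_meeting_def)

lemma arcs_meeting_subset: "arcs_meeting S C \<subseteq> arc8 S ` {..<8}"
  by (auto simp: arcs_meeting_def)

lemma finite_arcs_meeting [simp]: "finite (arcs_meeting S C)"
  using arcs_meeting_subset by (rule finite_subset) simp

text \<open>The half of a circle on one side of its diameter in direction \<open>i\<close> consists of four
  consecutive arcs; \<open>half_start i up\<close> is the index of the first of them, in counterclockwise order.\<close>

definition half_start :: "2 \<Rightarrow> bool \<Rightarrow> nat" where
  "half_start i up = (if i = 1 then (if up then 0 else 4) else (if up then 6 else 2))"

definition half_indices :: "2 \<Rightarrow> bool \<Rightarrow> nat set" where
  "half_indices i up = (if up then second_half i else first_half i)"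

text \<open>Both poles in direction \<open>i\<close> are left out: on this open half the
  \<open>i\<close>-th coordinate is a regular parameter, and no arc rule can be violated.\<close>

definition strict_half :: "2 \<Rightarrow> bool \<Rightarrow> circle \<Rightarrow> (real^2) set" where
  "strict_half i up S = {x \<in> circ S. if up then x $ other_index i > fst S $ other_index i
     else x $ other_index i < fst S $ other_index i}"

lemma half_indices_eq: "half_indices i up = (\<lambda>k. (half_start i up + k) mod 8) ` {..<4}"
proof -
  have n: "{..<4::nat} = {0, 1, 2, 3}" by auto
  show ?thesis
    unfolding n half_indices_def half_start_def first_half_def second_half_def
    by (cases up; cases "i = 1"; simp only: if_True if_False simp_thms; simp; fastforce?)
qed

text \<open>The angle is counted from the pole where the half begins, so that it runs through the
  interval from 0 to \<open>pi\<close> for either half and either \<open>i\<close>.\<close>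

definition half_point :: "2 \<Rightarrow> bool \<Rightarrow> circle \<Rightarrow> real \<Rightarrow> real^2" where
  "half_point i up S \<phi> = circle_point S (real (half_start i up) * pi / 4 + \<phi>)"

text \<open>All halves are traversed counterclockwise. On the \<open>up\<close> half the
  \<open>i\<close>-th coordinate therefore falls for \<open>i = 1\<close> and rises for the other
  index, and conversely on the opposite half; this is the sign given by
  \<open>up \<longleftrightarrow> i = 1\<close>.\<close>

lemma half_point_nth:
  "half_point i up S \<phi> $ other_index i
     = fst S $ other_index i + (if up then 1 else - 1) * snd S * sin \<phi>"
  "half_point i up S \<phi> $ i
     = fst S $ i + (if up \<longleftrightarrow> i = 1 then 1 else - 1) * snd S * cos \<phi>"
proof -
  have e: "6 * pi / 4 + \<phi> = pi + (pi / 2 + \<phi>)" "4 * pi / 4 + \<phi> = pi + \<phi>"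
     "2 * pi / 4 + \<phi> = pi / 2 + \<phi>" by auto
  have e32: "cos (3 * pi / 2) = 0" "sin (3 * pi / 2) = - 1"
    using cos_3over2_pi sin_3over2_pi by simp_all
  have i2: "i = 1 \<or> i = 2" using exhaust_2 by auto
  have "half_point i up S \<phi> $ other_index i
     = fst S $ other_index i + (if up then 1 else - 1) * snd S * sin \<phi> \<and>
     half_point i up S \<phi> $ i
     = fst S $ i + (if up \<longleftrightarrow> i = 1 then 1 else - 1) * snd S * cos \<phi>"
    using i2
    by (cases up) (auto simp: half_point_def half_start_def other_index_def e e32
        sin_add cos_add simp del: mult_numeral_1_right)
  then show "half_point i up S \<phi> $ other_index i
     = fst S $ other_index i + (if up then 1 else - 1) * snd S * sin \<phi>"
  "half_point i up S \<phi> $ i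
     = fst S $ i + (if up \<longleftrightarrow> i = 1 then 1 else - 1) * snd S * cos \<phi>" by auto
qed

text \<open>The inverse of \<open>half_point\<close> on the open half. It needs only the
  \<open>i\<close>-th coordinate and is continuous, so it turns connected curves into intervals of
  angles.\<close>

definition half_angle :: "2 \<Rightarrow> bool \<Rightarrow> circle \<Rightarrow> real^2 \<Rightarrow> real" where
  "half_angle i up S x = arccos ((if up \<longleftrightarrow> i = 1 then 1 else - 1) * (x $ i - fst S $ i) / snd S)"

lemma half_point_half_angle:
  assumes S: "snd S > 0" and x: "x \<in> strict_half i up S"
  shows "half_point i up S (half_angle i up S x) = x"
    and "0 < half_angle i up S x" "half_angle i up S x < pi"
    and "\<bar>x $ i - fst S $ i\<bar> < snd S"
proof -
  define s :: real where "s = (if up \<longleftrightarrow> i = 1 then 1 else - 1)"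
  define u where "u = s * (x $ i - fst S $ i) / snd S"
  define y where "y = x $ other_index i - fst S $ other_index i"
  have ss: "s * s = 1" by (simp add: s_def)
  have y: "if up then y > 0 else y < 0" using x by (simp add: strict_half_def y_def split: if_splits)
  have c: "(x $ i - fst S $ i)\<^sup>2 + y\<^sup>2 = (snd S)\<^sup>2"
    using x S by (simp add: strict_half_def circ_iff_index[of _ _ i] y_def)
  have "y\<^sup>2 > 0" using y by (auto split: if_splits)
  then have "(x $ i - fst S $ i)\<^sup>2 < (snd S)\<^sup>2" using c by linarith
  then show ab: "\<bar>x $ i - fst S $ i\<bar> < snd S"
    using S by (metis abs_le_square_iff abs_of_pos linorder_not_le)
  have u2: "u\<^sup>2 = 1 - (y / snd S)\<^sup>2"
    using c S by (simp add: u_def power_divide power_mult_distrib s_def field_simps power2_commute)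
  have u1: "\<bar>u\<bar> < 1" using ab S by (simp add: u_def s_def abs_mult)
  have ang: "half_angle i up S x = arccos u" by (simp add: half_angle_def u_def s_def)
  show "0 < half_angle i up S x" "half_angle i up S x < pi"
    using arccos_lt_bounded[of u] u1 by (auto simp: ang)
  have "sin (arccos u) = sqrt (1 - u\<^sup>2)" using u1 by (intro sin_arccos) auto
  also have "\<dots> = \<bar>y\<bar> / snd S" using S by (simp add: u2 real_sqrt_abs)
  finally have sn: "snd S * sin (arccos u) = \<bar>y\<bar>" using S by simp
  have cs: "snd S * cos (arccos u) = s * (x $ i - fst S $ i)"
    using u1 S cos_arccos[of u] by (simp add: abs_less_iff u_def[symmetric]) (simp add: u_def)
  show "half_point i up S (half_angle i up S x) = x"
  proof (rule vec2_eqI[of _ i])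
    show "half_point i up S (half_angle i up S x) $ i = x $ i"
      unfolding half_point_nth ang s_def[symmetric] mult.assoc cs
      by (simp add: mult.assoc[symmetric] ss)
    show "half_point i up S (half_angle i up S x) $ other_index i = x $ other_index i"
      unfolding half_point_nth ang mult.assoc sn using y by (auto simp: y_def split: if_splits)
  qed
qed

lemma half_point_inj:
  assumes "snd S > 0" "0 \<le> \<phi>" "\<phi> \<le> pi" "0 \<le> \<psi>" "\<psi> \<le> pi"
    "half_point i up S \<phi> $ i = half_point i up S \<psi> $ i"
  shows "\<phi> = \<psi>"
proof -
  have "cos \<phi> = cos \<psi>" using assms by (simp add: half_point_nth split: if_splits)
  then show ?thesis using assms cos_inj_pi by blast
qed

lemma continuous_on_half_angle:
  assumes "snd S > 0"
  shows "continuous_on (strict_half i up S) (half_angle i up S)"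
  unfolding half_angle_def
proof (intro continuous_intros ballI)
  fix x assume "x \<in> strict_half i up S"
  then have "\<bar>x $ i - fst S $ i\<bar> < snd S" using half_point_half_angle(4)[OF assms] by blast
  then have "\<bar>x $ i - fst S $ i\<bar> / snd S \<le> 1" using assms by simp
  then show "- 1 \<le> (if up = (i = 1) then 1 else - 1) * (x $ i - fst S $ i) / snd S \<and>
         (if up = (i = 1) then 1 else - 1) * (x $ i - fst S $ i) / snd S \<le> 1"
    using assms by (auto simp: abs_le_iff field_simps)
qed (use assms in auto)

lemma in_arc8_iff_half_angle:
  assumes "snd S > 0" "x \<in> strict_half i up S" "j < 8"
  shows "x \<in> arc8 S j \<longleftrightarrow> (\<exists>k<4. j = (half_start i up + k) mod 8 \<and>
     real k * pi / 4 \<le> half_angle i up S x \<and> half_angle i up S x \<le> real (Suc k) * pi / 4)"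
  using circle_point_in_arc8_iff[OF assms(1) half_point_half_angle(2,3)[OF assms(1,2)] assms(3)]
    half_point_half_angle(1)[OF assms(1,2)] by (metis half_point_def)

lemma arcs_meeting_subset_half:
  assumes "snd S > 0" "C \<subseteq> strict_half i up S"
  shows "arcs_meeting S C \<subseteq> arc8 S ` half_indices i up"
proof
  fix A assume "A \<in> arcs_meeting S C"
  then obtain j x where j: "j < 8" "A = arc8 S j" "x \<in> A" "x \<in> C"
    by (auto simp: arcs_meeting_def)
  then have "j \<in> half_indices i up"
    using in_arc8_iff_half_angle[OF assms(1) _ j(1), of x i up] assms(2)
    by (auto simp: half_indices_eq)
  then show "A \<in> arc8 S ` half_indices i up" using j by auto
qed

subsection \<open>Smoothness of circular arcs\<close>

text \<open>Differentiation advances the angle by a quarter turn, which gives all derivatives in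
  closed form; the centre survives only in order 0.\<close>

definition circle_deriv :: "circle \<Rightarrow> nat \<Rightarrow> real \<Rightarrow> real^2" where
  "circle_deriv S k t = (if k = 0 then fst S else 0)
     + snd S *\<^sub>R vector [cos (t + real k * pi / 2), sin (t + real k * pi / 2)]"

lemma circle_deriv_0: "circle_deriv S 0 = circle_point S"
  by (auto simp: circle_deriv_def circle_point_def)

lemma circle_deriv_1:
  "circle_deriv S (Suc 0) t $ 1 = - snd S * sin t"
  "circle_deriv S (Suc 0) t $ 2 = snd S * cos t"
  by (simp_all add: circle_deriv_def sin_add cos_add)


lemma circle_deriv_has_vector_derivative:
  "(circle_deriv S k has_vector_derivative circle_deriv S (Suc k) t) (at t within I)"
proof -
  define e where "e t = (vector [cos t, sin t] :: real^2)" for t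
  have e_eq: "e t = cos t *\<^sub>R axis 1 1 + sin t *\<^sub>R axis 2 1" for t
    by (simp add: e_def vec_eq_iff forall_2 axis_def)
  have cs: "circle_deriv S k = (\<lambda>t. (if k = 0 then fst S else 0) + snd S *\<^sub>R
     (cos (t + real k * pi / 2) *\<^sub>R axis 1 1 + sin (t + real k * pi / 2) *\<^sub>R axis 2 1))" for k
    using e_eq unfolding circle_deriv_def e_def by (intro ext) simp
  have "t + real (Suc k) * pi / 2 = (t + real k * pi / 2) + pi / 2" by (simp add: field_simps)
  then have s: "cos (t + real (Suc k) * pi / 2) = - sin (t + real k * pi / 2)"
     "sin (t + real (Suc k) * pi / 2) = cos (t + real k * pi / 2)"
    by (simp_all only: cos_add sin_add cos_pi_half sin_pi_half) auto
  show ?thesis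
    unfolding cs s
    by (auto intro!: derivative_eq_intros)
qed

lemma circle_deriv_1_neq_0: "snd S > 0 \<Longrightarrow> circle_deriv S 1 t \<noteq> 0"
  using circle_deriv_1[of S t] sin_zero_abs_cos_one[of t]
  by (auto simp: vec_eq_iff forall_2)

lemma continuous_on_circle_point: "continuous_on A (circle_point S)"
  using circle_deriv_has_vector_derivative[of S 0]
  by (metis circle_deriv_0 continuous_on_vector_derivative)

text \<open>The continuous inverse comes from compactness of a closed interval shorter than a full
  turn. The interval \<open>J\<close> itself may be open, so it is only required to lie inside such
  a closed interval and the homeomorphism is restricted to it.\<close>

lemma regular_parametrization_circle_point:
  assumes S: "snd S > 0" and J: "J \<subseteq> {\<alpha>..\<beta>}" "\<beta> - \<alpha> < 2 * pi" "is_interval J"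
    and nd: "a \<in> J" "b \<in> J" "a < b"
  shows "regular_parametrization J (circle_deriv S) (circle_point S ` J)"
proof -
  have inj: "inj_on (circle_point S) {\<alpha>..\<beta>}"
  proof (rule inj_onI)
    fix s t assume st: "s \<in> {\<alpha>..\<beta>}" "t \<in> {\<alpha>..\<beta>}" "circle_point S s = circle_point S t"
    then obtain n :: int where n: "s = t + 2 * of_int n * pi"
      using circle_point_eq_iff[OF S] by blast
    have "\<bar>s - t\<bar> < 2 * pi" using st J by auto
    then have "\<bar>real_of_int n\<bar> * (2 * pi) < 1 * (2 * pi)" by (simp add: n abs_mult)
    then have "\<bar>real_of_int n\<bar> < 1" by simp
    then have "n = 0" by linarith
    then show "s = t" using n by simp
  qed
  obtain h where h: "homeomorphism {\<alpha>..\<beta>} (circle_point S ` {\<alpha>..\<beta>}) (circle_point S) h"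
    using homeomorphism_compact[OF compact_Icc continuous_on_circle_point refl inj] by blast
  have "homeomorphism J (circle_point S ` J) (circle_point S) h"
    by (rule homeomorphism_of_subsets[OF h J(1)]) (use J in auto)
  then show ?thesis
    using J nd circle_deriv_1_neq_0[OF S] circle_deriv_has_vector_derivative
    by (auto simp: regular_parametrization_def circle_deriv_0)
qed

lemma half_curve_parametrization:
  assumes S: "snd S > 0" and C: "C \<subseteq> strict_half i up S" "connected C"
  defines "J \<equiv> half_angle i up S ` C"
  shows "is_interval J" "J \<subseteq> {0<..<pi}" "C = half_point i up S ` J"
proof -
  have "connected J" unfolding J_def
    using C continuous_on_half_angle[OF S] continuous_on_subset connected_continuous_image by blast
  then show "is_interval J" by (simp add: is_interval_connected_1)
  show "J \<subseteq> {0<..<pi}" using half_point_half_angle(2,3)[OF S] C by (auto simp: J_def)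
  show "C = half_point i up S ` J" using half_point_half_angle(1)[OF S] C
    by (force simp: J_def image_image)
qed

text \<open>The derivative of the \<open>i\<close>-th coordinate along a circle is, up to sign, the
  offset of the other coordinate from the centre, which does not vanish off the two poles. Two
  distinct points of \<open>C\<close> are needed to make the parameter interval
  nondegenerate.\<close>

lemma projects_regularly_half:
  assumes S: "snd S > 0" and C: "C \<subseteq> strict_half i up S" "connected C"
    and xy: "x \<in> C" "y \<in> C" "x \<noteq> y"
  shows "projects_regularly i C"
proof -
  define J where "J = half_angle i up S ` C"
  define \<alpha> where "\<alpha> = real (half_start i up) * pi / 4"
  note J = half_curve_parametrization[OF S C, folded J_def]
  define J' where "J' = (\<lambda>t. \<alpha> + t) ` J"
  have hp: "half_point i up S t = circle_point S (\<alpha> + t)" for t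
    by (simp add: half_point_def \<alpha>_def)
  have C': "C = circle_point S ` J'"
    unfolding J'_def image_image using J(3) by (simp add: hp)
  have "half_angle i up S x \<noteq> half_angle i up S y"
    using half_point_half_angle(1)[OF S] C xy by (metis subsetD)
  then obtain a b where ab: "a \<in> J" "b \<in> J" "a < b"
    using xy unfolding J_def by (metis imageI linorder_neqE_linordered_idom)
  have "regular_parametrization J' (circle_deriv S) C"
    unfolding C'
  proof (rule regular_parametrization_circle_point[OF S, of _ \<alpha> "\<alpha> + pi" "\<alpha> + a" "\<alpha> + b"])
    show "is_interval J'" unfolding J'_def using J(1) by simp
  qed (use ab J(2) in \<open>auto simp: J'_def\<close>)
  moreover have "circle_deriv S 1 t $ i \<noteq> 0" if t: "t \<in> J'" for t
  proof -
    obtain s where s: "t = \<alpha> + s" "s \<in> J" using t unfolding J'_def by blast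
    then have "sin s > 0" using J(2) by (auto intro!: sin_gt_zero)
    then have "circle_point S t $ other_index i \<noteq> fst S $ other_index i"
      using half_point_nth(1)[of i up S s] S unfolding hp s(1) by auto
    then show ?thesis using exhaust_2[of i] circle_deriv_1[of S t]
      by (auto simp: other_index_def)
  qed
  moreover have "inj_on (\<lambda>x. x $ i) C"
    unfolding J(3)
  proof (rule inj_onI)
    fix p q assume pq: "p \<in> half_point i up S ` J" "q \<in> half_point i up S ` J" "p $ i = q $ i"
    then obtain s t where st: "s \<in> J" "t \<in> J" "p = half_point i up S s" "q = half_point i up S t"
      by blast
    then have "s \<in> {0<..<pi}" "t \<in> {0<..<pi}" using J(2) by auto
    then show "p = q" using half_point_inj[OF S, of s t i up] pq(3) st by auto
  qed
  ultimately show ?thesis unfolding projects_regularly_def by blast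
qed

text \<open>The angles of \<open>C\<close> form an interval inside an open half turn, so the arcs it
  meets are consecutive and their union is one circular arc of angle at most \<open>pi\<close>. Each
  of the two forbidden pairs has one arc in either half of the circle, while all arcs met by
  \<open>C\<close> belong to a single half.\<close>

lemma arc_rule_half:
  assumes S: "snd S > 0" and C: "C \<subseteq> strict_half i up S" "connected C" "C \<noteq> {}"
  shows "arc_rule i S (arcs_meeting S C)" "card (arcs_meeting S C) \<le> 4"
proof -
  define F where "F = arcs_meeting S C"
  define m where "m = half_start i up"
  define J where "J = half_angle i up S ` C"
  note J = half_curve_parametrization[OF S C(1,2), folded J_def]
  define B where "B = {k. k < 4 \<and> (\<exists>\<phi>\<in>J. real k * pi / 4 \<le> \<phi> \<and> \<phi> \<le> real (Suc k) * pi / 4)}"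
  have F: "F = (\<lambda>k. arc8 S ((m + k) mod 8)) ` B"
  proof (intro set_eqI iffI)
    fix A assume "A \<in> F"
    then obtain j x where j: "j < 8" "A = arc8 S j" "x \<in> A" "x \<in> C"
      by (auto simp: F_def arcs_meeting_def)
    then obtain k where "k < 4" "j = (m + k) mod 8"
       "real k * pi / 4 \<le> half_angle i up S x" "half_angle i up S x \<le> real (Suc k) * pi / 4"
      using in_arc8_iff_half_angle[OF S _ j(1), of x i up] C by (auto simp: m_def)
    then show "A \<in> (\<lambda>k. arc8 S ((m + k) mod 8)) ` B" using j by (auto simp: B_def J_def)
  next
    fix A assume "A \<in> (\<lambda>k. arc8 S ((m + k) mod 8)) ` B"
    then obtain k x where k: "k < 4" "A = arc8 S ((m + k) mod 8)" "x \<in> C"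
       "real k * pi / 4 \<le> half_angle i up S x" "half_angle i up S x \<le> real (Suc k) * pi / 4"
      by (auto simp: B_def J_def)
    then have "x \<in> A"
      using in_arc8_iff_half_angle[OF S, of x i up "(m + k) mod 8"] C by (auto simp: m_def)
    then show "A \<in> F" using k by (auto simp: F_def arcs_meeting_def intro!: exI[of _ "(m + k) mod 8"])
  qed
  have finB: "finite B" by (simp add: B_def)
  obtain \<phi> where \<phi>: "\<phi> \<in> J" "0 < \<phi>" "\<phi> < pi" using J(2) C(3) by (force simp: J_def)
  define p where "p = Min B"
  define q where "q = Max B"
  have neB: "B \<noteq> {}"
  proof -
    \<comment> \<open>Angles are measured in units of one arc; the integer part names an arc
      containing \<phi>.\<close>
    define k where "k = nat \<lfloor>\<phi> * 4 / pi\<rfloor>"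
    have "\<phi> * 4 / pi > 0" "\<phi> * 4 / pi < 4" using \<phi> by (auto simp: field_simps)
    then have "k < 4" "real k \<le> \<phi> * 4 / pi" "\<phi> * 4 / pi \<le> real k + 1"
      unfolding k_def by linarith+
    then have "k \<in> B" using \<phi>(1) by (auto simp: B_def field_simps intro!: bexI[of _ \<phi>])
    then show ?thesis by blast
  qed
  have pB: "p \<in> B" and qB: "q \<in> B" using finB neB unfolding p_def q_def by auto
  have bnd: "p \<le> k \<and> k \<le> q" if "k \<in> B" for k using finB that unfolding p_def q_def by auto
  have "q < 4" using qB by (simp add: B_def)
  note pq = pB qB conjunct2[OF bnd[OF pB]] bnd this
  have B: "B = {p..q}"
  proof (intro set_eqI iffI)
    fix k assume "k \<in> {p..q}"
    then consider "k = p" | "k = q" | "p < k" "k < q" by force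
    then show "k \<in> B"
    proof cases
      case 3
      \<comment> \<open>The grid angle where arc \<open>k\<close> starts lies between an angle of
        \<open>J\<close> from arc \<open>p\<close> and one from arc \<open>q\<close>, so it belongs
        to the interval \<open>J\<close> itself.\<close>
      obtain a b where ab: "a \<in> J" "a \<le> real (Suc p) * pi / 4" "b \<in> J" "real q * pi / 4 \<le> b"
        using pq(1,2) by (auto simp: B_def)
      have m: "real (Suc p) * pi / 4 \<le> real k * pi / 4" "real k * pi / 4 \<le> real q * pi / 4"
        using 3 by (auto intro!: divide_right_mono mult_right_mono)
      have k: "a \<le> real k * pi / 4" "real k * pi / 4 \<le> b"
        using order_trans[OF ab(2) m(1)] order_trans[OF m(2) ab(4)] .
      then have "real k * pi / 4 \<in> J"
        using J(1) ab unfolding is_interval_1 by blast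
      then show ?thesis using 3 pq(5) by (auto simp: B_def field_simps intro!: bexI[of _ "real k * pi / 4"])
    qed (use pq in auto)
  qed (use pq in auto)
  have "\<Union>F = circle_point S ` {real (m + p) * pi / 4 .. real (Suc (m + q)) * pi / 4}"
  proof -
    have "\<Union>F = (\<Union>k\<in>{p..q}. circle_point S ` {real (m + k) * pi / 4 .. real (Suc (m + k)) * pi / 4})"
      unfolding F B by (simp add: arc8_mod)
    also have "\<dots> = circle_point S ` (\<Union>k\<in>{p..q}. {real (m + k) * pi / 4 .. real (Suc (m + k)) * pi / 4})"
      by blast
    also have "(\<Union>k\<in>{p..q}. {real (m + k) * pi / 4 .. real (Suc (m + k)) * pi / 4})
       = {real (m + p) * pi / 4 .. real (Suc (m + q)) * pi / 4}"
      using \<open>p \<le> q\<close>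
    proof (induction q rule: dec_induct)
      case base then show ?case by simp
    next
      case (step n)
      have "{p..Suc n} = insert (Suc n) {p..n}" using step by auto
      moreover have "real (m + p) * pi / 4 \<le> real (Suc (m + n)) * pi / 4"
        "real (Suc (m + n)) * pi / 4 \<le> real (Suc (Suc (m + n))) * pi / 4"
        using step by (auto intro!: divide_right_mono mult_right_mono)
      note ivl_disj_un_two_touch(4)[OF this]
      ultimately show ?case using step.IH
        by (simp only: UN_insert Un_commute add_Suc_right)
    qed
    finally show ?thesis .
  qed
  moreover have "regular_parametrization {real (m + p) * pi / 4 .. real (Suc (m + q)) * pi / 4}
      (circle_deriv S) (circle_point S ` {real (m + p) * pi / 4 .. real (Suc (m + q)) * pi / 4})"
  proof (rule regular_parametrization_circle_point[OF S order_refl])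
    have a: "real (m + p) * pi < real (Suc (m + q)) * pi" using pq(3) by (intro mult_strict_right_mono) auto
    have b: "(real (Suc (m + q)) - real (m + p)) * pi \<le> 4 * pi"
      using pq(3,5) by (intro mult_right_mono) (auto simp: of_nat_diff)
    show "real (Suc (m + q)) * pi / 4 - real (m + p) * pi / 4 < 2 * pi"
    proof -
      have "x / 4 - y / 4 < 2 * z" if "x - y \<le> 4 * z" "0 < z" for x y z :: real
        using that by linarith
      from this[OF b[unfolded left_diff_distrib] pi_gt_zero] show ?thesis .
    qed
    show "real (m + p) * pi / 4 < real (Suc (m + q)) * pi / 4" using a by simp
    show "real (m + p) * pi / 4 \<in> {real (m + p) * pi / 4 .. real (Suc (m + q)) * pi / 4}"
      "real (Suc (m + q)) * pi / 4 \<in> {real (m + p) * pi / 4 .. real (Suc (m + q)) * pi / 4}"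
      using a by auto
  qed (simp add: is_interval_1)
  ultimately have sm: "smooth_curve (\<Union>F)"
    unfolding smooth_curve_def by metis
  have sub: "F \<subseteq> arc8 S ` half_indices i up"
    unfolding F_def using arcs_meeting_subset_half[OF S C(1)] .
  have mem: "c \<in> half_indices i up" if c: "c < 8" "arc8 S c \<in> F" for c
  proof -
    from c(2) sub have "arc8 S c \<in> arc8 S ` half_indices i up" by (rule rev_subsetD)
    then obtain c' where c': "arc8 S c = arc8 S c'" "c' \<in> half_indices i up" by (rule imageE)
    from c'(2) have "c' < 8" by (auto simp: half_indices_eq)
    from arc8_eq_iff[OF S S c(1) this] c' show ?thesis by simp
  qed
  have "\<not> {arc8 S a, arc8 S b} \<subseteq> F"
    if ab: "a < 8" "b < 8" "a \<notin> half_indices i up \<or> b \<notin> half_indices i up" for a b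
    using mem[OF ab(1)] mem[OF ab(2)] ab(3) by auto
  from this[of 3 4] this[of 5 6] this[of 0 7] this[of 1 2]
  have "\<not> min_arcs i S \<subseteq> F" "\<not> max_arcs i S \<subseteq> F"
    unfolding min_arcs_def max_arcs_def half_indices_def first_half_def second_half_def
    by (cases "i = 1"; cases up; simp)+
  then show "arc_rule i S (arcs_meeting S C)" using sm by (simp add: arc_rule_def F_def)
  have "card F \<le> card (half_indices i up)"
  proof -
    have fin: "finite (half_indices i up)" unfolding half_indices_eq by simp
    show ?thesis using card_mono[OF finite_imageI[OF fin] sub] card_image_le[OF fin, of "arc8 S"]
      by linarith
  qed
  also have "\<dots> \<le> card {..<4::nat}" unfolding half_indices_eq by (rule card_image_le) simp
  finally show "card (arcs_meeting S C) \<le> 4" by (simp add: F_def)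
qed

lemma one_or_two_arcs_half:
  assumes S: "snd S > 0" and x: "x \<in> strict_half i up S"
  shows "one_or_two_arcs i S x (arcs_at S x)"
proof -
  define m where "m = half_start i up"
  define \<phi> where "\<phi> = half_angle i up S x"
  have \<phi>: "0 < \<phi>" "\<phi> < pi" using half_point_half_angle(2,3)[OF S x] by (auto simp: \<phi>_def)
  have mem: "x \<in> arc8 S j \<longleftrightarrow> (\<exists>k<4. j = (m + k) mod 8 \<and>
     real k * pi / 4 \<le> \<phi> \<and> \<phi> \<le> real (Suc k) * pi / 4)" if "j < 8" for j
    using in_arc8_iff_half_angle[OF S x that] by (simp add: m_def \<phi>_def)
  define k0 where "k0 = nat \<lfloor>\<phi> * 4 / pi\<rfloor>"
  have "\<phi> * 4 / pi > 0" "\<phi> * 4 / pi < 4" using \<phi> by (auto simp: field_simps)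
  then have k0: "k0 < 4" "real k0 \<le> \<phi> * 4 / pi" "\<phi> * 4 / pi < real k0 + 1"
    unfolding k0_def by linarith+
  \<comment> \<open>Only the preceding arc can share the point. For \<open>k0 = 0\<close> the
    truncated difference \<open>k0 - 1\<close> is again 0, so the second candidate repeats the
    first.\<close>
  have range: "k = k0 \<or> k = k0 - 1" if "real k * pi / 4 \<le> \<phi>" "\<phi> \<le> real (Suc k) * pi / 4" for k
  proof -
    have "real k \<le> \<phi> * 4 / pi" "\<phi> * 4 / pi \<le> real k + 1"
      using that by (auto simp: field_simps)
    then have "real k < real k0 + 1" "real k0 \<le> real k + 1" using k0 by linarith+
    then show ?thesis by linarith
  qed
  have sub: "arcs_at S x \<subseteq> {arc8 S ((m + k0) mod 8), arc8 S ((m + (k0 - 1)) mod 8)}"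
    unfolding arcs_at_def using mem range by blast
  have "arc8 S ((m + k0) mod 8) \<in> arcs_at S x"
  proof -
    have "real k0 * pi / 4 \<le> \<phi>" "\<phi> \<le> real (Suc k0) * pi / 4" using k0 by (auto simp: field_simps)
    then have "x \<in> arc8 S ((m + k0) mod 8)" using mem[of "(m + k0) mod 8"] k0 by auto
    then show ?thesis unfolding arcs_at_def by (metis (mono_tags, lifting) mem_Collect_eq
      mod_less_divisor zero_less_numeral)
  qed
  then have "card (arcs_at S x) \<noteq> 0"
    using finite_arcs_meeting by (auto simp: arcs_at_eq_arcs_meeting)
  moreover have "card (arcs_at S x) \<le> 2"
    using card_mono[OF _ sub] card_insert_le_m1[of 2] by (auto simp: card_insert_if split: if_splits)
  ultimately have card: "card (arcs_at S x) = 1 \<or> card (arcs_at S x) = 2" by linarith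
  have "(a, b) \<in> pole_free_pairs i \<or> (b, a) \<in> pole_free_pairs i"
    if ab: "a < 8" "b < 8" "a \<noteq> b" "arc8 S a \<in> arcs_at S x" "arc8 S b \<in> arcs_at S x" for a b
  proof -
    have "x \<in> arc8 S a" "x \<in> arc8 S b" using ab by (auto simp: arcs_at_def)
    then obtain k l where k: "k < 4" "a = (m + k) mod 8" "l < 4" "b = (m + l) mod 8"
      "k = k0 \<or> k = k0 - 1" "l = k0 \<or> l = k0 - 1"
      using mem[OF ab(1)] mem[OF ab(2)] range by blast
    then have "k \<noteq> l" using ab by auto
    then consider "k0 \<noteq> 0" "k = k0" "l = k0 - 1" | "k0 \<noteq> 0" "k = k0 - 1" "l = k0" using k by auto
    moreover have "k0 = 0 \<or> k0 = 1 \<or> k0 = 2 \<or> k0 = 3" using k0(1) by auto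
    moreover have "m = 0 \<and> i = 1 \<or> m = 4 \<and> i = 1 \<or> m = 2 \<and> i \<noteq> 1 \<or> m = 6 \<and> i \<noteq> 1"
      by (auto simp: m_def half_start_def)
    ultimately show ?thesis
      unfolding k by (elim disjE conjE; cases; simp add: pole_free_pairs_def)
  qed
  then show ?thesis using card by (auto simp: one_or_two_arcs_def)
qed

section \<open>Arcs at the poles of a circle\<close>

lemma arcs_at_pole_eq:
  assumes S: "snd S > 0" and j: "j < 8"
  shows "arcs_at S (pole S j) = {arc8 S ((j + 7) mod 8), arc8 S j}"
proof -
  have p: "0 < pi / 4" "pi / 4 < pi" by auto
  \<comment> \<open>The membership criterion excludes the offset 0. The pole is therefore seen from
    one arc earlier, with \<open>j + 7\<close> in place of \<open>j - 1\<close> modulo 8 and offset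
    \<open>pi / 4\<close>.\<close>
  have "circle_point S (real (j + 7) * pi / 4 + pi / 4) = pole S j"
    unfolding pole_def circle_point_eq_iff[OF S] by (intro exI[of _ 1]) (simp add: field_simps)
  then have mem: "pole S j \<in> arc8 S b \<longleftrightarrow> (\<exists>k<4. b = (j + 7 + k) mod 8 \<and>
     real k * pi / 4 \<le> pi / 4 \<and> pi / 4 \<le> real (Suc k) * pi / 4)" if "b < 8" for b
    using circle_point_in_arc8_iff[OF S p that, of "j + 7"] by simp
  have kk: "real k * pi / 4 \<le> pi / 4 \<and> pi / 4 \<le> real (Suc k) * pi / 4 \<longleftrightarrow> k = 0 \<or> k = 1" for k
  proof -
    have "real k * pi / 4 \<le> pi / 4 \<longleftrightarrow> real k * pi \<le> 1 * pi" by simp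
    also have "\<dots> \<longleftrightarrow> k \<le> 1" by (subst mult_le_cancel_right_pos) auto
    finally show ?thesis by (auto simp: le_Suc_eq)
  qed
  have "pole S j \<in> arc8 S b \<longleftrightarrow> b = (j + 7) mod 8 \<or> b = j" if "b < 8" for b
  proof -
    have "(j + 7 + 1) mod 8 = j" using j by simp
    then show ?thesis unfolding mem[OF that] kk by (auto intro: exI[of _ 0] exI[of _ 1])
  qed
  moreover have "(j + 7) mod 8 < 8" by simp
  ultimately show ?thesis using j unfolding arcs_at_def by blast
qed

lemma arcs_at_pole:
  assumes S: "snd S > 0" and x: "x \<in> circ S" "x $ other_index i = fst S $ other_index i"
  shows "x $ i < fst S $ i \<Longrightarrow> arcs_at S x = min_arcs i S"
    "x $ i > fst S $ i \<Longrightarrow> arcs_at S x = max_arcs i S"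
    "\<exists>j\<in>pole_indices i. x = pole S j"
    "x $ i \<noteq> fst S $ i"
proof -
  have e32: "cos (3 * pi / 2) = 0" "sin (3 * pi / 2) = - 1"
    using cos_3over2_pi sin_3over2_pi by simp_all
  have "(x $ i - fst S $ i)\<^sup>2 = (snd S)\<^sup>2" using x S by (simp add: circ_iff_index[of _ _ i])
  then have d: "x $ i = fst S $ i - snd S \<or> x $ i = fst S $ i + snd S"
    by (auto simp: power2_eq_iff)
  then show "x $ i \<noteq> fst S $ i" using S by auto
  have i2: "i = 1 \<or> i = 2" using exhaust_2 by auto
  have mn: "x = pole S (if i = 1 then 4 else 6)" if "x $ i = fst S $ i - snd S"
    using i2 that x(2) by (auto simp: pole_def vec_eq_iff forall_2 other_index_def e32)
  have mx: "x = pole S (if i = 1 then 0 else 2)" if "x $ i = fst S $ i + snd S"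
    using i2 that x(2) by (auto simp: pole_def vec_eq_iff forall_2 other_index_def)
  show "\<exists>j\<in>pole_indices i. x = pole S j" using d mn mx by (auto simp: pole_indices_def)
  show "arcs_at S x = min_arcs i S" if "x $ i < fst S $ i"
  proof -
    have "x = pole S (if i = 1 then 4 else 6)" using d mn that S by auto
    then show ?thesis using arcs_at_pole_eq[OF S, of "if i = 1 then 4 else 6"]
      by (auto simp: min_arcs_def)
  qed
  show "arcs_at S x = max_arcs i S" if "x $ i > fst S $ i"
  proof -
    have "x = pole S (if i = 1 then 0 else 2)" using d mx that S by auto
    then show ?thesis using arcs_at_pole_eq[OF S, of "if i = 1 then 0 else 2"]
      by (auto simp: max_arcs_def)
  qed
qed

lemma pole_index_iff:
  assumes S: "snd S > 0"
  shows "(\<exists>j\<in>pole_indices i. x = pole S j) \<longleftrightarrow>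
    x \<in> circ S \<and> x $ other_index i = fst S $ other_index i"
proof
  have e32: "cos (3 * pi / 2) = 0" "sin (3 * pi / 2) = - 1"
    using cos_3over2_pi sin_3over2_pi by simp_all
  have i2: "i = 1 \<or> i = 2" using exhaust_2 by auto
  assume "\<exists>j\<in>pole_indices i. x = pole S j"
  then show "x \<in> circ S \<and> x $ other_index i = fst S $ other_index i"
    using i2 S by (auto simp: pole_indices_def pole_def circle_point_in_circ other_index_def e32)
qed (use arcs_at_pole(3)[OF S] in blast)

lemma arcs_at_nonempty:
  assumes S: "snd S > 0" and x: "x \<in> circ S"
  shows "arcs_at S x \<noteq> {}"
proof (cases "x $ other_index 1 = fst S $ other_index 1")
  case True
  then obtain j where "j \<in> pole_indices 1" "x = pole S j" using pole_index_iff[OF S, of 1 x] x by blast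
  then show ?thesis using arcs_at_pole_eq[OF S, of j] by (auto simp: pole_indices_def)
next
  case False
  then have "x \<in> strict_half 1 (x $ other_index 1 > fst S $ other_index 1) S"
    using x by (auto simp: strict_half_def)
  from one_or_two_arcs_half[OF S this] show ?thesis by (auto simp: one_or_two_arcs_def)
qed

section \<open>Local structure of the closure of the domain\<close>

text \<open>Points are written with the \<open>i\<close>-th coordinate leading. For both values of
  \<open>i\<close> the number \<open>c\<close> is thought of as horizontal position and
  \<open>w\<close> as height, so one argument serves both projections.\<close>

definition pt :: "2 \<Rightarrow> real \<Rightarrow> real \<Rightarrow> real^2" where
  "pt i c w = (\<chi> k. if k = i then c else w)"

lemma pt_nth [simp]: "pt i c w $ i = c" "pt i c w $ other_index i = w"
  by (simp_all add: pt_def)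

lemma pt_eq_iff [simp]: "pt i c w = pt i c' w' \<longleftrightarrow> c = c' \<and> w = w'"
  by (metis pt_nth)

lemma pt_coords [simp]: "pt i (x $ i) (x $ other_index i) = x"
  by (rule vec2_eqI[of _ i]) simp_all

lemma pt_axis: "pt i c w = c *\<^sub>R axis i 1 + w *\<^sub>R axis (other_index i) 1"
  by (rule vec2_eqI[of _ i]) (simp_all add: axis_def)

lemma continuous_on_pt [continuous_intros]:
  "continuous_on A f \<Longrightarrow> continuous_on A g \<Longrightarrow> continuous_on A (\<lambda>x. pt i (f x) (g x))"
  unfolding pt_axis by (intro continuous_intros)

lemma tendsto_pt [tendsto_intros]:
  "(f \<longlongrightarrow> c) F \<Longrightarrow> (g \<longlongrightarrow> w) F \<Longrightarrow> ((\<lambda>x. pt i (f x) (g x)) \<longlongrightarrow> pt i c w) F"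
  unfolding pt_axis by (intro tendsto_intros)

lemma dist_pt_le: "dist (pt i c w) (pt i c' w') \<le> \<bar>c - c'\<bar> + \<bar>w - w'\<bar>"
proof -
  have "pt i c w - pt i c' w' = (c - c') *\<^sub>R axis i 1 + (w - w') *\<^sub>R axis (other_index i) 1"
    by (simp add: pt_axis algebra_simps)
  then show ?thesis
    using norm_triangle_ineq[of "(c - c') *\<^sub>R axis i (1::real)" "(w - w') *\<^sub>R axis (other_index i) 1"]
    by (simp add: dist_norm)
qed

lemma dist_pt_vertical: "dist (pt i c w) (pt i c w') = \<bar>w - w'\<bar>"
  using dist_index[of "pt i c w" "pt i c w'" i] real_sqrt_abs[of "w - w'"]
    real_sqrt_abs[of "dist (pt i c w) (pt i c w')"] by simp

text \<open>The determinant of the two vectors, up to a sign depending on \<open>i\<close>. For the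
  radius vectors of two circles at a common point it vanishes exactly when the circles are tangent
  there.\<close>

definition cross :: "2 \<Rightarrow> real^2 \<Rightarrow> real^2 \<Rightarrow> real" where
  "cross i a b = a $ i * b $ other_index i - a $ other_index i * b $ i"

text \<open>Cramer's rule in quantitative form: a vector is controlled by its inner products with
  two independent vectors. It is applied to displacements whose inner products are zero or of second
  order.\<close>

lemma norm_le_of_cross:
  fixes a b h :: "real^2"
  shows "\<bar>cross i a b\<bar> * norm h \<le> (\<bar>a \<bullet> h\<bar> + \<bar>b \<bullet> h\<bar>) *
    (\<bar>a $ i\<bar> + \<bar>a $ other_index i\<bar> + \<bar>b $ i\<bar> + \<bar>b $ other_index i\<bar>)"
proof -
  let ?o = "other_index i"
  have h: "norm h \<le> \<bar>h $ i\<bar> + \<bar>h $ ?o\<bar>"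
    using dist_pt_le[of i "h $ i" "h $ ?o" 0 0] pt_axis[of i 0 0] by (simp add: dist_norm)
  have e1: "cross i a b * h $ i = (a \<bullet> h) * b $ ?o - (b \<bullet> h) * a $ ?o"
    by (simp add: cross_def inner_index[of _ _ i] algebra_simps)
  have e2: "cross i a b * h $ ?o = (b \<bullet> h) * a $ i - (a \<bullet> h) * b $ i"
    by (simp add: cross_def inner_index[of _ _ i] algebra_simps)
  have "\<bar>cross i a b\<bar> * norm h \<le> \<bar>cross i a b\<bar> * (\<bar>h $ i\<bar> + \<bar>h $ ?o\<bar>)"
    using h by (intro mult_left_mono) auto
  also have "\<dots> = \<bar>cross i a b * h $ i\<bar> + \<bar>cross i a b * h $ ?o\<bar>"
    by (simp add: abs_mult algebra_simps)
  also have "\<dots> \<le> (\<bar>a \<bullet> h\<bar> * \<bar>b $ ?o\<bar> + \<bar>b \<bullet> h\<bar> * \<bar>a $ ?o\<bar>)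
      + (\<bar>b \<bullet> h\<bar> * \<bar>a $ i\<bar> + \<bar>a \<bullet> h\<bar> * \<bar>b $ i\<bar>)"
    unfolding e1 e2 abs_mult[symmetric] by (intro add_mono abs_triangle_ineq4)
  also have "\<dots> \<le> (\<bar>a \<bullet> h\<bar> + \<bar>b \<bullet> h\<bar>) * (\<bar>a $ i\<bar> + \<bar>a $ ?o\<bar> + \<bar>b $ i\<bar> + \<bar>b $ ?o\<bar>)"
    by (simp add: algebra_simps)
  finally show ?thesis .
qed

text \<open>What an NI arrangement looks like near a point of the closure of its domain \<open>D\<close>: the sign \<open>\<sigma> S\<close>
  is \<open>1\<close> if \<open>D\<close> lies inside \<open>S\<close> and \<open>- 1\<close> if it lies outside.\<close>

locale circle_arrangement =
  fixes \<S> :: "circle set" and D :: "(real^2) set" and \<sigma> :: "circle \<Rightarrow> real" and i :: 2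
  assumes finite_circles: "finite \<S>"
    and radius_pos: "S \<in> \<S> \<Longrightarrow> snd S > 0"
    and side: "S \<in> \<S> \<Longrightarrow> \<sigma> S = 1 \<or> \<sigma> S = - 1"
    and bounded_domain: "bounded D"
    and local_domain: "p \<in> closure D \<Longrightarrow> \<exists>r>0. \<forall>y\<in>ball p r.
       y \<in> D \<longleftrightarrow> (\<forall>S\<in>circles_through \<S> p. \<sigma> S * ((dist y (fst S))\<^sup>2 - (snd S)\<^sup>2) < 0)"
    and at_most_two: "p \<in> closure D \<Longrightarrow> card (circles_through \<S> p) \<le> 2"
    and transversal: "p \<in> closure D \<Longrightarrow> S \<in> circles_through \<S> p \<Longrightarrow> T \<in> circles_through \<S> p \<Longrightarrow>
       S \<noteq> T \<Longrightarrow> cross i (p - fst S) (p - fst T) \<noteq> 0"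
begin

abbreviation "oi \<equiv> other_index i"
abbreviation "K \<equiv> closure D"
abbreviation "cx S \<equiv> fst S $ i"
abbreviation "cy S \<equiv> fst S $ oi"
abbreviation "P \<equiv> pt i"
abbreviation "thru \<equiv> circles_through \<S>"

text \<open>The power of the point \<open>y\<close> with respect to \<open>S\<close>, signed so that
  it is negative on the side of the domain.\<close>

definition gap :: "circle \<Rightarrow> real^2 \<Rightarrow> real" where
  "gap S y = \<sigma> S * ((y $ i - cx S)\<^sup>2 + (y $ oi - cy S)\<^sup>2 - (snd S)\<^sup>2)"

lemma gap_dist: "gap S y = \<sigma> S * ((dist y (fst S))\<^sup>2 - (snd S)\<^sup>2)"
  by (simp add: gap_def dist_index[of _ _ i])

lemma side_sq: "S \<in> \<S> \<Longrightarrow> \<sigma> S * \<sigma> S = 1" "S \<in> \<S> \<Longrightarrow> \<sigma> S \<noteq> 0" "S \<in> \<S> \<Longrightarrow> \<bar>\<sigma> S\<bar> = 1"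
  using side by fastforce+

lemma thru_iff: "S \<in> thru p \<longleftrightarrow> S \<in> \<S> \<and> p \<in> circ S"
  by (simp add: circles_through_def)

lemma circ_iff: "S \<in> \<S> \<Longrightarrow> y \<in> circ S \<longleftrightarrow> (y $ i - cx S)\<^sup>2 + (y $ oi - cy S)\<^sup>2 = (snd S)\<^sup>2"
  using circ_iff_index radius_pos by blast

lemma circ_iff_gap: "S \<in> \<S> \<Longrightarrow> y \<in> circ S \<longleftrightarrow> gap S y = 0"
  using side_sq(2) by (simp add: circ_iff gap_def)

lemma continuous_on_gap [continuous_intros]:
  "continuous_on A f \<Longrightarrow> continuous_on A (\<lambda>x. gap S (f x))"
  unfolding gap_def by (intro continuous_intros)

lemma tendsto_gap [tendsto_intros]:
  "(f \<longlongrightarrow> p) F \<Longrightarrow> ((\<lambda>x. gap S (f x)) \<longlongrightarrow> gap S p) F"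
  unfolding gap_def by (intro tendsto_intros)

lemma gap_add: "gap S (p + h) = gap S p + \<sigma> S * (2 * ((p - fst S) \<bullet> h) + (norm h)\<^sup>2)"
  unfolding gap_def inner_index[of _ _ i] norm_index[of _ i]
  by (simp add: power2_eq_square algebra_simps)

lemma compact_K: "compact K"
  using bounded_domain by (simp add: compact_closure)

lemma finite_thru [simp]: "finite (thru p)"
  using finite_circles by (simp add: circles_through_def)

lemma thru_cases:
  assumes "p \<in> K"
  obtains "thru p = {}" | S where "thru p = {S}" | S T where "S \<noteq> T" "thru p = {S, T}"
proof -
  have "card (thru p) = 0 \<or> card (thru p) = 1 \<or> card (thru p) = 2"
    using at_most_two[OF assms] by linarith
  then show ?thesis using that finite_thru[of p] card_1_singletonE card_2_iff
    by (metis card_0_eq)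
qed

lemma local_gap: "p \<in> K \<Longrightarrow> \<exists>r>0. \<forall>y\<in>ball p r. y \<in> D \<longleftrightarrow> (\<forall>S\<in>thru p. gap S y < 0)"
  using local_domain unfolding gap_dist .

lemma domain_off_circles: "y \<in> D \<Longrightarrow> S \<in> \<S> \<Longrightarrow> y \<notin> circ S"
proof
  assume y: "y \<in> D" "S \<in> \<S>" "y \<in> circ S"
  then have "y \<in> K" using closure_subset by blast
  from local_gap[OF this] obtain r where "r > 0" "\<forall>z\<in>ball y r. z \<in> D \<longleftrightarrow> (\<forall>S\<in>thru y. gap S z < 0)"
    by blast
  then have "gap S y < 0" using y by (auto simp: thru_iff)
  then show False using y circ_iff_gap by fastforce
qed

lemma in_domain_if: "y \<in> K \<Longrightarrow> thru y = {} \<Longrightarrow> y \<in> D"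
  using local_gap[of y] by auto

lemma domain_iff: "y \<in> D \<longleftrightarrow> y \<in> K \<and> thru y = {}"
  using in_domain_if domain_off_circles closure_subset by (fastforce simp: circles_through_def)

lemma open_domain: "open D"
proof (rule openI)
  fix y assume y: "y \<in> D"
  then have "y \<in> K" "thru y = {}" by (auto simp: domain_iff)
  then show "\<exists>e>0. ball y e \<subseteq> D" using local_gap[of y] by auto
qed

text \<open>At a second common point \<open>p + h\<close> the two circle equations make both inner
  products of \<open>h\<close> with the radius vectors of size \<open>(norm h)\<^sup>2 / 2\<close>.
  Independence of the radius vectors bounds \<open>norm h\<close> linearly by these, so
  \<open>h\<close> cannot be arbitrarily small.\<close>

lemma double_point_isolated:
  assumes p: "p \<in> K" "S \<in> thru p" "T \<in> thru p" "S \<noteq> T"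
  shows "\<exists>r>0. \<forall>y\<in>ball p r. y \<in> circ S \<and> y \<in> circ T \<longrightarrow> y = p"
proof -
  define a where "a = p - fst S"
  define b where "b = p - fst T"
  define M where "M = \<bar>a $ i\<bar> + \<bar>a $ oi\<bar> + \<bar>b $ i\<bar> + \<bar>b $ oi\<bar>"
  \<comment> \<open>The summand 1 only keeps the denominator positive.\<close>
  define r where "r = \<bar>cross i a b\<bar> / (M + 1)"
  have cr: "\<bar>cross i a b\<bar> > 0" using transversal[OF p] by (simp add: a_def b_def)
  have M: "M \<ge> 0" by (simp add: M_def)
  have "r > 0" using cr M by (simp add: r_def)
  moreover have "y = p" if y: "y \<in> ball p r" "y \<in> circ S" "y \<in> circ T" for y
  proof (rule ccontr)
    assume ne: "y \<noteq> p"
    define h where "h = y - p"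
    have hn: "norm h > 0" "norm h < r" using y ne by (auto simp: h_def dist_norm norm_minus_commute)
    have "2 * (a \<bullet> h) + (norm h)\<^sup>2 = 0" "2 * (b \<bullet> h) + (norm h)\<^sup>2 = 0"
      using gap_add[of S p h] gap_add[of T p h] y p side_sq(2)[of S] side_sq(2)[of T]
      by (auto simp: h_def a_def b_def thru_iff circ_iff_gap)
    then have e: "\<bar>a \<bullet> h\<bar> + \<bar>b \<bullet> h\<bar> = (norm h)\<^sup>2"
      by (smt (verit) zero_le_power2)
    have "\<bar>cross i a b\<bar> * norm h \<le> (norm h)\<^sup>2 * M"
      using norm_le_of_cross[of i a b h] unfolding e M_def .
    then have "\<bar>cross i a b\<bar> * norm h \<le> (norm h * M) * norm h" by (simp add: power2_eq_square mult_ac)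
    then have "\<bar>cross i a b\<bar> \<le> norm h * M" using hn(1) by (rule mult_right_le_imp_le)
    also have "\<dots> \<le> norm h * (M + 1)" using hn by simp
    also have "\<dots> < r * (M + 1)" using hn M by simp
    also have "\<dots> = \<bar>cross i a b\<bar>" using M by (simp add: r_def)
    finally show False by simp
  qed
  ultimately show ?thesis by blast
qed

lemma double_points_isolated:
  assumes p: "p \<in> K"
  shows "\<exists>r>0. \<forall>y\<in>ball p r. \<forall>S\<in>thru p. \<forall>T\<in>thru p. S \<noteq> T \<and> y \<in> circ S \<and> y \<in> circ T \<longrightarrow> y = p"
  using p
proof (cases rule: thru_cases)
  case (3 S T)
  then show ?thesis using double_point_isolated[OF p, of S T] by auto
qed (auto intro: exI[of _ 1])

text \<open>Motion along the radius of \<open>S\<close> through \<open>y\<close>: for small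
  \<open>t > 0\<close> to the side of the domain, for small \<open>t < 0\<close> to the other
  side.\<close>

definition push :: "circle \<Rightarrow> real^2 \<Rightarrow> real \<Rightarrow> real^2" where
  "push S y t = y - (t * \<sigma> S) *\<^sub>R (y - fst S)"

lemma gap_push:
  assumes S: "S \<in> \<S>" and y: "y \<in> circ S"
  shows "gap S (push S y t) = - t * (2 - \<sigma> S * t) * (snd S)\<^sup>2"
proof -
  have n: "(norm (y - fst S))\<^sup>2 = (snd S)\<^sup>2"
    using y by (simp add: circ_def dist_norm norm_minus_commute)
  have "gap S (push S y t) = gap S y + \<sigma> S * (2 * ((y - fst S) \<bullet> (- (t * \<sigma> S) *\<^sub>R (y - fst S)))
       + (norm (- (t * \<sigma> S) *\<^sub>R (y - fst S)))\<^sup>2)"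
    using gap_add[of S y "- (t * \<sigma> S) *\<^sub>R (y - fst S)"] by (simp add: push_def)
  also have "\<dots> = \<sigma> S * (- 2 * t * \<sigma> S * (snd S)\<^sup>2 + (t * \<sigma> S)\<^sup>2 * (snd S)\<^sup>2)"
    using y S by (simp add: circ_iff_gap power_mult_distrib n flip: power2_norm_eq_inner)
  also have "\<dots> = - t * (2 - \<sigma> S * t) * (snd S)\<^sup>2"
    using side_sq(1)[OF S] side[OF S] by (auto simp: algebra_simps power2_eq_square)
  finally show ?thesis .
qed

lemma tendsto_push: "(push S y \<longlongrightarrow> y) (at 0 within A)"
proof -
  have "((\<lambda>t. y - (t * \<sigma> S) *\<^sub>R (y - fst S)) \<longlongrightarrow> y - (0 * \<sigma> S) *\<^sub>R (y - fst S)) (at 0 within A)"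
    by (intro tendsto_intros)
  then show ?thesis by (simp add: push_def[abs_def])
qed

text \<open>Replacing strict by weak inequalities need not describe a closure in general. Here it
  does: a nearby point other than \<open>p\<close> lies on at most one of the circles through
  \<open>p\<close>, and pushing it off that circle towards the domain keeps the remaining strict
  inequality.\<close>

lemma local_closure:
  assumes p: "p \<in> K"
  shows "\<exists>r>0. \<forall>y\<in>ball p r. y \<in> K \<longleftrightarrow> (\<forall>S\<in>thru p. gap S y \<le> 0)"
proof -
  obtain r1 where r1: "r1 > 0" "\<And>y. y \<in> ball p r1 \<Longrightarrow> y \<in> D \<longleftrightarrow> (\<forall>S\<in>thru p. gap S y < 0)"
    using local_gap[OF p] by blast
  obtain r2 where r2: "r2 > 0" "\<And>y S T. y \<in> ball p r2 \<Longrightarrow> S \<in> thru p \<Longrightarrow> T \<in> thru p \<Longrightarrow> S \<noteq> T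
      \<Longrightarrow> y \<in> circ S \<Longrightarrow> y \<in> circ T \<Longrightarrow> y = p"
    using double_points_isolated[OF p] by blast
  define r where "r = min r1 r2"
  have "y \<in> K \<longleftrightarrow> (\<forall>S\<in>thru p. gap S y \<le> 0)" if y: "y \<in> ball p r" for y
  proof
    assume yK: "y \<in> K"
    show "\<forall>S\<in>thru p. gap S y \<le> 0"
    proof (rule ccontr)
      assume "\<not> (\<forall>S\<in>thru p. gap S y \<le> 0)"
      then obtain S where S: "S \<in> thru p" "gap S y > 0" by auto
      have "open (ball p r1 \<inter> gap S -` {0<..})"
        by (intro open_Int open_ball open_vimage continuous_intros open_greaterThan)
      moreover have "y \<in> ball p r1 \<inter> gap S -` {0<..}" using S y by (auto simp: r_def)
      ultimately obtain z where "z \<in> D" "z \<in> ball p r1" "gap S z > 0"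
        using yK unfolding closure_iff_nhds_not_empty by blast
      then show False using r1(2)[of z] S by auto
    qed
  next
    assume le: "\<forall>S\<in>thru p. gap S y \<le> 0"
    show "y \<in> K"
    proof (cases "y = p \<or> (\<forall>S\<in>thru p. gap S y \<noteq> 0)")
      case True
      then show ?thesis
        using p r1(2)[of y] y le closure_subset[of D] by (auto simp: r_def order.strict_iff_order)
    next
      case False
      then obtain S where S: "S \<in> thru p" "gap S y = 0" "y \<noteq> p" by blast
      then have S': "S \<in> \<S>" "y \<in> circ S" by (auto simp: thru_iff circ_iff_gap)
      \<comment> \<open>Since \<open>y\<close> differs from \<open>p\<close> and double points are
        isolated, \<open>S\<close> is the only circle through \<open>p\<close> that also contains
        \<open>y\<close>.\<close>
      have lt: "gap T y < 0" if T: "T \<in> thru p - {S}" for T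
      proof -
        have "gap T y \<noteq> 0" using r2(2)[of y S T] T S S' y by (auto simp: r_def thru_iff circ_iff_gap)
        then show ?thesis using le T by force
      qed
      have "\<forall>\<^sub>F t in at_right 0. \<forall>T\<in>thru p - {S}. gap T (push S y t) < 0"
      proof (intro eventually_ball_finite ballI)
        fix T assume T: "T \<in> thru p - {S}"
        show "\<forall>\<^sub>F t in at_right 0. gap T (push S y t) < 0"
          using tendsto_gap[OF tendsto_push] lt[OF T] order_tendstoD(2) by blast
      qed simp
      moreover have "\<forall>\<^sub>F t in at_right 0. gap S (push S y t) < 0"
      proof -
        have "gap S (push S y t) < 0" if "0 < t" "t < 1" for t
          using that side[OF S'(1)] radius_pos[OF S'(1)] by (auto simp: gap_push[OF S'] intro!: mult_pos_pos)
        then show ?thesis by (auto simp: eventually_at_right_field intro: exI[of _ 1])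
      qed
      moreover have "\<forall>\<^sub>F t in at_right 0. push S y t \<in> ball p r1"
        using y by (intro topological_tendstoD[OF tendsto_push]) (auto simp: r_def)
      ultimately have "\<forall>\<^sub>F t in at_right 0. push S y t \<in> K"
      proof eventually_elim
        case (elim t)
        then have "push S y t \<in> D" using r1(2) by blast
        then show ?case using closure_subset by blast
      qed
      then show ?thesis
        by (rule Lim_in_closed_set[OF closed_closure _ _ tendsto_push]) simp
    qed
  qed
  then show ?thesis using r1(1) r2(1) by (intro exI[of _ r]) (auto simp: r_def)
qed

lemma gap_nonpos:
  assumes "p \<in> K" "S \<in> thru p"
  shows "\<exists>r>0. \<forall>y\<in>ball p r. y \<in> K \<longrightarrow> gap S y \<le> 0"
  using local_closure[OF assms(1)] assms(2) by blast

text \<open>Pushing the point away from the domain makes the gap positive, and near the point no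
  element of the closure has positive gap.\<close>

lemma circle_point_not_interior:
  assumes y: "y \<in> K" "S \<in> thru y"
  shows "y \<notin> interior K"
proof
  assume "y \<in> interior K"
  have S: "S \<in> \<S>" "y \<in> circ S" using y by (auto simp: thru_iff)
  obtain r where r: "r > 0" "\<forall>z\<in>ball y r. z \<in> K \<longrightarrow> gap S z \<le> 0" using gap_nonpos[OF y] by blast
  have "\<forall>\<^sub>F t in at_left 0. push S y t \<in> interior K \<inter> ball y r"
    using \<open>y \<in> interior K\<close> r(1) by (intro topological_tendstoD[OF tendsto_push]) auto
  moreover have "\<forall>\<^sub>F t in at_left (0::real). - 1 < t \<and> t < 0"
    by (auto simp: eventually_at_left_field intro: exI[of _ "-1"])
  ultimately have "\<forall>\<^sub>F t in at_left (0::real). False"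
  proof eventually_elim
    case (elim t)
    have "gap S (push S y t) > 0"
      using elim side[OF S(1)] radius_pos[OF S(1)]
      by (auto simp: gap_push[OF S] mult_neg_pos intro!: mult_neg_pos mult_pos_pos)
    moreover have "push S y t \<in> K" using elim interior_subset by blast
    ultimately show ?case using r(2) elim by force
  qed
  then show False by simp
qed

text \<open>Circle points are not interior and the remaining points of the closure belong to the
  open domain, so the interior of the closure is \<open>D\<close> again.\<close>

lemma frontier_K: "frontier K = {y \<in> K. thru y \<noteq> {}}"
proof -
  have "interior K = D"
  proof
    show "interior K \<subseteq> D"
      using circle_point_not_interior in_domain_if interior_subset[of K] by blast
    show "D \<subseteq> interior K" by (rule interior_maximal[OF closure_subset open_domain])
  qed
  then show ?thesis by (auto simp: frontier_def domain_iff)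
qed

subsection \<open>Critical points\<close>

definition crit :: "real^2 \<Rightarrow> bool" where
  "crit x \<longleftrightarrow> x \<in> K \<and> ((\<exists>S\<in>\<S>. x \<in> circ S \<and> x $ oi = cy S) \<or> card (thru x) = 2)"

lemma reeb_vertices_eq: "reeb_vertices \<S> D i = reeb_map D i ` {x. crit x}"
proof -
  have "(\<exists>S\<in>\<S>. \<exists>j\<in>pole_indices i. x = pole S j) \<longleftrightarrow> (\<exists>S\<in>\<S>. x \<in> circ S \<and> x $ oi = cy S)" for x
    using pole_index_iff radius_pos by metis
  then show ?thesis by (simp add: reeb_vertices_def crit_def)
qed

text \<open>A circle has two poles in direction \<open>i\<close>. The common points of two circles
  within \<open>K\<close> form a compact set, and an accumulation point of it would be a double
  point that is not isolated.\<close>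

lemma finite_crit: "finite {x. crit x}"
proof -
  have poles: "{x. \<exists>S\<in>\<S>. x \<in> circ S \<and> x $ oi = cy S}
      \<subseteq> (\<Union>S\<in>\<S>. {P (cx S - snd S) (cy S), P (cx S + snd S) (cy S)})"
  proof
    fix x assume "x \<in> {x. \<exists>S\<in>\<S>. x \<in> circ S \<and> x $ oi = cy S}"
    then obtain S where S: "S \<in> \<S>" "x \<in> circ S" "x $ oi = cy S" by blast
    then have "(x $ i - cx S)\<^sup>2 = (snd S)\<^sup>2" by (simp add: circ_iff)
    then have "x $ i = cx S - snd S \<or> x $ i = cx S + snd S" by (auto simp: power2_eq_iff)
    then have "x = P (cx S - snd S) (cy S) \<or> x = P (cx S + snd S) (cy S)"
      using S(3) by (metis pt_coords)
    then show "x \<in> (\<Union>S\<in>\<S>. {P (cx S - snd S) (cy S), P (cx S + snd S) (cy S)})" using S(1) by blast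
  qed
  have double: "finite (K \<inter> circ S \<inter> circ T)" if ST: "S \<in> \<S>" "T \<in> \<S>" "S \<noteq> T" for S T
  proof (rule ccontr)
    assume inf: "infinite (K \<inter> circ S \<inter> circ T)"
    have "compact (K \<inter> circ S \<inter> circ T)"
      unfolding circ_def by (intro compact_Int_closed compact_K closed_sphere)
    from Heine_Borel_imp_Bolzano_Weierstrass[OF this inf]
    obtain p where p: "p \<in> K" "p \<in> circ S" "p \<in> circ T" "p islimpt (K \<inter> circ S \<inter> circ T)" by auto
    obtain r where r: "r > 0" "\<forall>y\<in>ball p r. y \<in> circ S \<and> y \<in> circ T \<longrightarrow> y = p"
      using double_point_isolated[of p S T] p ST by (auto simp: thru_iff)
    obtain y where "y \<in> K \<inter> circ S \<inter> circ T" "y \<noteq> p" "dist y p < r"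
      using p(4) r(1) unfolding islimpt_approachable by blast
    then show False using r(2) by (auto simp: dist_commute)
  qed
  have "{x. crit x} \<subseteq> (\<Union>S\<in>\<S>. {P (cx S - snd S) (cy S), P (cx S + snd S) (cy S)})
     \<union> (\<Union>S\<in>\<S>. \<Union>T\<in>\<S> - {S}. K \<inter> circ S \<inter> circ T)"
  proof
    fix x assume "x \<in> {x. crit x}"
    then have x: "x \<in> K" "(\<exists>S\<in>\<S>. x \<in> circ S \<and> x $ oi = cy S) \<or> card (thru x) = 2"
      by (auto simp: crit_def)
    show "x \<in> (\<Union>S\<in>\<S>. {P (cx S - snd S) (cy S), P (cx S + snd S) (cy S)})
       \<union> (\<Union>S\<in>\<S>. \<Union>T\<in>\<S> - {S}. K \<inter> circ S \<inter> circ T)"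
      using x(2)
    proof
      assume "card (thru x) = 2"
      then obtain S T where "S \<noteq> T" "thru x = {S, T}" by (auto simp: card_2_iff)
      moreover from this have "S \<in> \<S>" "x \<in> circ S" "T \<in> \<S>" "x \<in> circ T" using thru_iff by blast+
      ultimately show ?thesis using x(1) by blast
    qed (use poles in blast)
  qed
  moreover have "finite \<dots>"
    by (intro finite_UnI finite_UN_I finite_Diff finite_circles) (auto intro: double)
  ultimately show ?thesis by (rule finite_subset)
qed


section \<open>Fibres\<close>

abbreviation "q \<equiv> reeb_map D i"

lemma reeb_map_subset: "y \<in> q x \<Longrightarrow> y \<in> K" "y \<in> q x \<Longrightarrow> y $ i = x $ i"
  using connected_component_subset[of "{y \<in> K. y $ i = x $ i}" x] by (auto simp: reeb_map_def)

lemma reeb_map_refl: "x \<in> K \<Longrightarrow> x \<in> q x"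
  by (simp add: reeb_map_def connected_component_refl_eq)

lemma reeb_map_eq: "y \<in> q x \<Longrightarrow> q y = q x"
  using connected_component_eq[of y "{y \<in> K. y $ i = x $ i}" x] reeb_map_subset(2)[of y x]
  by (simp add: reeb_map_def)

lemma reeb_mapI:
  assumes "\<And>w. w \<in> {lo..hi} \<Longrightarrow> P c w \<in> K" "w \<in> {lo..hi}" "w' \<in> {lo..hi}"
  shows "P c w' \<in> q (P c w)"
proof -
  have "P c ` {lo..hi} \<subseteq> q (P c w)"
    unfolding reeb_map_def
    by (rule connected_component_maximal)
      (use assms in \<open>auto intro!: connected_continuous_image continuous_intros\<close>)
  then show ?thesis using assms by blast
qed

text \<open>A component of the compact slice of \<open>K\<close> over \<open>c\<close> is compact
  and connected on a line, hence a segment.\<close>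

lemma reeb_map_interval:
  assumes "P c w \<in> K"
  obtains lo hi where "lo \<le> w" "w \<le> hi" "q (P c w) = P c ` {lo..hi}"
proof -
  let ?F = "{y \<in> K. y $ i = c}"
  have F: "q (P c w) = connected_component_set ?F (P c w)" by (simp add: reeb_map_def)
  have "?F = K \<inter> {y. y $ i = c}" by blast
  moreover have "closed {y :: real^2. y $ i = c}"
    by (intro closed_Collect_eq continuous_intros)
  ultimately have cp: "compact ?F" using compact_K by (simp add: compact_Int_closed)
  have c: "compact (q (P c w))"
    unfolding F compact_eq_bounded_closed
    by (intro conjI closed_connected_component compact_imp_closed[OF cp]
        bounded_subset[OF compact_imp_bounded[OF cp] connected_component_subset])
  have "connected (q (P c w))" unfolding F by simp
  then have "connected ((\<lambda>y. y $ oi) ` q (P c w))" "compact ((\<lambda>y. y $ oi) ` q (P c w))"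
    using c by (auto intro!: connected_continuous_image compact_continuous_image continuous_intros)
  then obtain lo hi where lh: "(\<lambda>y. y $ oi) ` q (P c w) = {lo..hi}"
    using connected_compact_interval_1[of "(\<lambda>y. y $ oi) ` q (P c w)"] by auto
  have "P c ` ((\<lambda>y. y $ oi) ` q (P c w)) = (\<lambda>y. y) ` q (P c w)"
    unfolding image_image
  proof (rule image_cong[OF refl])
    fix y assume "y \<in> q (P c w)"
    then have "y $ i = c" using reeb_map_subset(2) by fastforce
    then show "P c (y $ oi) = y" by (metis pt_coords)
  qed
  then have "q (P c w) = P c ` {lo..hi}" unfolding lh by simp
  moreover have "w \<in> {lo..hi}"
    unfolding lh[symmetric] using reeb_map_refl[OF assms] by (force intro: image_eqI[of _ _ "P c w"])
  ultimately show ?thesis using that by auto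
qed

lemma fibre_in_K: "q (P c w0) = P c ` {lo..hi} \<Longrightarrow> w \<in> {lo..hi} \<Longrightarrow> P c w \<in> K"
  using reeb_map_subset(1) by blast

lemma pt_image_iff [simp]: "P c w \<in> P c' ` A \<longleftrightarrow> c = c' \<and> w \<in> A"
  by auto

text \<open>The last hypotheses say that the two segments overlap. Their union is again a segment in
  \<open>K\<close>, and the fibre is a whole component.\<close>

lemma fibre_maximal:
  assumes q: "q (P c w0) = P c ` {lo..hi}" "lo \<le> hi"
    and K: "\<And>w. w \<in> {l..u} \<Longrightarrow> P c w \<in> K" and "l \<le> hi" "lo \<le> u" "l \<le> u"
  shows "{l..u} \<subseteq> {lo..hi}"
proof
  fix w assume w: "w \<in> {l..u}"
  have "P c v \<in> K" if "v \<in> {min l lo..max u hi}" for v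
  proof -
    have "v \<in> {l..u} \<or> v \<in> {lo..hi}"
      using that assms(2,4-6) by (auto simp: min_le_iff_disj le_max_iff_disj)
    then show ?thesis using K fibre_in_K[OF q(1)] by blast
  qed
  then have "P c w \<in> q (P c lo)"
    by (rule reeb_mapI[of "min l lo" "max u hi"])
      (use w assms in \<open>auto simp: min_le_iff_disj le_max_iff_disj\<close>)
  also have "q (P c lo) = q (P c w0)" using reeb_map_eq[of "P c lo" "P c w0"] q by simp
  finally show "w \<in> {lo..hi}" using q by simp
qed

lemma compact_fibre: "x \<in> K \<Longrightarrow> compact (q x)"
proof -
  assume "x \<in> K"
  then have "P (x $ i) (x $ oi) \<in> K" by simp
  from reeb_map_interval[OF this] obtain lo hi where "q x = P (x $ i) ` {lo..hi}"
    by (metis pt_coords)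
  then show ?thesis
    by (simp only:) (intro compact_continuous_image continuous_intros compact_Icc)
qed

lemma vertex_iff: "x \<in> K \<Longrightarrow> q x \<in> reeb_vertices \<S> D i \<longleftrightarrow> (\<exists>y\<in>q x. crit y)"
proof
  assume "x \<in> K" "q x \<in> reeb_vertices \<S> D i"
  then obtain y where y: "crit y" "q x = q y" by (auto simp: reeb_vertices_eq)
  then have "y \<in> q y" using reeb_map_refl by (simp add: crit_def)
  then show "\<exists>y\<in>q x. crit y" using y by auto
next
  assume "\<exists>y\<in>q x. crit y"
  then obtain y where "y \<in> q x" "crit y" by blast
  then show "q x \<in> reeb_vertices \<S> D i"
    unfolding reeb_vertices_eq using reeb_map_eq[of y x] by (metis image_eqI mem_Collect_eq)
qed

text \<open>The boundary curve of the closure of the domain on a circle: the lower curve bounding a region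
  for \<open>\<tau> = - 1\<close>, the upper one for \<open>\<tau> = 1\<close>.\<close>

definition ht :: "real \<Rightarrow> circle \<Rightarrow> real \<Rightarrow> real" where
  "ht \<tau> S c = cy S + \<tau> * \<sigma> S * sqrt ((snd S)\<^sup>2 - (c - cx S)\<^sup>2)"

abbreviation "lower S c \<equiv> ht (- 1) S c"
abbreviation "upper S c \<equiv> ht 1 S c"

lemma continuous_on_ht [continuous_intros]:
  "continuous_on A f \<Longrightarrow> continuous_on A (\<lambda>x. ht \<tau> S (f x))"
  unfolding ht_def by (intro continuous_intros)

lemma tendsto_ht [tendsto_intros]: "(f \<longlongrightarrow> c) F \<Longrightarrow> ((\<lambda>x. ht \<tau> S (f x)) \<longlongrightarrow> ht \<tau> S c) F"
  unfolding ht_def by (intro tendsto_intros)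

lemma ht_in_circ:
  assumes S: "S \<in> \<S>" and c: "\<bar>c - cx S\<bar> \<le> snd S" and \<tau>: "\<tau> = 1 \<or> \<tau> = - 1"
  shows "P c (ht \<tau> S c) \<in> circ S"
proof -
  have "(c - cx S)\<^sup>2 \<le> (snd S)\<^sup>2" using c by (simp add: abs_le_square_iff[symmetric] radius_pos[OF S] abs_of_pos)
  moreover have "\<tau>\<^sup>2 = 1" "(\<sigma> S)\<^sup>2 = 1" using \<tau> side[OF S] by auto
  ultimately show ?thesis by (simp add: circ_iff[OF S] ht_def power_mult_distrib)
qed

lemma ht_eqI:
  assumes S: "S \<in> \<S>" and w: "P c w \<in> circ S" "\<tau> * \<sigma> S * (w - cy S) \<ge> 0" and \<tau>: "\<tau> = 1 \<or> \<tau> = - 1"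
  shows "w = ht \<tau> S c"
proof -
  have e: "(snd S)\<^sup>2 - (c - cx S)\<^sup>2 = (\<tau> * \<sigma> S * (w - cy S))\<^sup>2"
    using w(1) side[OF S] \<tau> by (auto simp: circ_iff[OF S] power_mult_distrib)
  show ?thesis
    unfolding ht_def e real_sqrt_abs abs_of_nonneg[OF w(2)] using \<tau> side[OF S] by auto
qed

lemma ht_strict:
  assumes S: "S \<in> \<S>" and c: "\<bar>c - cx S\<bar> < snd S" and \<tau>: "\<tau> = 1 \<or> \<tau> = - 1"
  shows "\<tau> * \<sigma> S * (ht \<tau> S c - cy S) > 0"
proof -
  have "(c - cx S)\<^sup>2 < (snd S)\<^sup>2"
    using c radius_pos[OF S] by (metis abs_le_square_iff abs_of_pos linorder_not_le)
  then show ?thesis using \<tau> side[OF S] by (auto simp: ht_def)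
qed

lemma circ_domain: "S \<in> \<S> \<Longrightarrow> P c w \<in> circ S \<Longrightarrow> \<bar>c - cx S\<bar> \<le> snd S"
proof -
  assume S: "S \<in> \<S>" "P c w \<in> circ S"
  then have "(c - cx S)\<^sup>2 + (w - cy S)\<^sup>2 = (snd S)\<^sup>2" by (simp add: circ_iff)
  then have "(c - cx S)\<^sup>2 \<le> (snd S)\<^sup>2" using zero_le_power2[of "w - cy S"] by linarith
  then show ?thesis using radius_pos[OF S(1)] by (metis abs_le_square_iff abs_of_pos)
qed

lemma circ_domain_strict: "S \<in> \<S> \<Longrightarrow> P c w \<in> circ S \<Longrightarrow> w \<noteq> cy S \<Longrightarrow> \<bar>c - cx S\<bar> < snd S"
proof -
  assume S: "S \<in> \<S>" "P c w \<in> circ S" "w \<noteq> cy S"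
  then have "(c - cx S)\<^sup>2 + (w - cy S)\<^sup>2 = (snd S)\<^sup>2" by (simp add: circ_iff)
  moreover have "(w - cy S)\<^sup>2 > 0" using S by simp
  ultimately have "(c - cx S)\<^sup>2 < (snd S)\<^sup>2" by linarith
  then show ?thesis using radius_pos[OF S(1)] by (metis abs_le_square_iff abs_of_pos linorder_not_le)
qed

text \<open>On the side of the centre where the branch runs, the gap is
  \<open>\<sigma> S * (u - s) * (u + s)\<close> with \<open>u + s > 0\<close>, where
  \<open>s\<close> is the height of the branch over the centre; only the first factor
  decides.\<close>

lemma gap_nonpos_iff_ht:
  assumes S: "S \<in> \<S>" and c: "\<bar>c - cx S\<bar> \<le> snd S" and \<tau>: "\<tau> = 1 \<or> \<tau> = - 1"
    and w: "\<tau> * \<sigma> S * (w - cy S) > 0"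
  shows "gap S (P c w) \<le> 0 \<longleftrightarrow> \<tau> * w \<le> \<tau> * ht \<tau> S c"
proof -
  define s where "s = sqrt ((snd S)\<^sup>2 - (c - cx S)\<^sup>2)"
  define u where "u = \<tau> * \<sigma> S * (w - cy S)"
  have "(c - cx S)\<^sup>2 \<le> (snd S)\<^sup>2" using c by (simp add: abs_le_square_iff[symmetric] radius_pos[OF S] abs_of_pos)
  then have s: "s \<ge> 0" "s\<^sup>2 = (snd S)\<^sup>2 - (c - cx S)\<^sup>2" by (auto simp: s_def)
  have "(w - cy S)\<^sup>2 = u\<^sup>2" using \<tau> side[OF S] by (auto simp: u_def power2_commute)
  moreover have "(c - cx S)\<^sup>2 = (snd S)\<^sup>2 - s\<^sup>2" using s(2) by simp
  ultimately have g: "gap S (P c w) = \<sigma> S * (u - s) * (u + s)"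
    unfolding gap_def pt_nth by (simp only:) (simp add: algebra_simps power2_eq_square)
  have "\<tau> * w - \<tau> * ht \<tau> S c = \<sigma> S * (u - s)"
    using \<tau> side[OF S] by (auto simp: ht_def s_def[symmetric] u_def)
  then have "\<tau> * w \<le> \<tau> * ht \<tau> S c \<longleftrightarrow> \<sigma> S * (u - s) \<le> 0" by linarith
  also have "\<dots> \<longleftrightarrow> gap S (P c w) \<le> 0"
    unfolding g using w s(1) by (simp add: u_def mult_le_0_iff)
  finally show ?thesis by simp
qed

text \<open>Along the vertical line the gap is \<open>\<sigma> S * (t * (2 * a + t))\<close>, with
  \<open>a\<close> the height over the centre. For \<open>t\<close> smaller than \<open>a\<close> in
  absolute value the last factor has the sign of \<open>a\<close>, so the closure lies on exactly
  one vertical side.\<close>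

lemma vertical_local:
  assumes K: "P c w \<in> K" and S: "thru (P c w) = {S}" and ne: "w \<noteq> cy S"
  shows "\<exists>e>0. \<forall>w'. \<bar>w' - w\<bar> < e \<longrightarrow> (P c w' \<in> K \<longleftrightarrow> \<sigma> S * (w - cy S) * (w' - w) \<le> 0)"
proof -
  obtain r where r: "r > 0" "\<forall>y\<in>ball (P c w) r. y \<in> K \<longleftrightarrow> gap S y \<le> 0"
    using local_closure[OF K] S by auto
  have S': "S \<in> \<S>" "P c w \<in> circ S" using S thru_iff by blast+
  define e where "e = min r \<bar>w - cy S\<bar>"
  have "P c w' \<in> K \<longleftrightarrow> \<sigma> S * (w - cy S) * (w' - w) \<le> 0" if w': "\<bar>w' - w\<bar> < e" for w'
  proof -
    define a where "a = w - cy S"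
    define t where "t = w' - w"
    have at: "\<bar>t\<bar> < \<bar>a\<bar>" using w' by (simp add: e_def a_def t_def)
    have "gap S (P c w') = gap S (P c w) + \<sigma> S * (t * (2 * a + t))"
      by (simp add: gap_def a_def t_def algebra_simps power2_eq_square)
    also have "gap S (P c w) = 0" using S' circ_iff_gap by blast
    finally have g: "gap S (P c w') = \<sigma> S * (t * (2 * a + t))" by simp
    have "gap S (P c w') \<le> 0 \<longleftrightarrow> \<sigma> S * a * t \<le> 0"
      unfolding g using at side[OF S'(1)]
      by (auto simp: mult_le_0_iff zero_le_mult_iff abs_if split: if_splits)
    moreover have "P c w' \<in> ball (P c w) r" using w' by (simp add: dist_pt_vertical e_def abs_minus_commute)
    ultimately show ?thesis using r(2) by (simp add: a_def t_def)
  qed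
  then show ?thesis using r(1) ne by (intro exI[of _ e]) (auto simp: e_def)
qed

lemma noncrit_thru:
  assumes "P c w \<in> K" "\<not> crit (P c w)"
  obtains "thru (P c w) = {}" "P c w \<in> D" | S where "thru (P c w) = {S}" "w \<noteq> cy S"
  using assms(1)
proof (cases rule: thru_cases)
  case 1
  then show ?thesis using that(1) assms(1) by (simp add: domain_iff)
next
  case (2 S)
  then have "S \<in> \<S>" "P c w \<in> circ S" using thru_iff by blast+
  then have "w \<noteq> cy S" using assms by (auto simp: crit_def)
  then show ?thesis using that(2) 2 by blast
next
  case (3 S T)
  then show ?thesis using assms by (simp add: crit_def)
qed

lemma domain_vertical: "P c w \<in> D \<Longrightarrow> \<exists>e>0. \<forall>w'. \<bar>w' - w\<bar> < e \<longrightarrow> P c w' \<in> D"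
proof -
  assume "P c w \<in> D"
  then obtain e where "e > 0" "ball (P c w) e \<subseteq> D" using open_domain open_contains_ball by blast
  then show ?thesis by (intro exI[of _ e]) (auto simp: dist_pt_vertical subset_eq)
qed

text \<open>A noncritical circle point has the closure on only one of its vertical sides. Inside the
  fibre both sides belong to the closure, so no circle passes there. At an end the fibre must stop,
  so a circle passes, and its side is known.\<close>

lemma noncrit_fibre:
  assumes q: "q (P c w0) = P c ` {lo..hi}" "lo \<le> hi" and nc: "\<And>w. w \<in> {lo..hi} \<Longrightarrow> \<not> crit (P c w)"
  shows "lo < hi"
    and "\<exists>S. thru (P c lo) = {S} \<and> \<sigma> S * (lo - cy S) < 0"
    and "\<exists>T. thru (P c hi) = {T} \<and> \<sigma> T * (hi - cy T) > 0"
    and "\<And>w. lo < w \<Longrightarrow> w < hi \<Longrightarrow> P c w \<in> D"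
proof -
  note inK = fibre_in_K[OF q(1)]
  have below: "\<not> (\<forall>w\<in>{l..lo}. P c w \<in> K)" if "l < lo" for l
    using fibre_maximal[OF q, of l lo] that q(2) by fastforce
  have above: "\<not> (\<forall>w\<in>{hi..u}. P c w \<in> K)" if "hi < u" for u
    using fibre_maximal[OF q, of hi u] that q(2) by fastforce
  have lomem: "lo \<in> {lo..hi}" and himem: "hi \<in> {lo..hi}" using q(2) by auto
  note loK = inK[OF lomem] and hiK = inK[OF himem]
  have lo: "\<exists>S e. thru (P c lo) = {S} \<and> \<sigma> S * (lo - cy S) < 0 \<and> e > 0 \<and>
      (\<forall>w'. \<bar>w' - lo\<bar> < e \<longrightarrow> (P c w' \<in> K \<longleftrightarrow> \<sigma> S * (lo - cy S) * (w' - lo) \<le> 0))"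
    using noncrit_thru[OF loK nc[OF lomem]]
  proof cases
    case 1
    then obtain e where e: "e > 0" "\<And>w'. \<bar>w' - lo\<bar> < e \<Longrightarrow> P c w' \<in> D" using domain_vertical[OF 1(2)] by blast
    have "P c w \<in> K" if "w \<in> {lo - e / 2..lo}" for w
      using e(2)[of w] e(1) that closure_subset[of D] by (auto simp: subset_iff abs_if)
    then show ?thesis using below[of "lo - e / 2"] e(1) by auto
  next
    case (2 S)
    then obtain e where e: "e > 0"
      "\<And>w'. \<bar>w' - lo\<bar> < e \<Longrightarrow> P c w' \<in> K \<longleftrightarrow> \<sigma> S * (lo - cy S) * (w' - lo) \<le> 0"
      using vertical_local[OF loK] by blast
    have "S \<in> \<S>" using 2 thru_iff by blast
    then have nz: "\<sigma> S * (lo - cy S) \<noteq> 0" using 2 side_sq(2) by simp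
    have "\<not> \<sigma> S * (lo - cy S) > 0"
    proof
      assume pos: "\<sigma> S * (lo - cy S) > 0"
      have "P c w \<in> K" if "w \<in> {lo - e / 2..lo}" for w
        using e(2)[of w] e(1) that mult_nonneg_nonpos[of "\<sigma> S * (lo - cy S)" "w - lo"] pos
        by (auto simp: abs_if)
      then show False using below[of "lo - e / 2"] e(1) by auto
    qed
    then have "\<sigma> S * (lo - cy S) < 0" using nz by linarith
    then show ?thesis using 2 e by blast
  qed
  have hi: "\<exists>S e. thru (P c hi) = {S} \<and> \<sigma> S * (hi - cy S) > 0 \<and> e > 0 \<and>
      (\<forall>w'. \<bar>w' - hi\<bar> < e \<longrightarrow> (P c w' \<in> K \<longleftrightarrow> \<sigma> S * (hi - cy S) * (w' - hi) \<le> 0))"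
    using noncrit_thru[OF hiK nc[OF himem]]
  proof cases
    case 1
    then obtain e where e: "e > 0" "\<And>w'. \<bar>w' - hi\<bar> < e \<Longrightarrow> P c w' \<in> D" using domain_vertical[OF 1(2)] by blast
    have "P c w \<in> K" if "w \<in> {hi..hi + e / 2}" for w
      using e(2)[of w] e(1) that closure_subset[of D] by (auto simp: subset_iff abs_if)
    then show ?thesis using above[of "hi + e / 2"] e(1) by auto
  next
    case (2 S)
    then obtain e where e: "e > 0"
      "\<And>w'. \<bar>w' - hi\<bar> < e \<Longrightarrow> P c w' \<in> K \<longleftrightarrow> \<sigma> S * (hi - cy S) * (w' - hi) \<le> 0"
      using vertical_local[OF hiK] by blast
    have "S \<in> \<S>" using 2 thru_iff by blast
    then have nz: "\<sigma> S * (hi - cy S) \<noteq> 0" using 2 side_sq(2) by simp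
    have "\<not> \<sigma> S * (hi - cy S) < 0"
    proof
      assume neg: "\<sigma> S * (hi - cy S) < 0"
      have "P c w \<in> K" if "w \<in> {hi..hi + e / 2}" for w
        using e(2)[of w] e(1) that mult_nonpos_nonneg[of "\<sigma> S * (hi - cy S)" "w - hi"] neg
        by (auto simp: abs_if)
      then show False using above[of "hi + e / 2"] e(1) by auto
    qed
    then have "\<sigma> S * (hi - cy S) > 0" using nz by linarith
    then show ?thesis using 2 e by blast
  qed
  obtain S e where S: "thru (P c lo) = {S}" "\<sigma> S * (lo - cy S) < 0" using lo by blast
  obtain T e' where T: "thru (P c hi) = {T}" "\<sigma> T * (hi - cy T) > 0" using hi by blast
  \<comment> \<open>A fibre of one point would give its single circle two opposite signs.\<close>
  show "lo < hi" using S T q(2) by (cases "lo = hi") auto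
  show "\<exists>S. thru (P c lo) = {S} \<and> \<sigma> S * (lo - cy S) < 0" using S by blast
  show "\<exists>T. thru (P c hi) = {T} \<and> \<sigma> T * (hi - cy T) > 0" using T by blast
  show "P c w \<in> D" if w: "lo < w" "w < hi" for w
  proof -
    have wK: "P c w \<in> K" "\<not> crit (P c w)" using inK nc w by auto
    show ?thesis
      using noncrit_thru[OF wK]
    proof cases
      case (2 S)
      then obtain e where e: "e > 0"
        "\<And>w'. \<bar>w' - w\<bar> < e \<Longrightarrow> P c w' \<in> K \<longleftrightarrow> \<sigma> S * (w - cy S) * (w' - w) \<le> 0"
        using vertical_local[OF wK(1)] by blast
      have "S \<in> \<S>" using 2 thru_iff by blast
      then have nz: "\<sigma> S * (w - cy S) \<noteq> 0" using 2 side_sq(2) by simp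
      define d where "d = min (e / 2) (min (w - lo) (hi - w))"
      have d: "0 < d" "d < e" "lo \<le> w - d" "w + d \<le> hi" using e(1) w by (auto simp: d_def)
      have "P c (w + d) \<in> K" "P c (w - d) \<in> K" using d w by (auto intro!: inK)
      then have "\<sigma> S * (w - cy S) * d \<le> 0" "\<sigma> S * (w - cy S) * (- d) \<le> 0"
        using e(2)[of "w + d"] e(2)[of "w - d"] d by auto
      then have "\<sigma> S * (w - cy S) * d = 0" by linarith
      then show ?thesis using d(1) nz by simp
    qed
  qed
qed

text \<open>\<open>fib S T c\<close>: the fibre over \<open>c\<close> from the lower curve of \<open>S\<close> to the upper curve of \<open>T\<close> is a
  point of the Reeb space other than a vertex.\<close>

definition fib :: "circle \<Rightarrow> circle \<Rightarrow> real \<Rightarrow> bool" where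
  "fib S T c \<longleftrightarrow> S \<in> \<S> \<and> T \<in> \<S> \<and> \<bar>c - cx S\<bar> < snd S \<and> \<bar>c - cx T\<bar> < snd T \<and>
     lower S c < upper T c \<and> P c (lower S c) \<in> K \<and>
     q (P c (lower S c)) = P c ` {lower S c..upper T c} \<and> (\<forall>w\<in>{lower S c..upper T c}. \<not> crit (P c w))"

lemma fibI:
  assumes x: "P c w \<in> K" and nc: "\<And>y. y \<in> q (P c w) \<Longrightarrow> \<not> crit y"
  obtains S T where "fib S T c" "w \<in> {lower S c..upper T c}"
proof -
  obtain lo hi where lh: "lo \<le> w" "w \<le> hi" "q (P c w) = P c ` {lo..hi}"
    using reeb_map_interval[OF x] by blast
  have le: "lo \<le> hi" using lh by simp
  have nc': "\<not> crit (P c w')" if "w' \<in> {lo..hi}" for w' using nc lh(3) that by auto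
  note F = noncrit_fibre[OF lh(3) le nc']
  obtain S where S: "thru (P c lo) = {S}" "\<sigma> S * (lo - cy S) < 0" using F(2) by blast
  obtain T where T: "thru (P c hi) = {T}" "\<sigma> T * (hi - cy T) > 0" using F(3) by blast
  have S': "S \<in> \<S>" "P c lo \<in> circ S" using S thru_iff by blast+
  have T': "T \<in> \<S>" "P c hi \<in> circ T" using T thru_iff by blast+
  have b: "lo = lower S c" using S S' by (intro ht_eqI) (auto simp: mult.commute)
  have t: "hi = upper T c" using T T' by (intro ht_eqI) auto
  have "\<bar>c - cx S\<bar> < snd S" using circ_domain_strict[OF S'] S(2) by (cases "lo = cy S") auto
  moreover have "\<bar>c - cx T\<bar> < snd T" using circ_domain_strict[OF T'] T(2) by (cases "hi = cy T") auto
  moreover have "q (P c lo) = q (P c w)" using lh by (intro reeb_map_eq) auto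
  ultimately have "fib S T c"
    unfolding fib_def b[symmetric] t[symmetric] using S' T' F(1) lh nc' fibre_in_K[OF lh(3)] by auto
  then show ?thesis using that lh b t by auto
qed

lemma fibD:
  assumes "fib S T c"
  shows "thru (P c (lower S c)) = {S}" "thru (P c (upper T c)) = {T}"
    "\<And>w. lower S c < w \<Longrightarrow> w < upper T c \<Longrightarrow> P c w \<in> D"
    "\<And>w. w \<in> {lower S c..upper T c} \<Longrightarrow> P c w \<in> K"
    "\<And>w. w \<in> {lower S c..upper T c} \<Longrightarrow> q (P c w) = P c ` {lower S c..upper T c}"
    "\<And>w. w \<in> {lower S c..upper T c} \<Longrightarrow> q (P c w) \<notin> reeb_vertices \<S> D i"
proof -
  note f = assms[unfolded fib_def]
  have q: "q (P c (lower S c)) = P c ` {lower S c..upper T c}" "lower S c \<le> upper T c" using f by auto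
  have nc: "\<And>w. w \<in> {lower S c..upper T c} \<Longrightarrow> \<not> crit (P c w)" using f by blast
  note F = noncrit_fibre[OF q nc]
  have "P c (lower S c) \<in> circ S" "P c (upper T c) \<in> circ T" using f by (auto intro!: ht_in_circ)
  then have "S \<in> thru (P c (lower S c))" "T \<in> thru (P c (upper T c))" using f by (auto simp: thru_iff)
  then show "thru (P c (lower S c)) = {S}" "thru (P c (upper T c)) = {T}" using F(2,3) by auto
  show "P c w \<in> D" if "lower S c < w" "w < upper T c" for w using F(4) that by blast
  show K: "P c w \<in> K" if "w \<in> {lower S c..upper T c}" for w using fibre_in_K[OF q(1)] that by blast
  show e: "q (P c w) = P c ` {lower S c..upper T c}" if "w \<in> {lower S c..upper T c}" for w
    using reeb_map_eq[of "P c w" "P c (lower S c)"] q that by simp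
  show "q (P c w) \<notin> reeb_vertices \<S> D i" if "w \<in> {lower S c..upper T c}" for w
    using vertex_iff[OF K[OF that]] e[OF that] nc by auto
qed

text \<open>Overlapping fibres are the same segment, and each end of a non-vertex fibre lies on a
  single circle.\<close>

lemma fib_unique:
  assumes "fib S T c" "fib S' T' c" "w \<in> {lower S c..upper T c}" "w \<in> {lower S' c..upper T' c}"
  shows "S = S'" "T = T'"
proof -
  have "P c ` {lower S c..upper T c} = P c ` {lower S' c..upper T' c}"
    using fibD(5)[OF assms(1,3)] fibD(5)[OF assms(2,4)] by simp
  then have "{lower S c..upper T c} = {lower S' c..upper T' c}"
    by (metis (no_types, lifting) inj_image_eq_iff injI pt_eq_iff)
  moreover have "lower S c \<le> upper T c" using assms(1) by (simp add: fib_def)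
  ultimately have "lower S c = lower S' c" "upper T c = upper T' c"
    using Icc_eq_Icc by metis+
  then have "{S} = {S'}" "{T} = {T'}"
    using fibD(1,2)[OF assms(1)] fibD(1,2)[OF assms(2)] by metis+
  then show "S = S'" "T = T'" by simp_all
qed

text \<open>Near either end of the fibre the closure is governed by one gap, which compares with the
  boundary curve; in between the fibre is compact in the open domain. So in a window slightly larger
  than the fibre the closure is exactly the region between the two curves. Besides continuation of
  the fibre, this shows that no other point of the closure is close to it, which makes strips
  open.\<close>

lemma fib_local:
  assumes "fib S T c"
  obtains \<delta> \<eta> where "\<delta> > 0" "\<eta> > 0" "\<And>c'. \<bar>c' - c\<bar> < \<delta> \<Longrightarrow> fib S T c'"
    "\<And>c' w. \<bar>c' - c\<bar> < \<delta> \<Longrightarrow> lower S c - \<eta> < w \<Longrightarrow> w < upper T c + \<eta> \<Longrightarrow> P c' w \<in> K \<Longrightarrow>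
       w \<in> {lower S c'..upper T c'}"
proof -
  note f = assms[unfolded fib_def]
  define lo where "lo = lower S c"
  define hi where "hi = upper T c"
  have S: "S \<in> \<S>" "\<bar>c - cx S\<bar> < snd S" and T: "T \<in> \<S>" "\<bar>c - cx T\<bar> < snd T"
    and lh: "lo < hi" using f by (auto simp: lo_def hi_def)
  have loK: "P c lo \<in> K" and hiK: "P c hi \<in> K" using fibD(4)[OF assms] lh by (auto simp: lo_def hi_def)
  have sS: "- 1 * \<sigma> S * (lo - cy S) > 0" and sT: "1 * \<sigma> T * (hi - cy T) > 0"
    unfolding lo_def hi_def using ht_strict[OF S] ht_strict[OF T] by blast+
  obtain r1 where r1: "r1 > 0" "\<And>y. y \<in> ball (P c lo) r1 \<Longrightarrow> y \<in> K \<longleftrightarrow> gap S y \<le> 0"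
    using local_closure[OF loK] fibD(1)[OF assms] by (auto simp: lo_def)
  obtain r2 where r2: "r2 > 0" "\<And>y. y \<in> ball (P c hi) r2 \<Longrightarrow> y \<in> K \<longleftrightarrow> gap T y \<le> 0"
    using local_closure[OF hiK] fibD(2)[OF assms] by (auto simp: hi_def)
  have cL: "compact (P c ` {l..u})" for l u
    by (intro compact_continuous_image continuous_intros compact_Icc)
  have "P c ` {lo..hi} \<subseteq> - {x. crit x}" using f by (auto simp: lo_def hi_def)
  moreover have "open (- {x. crit x})" using finite_crit by (simp add: finite_imp_closed open_Compl)
  ultimately obtain e0 where e0: "e0 > 0" "(\<Union>x\<in>P c ` {lo..hi}. ball x e0) \<subseteq> - {x. crit x}"
    using compact_subset_open_imp_ball_epsilon_subset[OF cL] by blast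
  \<comment> \<open>Half of \<open>r1\<close>, \<open>r2\<close> and \<open>e0\<close> leaves room
    for the horizontal displacement, a third of the length keeps the two end zones apart, and the
    distances to the centres keep heights in an end zone on the side of the centre where the branch
    lies.\<close>
  define \<eta> where "\<eta> = Min {r1 / 2, r2 / 2, (hi - lo) / 3, \<bar>lo - cy S\<bar>, \<bar>hi - cy T\<bar>, e0 / 2}"
  have "lo \<noteq> cy S" "hi \<noteq> cy T" using sS sT by auto
  then have \<eta>: "\<eta> > 0" using r1(1) r2(1) lh e0(1) by (simp add: \<eta>_def)
  have \<eta>': "\<eta> \<le> r1 / 2" "\<eta> \<le> r2 / 2" "\<eta> \<le> (hi - lo) / 3" "\<eta> \<le> \<bar>lo - cy S\<bar>" "\<eta> \<le> \<bar>hi - cy T\<bar>" "\<eta> \<le> e0 / 2"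
    unfolding \<eta>_def by (intro Min_le; simp)+
  have "P c ` {lo + \<eta> / 2..hi - \<eta> / 2} \<subseteq> D" using fibD(3)[OF assms] \<eta> by (auto simp: lo_def hi_def)
  then obtain e1 where e1: "e1 > 0" "(\<Union>x\<in>P c ` {lo + \<eta> / 2..hi - \<eta> / 2}. ball x e1) \<subseteq> D"
    using compact_subset_open_imp_ball_epsilon_subset[OF cL open_domain] by blast
  have "\<forall>\<^sub>F c' in nhds c. \<bar>lower S c' - lo\<bar> < \<eta> / 2"
  proof -
    have "((\<lambda>c'. lower S c' - lo) \<longlongrightarrow> lower S c - lo) (nhds c)" by (intro tendsto_intros filterlim_ident)
    then have "\<forall>\<^sub>F c' in nhds c. dist (lower S c' - lo) (lower S c - lo) < \<eta> / 2" using \<eta> tendstoD half_gt_zero by blast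
    then show ?thesis by (simp add: lo_def dist_real_def)
  qed
  moreover have "\<forall>\<^sub>F c' in nhds c. \<bar>upper T c' - hi\<bar> < \<eta> / 2"
  proof -
    have "((\<lambda>c'. upper T c' - hi) \<longlongrightarrow> upper T c - hi) (nhds c)" by (intro tendsto_intros filterlim_ident)
    then have "\<forall>\<^sub>F c' in nhds c. dist (upper T c' - hi) (upper T c - hi) < \<eta> / 2" using \<eta> tendstoD half_gt_zero by blast
    then show ?thesis by (simp add: hi_def dist_real_def)
  qed
  moreover have "\<forall>\<^sub>F c' in nhds c. \<bar>c' - cx S\<bar> < snd S"
    by (rule order_tendstoD(2)[OF _ S(2)]) (intro tendsto_intros filterlim_ident)
  moreover have "\<forall>\<^sub>F c' in nhds c. \<bar>c' - cx T\<bar> < snd T"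
    by (rule order_tendstoD(2)[OF _ T(2)]) (intro tendsto_intros filterlim_ident)
  ultimately have "\<forall>\<^sub>F c' in nhds c. \<bar>lower S c' - lo\<bar> < \<eta> / 2 \<and> \<bar>upper T c' - hi\<bar> < \<eta> / 2 \<and>
      \<bar>c' - cx S\<bar> < snd S \<and> \<bar>c' - cx T\<bar> < snd T"
    by eventually_elim auto
  then obtain d where d: "d > 0" "\<And>c'. \<bar>c' - c\<bar> < d \<Longrightarrow> \<bar>lower S c' - lo\<bar> < \<eta> / 2 \<and> \<bar>upper T c' - hi\<bar> < \<eta> / 2 \<and>
      \<bar>c' - cx S\<bar> < snd S \<and> \<bar>c' - cx T\<bar> < snd T"
    unfolding eventually_nhds_metric dist_real_def by blast
  define \<delta> where "\<delta> = min d (min (\<eta> / 2) e1)"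
  have \<delta>: "\<delta> > 0" "\<delta> \<le> d" "\<delta> \<le> \<eta> / 2" "\<delta> \<le> e1" using d(1) \<eta> e1(1) by (auto simp: \<delta>_def)
  have main: "P c' w \<in> K \<longleftrightarrow> lower S c' \<le> w \<and> w \<le> upper T c'"
    if c': "\<bar>c' - c\<bar> < \<delta>" and w: "lo - \<eta> < w" "w < hi + \<eta>" for c' w
  proof -
    have dc: "\<bar>lower S c' - lo\<bar> < \<eta> / 2" "\<bar>upper T c' - hi\<bar> < \<eta> / 2" "\<bar>c' - cx S\<bar> < snd S" "\<bar>c' - cx T\<bar> < snd T"
      using d(2)[of c'] c' \<delta> by auto
    consider "\<bar>w - lo\<bar> < \<eta>" | "\<bar>w - hi\<bar> < \<eta>" | "lo + \<eta> / 2 \<le> w" "w \<le> hi - \<eta> / 2"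
      using w \<eta> by argo
    then show ?thesis
    proof cases
      case 1
      have "P c' w \<in> ball (P c lo) r1"
        using dist_pt_le[of i c lo c' w] c' 1 \<delta> \<eta>' by (simp add: abs_minus_commute)
      then have "P c' w \<in> K \<longleftrightarrow> gap S (P c' w) \<le> 0" by (rule r1(2))
      moreover have "- 1 * \<sigma> S * (w - cy S) > 0"
        using 1 \<eta>'(4) sS side[OF S(1)] by (auto simp: abs_if split: if_splits)
      then have "gap S (P c' w) \<le> 0 \<longleftrightarrow> - 1 * w \<le> - 1 * lower S c'"
        by (intro gap_nonpos_iff_ht S(1)) (use dc in auto)
      ultimately show ?thesis using dc 1 \<eta>' by (auto simp: abs_if split: if_splits)
    next
      case 2
      have "P c' w \<in> ball (P c hi) r2"
        using dist_pt_le[of i c hi c' w] c' 2 \<delta> \<eta>' by (simp add: abs_minus_commute)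
      then have "P c' w \<in> K \<longleftrightarrow> gap T (P c' w) \<le> 0" by (rule r2(2))
      moreover have "1 * \<sigma> T * (w - cy T) > 0"
        using 2 \<eta>'(5) sT side[OF T(1)] by (auto simp: abs_if split: if_splits)
      then have "gap T (P c' w) \<le> 0 \<longleftrightarrow> 1 * w \<le> 1 * upper T c'"
        by (intro gap_nonpos_iff_ht T(1)) (use dc in auto)
      ultimately show ?thesis using dc 2 \<eta>' by (auto simp: abs_if split: if_splits)
    next
      case 3
      have "P c' w \<in> ball (P c w) e1"
        using dist_pt_le[of i c w c' w] c' \<delta> by (simp add: abs_minus_commute)
      moreover have "P c w \<in> P c ` {lo + \<eta> / 2..hi - \<eta> / 2}" using 3 by simp
      ultimately have "P c' w \<in> D" using e1(2) by blast
      then show ?thesis using closure_subset[of D] dc 3 by (auto simp: abs_if split: if_splits)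
    qed
  qed
  have "fib S T c'" if c': "\<bar>c' - c\<bar> < \<delta>" for c'
  proof -
    have dc: "\<bar>lower S c' - lo\<bar> < \<eta> / 2" "\<bar>upper T c' - hi\<bar> < \<eta> / 2" "\<bar>c' - cx S\<bar> < snd S" "\<bar>c' - cx T\<bar> < snd T"
      using d(2)[of c'] c' \<delta> by auto
    have bt: "lower S c' < upper T c'" using dc(1,2) \<eta>'(3) \<eta> by argo
    have inK: "P c' w \<in> K" if "w \<in> {lower S c'..upper T c'}" for w
    proof -
      have w: "lower S c' \<le> w" "w \<le> upper T c'" using that by auto
      have "lo - \<eta> < w" "w < hi + \<eta>" using w dc(1,2) \<eta> by argo+
      then show ?thesis using main[OF c'] w by blast
    qed
    then have bK: "P c' (lower S c') \<in> K" using bt by simp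
    obtain l u where lu: "l \<le> lower S c'" "lower S c' \<le> u" "q (P c' (lower S c')) = P c' ` {l..u}"
      using reeb_map_interval[OF bK] by blast
    have "{lower S c'..upper T c'} \<subseteq> {l..u}"
      by (rule fibre_maximal[OF lu(3)]) (use lu bt inK in auto)
    then have tu: "upper T c' \<le> u" using bt by auto
    have "\<not> l < lower S c'"
    proof
      assume l: "l < lower S c'"
      \<comment> \<open>A point of the fibre just below the curve; the lower bound
        \<open>lo - \<eta> / 2\<close> keeps it inside the window where the closure is
        known.\<close>
      define w where "w = max l (lo - \<eta> / 2)"
      have w: "w < lower S c'" "w \<in> {l..u}" "lo - \<eta> < w" "w < hi + \<eta>"
        using l lu dc(1) lh \<eta> tu by (auto simp: w_def abs_if split: if_splits)
      then show False using main[OF c' w(3,4)] fibre_in_K[OF lu(3) w(2)] by auto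
    qed
    moreover have "\<not> upper T c' < u"
    proof
      assume u: "upper T c' < u"
      define w where "w = min u (hi + \<eta> / 2)"
      have w: "upper T c' < w" "w \<in> {l..u}" "lo - \<eta> < w" "w < hi + \<eta>"
        using u lu dc(1,2) lh \<eta> tu bt by (auto simp: w_def abs_if split: if_splits)
      then show False using main[OF c' w(3,4)] fibre_in_K[OF lu(3) w(2)] by auto
    qed
    ultimately have q': "q (P c' (lower S c')) = P c' ` {lower S c'..upper T c'}" using lu tu by auto
    have "\<not> crit (P c' w)" if w: "w \<in> {lower S c'..upper T c'}" for w
    proof -
      \<comment> \<open>The point of the original fibre closest in height to \<open>w\<close>; a
        whole neighbourhood of the original fibre is free of critical points.\<close>
      define v where "v = max lo (min hi w)"
      have v: "v \<in> {lo..hi}" "\<bar>v - w\<bar> < \<eta> / 2"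
        using lh w dc(1,2) \<eta> by (auto simp: v_def abs_if min_def max_def split: if_splits)
      have "P c' w \<in> ball (P c v) e0"
        using dist_pt_le[of i c v c' w] v(2) c' \<delta> \<eta>'(6) \<eta> by (simp add: abs_minus_commute)
      then show ?thesis using e0(2) v(1) by blast
    qed
    then show ?thesis unfolding fib_def using S(1) T(1) dc(3,4) bt bK q' by blast
  qed
  then show ?thesis using that[OF \<delta>(1) \<eta>] main by (auto simp: lo_def hi_def)
qed

end

lemma affine_image_Icc:
  fixes lo hi :: real
  assumes "lo \<le> hi"
  shows "(\<lambda>t. lo + t * (hi - lo)) ` {0..1} = {lo..hi}"
proof (intro set_eqI iffI)
  fix w assume "w \<in> (\<lambda>t. lo + t * (hi - lo)) ` {0..1}"
  then obtain t where t: "0 \<le> t" "t \<le> 1" "w = lo + t * (hi - lo)" by auto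
  moreover have "t * (hi - lo) \<le> 1 * (hi - lo)" "0 \<le> t * (hi - lo)"
    using t assms by (intro mult_right_mono; simp) (use t assms in simp)
  ultimately show "w \<in> {lo..hi}" by simp
next
  fix w assume w: "w \<in> {lo..hi}"
  show "w \<in> (\<lambda>t. lo + t * (hi - lo)) ` {0..1}"
  proof (cases "lo = hi")
    case True
    then show ?thesis using w by (auto intro!: image_eqI[of _ _ 0])
  next
    case False
    then show ?thesis using w assms
      by (intro image_eqI[of _ _ "(w - lo) / (hi - lo)"]) (auto simp: field_simps)
  qed
qed

context circle_arrangement
begin

section \<open>Edges of the Reeb graph\<close>

text \<open>Failure at both ends makes the interval a component of the set of all \<open>c\<close>
  with \<open>fib S T c\<close>, so it is determined by any of its inner points.\<close>

definition is_strip :: "circle \<Rightarrow> circle \<Rightarrow> real \<Rightarrow> real \<Rightarrow> bool" where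
  "is_strip S T a b \<longleftrightarrow> a < b \<and> (\<forall>c\<in>{a<..<b}. fib S T c) \<and> \<not> fib S T a \<and> \<not> fib S T b"

definition strip_map :: "circle \<Rightarrow> circle \<Rightarrow> real \<times> real \<Rightarrow> real^2" where
  "strip_map S T x = P (fst x) (lower S (fst x) + snd x * (upper T (fst x) - lower S (fst x)))"

definition strip :: "circle \<Rightarrow> circle \<Rightarrow> real \<Rightarrow> real \<Rightarrow> (real^2) set" where
  "strip S T a b = (\<Union>c\<in>{a<..<b}. P c ` {lower S c..upper T c})"

lemma open_fib: "open {c. fib S T c}"
proof (rule openI)
  fix c assume "c \<in> {c. fib S T c}"
  then have "fib S T c" by simp
  then obtain \<delta> where "\<delta> > 0" "\<And>c'. \<bar>c' - c\<bar> < \<delta> \<Longrightarrow> fib S T c'" by (rule fib_local) blast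
  then show "\<exists>T'>0. ball c T' \<subseteq> {c. fib S T c}"
    by (intro exI[of _ \<delta>]) (auto simp: dist_real_def abs_minus_commute)
qed

text \<open>The ends are the nearest failures on either side. They are attained because
  \<open>fib\<close> is an open condition, and they exist because it fails at the two extreme
  positions of \<open>S\<close>.\<close>

lemma strip_exists:
  assumes c: "fib S T c"
  obtains a b where "is_strip S T a b" "a < c" "c < b"
proof -
  let ?A = "{..c} \<inter> - {c. fib S T c}" and ?B = "{c..} \<inter> - {c. fib S T c}"
  have dom: "\<bar>c - cx S\<bar> < snd S" using c by (simp add: fib_def)
  have cl: "closed ?A" "closed ?B"
    using open_fib[of S T] by (auto intro!: closed_Int simp: closed_Compl)
  have "\<not> fib S T (cx S - snd S)" "\<not> fib S T (cx S + snd S)" by (auto simp: fib_def)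
  then have "cx S - snd S \<in> ?A" "cx S + snd S \<in> ?B"
    using dom by (auto simp: abs_less_iff)
  then have ne: "?A \<noteq> {}" "?B \<noteq> {}" by blast+
  have bd: "bdd_above ?A" "bdd_below ?B" by auto
  define a where "a = Sup ?A"
  define b where "b = Inf ?B"
  have a: "a \<in> ?A" unfolding a_def by (rule closed_contains_Sup[OF ne(1) bd(1) cl(1)])
  have b: "b \<in> ?B" unfolding b_def by (rule closed_contains_Inf[OF ne(2) bd(2) cl(2)])
  have ac: "a < c" using a c by (cases "a = c") auto
  have cb: "c < b" using b c by (cases "b = c") auto
  have "fib S T t" if t: "a < t" "t < b" for t
  proof (rule ccontr)
    assume n: "\<not> fib S T t"
    show False
    proof (cases "t \<le> c")
      case True
      then have "t \<le> a" unfolding a_def using n bd by (intro cSup_upper) auto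
      then show False using t by simp
    next
      case False
      then have "b \<le> t" unfolding b_def using n bd by (intro cInf_lower) auto
      then show False using t by simp
    qed
  qed
  then have "is_strip S T a b" using a b ac cb by (auto simp: is_strip_def)
  then show ?thesis using that ac cb by blast
qed

lemma is_strip_unique:
  assumes "is_strip S T a b" "is_strip S T a' b'" "a < c" "c < b" "a' < c" "c < b'"
  shows "a = a'" "b = b'"
proof -
  have 1: "\<And>t. a < t \<Longrightarrow> t < b \<Longrightarrow> fib S T t" "\<not> fib S T a" "\<not> fib S T b"
    using assms(1) by (auto simp: is_strip_def)
  have 2: "\<And>t. a' < t \<Longrightarrow> t < b' \<Longrightarrow> fib S T t" "\<not> fib S T a'" "\<not> fib S T b'"
    using assms(2) by (auto simp: is_strip_def)
  have "\<not> a < a'" using 1(1)[of a'] 2(2) assms by auto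
  moreover have "\<not> a' < a" using 2(1)[of a] 1(2) assms by auto
  ultimately show "a = a'" by simp
  have "\<not> b < b'" using 2(1)[of b] 1(3) assms by auto
  moreover have "\<not> b' < b" using 1(1)[of b'] 2(3) assms by auto
  ultimately show "b = b'" by simp
qed

lemma strip_fib: "is_strip S T a b \<Longrightarrow> c \<in> {a<..<b} \<Longrightarrow> fib S T c"
  by (simp add: is_strip_def)

lemma strip_mid:
  assumes "is_strip S T a b"
  shows "(a + b) / 2 \<in> {a<..<b}" "fib S T ((a + b) / 2)" "S \<in> \<S>" "T \<in> \<S>" "a < b"
proof -
  show m: "(a + b) / 2 \<in> {a<..<b}" "a < b" using assms by (auto simp: is_strip_def)
  show f: "fib S T ((a + b) / 2)" using strip_fib[OF assms m(1)] .
  show "S \<in> \<S>" "T \<in> \<S>" using f by (auto simp: fib_def)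
qed

lemma strip_memI: "c \<in> {a<..<b} \<Longrightarrow> w \<in> {lower S c..upper T c} \<Longrightarrow> P c w \<in> strip S T a b"
  by (auto simp: strip_def)

lemma strip_memE:
  assumes "x \<in> strip S T a b" "is_strip S T a b"
  obtains c w where "x = P c w" "c \<in> {a<..<b}" "w \<in> {lower S c..upper T c}" "fib S T c"
  using assms strip_fib by (auto simp: strip_def)

lemma strip_subset_K: "is_strip S T a b \<Longrightarrow> strip S T a b \<subseteq> K"
  by (auto elim!: strip_memE dest: fibD(4))

lemma continuous_on_strip_map: "continuous_on A (strip_map S T)"
  unfolding strip_map_def by (intro continuous_intros)

lemma strip_eq_image:
  assumes "is_strip S T a b"
  shows "strip S T a b = strip_map S T ` ({a<..<b} \<times> {0..1})"
proof -
  have "strip_map S T ` ({a<..<b} \<times> {0..1})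
     = (\<Union>c\<in>{a<..<b}. (\<lambda>t. strip_map S T (c, t)) ` {0..1})" by auto
  also have "\<dots> = (\<Union>c\<in>{a<..<b}. P c ` (\<lambda>t. lower S c + t * (upper T c - lower S c)) ` {0..1})"
    by (simp add: strip_map_def image_image)
  also have "\<dots> = (\<Union>c\<in>{a<..<b}. P c ` {lower S c..upper T c})"
  proof (rule SUP_cong[OF refl])
    fix c assume "c \<in> {a<..<b}"
    then have "lower S c \<le> upper T c" using strip_fib[OF assms] by (force simp: fib_def)
    then show "P c ` (\<lambda>t. lower S c + t * (upper T c - lower S c)) ` {0..1}
       = P c ` {lower S c..upper T c}" by (simp only: affine_image_Icc)
  qed
  finally show ?thesis by (simp add: strip_def)
qed

text \<open>Strict inequalities survive as weak ones in the limit, and the strip is the image of a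
  rectangle whose closure is mapped continuously into the closed set \<open>K\<close>.\<close>

lemma strip_closed:
  assumes s: "is_strip S T a b" and c: "c \<in> {a..b}"
  shows "lower S c \<le> upper T c" "w \<in> {lower S c..upper T c} \<Longrightarrow> P c w \<in> K"
    "\<bar>c - cx S\<bar> \<le> snd S" "\<bar>c - cx T\<bar> \<le> snd T"
proof -
  have ab: "a < b" using strip_mid[OF s] by simp
  have cl: "closure {a<..<b} = {a..b}" using ab by simp
  have lim: "f c \<le> r" if "\<And>t. t \<in> {a<..<b} \<Longrightarrow> f t \<le> r" "continuous_on UNIV f" for f :: "real \<Rightarrow> real" and r
  proof -
    have "f ` closure {a<..<b} \<subseteq> {..r}"
      by (rule image_closure_subset[OF continuous_on_subset[OF that(2) subset_UNIV]])
        (use that(1) in auto)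
    then have "f c \<in> {..r}" using c unfolding cl by blast
    then show ?thesis by simp
  qed
  have "lower S c - upper T c \<le> 0"
    by (rule lim) (use strip_fib[OF s] in \<open>auto simp: fib_def less_imp_le intro!: continuous_intros\<close>)
  then show le: "lower S c \<le> upper T c" by simp
  show "\<bar>c - cx S\<bar> \<le> snd S"
    by (rule lim[of "\<lambda>t. \<bar>t - cx S\<bar>"]) (use strip_fib[OF s] in \<open>auto simp: fib_def less_imp_le intro!: continuous_intros\<close>)
  show "\<bar>c - cx T\<bar> \<le> snd T"
    by (rule lim[of "\<lambda>t. \<bar>t - cx T\<bar>"]) (use strip_fib[OF s] in \<open>auto simp: fib_def less_imp_le intro!: continuous_intros\<close>)
  assume w: "w \<in> {lower S c..upper T c}"
  have "strip_map S T ` closure ({a<..<b} \<times> {0..1}) \<subseteq> K"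
    using strip_subset_K[OF s] continuous_on_strip_map
    by (intro image_closure_subset) (auto simp: strip_eq_image[OF s])
  then have K: "strip_map S T ` ({a..b} \<times> {0..1}) \<subseteq> K" by (simp add: closure_Times cl)
  obtain t where "t \<in> {0..1}" "w = lower S c + t * (upper T c - lower S c)"
    using w unfolding affine_image_Icc[OF le, symmetric] by blast
  then have "P c w = strip_map S T (c, t)" "(c, t) \<in> {a..b} \<times> {0..1}"
    using c by (auto simp: strip_map_def)
  then show "P c w \<in> K" using K by auto
qed

lemma strip_saturated:
  assumes "is_strip S T a b" "x \<in> K" "q x \<in> q ` strip S T a b"
  shows "x \<in> strip S T a b"
proof -
  obtain y where y: "q x = q y" "y \<in> strip S T a b" using assms(3) by blast
  obtain c w where c: "y = P c w" "c \<in> {a<..<b}" "w \<in> {lower S c..upper T c}" "fib S T c"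
    using strip_memE[OF y(2) assms(1)] .
  have "x \<in> q y" using reeb_map_refl[OF assms(2)] y by simp
  then have "x \<in> P c ` {lower S c..upper T c}" unfolding c(1) fibD(5)[OF c(4,3)] .
  then show ?thesis using c(2) by (auto simp: strip_def)
qed

lemma strip_not_vertex:
  assumes "is_strip S T a b" "x \<in> strip S T a b"
  shows "q x \<notin> reeb_vertices \<S> D i"
  using strip_memE[OF assms(2,1)] fibD(6) by metis

lemma strips_disjoint:
  assumes "is_strip S T a b" "is_strip S' T' a' b'" "x \<in> strip S T a b" "x \<in> strip S' T' a' b'"
  shows "S = S' \<and> T = T' \<and> a = a' \<and> b = b'"
proof -
  obtain c w where c: "x = P c w" "c \<in> {a<..<b}" "w \<in> {lower S c..upper T c}" "fib S T c"
    using strip_memE[OF assms(3,1)] .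
  obtain c' w' where c': "x = P c' w'" "c' \<in> {a'<..<b'}" "w' \<in> {lower S' c'..upper T' c'}" "fib S' T' c'"
    using strip_memE[OF assms(4,2)] .
  have e: "c' = c" "w' = w" using c(1) c'(1) by auto
  have ST: "S = S'" "T = T'" using fib_unique[OF c(4) c'(4)[unfolded e] c(3) c'(3)[unfolded e]] by auto
  then show ?thesis using is_strip_unique[OF assms(1), of a' b' c] assms(2) c(2) c'(2) e by auto
qed

lemma strip_cover:
  assumes "x \<in> K" "q x \<notin> reeb_vertices \<S> D i"
  obtains S T a b where "is_strip S T a b" "x \<in> strip S T a b"
proof -
  have "P (x $ i) (x $ oi) \<in> K" "\<And>y. y \<in> q (P (x $ i) (x $ oi)) \<Longrightarrow> \<not> crit y"
    using vertex_iff[OF assms(1)] assms by auto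
  then obtain S T where f: "fib S T (x $ i)" "x $ oi \<in> {lower S (x $ i)..upper T (x $ i)}"
    using fibI by blast
  obtain a b where ab: "is_strip S T a b" "a < x $ i" "x $ i < b" using strip_exists[OF f(1)] .
  have "P (x $ i) (x $ oi) \<in> strip S T a b" using ab f by (intro strip_memI) auto
  then show ?thesis using that ab by auto
qed

text \<open>The window around a fibre contains every sufficiently near point of \<open>K\<close>,
  and inside the window such a point must lie on the continued fibre.\<close>

lemma openin_strip:
  assumes s: "is_strip S T a b"
  shows "openin (top_of_set K) (strip S T a b)"
proof (subst openin_contains_ball, intro conjI ballI)
  show "strip S T a b \<subseteq> K" using strip_subset_K[OF s] .
  fix x assume "x \<in> strip S T a b"
  then obtain c w where c: "x = P c w" "c \<in> {a<..<b}" "w \<in> {lower S c..upper T c}" "fib S T c"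
    using strip_memE[OF _ s] by blast
  obtain \<delta> \<eta> where d: "\<delta> > 0" "\<eta> > 0"
    "\<And>c' w. \<bar>c' - c\<bar> < \<delta> \<Longrightarrow> lower S c - \<eta> < w \<Longrightarrow> w < upper T c + \<eta> \<Longrightarrow> P c' w \<in> K \<Longrightarrow>
       w \<in> {lower S c'..upper T c'}" using fib_local[OF c(4)] by metis
  define e where "e = min (min \<delta> \<eta>) (min (c - a) (b - c))"
  have "e > 0" using d c(2) by (simp add: e_def)
  moreover have "y \<in> strip S T a b" if y: "y \<in> ball x e" "y \<in> K" for y
  proof -
    have "\<bar>y $ i - c\<bar> < e" "\<bar>y $ oi - w\<bar> < e"
      using component_le_norm_cart[of "y - x" i] component_le_norm_cart[of "y - x" oi] y(1)
      by (auto simp: c(1) dist_norm norm_minus_commute)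
    then have "y $ oi \<in> {lower S (y $ i)..upper T (y $ i)}" "y $ i \<in> {a<..<b}"
      using c(3) y(2) by (auto simp: e_def intro!: d(3)) (use c(3) y(2) d(3)[of "y $ i" "y $ oi"] in auto)
    then show ?thesis using strip_memI[of "y $ i" a b "y $ oi" S T] by simp
  qed
  ultimately show "\<exists>e>0. ball x e \<inter> K \<subseteq> strip S T a b" by blast
qed

lemma topspace_reeb: "topspace (reeb_topology D i) = reeb_space D i"
  using quotient_map_reeb_map[of D i]
  by (metis quotient_imp_surjective_map reeb_space_def topspace_euclidean_subtopology)

abbreviation "V \<equiv> reeb_vertices \<S> D i"

section \<open>Edges as components of the complement of the vertices\<close>

lemma openin_strip_image:
  assumes s: "is_strip S T a b"
  shows "openin (reeb_topology D i) (q ` strip S T a b)"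
proof -
  have "{x \<in> K. q x \<in> q ` strip S T a b} = strip S T a b"
    using strip_saturated[OF s] strip_subset_K[OF s] by blast
  then show ?thesis
    using openin_strip[OF s] strip_subset_K[OF s]
    by (auto simp: openin_reeb_topology reeb_space_def)
qed

text \<open>The preimage is the union of all other strips. Every point off the vertices lies in a
  strip, and distinct strips are disjoint.\<close>

lemma openin_strip_complement:
  assumes s: "is_strip S T a b"
  shows "openin (reeb_topology D i) (reeb_space D i - V - q ` strip S T a b)"
proof -
  let ?Z = "strip S T a b"
  define \<U> where "\<U> = {strip S' T' a' b' | S' T' a' b'. is_strip S' T' a' b' \<and> strip S' T' a' b' \<inter> ?Z = {}}"
  have "{x \<in> K. q x \<in> reeb_space D i - V - q ` ?Z} = \<Union>\<U>"
  proof (intro set_eqI iffI)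
    fix x assume "x \<in> {x \<in> K. q x \<in> reeb_space D i - V - q ` ?Z}"
    then have x: "x \<in> K" "q x \<notin> V" "q x \<notin> q ` ?Z" by auto
    obtain S' T' a' b' where s': "is_strip S' T' a' b'" "x \<in> strip S' T' a' b'"
      using strip_cover[OF x(1,2)] .
    have "strip S' T' a' b' \<inter> ?Z = {}"
      using strips_disjoint[OF s'(1) s] s'(2) x(3) by blast
    then show "x \<in> \<Union>\<U>" using s' unfolding \<U>_def by blast
  next
    fix x assume "x \<in> \<Union>\<U>"
    then obtain S' T' a' b' where s': "is_strip S' T' a' b'" "x \<in> strip S' T' a' b'"
      "strip S' T' a' b' \<inter> ?Z = {}" unfolding \<U>_def by blast
    then have "x \<in> K" "q x \<notin> V" "x \<notin> ?Z" using strip_subset_K strip_not_vertex by blast+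
    then show "x \<in> {x \<in> K. q x \<in> reeb_space D i - V - q ` ?Z}"
      using strip_saturated[OF s] by (auto simp: reeb_space_def)
  qed
  moreover have "openin (top_of_set K) (\<Union>\<U>)"
    unfolding \<U>_def by (intro openin_Union) (auto intro: openin_strip)
  ultimately show ?thesis by (auto simp: openin_reeb_topology)
qed

lemma connectedin_strip_image:
  assumes s: "is_strip S T a b"
  shows "connectedin (reeb_topology D i) (q ` strip S T a b)"
proof (rule connectedin_continuous_map_image)
  show "continuous_map (top_of_set K) (reeb_topology D i) q"
    using quotient_map_reeb_map quotient_imp_continuous_map by blast
  have "connected (strip S T a b)"
    unfolding strip_eq_image[OF s]
    by (intro connected_continuous_image continuous_on_strip_map connected_Times) auto
  then show "connectedin (top_of_set K) (strip S T a b)"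
    using strip_subset_K[OF s] by (simp add: connectedin_subtopology)
qed

lemma strip_nonempty: "is_strip S T a b \<Longrightarrow> strip S T a b \<noteq> {}"
  using strip_mid[of S T a b] strip_memI[of "(a + b) / 2" a b "lower S ((a + b) / 2)" S T]
  by (force simp: fib_def)

text \<open>A nonempty connected set that is both open and closed is a component; closedness holds
  because the other strips cover the rest.\<close>

lemma strip_component:
  assumes s: "is_strip S T a b" and z: "z \<in> q ` strip S T a b"
  shows "connected_component_of_set (subtopology (reeb_topology D i) (reeb_space D i - V)) z
     = q ` strip S T a b"
proof -
  let ?X = "subtopology (reeb_topology D i) (reeb_space D i - V)"
  let ?E = "q ` strip S T a b"
  have sub: "?E \<subseteq> reeb_space D i - V"
    using strip_not_vertex[OF s] strip_subset_K[OF s] by (auto simp: reeb_space_def)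
  have top: "topspace ?X = reeb_space D i - V"
    by (auto simp: topspace_reeb)
  have op: "openin ?X ?E"
    using openin_strip_image[OF s] sub by (auto simp: openin_subtopology intro: exI[of _ ?E])
  have "openin ?X (reeb_space D i - V - ?E)"
    using openin_strip_complement[OF s]
    by (auto simp: openin_subtopology intro: exI[of _ "reeb_space D i - V - ?E"])
  then have cl: "closedin ?X ?E" using sub unfolding closedin_def top by blast
  have con: "connectedin ?X ?E" using connectedin_strip_image[OF s] sub by (simp add: connectedin_subtopology)
  show ?thesis
  proof
    show "?E \<subseteq> connected_component_of_set ?X z"
      using connected_component_of_maximal[OF con z] .
    have "connected_component_of_set ?X z \<subseteq> ?E \<or> disjnt (connected_component_of_set ?X z) ?E"
      using connectedin_clopen_cases[OF connectedin_connected_component_of cl op] .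
    moreover have "z \<in> connected_component_of_set ?X z"
      using z sub top by (auto simp: connected_component_of_refl)
    ultimately show "connected_component_of_set ?X z \<subseteq> ?E"
      using z by (auto simp: disjnt_iff)
  qed
qed

lemma reeb_edges_eq: "reeb_edges \<S> D i = {q ` strip S T a b | S T a b. is_strip S T a b}"
proof (intro set_eqI iffI)
  let ?X = "subtopology (reeb_topology D i) (reeb_space D i - V)"
  have top: "topspace ?X = reeb_space D i - V" by (auto simp: topspace_reeb)
  fix e
  {
    assume "e \<in> reeb_edges \<S> D i"
    then obtain z where z: "z \<in> reeb_space D i - V" "e = connected_component_of_set ?X z"
      unfolding reeb_edges_def connected_components_of_def top by blast
    then obtain x where x: "x \<in> K" "z = q x" "q x \<notin> V" by (auto simp: reeb_space_def)
    obtain S T a b where s: "is_strip S T a b" "x \<in> strip S T a b" using strip_cover[OF x(1,3)] .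
    have "e = q ` strip S T a b" unfolding z(2) using strip_component[OF s(1)] s(2) x(2) by blast
    then show "e \<in> {q ` strip S T a b | S T a b. is_strip S T a b}" using s by blast
  next
    assume "e \<in> {q ` strip S T a b | S T a b. is_strip S T a b}"
    then obtain S T a b where s: "is_strip S T a b" "e = q ` strip S T a b" by blast
    obtain x where x: "x \<in> strip S T a b" using strip_nonempty[OF s(1)] by blast
    have "q x \<in> topspace ?X"
      unfolding top using strip_not_vertex[OF s(1) x] strip_subset_K[OF s(1)] x
      by (auto simp: reeb_space_def)
    moreover have "connected_component_of_set ?X (q x) = e"
      using strip_component[OF s(1)] x s(2) by blast
    ultimately show "e \<in> reeb_edges \<S> D i"
      unfolding reeb_edges_def connected_components_of_def by blast
  }
qed

lemma strip_image_inj: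
  assumes "is_strip S T a b" "is_strip S' T' a' b'" "q ` strip S T a b = q ` strip S' T' a' b'"
  shows "S = S' \<and> T = T' \<and> a = a' \<and> b = b'"
proof -
  obtain x where x: "x \<in> strip S T a b" using strip_nonempty[OF assms(1)] by blast
  then have "x \<in> strip S' T' a' b'"
    using strip_saturated[OF assms(2)] strip_subset_K[OF assms(1)] assms(3) by blast
  then show ?thesis using strips_disjoint[OF assms(1,2) x] by blast
qed

lemma edge_preimage:
  assumes s: "is_strip S T a b"
  shows "reeb_preimage D i (Inr (q ` strip S T a b)) = strip S T a b"
  using strip_saturated[OF s] strip_subset_K[OF s] by (auto simp: reeb_preimage_def)

subsection \<open>End points\<close>

lemma interval_near:
  fixes a b e d :: real
  assumes "a < b" "e = a \<or> e = b" "d > 0"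
  obtains c where "c \<in> {a<..<b}" "\<bar>c - e\<bar> < d"
proof -
  define m where "m = min d (b - a) / 2"
  have m: "0 < m" "m < d" "m < b - a" using assms by (auto simp: m_def min_def)
  show ?thesis using assms(2) that[of "a + m"] that[of "b - m"] m by auto
qed

lemma curve_near:
  assumes "a < b" "e = a \<or> e = b" "d > 0" "r > 0"
  obtains c where "c \<in> {a<..<b}" "\<bar>c - e\<bar> < d" "\<bar>ht \<tau> S c - ht \<tau> S e\<bar> < r"
proof -
  have "isCont (ht \<tau> S) e"
    using continuous_on_ht[of UNIV "\<lambda>x. x" \<tau> S] by (simp add: continuous_on_eq_continuous_at)
  then obtain d' where d': "d' > 0" "\<And>c. \<bar>c - e\<bar> < d' \<Longrightarrow> \<bar>ht \<tau> S c - ht \<tau> S e\<bar> < r"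
    using assms(4) unfolding continuous_at_eps_delta dist_real_def by blast
  obtain c where "c \<in> {a<..<b}" "\<bar>c - e\<bar> < min d d'"
    using interval_near[OF assms(1,2), of "min d d'"] assms(3) d'(1) by auto
  then show ?thesis using that d'(2) by auto
qed

text \<open>The limit of an edge at an end of its interval lies in a vertex: a fibre that is not a
  vertex would continue the edge.\<close>

lemma strip_end:
  assumes s: "is_strip S T a b" and e: "e = a \<or> e = b"
  shows "P e (lower S e) \<in> K" "P e (upper T e) \<in> K"
    "q (P e (lower S e)) \<in> V"
    "w \<in> {lower S e..upper T e} \<Longrightarrow> q (P e w) = q (P e (lower S e))"
proof -
  have ab: "a < b" using strip_mid[OF s] by simp
  then have eab: "e \<in> {a..b}" using e by auto
  note cl = strip_closed[OF s eab]
  show lK: "P e (lower S e) \<in> K" "P e (upper T e) \<in> K" using cl(1) by (auto intro!: cl(2))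
  show "q (P e w) = q (P e (lower S e))" if w: "w \<in> {lower S e..upper T e}" for w
    by (rule reeb_map_eq, rule reeb_mapI[of "lower S e" "upper T e"]) (use cl w in auto)
  show "q (P e (lower S e)) \<in> V"
  proof (rule ccontr)
    assume "q (P e (lower S e)) \<notin> V"
    then obtain S' T' where f: "fib S' T' e" "lower S e \<in> {lower S' e..upper T' e}"
      using fibI[OF lK(1)] vertex_iff[OF lK(1)] by blast
    obtain \<delta> \<eta> where d: "\<delta> > 0" "\<eta> > 0" "\<And>c'. \<bar>c' - e\<bar> < \<delta> \<Longrightarrow> fib S' T' c'"
      "\<And>c' w. \<bar>c' - e\<bar> < \<delta> \<Longrightarrow> lower S' e - \<eta> < w \<Longrightarrow> w < upper T' e + \<eta> \<Longrightarrow> P c' w \<in> K \<Longrightarrow>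
         w \<in> {lower S' c'..upper T' c'}" using fib_local[OF f(1)] by metis
    obtain c where c: "c \<in> {a<..<b}" "\<bar>c - e\<bar> < \<delta>" "\<bar>lower S c - lower S e\<bar> < \<eta>"
      using curve_near[OF ab e d(1,2)] .
    have fc: "fib S T c" using strip_fib[OF s c(1)] .
    have lc: "lower S c \<in> {lower S c..upper T c}" using fc by (simp add: fib_def)
    have "lower S c \<in> {lower S' c..upper T' c}"
      using d(4)[OF c(2)] c(3) f(2) fibD(4)[OF fc lc] by (auto simp: abs_less_iff)
    then have "S = S'" "T = T'" using fib_unique[OF fc d(3)[OF c(2)] lc] by auto
    then show False using f(1) e s by (auto simp: is_strip_def)
  qed
qed

definition strip_vertex :: "circle \<Rightarrow> real \<Rightarrow> (real^2) set" where
  "strip_vertex S e = q (P e (lower S e))"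

text \<open>The strip together with the two vertex fibres is closed and saturated, so its image is
  closed and nothing else can be added by the closure. Conversely the lower boundary curve runs into
  both vertices.\<close>

lemma endpoints_strip:
  assumes s: "is_strip S T a b"
  shows "endpoints D i (q ` strip S T a b) = {strip_vertex S a, strip_vertex S b}"
proof -
  let ?Y = "reeb_topology D i" and ?E = "q ` strip S T a b"
  let ?va = "strip_vertex S a" and ?vb = "strip_vertex S b"
  have ab: "a < b" using strip_mid[OF s] by simp
  have aK: "P a (lower S a) \<in> K" and bK: "P b (lower S b) \<in> K" using strip_end(1)[OF s] by auto
  have "?va \<in> V" "?vb \<in> V" using strip_end(3)[OF s] by (auto simp: strip_vertex_def)
  then have nE: "?va \<notin> ?E" "?vb \<notin> ?E" using strip_not_vertex[OF s] by auto
  have vtop: "?va \<in> topspace ?Y" "?vb \<in> topspace ?Y"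
    using aK bK by (auto simp: topspace_reeb reeb_space_def strip_vertex_def)
  have Etop: "?E \<subseteq> topspace ?Y" using strip_subset_K[OF s] by (auto simp: topspace_reeb reeb_space_def)
  have "compact (strip_map S T ` ({a..b} \<times> {0..1}))"
    by (intro compact_continuous_image continuous_on_strip_map compact_Times compact_Icc)
  \<comment> \<open>The limit segment of the strip over an end may be a proper part of the vertex
    fibre, so the whole fibres are added to make the set saturated.\<close>
  then have cc: "closed (strip_map S T ` ({a..b} \<times> {0..1}) \<union> ?va \<union> ?vb)"
    using compact_fibre[OF aK] compact_fibre[OF bK]
    by (auto simp: strip_vertex_def intro!: closed_Un compact_imp_closed)
  have q_iff: "q x = strip_vertex S e \<longleftrightarrow> x \<in> strip_vertex S e" if "x \<in> K" for x e
    unfolding strip_vertex_def using reeb_map_refl[OF that] by (metis reeb_map_eq)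
  have "strip S T a b \<union> ?va \<union> ?vb = strip_map S T ` ({a..b} \<times> {0..1}) \<union> ?va \<union> ?vb" (is "?L = ?R")
  proof
    show "?L \<subseteq> ?R" unfolding strip_eq_image[OF s] by force
    have "strip_map S T (c, t) \<in> ?L" if ct: "c \<in> {a..b}" "t \<in> {0..1}" for c t
    proof (cases "c \<in> {a<..<b}")
      case True
      then show ?thesis unfolding strip_eq_image[OF s] using ct by blast
    next
      case False
      then have c: "c = a \<or> c = b" using ct by auto
      define w where "w = lower S c + t * (upper T c - lower S c)"
      have w: "w \<in> {lower S c..upper T c}"
        unfolding affine_image_Icc[OF strip_closed(1)[OF s ct(1)], symmetric] w_def using ct(2) by blast
      have "P c w \<in> q (P c w)" using strip_closed(2)[OF s ct(1) w] reeb_map_refl by blast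
      then have "P c w \<in> strip_vertex S c" unfolding strip_vertex_def strip_end(4)[OF s c w] .
      then show ?thesis using c by (auto simp: strip_map_def w_def)
    qed
    then show "?R \<subseteq> ?L" by blast
  qed
  with cc have cc': "closed (strip S T a b \<union> ?va \<union> ?vb)" by simp
  have pre: "{x \<in> K. q x \<in> reeb_space D i - (?E \<union> {?va, ?vb})} = K \<inter> - (strip S T a b \<union> ?va \<union> ?vb)"
  proof (rule set_eqI)
    fix x
    show "x \<in> {x \<in> K. q x \<in> reeb_space D i - (?E \<union> {?va, ?vb})} \<longleftrightarrow>
        x \<in> K \<inter> - (strip S T a b \<union> ?va \<union> ?vb)"
    proof (cases "x \<in> K")
      case True
      have "q x \<in> ?E \<longleftrightarrow> x \<in> strip S T a b" using strip_saturated[OF s True] by blast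
      moreover have "q x \<in> reeb_space D i" using True by (simp add: reeb_space_def)
      ultimately show ?thesis using True by (simp only: mem_Collect_eq Diff_iff Un_iff insert_iff
        empty_iff Int_iff Compl_iff q_iff[OF True] disj_assoc simp_thms)
    qed simp
  qed
  have "openin ?Y (reeb_space D i - (?E \<union> {?va, ?vb}))"
    unfolding openin_reeb_topology pre
    by (intro conjI Diff_subset openin_open_Int open_Compl cc')
  then have "closedin ?Y (?E \<union> {?va, ?vb})"
    using vtop Etop by (simp add: closedin_def topspace_reeb)
  then have 1: "?Y closure_of ?E \<subseteq> ?E \<union> {?va, ?vb}" by (intro closure_of_minimal) auto
  have 2: "strip_vertex S e \<in> ?Y closure_of ?E" if e: "e = a \<or> e = b" for e
    unfolding in_closure_of
  proof (intro conjI allI impI)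
    show "strip_vertex S e \<in> topspace ?Y" using e vtop by auto
    fix U assume U: "strip_vertex S e \<in> U \<and> openin ?Y U"
    have eK: "P e (lower S e) \<in> K" using strip_end(1)[OF s e] .
    have "openin (top_of_set K) {x \<in> K. q x \<in> U}" using U by (simp add: openin_reeb_topology)
    moreover have "P e (lower S e) \<in> {x \<in> K. q x \<in> U}" using U eK by (simp add: strip_vertex_def)
    ultimately obtain r where r: "r > 0" "ball (P e (lower S e)) r \<inter> K \<subseteq> {x \<in> K. q x \<in> U}"
      unfolding openin_contains_ball by blast
    obtain c where c: "c \<in> {a<..<b}" "\<bar>c - e\<bar> < r / 2" "\<bar>lower S c - lower S e\<bar> < r / 2"
      by (rule curve_near[OF ab e half_gt_zero[OF r(1)] half_gt_zero[OF r(1)]])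
    have "P c (lower S c) \<in> strip S T a b"
      using c(1) strip_fib[OF s c(1)] by (intro strip_memI) (auto simp: fib_def)
    moreover have "P c (lower S c) \<in> ball (P e (lower S e)) r"
      using dist_pt_le[of i e "lower S e" c "lower S c"] c by (simp add: abs_minus_commute)
    moreover have "P c (lower S c) \<in> K" using calculation strip_subset_K[OF s] by blast
    ultimately show "\<exists>y. y \<in> ?E \<and> y \<in> U" using r(2) by blast
  qed
  have 3: "?E \<subseteq> ?Y closure_of ?E" using Etop by (rule closure_of_subset)
  have "?Y closure_of ?E = ?E \<union> {?va, ?vb}" using 1 2 3 by auto
  then show ?thesis using nE by (auto simp: endpoints_def)
qed

lemma reeb_value_fibre: "P c w \<in> K \<Longrightarrow> reeb_value i (q (P c w)) = c"
  unfolding reeb_value_def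
  by (rule the_equality) (use reeb_map_subset(2)[of _ "P c w"] reeb_map_refl in \<open>force+\<close>)

lemma strip_vertex_value:
  assumes "is_strip S T a b" "e = a \<or> e = b"
  shows "reeb_value i (strip_vertex S e) = e"
  using strip_end(1)[OF assms] by (simp add: strip_vertex_def reeb_value_fibre)

subsection \<open>The two boundary curves of an edge\<close>

lemma curve_strict_half:
  assumes "S \<in> \<S>" "\<tau> = 1 \<or> \<tau> = - 1" "\<And>c. c \<in> I \<Longrightarrow> \<bar>c - cx S\<bar> < snd S"
  shows "(\<lambda>c. P c (ht \<tau> S c)) ` I \<subseteq> strict_half i (\<tau> * \<sigma> S = 1) S"
proof
  fix x assume "x \<in> (\<lambda>c. P c (ht \<tau> S c)) ` I"
  then obtain c where c: "c \<in> I" "x = P c (ht \<tau> S c)" by blast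
  have "\<tau> * \<sigma> S * (ht \<tau> S c - cy S) > 0" using ht_strict assms c by blast
  moreover have "P c (ht \<tau> S c) \<in> circ S" using ht_in_circ assms c less_imp_le by metis
  ultimately show "x \<in> strict_half i (\<tau> * \<sigma> S = 1) S"
    using assms(2) side[OF assms(1)] by (auto simp: strict_half_def c(2))
qed

lemma carriers_arcs_meeting:
  assumes S: "S \<in> \<S>" and C: "C \<subseteq> circ S" "C \<noteq> {}"
  shows "carriers \<S> (arcs_meeting S C) = {S}"
proof -
  obtain x where x: "x \<in> C" "x \<in> circ S" using C by blast
  obtain A where "A \<in> arcs_at S x" using arcs_at_nonempty[OF radius_pos[OF S] x(2)] by blast
  then obtain j where j: "j < 8" "arc8 S j \<in> arcs_meeting S C"
    using x(1) by (auto simp: arcs_at_def arcs_meeting_def)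
  have "T = S" if "T \<in> carriers \<S> (arcs_meeting S C)" for T
    using circle_eq_if_arc8_subset[OF radius_pos[OF S], of T j] that j radius_pos
    by (auto simp: carriers_def)
  moreover have "S \<in> carriers \<S> (arcs_meeting S C)"
    using S arc8_subset_circ[OF radius_pos[OF S]] by (auto simp: carriers_def arcs_meeting_def)
  ultimately show ?thesis by blast
qed

text \<open>Inside a strip only the two boundary curves meet circles, so they make up its frontier
  part. If both lie on the same circle, the lower curve can be below the upper one only when the
  domain is inside the circle.\<close>

lemma edge_curves_strip:
  assumes s: "is_strip S T a b"
  defines "C1 \<equiv> (\<lambda>c. P c (lower S c)) ` {a<..<b}" and "C2 \<equiv> (\<lambda>c. P c (upper T c)) ` {a<..<b}"
  shows "edge_curves \<S> D i (q ` strip S T a b) C1 C2 S T"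
    and "C1 \<subseteq> strict_half i (\<sigma> S = - 1) S" "C2 \<subseteq> strict_half i (\<sigma> T = 1) T"
    and "connected C1" "connected C2" "C1 \<noteq> {}" "C2 \<noteq> {}"
    and "S = T \<Longrightarrow> \<sigma> S = 1"
proof -
  have ab: "a < b" and S: "S \<in> \<S>" and T: "T \<in> \<S>" using strip_mid[OF s] by auto
  have f: "fib S T c" if "c \<in> {a<..<b}" for c using strip_fib[OF s that] .
  have dom: "\<bar>c - cx S\<bar> < snd S" "\<bar>c - cx T\<bar> < snd T" "lower S c < upper T c" if "c \<in> {a<..<b}" for c
    using f[OF that] by (auto simp: fib_def)
  have "(- 1 * \<sigma> S = 1) = (\<sigma> S = - 1)" by auto
  then show h1: "C1 \<subseteq> strict_half i (\<sigma> S = - 1) S"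
    using curve_strict_half[OF S, of "- 1" "{a<..<b}"] dom by (simp add: C1_def)
  show h2: "C2 \<subseteq> strict_half i (\<sigma> T = 1) T"
    using curve_strict_half[OF T, of 1 "{a<..<b}"] dom by (simp add: C2_def)
  show c12: "connected C1" "connected C2"
    unfolding C1_def C2_def by (auto intro!: connected_continuous_image continuous_intros)
  \<comment> \<open>Two different positions over the interval, to witness that the curves are not
    reduced to a point.\<close>
  define m where "m = (a + b) / 2"
  define m' where "m' = (a + m) / 2"
  have m: "m \<in> {a<..<b}" "m' \<in> {a<..<b}" "m \<noteq> m'" using ab by (auto simp: m_def m'_def field_simps)
  then have pts: "P m (lower S m) \<in> C1" "P m' (lower S m') \<in> C1" "P m (upper T m) \<in> C2" "P m' (upper T m') \<in> C2"
    by (auto simp: C1_def C2_def)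
  then show ne: "C1 \<noteq> {}" "C2 \<noteq> {}" by auto
  have pr: "projects_regularly i C1" "projects_regularly i C2"
    using projects_regularly_half[OF radius_pos[OF S] h1 c12(1) pts(1,2)]
      projects_regularly_half[OF radius_pos[OF T] h2 c12(2) pts(3,4)] m(3) by auto
  have "thru (P c w) \<noteq> {} \<longleftrightarrow> w = lower S c \<or> w = upper T c"
    if c: "c \<in> {a<..<b}" "w \<in> {lower S c..upper T c}" for c w
    using fibD(1,2,3)[OF f[OF c(1)]] c(2) by (auto simp: domain_iff less_le)
  then have fr: "P c w \<in> frontier K \<longleftrightarrow> w = lower S c \<or> w = upper T c"
    if c: "c \<in> {a<..<b}" "w \<in> {lower S c..upper T c}" for c w
    using that fibD(4)[OF f[OF c(1)] c(2)] by (simp add: frontier_K)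
  have fr: "strip S T a b \<inter> frontier K = C1 \<union> C2"
  proof (intro set_eqI iffI)
    fix x assume "x \<in> strip S T a b \<inter> frontier K"
    then obtain c w where x: "x = P c w" "c \<in> {a<..<b}" "w \<in> {lower S c..upper T c}" "x \<in> frontier K"
      using strip_memE[OF _ s] by blast
    then have "w = lower S c \<or> w = upper T c" using fr by blast
    then show "x \<in> C1 \<union> C2" using x by (auto simp: C1_def C2_def)
  next
    fix x assume "x \<in> C1 \<union> C2"
    then obtain c where c: "c \<in> {a<..<b}" "x = P c (lower S c) \<or> x = P c (upper T c)"
      unfolding C1_def C2_def by blast
    moreover have "lower S c \<in> {lower S c..upper T c}" "upper T c \<in> {lower S c..upper T c}"
      using dom(3)[OF c(1)] by auto
    ultimately show "x \<in> strip S T a b \<inter> frontier K" using fr[OF c(1)] strip_memI[OF c(1)] by blast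
  qed
  have dj: "C1 \<inter> C2 = {}" using dom(3) by (force simp: C1_def C2_def)
  have lb: "lies_beyond i C2 C1"
    unfolding lies_beyond_def C1_def C2_def using dom(3) by (auto simp: inj_on_def image_image)
  have u1: "U = S" if "U \<in> \<S>" "C1 \<subseteq> circ U" for U
    using fibD(1)[OF f[OF m(1)]] that pts thru_iff by blast
  have u2: "U = T" if "U \<in> \<S>" "C2 \<subseteq> circ U" for U
    using fibD(2)[OF f[OF m(1)]] that pts thru_iff by blast
  have sub: "C1 \<subseteq> circ S" "C2 \<subseteq> circ T" using h1 h2 by (auto simp: strict_half_def)
  show "edge_curves \<S> D i (q ` strip S T a b) C1 C2 S T"
    unfolding edge_curves_def edge_preimage[OF s] using fr dj pr lb u1 u2 sub S T by blast
  show "\<sigma> S = 1" if "S = T"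
    using dom(3)[OF m(1)] side[OF S] that dom(1)[OF m(1)] ht_strict[OF S, of m 1] ht_strict[OF S, of m "-1"] by auto
qed


section \<open>Edges at a vertex\<close>

lemma right_limit_ht: "((\<lambda>t. ht \<tau> S (c + s * t)) \<longlongrightarrow> ht \<tau> S c) (at_right 0)"
proof -
  have "((\<lambda>t. ht \<tau> S (c + s * t)) \<longlongrightarrow> ht \<tau> S (c + s * 0)) (at_right 0)"
    by (intro tendsto_intros)
  then show ?thesis by simp
qed

lemma eventually_right: "\<delta> > 0 \<Longrightarrow> \<forall>\<^sub>F t in at_right (0::real). 0 < t \<and> t < \<delta>"
  by (auto simp: eventually_at_right_field)

text \<open>If the curve of \<open>S\<close> runs on the wrong side of the curve of \<open>S'\<close>, then \<open>(c, w)\<close> is a pole of \<open>S'\<close>,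
  where \<open>S'\<close> opens like a square root, while \<open>S\<close> grows only linearly.\<close>

lemma germ_order:
  assumes S: "S \<in> \<S>" "S' \<in> \<S>" "S \<noteq> S'" and \<tau>: "\<tau> = 1 \<or> \<tau> = - 1" and s: "s = 1 \<or> s = - 1"
    and x: "P c w \<in> K" "ht \<tau> S c = w" "ht \<tau> S' c = w" "P c w \<in> circ S" "P c w \<in> circ S'"
    and \<delta>: "\<delta> > 0" "\<And>t. 0 < t \<Longrightarrow> t < \<delta> \<Longrightarrow> \<bar>c + s * t - cx S\<bar> < snd S"
      "\<And>t. 0 < t \<Longrightarrow> t < \<delta> \<Longrightarrow> \<bar>c + s * t - cx S'\<bar> < snd S'"
      "\<And>t. 0 < t \<Longrightarrow> t < \<delta> \<Longrightarrow> gap S' (P (c + s * t) (ht \<tau> S (c + s * t))) \<le> 0"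
  shows "\<not> (\<exists>\<^sub>F t in at_right 0. \<tau> * ht \<tau> S (c + s * t) > \<tau> * ht \<tau> S' (c + s * t))"
proof
  assume freq: "\<exists>\<^sub>F t in at_right 0. \<tau> * ht \<tau> S (c + s * t) > \<tau> * ht \<tau> S' (c + s * t)"
  define u where "u t = ht \<tau> S (c + s * t)" for t
  have ev: "\<forall>\<^sub>F t in at_right 0. 0 < t \<and> t < \<delta>" using eventually_right[OF \<delta>(1)] .
  have freq1: "\<exists>\<^sub>F t in at_right 0. (0 < t \<and> t < \<delta>) \<and> \<tau> * u t > \<tau> * ht \<tau> S' (c + s * t)"
    using frequently_eventually_conj[OF freq ev] by (simp add: u_def)
  \<comment> \<open>On the side of the centre where the branch of \<open>S'\<close> runs, a
    nonpositive gap keeps the curve of \<open>S\<close> on the right side of that branch. A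
    violation is thus possible only beyond the centre of \<open>S'\<close>.\<close>
  have wrong: "\<tau> * \<sigma> S' * (u t - cy S') \<le> 0"
    if t: "0 < t" "t < \<delta>" "\<tau> * u t > \<tau> * ht \<tau> S' (c + s * t)" for t
  proof (rule ccontr)
    assume "\<not> \<tau> * \<sigma> S' * (u t - cy S') \<le> 0"
    then have "\<tau> * \<sigma> S' * (u t - cy S') > 0" by simp
    from gap_nonpos_iff_ht[OF S(2) less_imp_le[OF \<delta>(3)[OF t(1,2)]] \<tau> this] \<delta>(4)[OF t(1,2)] t(3)
    show False by (simp add: u_def)
  qed
  have ulim: "(u \<longlongrightarrow> w) (at_right 0)"
    using right_limit_ht[of \<tau> S c s] x(2) by (simp add: u_def[abs_def])
  \<comment> \<open>Violations occur arbitrarily close to \<open>c\<close>, so the limit point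
    cannot lie strictly on the branch side. Being on the branch, it has the height of the
    centre.\<close>
  have "\<not> \<tau> * \<sigma> S' * (w - cy S') > 0"
  proof
    assume pos: "\<tau> * \<sigma> S' * (w - cy S') > 0"
    have "((\<lambda>t. \<tau> * \<sigma> S' * (u t - cy S')) \<longlongrightarrow> \<tau> * \<sigma> S' * (w - cy S')) (at_right 0)"
      by (intro tendsto_intros ulim)
    from frequently_eventually_conj[OF freq1 order_tendstoD(1)[OF this pos]]
    have "\<exists>\<^sub>F t in at_right (0::real). False"
    proof (rule frequently_elim1)
      fix t assume t: "0 < \<tau> * \<sigma> S' * (u t - cy S') \<and> (0 < t \<and> t < \<delta>) \<and>
          \<tau> * ht \<tau> S' (c + s * t) < \<tau> * u t"
      then have "\<tau> * \<sigma> S' * (u t - cy S') \<le> 0" by (intro wrong) auto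
      then show False using t by linarith
    qed
    then show False by simp
  qed
  moreover have "(c - cx S')\<^sup>2 \<le> (snd S')\<^sup>2"
    using circ_domain[OF S(2) x(5)] radius_pos[OF S(2)] by (simp add: abs_le_square_iff[symmetric])
  then have "\<tau> * \<sigma> S' * (w - cy S') \<ge> 0"
    unfolding x(3)[symmetric] using \<tau> side[OF S(2)] by (auto simp: ht_def) 
  ultimately have wc: "w = cy S'" using \<tau> side[OF S(2)] by auto
  define r where "r = snd S'"
  have r: "r > 0" using radius_pos[OF S(2)] by (simp add: r_def)
  have "(c - cx S')\<^sup>2 = r\<^sup>2" using x(5) by (simp add: circ_iff[OF S(2)] wc r_def)
  then have "c - cx S' = r \<or> c - cx S' = - r" by (auto simp: power2_eq_iff)
  \<comment> \<open>The branch of \<open>S'\<close> exists in direction \<open>s\<close>, so the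
    centre of \<open>S'\<close> lies in that direction from the pole.\<close>
  then have cc: "c - cx S' = - s * r"
    using s \<delta>(3)[of "\<delta> / 2"] \<delta>(1) by (auto simp: r_def abs_less_iff)
  define a where "a = P c w - fst S"
  have "cross i a (P c w - fst S') \<noteq> 0"
    unfolding a_def using transversal[OF x(1), of S S'] x S by (auto simp: thru_iff)
  \<comment> \<open>At the pole the radius vector of \<open>S'\<close> is horizontal, so
    independence means that \<open>S\<close> has no vertical tangent there.\<close>
  then have ao: "a $ oi \<noteq> 0" by (auto simp: cross_def wc)
  \<comment> \<open>What remains of the equation of \<open>S\<close> after division by
    \<open>2 * \<bar>k\<bar>\<close>, with \<open>t\<close> bounded by \<open>k\<^sup>2 / r\<close>.
    It tends to 0 with \<open>k\<close>, whereas the equation will bound it below by the constant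
    \<open>\<bar>a $ oi\<bar>\<close>.\<close>
  define E where "E k = \<bar>k\<bar> * (\<bar>a $ i\<bar> / r + (k\<^sup>2 / r\<^sup>2 + 1) / 2)" for k
  have "((\<lambda>t. E (u t - w)) \<longlongrightarrow> E (w - w)) (at_right 0)"
    unfolding E_def by (intro tendsto_intros ulim) (use r in auto)
  then have "((\<lambda>t. E (u t - w)) \<longlongrightarrow> 0) (at_right 0)" by (simp add: E_def)
  from order_tendstoD(2)[OF this] have "\<forall>\<^sub>F t in at_right 0. E (u t - w) < \<bar>a $ oi\<bar>"
    using ao by simp
  moreover have "\<forall>\<^sub>F t in at_right 0. 0 < t \<and> t < r" using eventually_right[OF r] .
  ultimately have "\<forall>\<^sub>F t in at_right 0. E (u t - w) < \<bar>a $ oi\<bar> \<and> 0 < t \<and> t < r"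
    by eventually_elim simp
  from frequently_eventually_conj[OF freq1 this]
  obtain t where t: "0 < t" "t < \<delta>" "\<tau> * u t > \<tau> * ht \<tau> S' (c + s * t)" "E (u t - w) < \<bar>a $ oi\<bar>" "t < r"
    using frequently_ex by (metis (no_types, lifting))
  define k where "k = u t - w"
  have s2: "s * s = 1" using s by auto
  \<comment> \<open>With the domain inside \<open>S'\<close>, the branch lies in direction \<tau>
    from the centre, and a point beyond it in direction \<tau> would be on the branch side.\<close>
  have sg: "\<sigma> S' = - 1"
  proof (rule ccontr)
    assume "\<sigma> S' \<noteq> - 1"
    then have "\<sigma> S' = 1" using side[OF S(2)] by simp
    moreover have "\<tau> * \<sigma> S' * (ht \<tau> S' (c + s * t) - cy S') > 0"
      using ht_strict[OF S(2) \<delta>(3)[OF t(1,2)] \<tau>] .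
    ultimately show False using wrong[OF t(1-3)] t(3) by (simp add: algebra_simps)
  qed
  have "c + s * t - cx S' = s * (t - r)" using cc by (simp add: algebra_simps)
  then have "(c + s * t - cx S')\<^sup>2 = s\<^sup>2 * (t - r)\<^sup>2" by (simp only: power_mult_distrib)
  then have "(c + s * t - cx S')\<^sup>2 = (t - r)\<^sup>2" using s2 by (simp add: power2_eq_square)
  then have "gap S' (P (c + s * t) (u t)) = - ((t - r)\<^sup>2 + k\<^sup>2 - r\<^sup>2)"
    by (simp add: gap_def sg r_def k_def wc)
  then have "(t - r)\<^sup>2 + k\<^sup>2 - r\<^sup>2 \<ge> 0" using \<delta>(4)[OF t(1,2)] by (simp add: u_def)
  then have "k\<^sup>2 \<ge> t * r + t * (r - t)" by (simp add: power2_eq_square algebra_simps)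
  moreover have "t * (r - t) \<ge> 0" using t(1,5) by simp
  \<comment> \<open>Staying outside the disc of \<open>S'\<close> at horizontal distance
    \<open>t\<close> from its pole costs a vertical displacement of at least the square root of
    \<open>t * r\<close>.\<close>
  ultimately have kt: "t * r \<le> k\<^sup>2" by linarith
  then have "k\<^sup>2 > 0" using t(1) r by (metis mult_pos_pos less_le_trans)
  then have k0: "\<bar>k\<bar> > 0" by simp
  have tk: "t \<le> k\<^sup>2 / r" using kt r by (simp add: field_simps)
  have "P (c + s * t) (u t) \<in> circ S"
    unfolding u_def using ht_in_circ[OF S(1) less_imp_le[OF \<delta>(2)[OF t(1,2)]] \<tau>] .
  then have "(c + s * t - cx S)\<^sup>2 + (u t - cy S)\<^sup>2 = (c - cx S)\<^sup>2 + (w - cy S)\<^sup>2"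
    using x(4) by (simp add: circ_iff[OF S(1)])
  moreover have "c - cx S = a $ i" "w - cy S = a $ oi" by (simp_all add: a_def)
  moreover have "c + s * t - cx S = a $ i + s * t" "u t - cy S = a $ oi + k" by (simp_all add: a_def k_def)
  ultimately have "2 * a $ oi * k = - (2 * a $ i * (s * t) + (s * s) * t\<^sup>2 + k\<^sup>2)"
    by (simp add: power2_eq_square algebra_simps)
  then have "\<bar>2 * a $ oi * k\<bar> = \<bar>2 * a $ i * (s * t) + t\<^sup>2 + k\<^sup>2\<bar>" by (simp add: s2)
  also have "\<dots> \<le> \<bar>2 * a $ i * (s * t)\<bar> + (t\<^sup>2 + k\<^sup>2)"
    using abs_triangle_ineq[of "2 * a $ i * (s * t)" "t\<^sup>2 + k\<^sup>2"] by (simp add: add.assoc)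
  also have "\<bar>2 * a $ i * (s * t)\<bar> = 2 * \<bar>a $ i\<bar> * t" using s t(1) by (auto simp: abs_mult)
  also have "2 * \<bar>a $ i\<bar> * t + (t\<^sup>2 + k\<^sup>2) \<le> 2 * \<bar>a $ i\<bar> * (k\<^sup>2 / r) + ((k\<^sup>2 / r)\<^sup>2 + k\<^sup>2)"
    using mult_left_mono[OF tk, of "2 * \<bar>a $ i\<bar>"] power_mono[OF tk, of 2] t(1) by simp
  also have "\<dots> = 2 * \<bar>k\<bar> * E k"
  proof -
    have "2 * A * (x\<^sup>2 / r) + ((x\<^sup>2 / r)\<^sup>2 + x\<^sup>2) = 2 * x * (x * (A / r + (x\<^sup>2 / r\<^sup>2 + 1) / 2))" for A x :: real
      using r by (simp add: power2_eq_square field_simps)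
    from this[of "\<bar>a $ i\<bar>" "\<bar>k\<bar>"] show ?thesis by (simp add: E_def)
  qed
  finally have "\<bar>a $ oi\<bar> * (2 * \<bar>k\<bar>) \<le> E k * (2 * \<bar>k\<bar>)" by (simp add: abs_mult mult_ac)
  then have "\<bar>a $ oi\<bar> \<le> E k" using k0 by simp
  then show False using t(4) by (simp add: k_def)
qed

text \<open>Near their common start the two curves do not meet again, because double points are
  isolated. One of them would be beyond the other at positions arbitrarily close to
  \<open>c\<close>, and \<open>germ_order\<close> excludes both orders.\<close>

lemma germ_unique:
  assumes S: "S \<in> \<S>" "S' \<in> \<S>" and \<tau>: "\<tau> = 1 \<or> \<tau> = - 1" and s: "s = 1 \<or> s = - 1"
    and x: "P c w \<in> K" "ht \<tau> S c = w" "ht \<tau> S' c = w"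
    and \<delta>: "\<delta> > 0" "\<And>t. 0 < t \<Longrightarrow> t < \<delta> \<Longrightarrow> \<bar>c + s * t - cx S\<bar> < snd S \<and> P (c + s * t) (ht \<tau> S (c + s * t)) \<in> K"
      "\<And>t. 0 < t \<Longrightarrow> t < \<delta> \<Longrightarrow> \<bar>c + s * t - cx S'\<bar> < snd S' \<and> P (c + s * t) (ht \<tau> S' (c + s * t)) \<in> K"
  shows "S = S'"
proof (rule ccontr)
  assume ne: "S \<noteq> S'"
  have dom: "\<bar>c - cx U\<bar> \<le> snd U"
    if "\<And>t. 0 < t \<Longrightarrow> t < \<delta> \<Longrightarrow> \<bar>c + s * t - cx U\<bar> < snd U" for U
  proof -
    have "((\<lambda>t. \<bar>c + s * t - cx U\<bar>) \<longlongrightarrow> \<bar>c + s * 0 - cx U\<bar>) (at_right 0)" by (intro tendsto_intros)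
    moreover have "\<forall>\<^sub>F t in at_right 0. \<bar>c + s * t - cx U\<bar> \<le> snd U"
      using eventually_right[OF \<delta>(1)] by eventually_elim (use that in force)
    ultimately show ?thesis using tendsto_upperbound[of _ _ "at_right (0::real)"] by fastforce
  qed
  have xS: "P c w \<in> circ S" using ht_in_circ[OF S(1) dom \<tau>] \<delta>(2) x(2) by auto
  have xS': "P c w \<in> circ S'" using ht_in_circ[OF S(2) dom \<tau>] \<delta>(3) x(3) by auto
  have th: "S \<in> thru (P c w)" "S' \<in> thru (P c w)" using xS xS' S by (auto simp: thru_iff)
  obtain r1 where r1: "r1 > 0" "\<forall>y\<in>ball (P c w) r1. y \<in> K \<longrightarrow> gap S y \<le> 0" using gap_nonpos[OF x(1) th(1)] by blast
  obtain r2 where r2: "r2 > 0" "\<forall>y\<in>ball (P c w) r2. y \<in> K \<longrightarrow> gap S' y \<le> 0" using gap_nonpos[OF x(1) th(2)] by blast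
  obtain r3 where r3: "r3 > 0" "\<forall>y\<in>ball (P c w) r3. y \<in> circ S \<and> y \<in> circ S' \<longrightarrow> y = P c w"
    using double_point_isolated[OF x(1) th ne] by blast
  define r where "r = min r1 (min r2 r3)"
  have r: "r > 0" using r1 r2 r3 by (simp add: r_def)
  have near: "\<forall>\<^sub>F t in at_right 0. P (c + s * t) (ht \<tau> U (c + s * t)) \<in> ball (P c w) r" if "ht \<tau> U c = w" for U
  proof -
    have "((\<lambda>t. P (c + s * t) (ht \<tau> U (c + s * t))) \<longlongrightarrow> P (c + s * 0) (ht \<tau> U c)) (at_right 0)"
      by (intro tendsto_pt right_limit_ht tendsto_intros)
    then show ?thesis using r that by (intro topological_tendstoD) auto
  qed
  have "\<forall>\<^sub>F t in at_right 0. (0 < t \<and> t < \<delta>) \<and> P (c + s * t) (ht \<tau> S (c + s * t)) \<in> ball (P c w) r \<and>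
     P (c + s * t) (ht \<tau> S' (c + s * t)) \<in> ball (P c w) r"
    by (intro eventually_conj eventually_right[OF \<delta>(1)] near x)
  then obtain d where d: "d > 0" "\<And>t. 0 < t \<Longrightarrow> t < d \<Longrightarrow> (0 < t \<and> t < \<delta>) \<and>
     P (c + s * t) (ht \<tau> S (c + s * t)) \<in> ball (P c w) r \<and> P (c + s * t) (ht \<tau> S' (c + s * t)) \<in> ball (P c w) r"
    unfolding eventually_at_right_field by blast
  have neq: "ht \<tau> S (c + s * t) \<noteq> ht \<tau> S' (c + s * t)" if t: "0 < t" "t < d" for t
  proof
    assume eq: "ht \<tau> S (c + s * t) = ht \<tau> S' (c + s * t)"
    have "P (c + s * t) (ht \<tau> S (c + s * t)) \<in> circ S" "P (c + s * t) (ht \<tau> S' (c + s * t)) \<in> circ S'"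
      using \<delta>(2,3) d(2)[OF t] by (auto intro!: ht_in_circ S \<tau> less_imp_le)
    moreover have "P (c + s * t) (ht \<tau> S (c + s * t)) \<in> ball (P c w) r3"
      using d(2)[OF t] by (simp add: r_def)
    ultimately have "P (c + s * t) (ht \<tau> S (c + s * t)) = P c w"
      using r3(2) by (simp only: eq)
    then show False using t s by auto
  qed
  have "\<not> (\<exists>\<^sub>F t in at_right 0. \<tau> * ht \<tau> S (c + s * t) > \<tau> * ht \<tau> S' (c + s * t))"
    by (rule germ_order[OF S ne \<tau> s x xS xS' d(1)]) (use d(2) \<delta>(2,3) r2(2) in \<open>auto simp: r_def\<close>)
  moreover have "\<not> (\<exists>\<^sub>F t in at_right 0. \<tau> * ht \<tau> S' (c + s * t) > \<tau> * ht \<tau> S (c + s * t))"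
    by (rule germ_order[OF S(2,1) ne[symmetric] \<tau> s x(1,3,2) xS' xS d(1)])
      (use d(2) \<delta>(2,3) r1(2) in \<open>auto simp: r_def\<close>)
  ultimately have "\<forall>\<^sub>F t in at_right 0. \<not> \<tau> * ht \<tau> S (c + s * t) > \<tau> * ht \<tau> S' (c + s * t) \<and>
     \<not> \<tau> * ht \<tau> S' (c + s * t) > \<tau> * ht \<tau> S (c + s * t) \<and> (0 < t \<and> t < d)"
    unfolding frequently_def not_not by (intro eventually_conj eventually_right[OF d(1)])
  then have "\<forall>\<^sub>F t in at_right (0::real). False"
    by eventually_elim (use neq \<tau> in force)
  then show False by simp
qed

subsection \<open>Vertices as fibres\<close>

definition vertex_fibre :: "(real^2) set \<Rightarrow> real \<Rightarrow> real \<Rightarrow> real \<Rightarrow> bool" where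
  "vertex_fibre v c lo hi \<longleftrightarrow> v \<in> V \<and> lo \<le> hi \<and> v = P c ` {lo..hi} \<and> (\<forall>w\<in>{lo..hi}. P c w \<in> K \<and> q (P c w) = v)"

lemma vertex_fibre_exists:
  assumes "v \<in> V"
  obtains c lo hi where "vertex_fibre v c lo hi"
proof -
  obtain x where x: "crit x" "v = q x" using assms by (auto simp: reeb_vertices_eq)
  then have "P (x $ i) (x $ oi) \<in> K" by (simp add: crit_def)
  from reeb_map_interval[OF this] obtain lo hi where lh: "lo \<le> x $ oi" "x $ oi \<le> hi"
    "q x = P (x $ i) ` {lo..hi}" by (metis pt_coords)
  have "P (x $ i) w \<in> K \<and> q (P (x $ i) w) = v" if "w \<in> {lo..hi}" for w
  proof -
    have "P (x $ i) w \<in> q x" using lh that by simp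
    then show ?thesis using reeb_map_subset(1) reeb_map_eq x(2) by blast
  qed
  then show ?thesis using that[of "x $ i" lo hi] assms lh x(2) by (simp add: vertex_fibre_def)
qed

definition cpoints :: "real \<Rightarrow> real \<Rightarrow> real \<Rightarrow> real set" where
  "cpoints c lo hi = {w \<in> {lo..hi}. thru (P c w) \<noteq> {}}"

text \<open>The strips leaving the fibre over \<open>c\<close> to the right for \<open>s = 1\<close>
  and to the left for \<open>s = - 1\<close>, recorded by their two circles. The condition on the
  lower end selects those that arrive at \<open>v\<close> and not at another fibre over the same
  \<open>c\<close>.\<close>

definition germs :: "real \<Rightarrow> (real^2) set \<Rightarrow> real \<Rightarrow> (circle \<times> circle) set" where
  "germs s v c = {(S, T). S \<in> \<S> \<and> T \<in> \<S> \<and> (\<exists>\<delta>>0. \<forall>t\<in>{0<..<\<delta>}. fib S T (c + s * t)) \<and> P c (lower S c) \<in> v}"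

lemma finite_germs: "finite (germs s v c)"
proof (rule finite_subset)
  show "germs s v c \<subseteq> \<S> \<times> \<S>" by (auto simp: germs_def)
qed (use finite_circles in simp)

lemma vertex_not_fib:
  assumes v: "vertex_fibre v c lo hi" and m: "P c (lower S c) \<in> v"
  shows "\<not> fib S T c"
proof
  assume f: "fib S T c"
  then have "lower S c \<in> {lower S c..upper T c}" by (simp add: fib_def)
  from fibD(6)[OF f this] show False using v m by (auto simp: vertex_fibre_def)
qed

lemma vertex_fibre_value: "vertex_fibre v c lo hi \<Longrightarrow> reeb_value i v = c"
  using reeb_value_fibre[of c lo] by (auto simp: vertex_fibre_def)

text \<open>A germ extends to a maximal interval, and this interval stops at \<open>c\<close>
  because the fibre there is a vertex.\<close>

lemma strip_of_germ:
  assumes v: "vertex_fibre v c lo hi" and g: "(S, T) \<in> germs s v c"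
  shows "s = 1 \<Longrightarrow> \<exists>b. is_strip S T c b" "s = - 1 \<Longrightarrow> \<exists>a. is_strip S T a c" "strip_vertex S c = v"
proof -
  obtain \<delta> where \<delta>: "\<delta> > 0" "\<And>t. 0 < t \<Longrightarrow> t < \<delta> \<Longrightarrow> fib S T (c + s * t)" and m: "P c (lower S c) \<in> v"
    using g by (auto simp: germs_def)
  have nf: "\<not> fib S T c" using vertex_not_fib[OF v m] .
  have "fib S T (c + s * (\<delta> / 2))" by (rule \<delta>(2)) (use \<delta>(1) in auto)
  then obtain a b where ab: "is_strip S T a b" "a < c + s * (\<delta> / 2)" "c + s * (\<delta> / 2) < b"
    using strip_exists by blast
  have f: "\<And>t. a < t \<Longrightarrow> t < b \<Longrightarrow> fib S T t" "\<not> fib S T a" "\<not> fib S T b"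
    using ab(1) by (auto simp: is_strip_def)
  show "\<exists>b. is_strip S T c b" if s: "s = 1"
  proof -
    have "\<not> a < c" using f(1)[of c] nf ab \<delta>(1) s by auto
    moreover have "\<not> c < a" using \<delta>(2)[of "a - c"] f(2) ab s by auto
    ultimately have "a = c" by simp
    then show ?thesis using ab by blast
  qed
  show "\<exists>a. is_strip S T a c" if s: "s = - 1"
  proof -
    have "\<not> c < b" using f(1)[of c] nf ab \<delta>(1) s by auto
    moreover have "\<not> b < c" using \<delta>(2)[of "c - b"] f(3) ab s by auto
    ultimately have "b = c" by simp
    then show ?thesis using ab by blast
  qed
  show "strip_vertex S c = v" using m v by (auto simp: strip_vertex_def vertex_fibre_def)
qed

lemma germ_of_strip:
  assumes s: "is_strip S T a b" and v: "strip_vertex S e = v"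
  shows "e = a \<Longrightarrow> (S, T) \<in> germs 1 v a" "e = b \<Longrightarrow> (S, T) \<in> germs (- 1) v b"
proof -
  have ST: "S \<in> \<S>" "T \<in> \<S>" "a < b" using strip_mid[OF s] by auto
  have m: "P e (lower S e) \<in> v" if "e = a \<or> e = b"
    using reeb_map_refl[OF strip_end(1)[OF s that]] v by (simp add: strip_vertex_def)
  show "(S, T) \<in> germs 1 v a" if "e = a"
    unfolding germs_def using ST m that strip_fib[OF s]
    by (auto intro!: exI[of _ "b - a"])
  show "(S, T) \<in> germs (- 1) v b" if "e = b"
    unfolding germs_def using ST m that strip_fib[OF s]
    by (auto intro!: exI[of _ "b - a"])
qed

text \<open>Germs to the right correspond bijectively to departing edges: the germ fixes the circles
  and one end of the strip, and the other end is then determined. The values at the two ends of an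
  edge identify \<open>v\<close> as its left end.\<close>

lemma out_degree_eq:
  assumes v: "vertex_fibre v c lo hi"
  shows "out_degree \<S> D i v = card (germs 1 v c)"
    and "finite {e \<in> reeb_edges \<S> D i. v \<in> endpoints D i e \<and>
     (\<exists>w\<in>endpoints D i e. reeb_value i v < reeb_value i w)}"
proof -
  define B where "B S T = (SOME b. is_strip S T c b)" for S T
  define F where "F = (\<lambda>(S, T). q ` strip S T c (B S T))"
  have B: "is_strip S T c (B S T)" if "(S, T) \<in> germs 1 v c" for S T
    unfolding B_def using strip_of_germ(1)[OF v that] by (auto intro: someI_ex)
  have "inj_on F (germs 1 v c)"
  proof (rule inj_onI)
    fix x y assume xy: "x \<in> germs 1 v c" "y \<in> germs 1 v c" "F x = F y"
    obtain S T S' T' where e: "x = (S, T)" "y = (S', T')" by (cases x, cases y)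
    show "x = y" using strip_image_inj[OF B B, of S T S' T'] xy by (simp add: e F_def)
  qed
  moreover have eq: "{e \<in> reeb_edges \<S> D i. v \<in> endpoints D i e \<and>
     (\<exists>w\<in>endpoints D i e. reeb_value i v < reeb_value i w)} = F ` germs 1 v c" (is "?L = _")
  proof (intro set_eqI iffI)
    fix e assume "e \<in> ?L"
    then obtain S T a b w where e: "is_strip S T a b" "e = q ` strip S T a b"
      "v \<in> {strip_vertex S a, strip_vertex S b}" "w \<in> {strip_vertex S a, strip_vertex S b}"
      "reeb_value i v < reeb_value i w"
      using endpoints_strip by (auto simp: reeb_edges_eq)
    have ab: "a < b" using strip_mid[OF e(1)] by simp
    have va: "reeb_value i (strip_vertex S a) = a" "reeb_value i (strip_vertex S b) = b"
      using strip_vertex_value[OF e(1)] by auto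
    have "v = strip_vertex S a" using e(3-5) va ab by auto
    then have ac: "a = c" using va vertex_fibre_value[OF v] by simp
    have g: "(S, T) \<in> germs 1 v c" using germ_of_strip(1)[OF e(1) _ refl] \<open>v = strip_vertex S a\<close> ac by simp
    \<comment> \<open>Two strips with the same circles that both start at \<open>c\<close> share the
      position halfway to the nearer right end, hence coincide.\<close>
    have "B S T = b"
      using B[OF g] e(1) ac strip_mid[OF B[OF g]] is_strip_unique(2)[of S T c "B S T" c b "(c + min (B S T) b) / 2"] ab
      by (auto simp: min_def split: if_splits)
    then show "e \<in> F ` germs 1 v c" using g e(2) ac by (force simp: F_def)
  next
    fix e assume "e \<in> F ` germs 1 v c"
    then obtain S T where g: "(S, T) \<in> germs 1 v c" "e = q ` strip S T c (B S T)" by (auto simp: F_def)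
    note s = B[OF g(1)]
    have "endpoints D i e = {v, strip_vertex S (B S T)}"
      unfolding g(2) endpoints_strip[OF s] strip_of_germ(3)[OF v g(1)] by simp
    moreover have "reeb_value i v < reeb_value i (strip_vertex S (B S T))"
      using vertex_fibre_value[OF v] strip_vertex_value[OF s, of "B S T"] strip_mid[OF s] by simp
    moreover have "e \<in> reeb_edges \<S> D i" unfolding reeb_edges_eq using s g(2) by blast
    ultimately show "e \<in> ?L" by simp
  qed
  ultimately show "out_degree \<S> D i v = card (germs 1 v c)"
    unfolding out_degree_def by (simp add: card_image)
  show "finite ?L" unfolding eq using finite_germs by simp
qed

lemma in_degree_eq:
  assumes v: "vertex_fibre v c lo hi"
  shows "in_degree \<S> D i v = card (germs (- 1) v c)"
    and "finite {e \<in> reeb_edges \<S> D i. v \<in> endpoints D i e \<and>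
     (\<exists>w\<in>endpoints D i e. reeb_value i w < reeb_value i v)}"
proof -
  define B where "B S T = (SOME a. is_strip S T a c)" for S T
  define F where "F = (\<lambda>(S, T). q ` strip S T (B S T) c)"
  have B: "is_strip S T (B S T) c" if "(S, T) \<in> germs (- 1) v c" for S T
    unfolding B_def using strip_of_germ(2)[OF v that] by (auto intro: someI_ex)
  have "inj_on F (germs (- 1) v c)"
  proof (rule inj_onI)
    fix x y assume xy: "x \<in> germs (- 1) v c" "y \<in> germs (- 1) v c" "F x = F y"
    obtain S T S' T' where e: "x = (S, T)" "y = (S', T')" by (cases x, cases y)
    show "x = y" using strip_image_inj[OF B B, of S T S' T'] xy by (simp add: e F_def)
  qed
  moreover have eq: "{e \<in> reeb_edges \<S> D i. v \<in> endpoints D i e \<and>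
     (\<exists>w\<in>endpoints D i e. reeb_value i w < reeb_value i v)} = F ` germs (- 1) v c" (is "?L = _")
  proof (intro set_eqI iffI)
    fix e assume "e \<in> ?L"
    then obtain S T a b w where e: "is_strip S T a b" "e = q ` strip S T a b"
      "v \<in> {strip_vertex S a, strip_vertex S b}" "w \<in> {strip_vertex S a, strip_vertex S b}"
      "reeb_value i w < reeb_value i v"
      using endpoints_strip by (auto simp: reeb_edges_eq)
    have ab: "a < b" using strip_mid[OF e(1)] by simp
    have va: "reeb_value i (strip_vertex S a) = a" "reeb_value i (strip_vertex S b) = b"
      using strip_vertex_value[OF e(1)] by auto
    have "v = strip_vertex S b" using e(3-5) va ab by auto
    then have ac: "b = c" using va vertex_fibre_value[OF v] by simp
    have g: "(S, T) \<in> germs (- 1) v c" using germ_of_strip(2)[OF e(1) _ refl] \<open>v = strip_vertex S b\<close> ac by simp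
    have "B S T = a"
      using B[OF g] e(1) ac strip_mid[OF B[OF g]] is_strip_unique(1)[of S T "B S T" c a c "(c + max (B S T) a) / 2"] ab
      by (auto simp: max_def split: if_splits)
    then show "e \<in> F ` germs (- 1) v c" using g e(2) ac by (force simp: F_def)
  next
    fix e assume "e \<in> F ` germs (- 1) v c"
    then obtain S T where g: "(S, T) \<in> germs (- 1) v c" "e = q ` strip S T (B S T) c" by (auto simp: F_def)
    note s = B[OF g(1)]
    have "endpoints D i e = {strip_vertex S (B S T), v}"
      unfolding g(2) endpoints_strip[OF s] strip_of_germ(3)[OF v g(1)] by simp
    moreover have "reeb_value i (strip_vertex S (B S T)) < reeb_value i v"
      using vertex_fibre_value[OF v] strip_vertex_value[OF s, of "B S T"] strip_mid[OF s] by simp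
    moreover have "e \<in> reeb_edges \<S> D i" unfolding reeb_edges_eq using s g(2) by blast
    ultimately show "e \<in> ?L" by simp
  qed
  ultimately show "in_degree \<S> D i v = card (germs (- 1) v c)"
    unfolding in_degree_def by (simp add: card_image)
  show "finite ?L" unfolding eq using finite_germs by simp
qed

text \<open>The two ends of an edge have different values, so an edge at \<open>v\<close> either
  departs or enters, and never both.\<close>

lemma degree_eq:
  assumes v: "vertex_fibre v c lo hi"
  shows "reeb_degree \<S> D i v = out_degree \<S> D i v + in_degree \<S> D i v"
proof -
  let ?A = "{e \<in> reeb_edges \<S> D i. v \<in> endpoints D i e \<and> (\<exists>w\<in>endpoints D i e. reeb_value i v < reeb_value i w)}"
  let ?B = "{e \<in> reeb_edges \<S> D i. v \<in> endpoints D i e \<and> (\<exists>w\<in>endpoints D i e. reeb_value i w < reeb_value i v)}"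
  have ends: "\<exists>x y. endpoints D i e = {x, y} \<and> reeb_value i x < reeb_value i y" if e: "e \<in> reeb_edges \<S> D i" for e
  proof -
    obtain S T a b where s: "is_strip S T a b" "e = q ` strip S T a b" using e by (auto simp: reeb_edges_eq)
    have "reeb_value i (strip_vertex S a) < reeb_value i (strip_vertex S b)"
      using strip_vertex_value[OF s(1)] strip_mid[OF s(1)] by simp
    then show ?thesis using endpoints_strip[OF s(1)] s(2) by blast
  qed
  have "{e \<in> reeb_edges \<S> D i. v \<in> endpoints D i e} = ?A \<union> ?B"
  proof (intro set_eqI iffI)
    fix e assume e: "e \<in> {e \<in> reeb_edges \<S> D i. v \<in> endpoints D i e}"
    from e have e': "e \<in> reeb_edges \<S> D i" "v \<in> endpoints D i e" by simp_all
    obtain x y where xy: "endpoints D i e = {x, y}" "reeb_value i x < reeb_value i y"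
      using ends[OF e'(1)] by (elim exE conjE)
    have "v = x \<or> v = y" using xy(1) e'(2) by simp
    moreover have "x \<in> endpoints D i e" "y \<in> endpoints D i e" using xy(1) by simp_all
    ultimately have "(\<exists>w\<in>endpoints D i e. reeb_value i v < reeb_value i w) \<or>
        (\<exists>w\<in>endpoints D i e. reeb_value i w < reeb_value i v)" using xy(2) by metis
    then show "e \<in> ?A \<union> ?B" using e' by simp
  next
    fix e assume "e \<in> ?A \<union> ?B"
    then show "e \<in> {e \<in> reeb_edges \<S> D i. v \<in> endpoints D i e}" by (elim UnE; simp)
  qed
  moreover have "?A \<inter> ?B = {}"
  proof -
    have False if A: "e \<in> ?A" and B: "e \<in> ?B" for e
    proof -
      from A have e: "e \<in> reeb_edges \<S> D i" "v \<in> endpoints D i e" by simp_all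
      obtain x y where xy: "endpoints D i e = {x, y}" "reeb_value i x < reeb_value i y" using ends[OF e(1)] by (elim exE conjE)
      have "v = x \<or> v = y" using e(2) xy(1) by simp
      moreover have "reeb_value i v < reeb_value i x \<or> reeb_value i v < reeb_value i y"
        using A xy(1) by simp
      moreover have "reeb_value i x < reeb_value i v \<or> reeb_value i y < reeb_value i v"
        using B xy(1) by simp
      ultimately show False using xy(2) by auto
    qed
    then show ?thesis by (intro equals0I) (elim IntE)
  qed
  ultimately show ?thesis
    unfolding reeb_degree_def out_degree_def in_degree_def
    using card_Un_disjoint[OF out_degree_eq(2)[OF v] in_degree_eq(2)[OF v]] by simp
qed


lemma vertex_fibreD:
  assumes "vertex_fibre v c lo hi"
  shows "v \<in> V" "lo \<le> hi" "v = P c ` {lo..hi}" "\<And>w. w \<in> {lo..hi} \<Longrightarrow> P c w \<in> K"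
    "\<And>w. w \<in> {lo..hi} \<Longrightarrow> q (P c w) = P c ` {lo..hi}"
  using assms unfolding vertex_fibre_def by blast+

lemma vertex_fibre_maximal:
  assumes v: "vertex_fibre v c lo hi" and K: "\<And>w. w \<in> {l..u} \<Longrightarrow> P c w \<in> K"
    and "l \<le> hi" "lo \<le> u" "l \<le> u"
  shows "{l..u} \<subseteq> {lo..hi}"
proof -
  have "lo \<in> {lo..hi}" using vertex_fibreD(2)[OF v] by simp
  from fibre_maximal[OF vertex_fibreD(5)[OF v this] vertex_fibreD(2)[OF v] K] assms(3-5)
  show ?thesis by blast
qed

text \<open>Edges leaving through an interior point of a vertex fibre: just beside the fibre, the
  horizontal line through that point stays in one edge up to the next critical value.\<close>

lemma germ_exists:
  assumes v: "vertex_fibre v c lo hi" and w0: "w0 \<in> {lo..hi}" "P c w0 \<in> D" and s: "s = 1 \<or> s = - 1"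
  obtains S T where "(S, T) \<in> germs s v c" "lower S c < w0" "w0 < upper T c"
proof -
  obtain e where e: "e > 0" "ball (P c w0) e \<subseteq> D" using open_domain w0(2) open_contains_ball by blast
  obtain d where d: "d > 0" "\<And>f. f \<in> (\<lambda>x. x $ i) ` {x. crit x} \<Longrightarrow> f \<noteq> c \<Longrightarrow> d \<le> dist c f"
    using finite_set_avoid[OF finite_imageI[OF finite_crit, of "\<lambda>x. x $ i"], of c] by blast
  have d': "d \<le> \<bar>x $ i - c\<bar>" if "crit x" "x $ i \<noteq> c" for x
    using d(2)[of "x $ i"] that by (auto simp: dist_real_def abs_minus_commute)
  \<comment> \<open>\<open>e\<close> keeps the horizontal segment from \<open>w0\<close> in the open
    domain, \<open>d\<close> keeps it short of the next critical value.\<close>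
  define \<delta> where "\<delta> = min e d / 2"
  have \<delta>: "\<delta> > 0" "\<delta> < e" "\<delta> < d" using e(1) d(1) by (auto simp: \<delta>_def)
  have inD: "P (c + s * t) w0 \<in> D" if "0 \<le> t" "t \<le> \<delta>" for t
  proof -
    have "dist (P c w0) (P (c + s * t) w0) \<le> t" using dist_pt_le[of i c w0 "c + s * t" w0] s that by auto
    then show ?thesis using e(2) \<delta> that by auto
  qed
  have sd: "\<bar>c + s * t - c\<bar> = t" if "0 \<le> t" for t using s that by auto
  have "P (c + s * \<delta>) w0 \<in> K" using inD[of \<delta>] \<delta>(1) closure_subset[of D] by auto
  moreover have "\<not> crit y" if "y \<in> q (P (c + s * \<delta>) w0)" for y
  proof
    assume "crit y"
    moreover have "y $ i = c + s * \<delta>" using reeb_map_subset(2)[OF that] by simp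
    ultimately show False using d'[of y] \<delta> sd[of \<delta>] s by auto
  qed
  ultimately obtain S T where f: "fib S T (c + s * \<delta>)" "w0 \<in> {lower S (c + s * \<delta>)..upper T (c + s * \<delta>)}"
    using fibI by metis
  obtain a b where ab: "is_strip S T a b" "a < c + s * \<delta>" "c + s * \<delta> < b" using strip_exists[OF f(1)] .
  \<comment> \<open>An end of a strip lies over a critical value, and none except \<open>c\<close>
    is within \<delta>.\<close>
  have endp: "\<not> (\<bar>x - c\<bar> \<le> \<delta> \<and> x \<noteq> c)" if x: "x = a \<or> x = b" for x
  proof
    assume h: "\<bar>x - c\<bar> \<le> \<delta> \<and> x \<noteq> c"
    have "q (P x (lower S x)) \<in> V" "P x (lower S x) \<in> K" using strip_end(3,1)[OF ab(1) x] by auto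
    then obtain y where y: "crit y" "y \<in> q (P x (lower S x))" using vertex_iff by blast
    then have "y $ i = x" using reeb_map_subset(2) by fastforce
    then show False using d'[OF y(1)] h \<delta> by auto
  qed
  have inab: "c + s * t \<in> {a<..<b}" if t: "0 < t" "t \<le> \<delta>" for t
    using s
  proof
    assume s: "s = 1"
    show ?thesis using endp[of a] ab t s by (auto simp: abs_if split: if_splits)
  next
    assume s: "s = - 1"
    show ?thesis using endp[of b] ab t s by (auto simp: abs_if split: if_splits)
  qed
  have fib: "fib S T (c + s * t)" if "0 < t" "t \<le> \<delta>" for t using strip_fib[OF ab(1) inab[OF that]] .
  \<comment> \<open>The horizontal segment through \<open>w0\<close> lies in the domain, so no
    boundary curve can cross it; the intermediate value theorem then keeps the lower curve below
    \<open>w0\<close> and the upper curve above it all the way to \<open>c\<close>.\<close>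
  have off: "w0 \<noteq> ht \<tau> U (c + s * t)"
    if "0 \<le> t" "t \<le> \<delta>" "U \<in> \<S>" "\<bar>c + s * t - cx U\<bar> \<le> snd U" "\<tau> = 1 \<or> \<tau> = - 1" for t \<tau> U
    using inD[OF that(1,2)] ht_in_circ[OF that(3-5)] domain_off_circles[OF _ that(3)] by auto
  have ST: "S \<in> \<S>" "T \<in> \<S>" using strip_mid[OF ab(1)] by auto
  have cont: "continuous_on A (\<lambda>t. ht \<tau> U (c + s * t))" for A \<tau> U by (intro continuous_intros)
  have lowt: "lower S (c + s * t) \<le> w0" if t: "0 < t" "t \<le> \<delta>" for t
  proof (rule ccontr)
    assume "\<not> lower S (c + s * t) \<le> w0"
    then have "\<exists>x\<ge>t. x \<le> \<delta> \<and> lower S (c + s * x) = w0"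
      using f(2) t by (intro IVT2' cont) auto
    then obtain x where x: "t \<le> x" "x \<le> \<delta>" "lower S (c + s * x) = w0" by blast
    have "\<bar>c + s * x - cx S\<bar> \<le> snd S" using fib[of x] x t by (simp add: fib_def)
    then show False using off[of x S "- 1"] x t ST by auto
  qed
  have upt: "w0 \<le> upper T (c + s * t)" if t: "0 < t" "t \<le> \<delta>" for t
  proof (rule ccontr)
    assume "\<not> w0 \<le> upper T (c + s * t)"
    then have "\<exists>x\<ge>t. x \<le> \<delta> \<and> upper T (c + s * x) = w0"
      using f(2) t by (intro IVT' cont) auto
    then obtain x where x: "t \<le> x" "x \<le> \<delta>" "upper T (c + s * x) = w0" by blast
    have "\<bar>c + s * x - cx T\<bar> \<le> snd T" using fib[of x] x t by (simp add: fib_def)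
    then show False using off[of x T 1] x t ST by auto
  qed
  have ev: "\<forall>\<^sub>F t in at_right 0. 0 < t \<and> t < \<delta>" using eventually_right[OF \<delta>(1)] .
  have "\<forall>\<^sub>F t in at_right 0. lower S (c + s * t) \<le> w0" "\<forall>\<^sub>F t in at_right 0. w0 \<le> upper T (c + s * t)"
    using ev by (eventually_elim, use lowt upt in auto)+
  then have "lower S c \<le> w0" "w0 \<le> upper T c"
    using tendsto_upperbound[OF right_limit_ht[of "-1" S c s]] tendsto_lowerbound[OF right_limit_ht[of 1 T c s]]
    by auto
  moreover have cab: "c \<in> {a..b}"
  proof -
    have "((\<lambda>t. c + s * t) \<longlongrightarrow> c + s * 0) (at_right 0)" by (intro tendsto_intros)
    moreover have "\<forall>\<^sub>F t in at_right 0. c + s * t \<in> {a..b}"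
      using ev by eventually_elim (use inab in force)
    ultimately have "c + s * 0 \<in> {a..b}" by (intro Lim_in_closed_set[of "{a..b}" "\<lambda>t. c + s * t" "at_right 0"]) auto
    then show ?thesis by simp
  qed
  \<comment> \<open>Passing to the limit gives only weak inequalities; they are strict because
    \<open>P c w0\<close> itself lies on no circle.\<close>
  ultimately have lu: "w0 \<in> {lower S c..upper T c}" "lower S c \<noteq> w0" "upper T c \<noteq> w0"
    using off[of 0 S "- 1"] off[of 0 T 1] strip_closed(3,4)[OF ab(1) cab] \<delta>(1) ST by auto
  have "P c (lower S c) \<in> q (P c w0)"
    by (rule reeb_mapI[of "lower S c" "upper T c"]) (use strip_closed(2)[OF ab(1) cab] lu in auto)
  also have "q (P c w0) = v" using v w0(1) by (simp add: vertex_fibre_def)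
  finally have "(S, T) \<in> germs s v c"
    using ST fib \<delta>(1) by (auto simp: germs_def intro!: exI[of _ \<delta>])
  then show ?thesis using that lu by auto
qed

lemma germ_data:
  assumes v: "vertex_fibre v c lo hi" and g: "(S, T) \<in> germs s v c" and s: "s = 1 \<or> s = - 1"
  shows "S \<in> \<S>" "T \<in> \<S>" "lower S c \<le> upper T c" "lo \<le> lower S c" "upper T c \<le> hi"
    "S \<in> thru (P c (lower S c))" "T \<in> thru (P c (upper T c))"
proof -
  show ST: "S \<in> \<S>" "T \<in> \<S>" using g by (auto simp: germs_def)
  have "\<exists>a b. is_strip S T a b \<and> (c = a \<or> c = b)" using strip_of_germ(1,2)[OF v g] s by blast
  then obtain a b where ab: "is_strip S T a b" "c = a \<or> c = b" by blast
  then have cab: "c \<in> {a..b}" using strip_mid[OF ab(1)] by auto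
  note cl = strip_closed[OF ab(1) cab]
  show le: "lower S c \<le> upper T c" using cl(1) .
  show "S \<in> thru (P c (lower S c))" "T \<in> thru (P c (upper T c))"
    using ST cl(3,4) by (auto simp: thru_iff intro!: ht_in_circ)
  have "P c (lower S c) \<in> v" using g by (auto simp: germs_def)
  then have "lower S c \<in> {lo..hi}" using vertex_fibreD(3)[OF v] by simp
  then have "{lower S c..upper T c} \<subseteq> {lo..hi}"
    using le by (intro vertex_fibre_maximal[OF v]) (auto intro: cl(2))
  then show "lo \<le> lower S c" "upper T c \<le> hi" using le by auto
qed

text \<open>A common lower or upper limit identifies one of the two circles. The neighbouring fibres
  then share an end, so the other circle agrees as well.\<close>

lemma germ_eqI:
  assumes v: "vertex_fibre v c lo hi" and s: "s = 1 \<or> s = - 1"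
    and g: "(S, T) \<in> germs s v c" "(S', T') \<in> germs s v c"
    and eq: "lower S c = lower S' c \<or> upper T c = upper T' c"
  shows "S = S'" "T = T'"
proof -
  obtain \<delta>1 where 1: "\<delta>1 > 0" "\<And>t. t \<in> {0<..<\<delta>1} \<Longrightarrow> fib S T (c + s * t)" using g(1) unfolding germs_def by blast
  obtain \<delta>2 where 2: "\<delta>2 > 0" "\<And>t. t \<in> {0<..<\<delta>2} \<Longrightarrow> fib S' T' (c + s * t)" using g(2) unfolding germs_def by blast
  define \<delta> where "\<delta> = min \<delta>1 \<delta>2"
  have \<delta>: "\<delta> > 0" and f: "\<And>t. 0 < t \<Longrightarrow> t < \<delta> \<Longrightarrow> fib S T (c + s * t)"
    "\<And>t. 0 < t \<Longrightarrow> t < \<delta> \<Longrightarrow> fib S' T' (c + s * t)" using 1 2 by (auto simp: \<delta>_def)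
  note d1 = germ_data[OF v g(1) s] and d2 = germ_data[OF v g(2) s]
  have h: "0 < \<delta> / 2" "\<delta> / 2 < \<delta>" using \<delta> by auto
  note f1 = f(1)[OF h] and f2 = f(2)[OF h]
  have inl: "\<bar>c' - cx U\<bar> < snd U \<and> P c' (lower U c') \<in> K" if "fib U W c'" for U W c'
    using that fibD(4)[OF that] by (auto simp: fib_def)
  have inu: "\<bar>c' - cx W\<bar> < snd W \<and> P c' (upper W c') \<in> K" if "fib U W c'" for U W c'
    using that fibD(4)[OF that] by (auto simp: fib_def)
  have "S = S' \<and> T = T'"
    using eq
  proof
    assume e: "lower S c = lower S' c"
    have lK: "P c (lower S c) \<in> K" using vertex_fibreD(4)[OF v] d1 by auto
    have S: "S = S'"
      by (rule germ_unique[where \<tau> = "- 1", OF d1(1) d2(1) _ s lK refl e[symmetric] \<delta>])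
        (simp, erule (1) inl[OF f(1)], erule (1) inl[OF f(2)])
    then show ?thesis using fib_unique[OF f1 f2, of "lower S (c + s * (\<delta> / 2))"] f1 f2 by (auto simp: fib_def)
  next
    assume e: "upper T c = upper T' c"
    have uK: "P c (upper T c) \<in> K" using vertex_fibreD(4)[OF v] d1 by auto
    have S: "T = T'"
      by (rule germ_unique[where \<tau> = 1, OF d1(2) d2(2) _ s uK refl e[symmetric] \<delta>])
        (simp, erule (1) inu[OF f(1)], erule (1) inu[OF f(2)])
    then show ?thesis using fib_unique[OF f1 f2, of "upper T (c + s * (\<delta> / 2))"] f1 f2 by (auto simp: fib_def)
  qed
  then show "S = S'" "T = T'" by auto
qed

subsection \<open>Circle points on a vertex fibre\<close>

lemma gap_vertical: "S \<in> thru (P c w) \<Longrightarrow> gap S (P c (w + t)) = \<sigma> S * (t * (2 * (w - cy S) + t))"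
proof -
  assume "S \<in> thru (P c w)"
  then have "gap S (P c w) = 0" using circ_iff_gap[of S "P c w"] by (simp add: thru_iff)
  moreover have "gap S (P c (w + t)) = gap S (P c w) + \<sigma> S * (t * (2 * (w - cy S) + t))"
    by (simp add: gap_def algebra_simps power2_eq_square)
  ultimately show ?thesis by simp
qed

text \<open>The vertical gap \<open>\<sigma> S * (t * (2 * a + t))\<close> is nonpositive for small
  \<open>t\<close> of both signs. Its linear part must vanish, which makes the point a pole, and the
  remaining \<open>\<sigma> S * t\<^sup>2\<close> forces the domain outside.\<close>

lemma passing_point:
  assumes S: "S \<in> thru (P c w)" and e: "e > 0" "\<And>w'. \<bar>w' - w\<bar> < e \<Longrightarrow> P c w' \<in> K"
  shows "w = cy S" "\<sigma> S = - 1"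
proof -
  have K: "P c w \<in> K" using e by simp
  have S': "S \<in> \<S>" using S by (simp add: thru_iff)
  obtain r where r: "r > 0" "\<forall>y\<in>ball (P c w) r. y \<in> K \<longrightarrow> gap S y \<le> 0" using gap_nonpos[OF K S] by blast
  have g: "\<sigma> S * (t * (2 * (w - cy S) + t)) \<le> 0" if "\<bar>t\<bar> < min e r" for t
    using r(2) e(2)[of "w + t"] that gap_vertical[OF S, of t] by (auto simp: dist_pt_vertical)
  show w: "w = cy S"
  proof (rule ccontr)
    assume ne: "w \<noteq> cy S"
    define t where "t = min (min e r) \<bar>w - cy S\<bar> / 2"
    have t: "0 < t" "t < min e r" "t < \<bar>w - cy S\<bar>" using e(1) r(1) ne by (auto simp: t_def min_def)
    have "\<sigma> S * (t * (2 * (w - cy S) + t)) \<le> 0" "\<sigma> S * (- t * (2 * (w - cy S) + - t)) \<le> 0"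
      using g[of t] g[of "- t"] t by auto
    then show False using side[OF S'] t(1,3)
      by (auto simp: mult_le_0_iff zero_le_mult_iff abs_if split: if_splits)
  qed
  have t: "0 < min e r / 2" "\<bar>min e r / 2\<bar> < min e r" using e(1) r(1) by auto
  define t where "t = min e r / 2"
  have "\<sigma> S * (t * t) \<le> 0" using g[OF t(2)] w by (simp add: t_def)
  moreover have "t * t > 0" using t(1) by (simp add: t_def)
  ultimately show "\<sigma> S = - 1" using side[OF S'] by auto
qed

text \<open>Both circles through an inner double point would have a pole there, so their radius
  vectors would be horizontal and dependent.\<close>

lemma interior_cpoint:
  assumes v: "vertex_fibre v c lo hi" and w: "lo < w" "w < hi" "w \<in> cpoints c lo hi"
  obtains C where "thru (P c w) = {C}" "C \<in> \<S>" "w = cy C" "\<sigma> C = - 1" "\<bar>c - cx C\<bar> = snd C"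
proof -
  have K: "P c w \<in> K" using vertex_fibreD(4)[OF v] w by auto
  define e where "e = min (w - lo) (hi - w)"
  have e: "e > 0" "\<And>w'. \<bar>w' - w\<bar> < e \<Longrightarrow> P c w' \<in> K"
    using w by (auto simp: e_def intro!: vertex_fibreD(4)[OF v])
  note pp = passing_point[where w = w and c = c and e = e, OF _ e]
  have "\<exists>C. thru (P c w) = {C}"
    using K
  proof (cases rule: thru_cases)
    case 1
    then show ?thesis using w(3) by (simp add: cpoints_def)
  next
    case (3 S T)
    then have "cross i (P c w - fst S) (P c w - fst T) \<noteq> 0" using transversal[OF K, of S T] by auto
    then show ?thesis using pp(1)[of S] pp(1)[of T] 3 by (auto simp: cross_def)
  qed blast
  then obtain C where C: "thru (P c w) = {C}" by blast
  then have C': "C \<in> \<S>" "P c w \<in> circ C" using thru_iff by blast+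
  have w': "w = cy C" "\<sigma> C = - 1" using pp[of C] C by auto
  have "(c - cx C)\<^sup>2 = (snd C)\<^sup>2" using C'(2) w'(1) by (simp add: circ_iff[OF C'(1)])
  then have "\<bar>c - cx C\<bar> = snd C" using radius_pos[OF C'(1)] by (metis abs_of_pos power2_eq_iff_nonneg
    abs_ge_zero power2_abs less_imp_le)
  then show ?thesis using that C C' w' by blast
qed

lemma end_cpoints:
  assumes v: "vertex_fibre v c lo hi"
  shows "lo \<in> cpoints c lo hi" "hi \<in> cpoints c lo hi"
proof -
  note le = vertex_fibreD(2)[OF v]
  have "thru (P c lo) \<noteq> {}"
  proof
    assume "thru (P c lo) = {}"
    then have "P c lo \<in> D" using vertex_fibreD(4)[OF v, of lo] le by (simp add: domain_iff)
    then obtain e where e: "e > 0" "\<And>w'. \<bar>w' - lo\<bar> < e \<Longrightarrow> P c w' \<in> D" using domain_vertical by blast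
    have "{lo - e / 2..lo} \<subseteq> {lo..hi}"
      using e le closure_subset[of D] by (intro vertex_fibre_maximal[OF v]) (auto simp: subset_iff)
    then show False using e(1) by auto
  qed
  then show "lo \<in> cpoints c lo hi" using le by (simp add: cpoints_def)
  have "thru (P c hi) \<noteq> {}"
  proof
    assume "thru (P c hi) = {}"
    then have "P c hi \<in> D" using vertex_fibreD(4)[OF v, of hi] le by (simp add: domain_iff)
    then obtain e where e: "e > 0" "\<And>w'. \<bar>w' - hi\<bar> < e \<Longrightarrow> P c w' \<in> D" using domain_vertical by blast
    have "{hi..hi + e / 2} \<subseteq> {lo..hi}"
      using e le closure_subset[of D] by (intro vertex_fibre_maximal[OF v]) (auto simp: subset_iff)
    then show False using e(1) by auto
  qed
  then show "hi \<in> cpoints c lo hi" using le by (simp add: cpoints_def)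
qed

text \<open>The inner poles whose circle lies on the side \<open>s\<close> of the fibre. Such a
  disc, being outside the domain, separates the strips above and below the pole on that
  side.\<close>

definition sided :: "real \<Rightarrow> real \<Rightarrow> real \<Rightarrow> real \<Rightarrow> real set" where
  "sided s c lo hi = {w \<in> cpoints c lo hi. lo < w \<and> w < hi \<and> (\<exists>C\<in>thru (P c w). s * (cx C - c) > 0)}"

lemma finite_cpoints:
  assumes v: "vertex_fibre v c lo hi"
  shows "finite (cpoints c lo hi)"
proof (rule finite_subset)
  show "cpoints c lo hi \<subseteq> {lo, hi} \<union> (\<lambda>x. x $ oi) ` {x. crit x}"
  proof
    fix w assume w: "w \<in> cpoints c lo hi"
    then have lh: "w \<in> {lo..hi}" by (simp add: cpoints_def)
    show "w \<in> {lo, hi} \<union> (\<lambda>x. x $ oi) ` {x. crit x}"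
    proof (cases "w = lo \<or> w = hi")
      case False
      then have "lo < w" "w < hi" using lh by auto
      then obtain C where C: "thru (P c w) = {C}" "w = cy C" using interior_cpoint[OF v _ _ w] by metis
      then have "C \<in> \<S>" "P c w \<in> circ C" using thru_iff by blast+
      then have "crit (P c w)" using C(2) vertex_fibreD(4)[OF v lh] by (auto simp: crit_def)
      then show ?thesis by (intro UnI2 image_eqI[of _ _ "P c w"]) auto
    qed auto
  qed
qed (use finite_crit in simp)

section \<open>Counting the strips at a vertex by their lower ends\<close>

lemma near_above:
  assumes "finite A" "w < (hi::real)"
  obtains w0 where "w < w0" "w0 < hi" "\<And>a. a \<in> A \<Longrightarrow> w < a \<Longrightarrow> w0 < a"
proof -
  define m where "m = Min (insert hi {a \<in> A. w < a})"
  have fin: "finite (insert hi {a \<in> A. w < a})" using assms(1) by simp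
  have "w < m" unfolding m_def using fin assms(2) by (subst Min_gr_iff) auto
  moreover have "m \<le> hi" "\<And>a. a \<in> A \<Longrightarrow> w < a \<Longrightarrow> m \<le> a" unfolding m_def using fin by (auto intro!: Min_le)
  moreover define w0 where "w0 = (w + m) / 2"
  ultimately have w0: "w < w0" "w0 < m" "m \<le> hi" "\<And>a. a \<in> A \<Longrightarrow> w < a \<Longrightarrow> m \<le> a" by auto
  then have "w < w0" "w0 < hi" "\<And>a. a \<in> A \<Longrightarrow> w < a \<Longrightarrow> w0 < a"
    using less_le_trans[OF w0(2)] by blast+
  then show ?thesis using that by blast
qed

lemma near_below:
  assumes "finite A" "(lo::real) < w"
  obtains w0 where "lo < w0" "w0 < w" "\<And>a. a \<in> A \<Longrightarrow> a < w \<Longrightarrow> a < w0"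
proof -
  obtain u where u: "- w < u" "u < - lo" "\<And>a. a \<in> uminus ` A \<Longrightarrow> - w < a \<Longrightarrow> u < a"
    using near_above[of "uminus ` A" "- w" "- lo"] assms by auto
  show ?thesis using that[of "- u"] u by force
qed

text \<open>A lower curve starting at an inner pole needs its circle on side \<open>s\<close>.
  Conversely, the strip through a point slightly above \<open>lo\<close> or above such a pole,
  before the next circle point, cannot have its lower end beneath the pole, because the disc outside
  the domain is in the way.\<close>

lemma germ_lowers:
  assumes v: "vertex_fibre v c lo hi" and lt: "lo < hi" and s: "s = 1 \<or> s = - 1"
  shows "(\<lambda>(S, T). lower S c) ` germs s v c = insert lo (sided s c lo hi)"
proof (intro set_eqI iffI)
  fix w assume "w \<in> (\<lambda>(S, T). lower S c) ` germs s v c"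
  then obtain S T where g: "(S, T) \<in> germs s v c" "w = lower S c" by auto
  note d = germ_data[OF v g(1) s]
  have wW: "w \<in> cpoints c lo hi" using d g(2) by (auto simp: cpoints_def)
  show "w \<in> insert lo (sided s c lo hi)"
  proof (rule ccontr)
    assume n: "w \<notin> insert lo (sided s c lo hi)"
    then have low: "lo < w" using d(4) g(2) by auto
    show False
    proof (cases "w < hi")
      case True
      obtain C where C: "thru (P c w) = {C}" "C \<in> \<S>" "\<bar>c - cx C\<bar> = snd C"
        using interior_cpoint[OF v low True wW] by metis
      have "S = C" using d(6) C(1) g(2) by auto
      obtain \<delta> where \<delta>: "\<delta> > 0" "\<And>t. t \<in> {0<..<\<delta>} \<Longrightarrow> fib S T (c + s * t)"
        using g(1) unfolding germs_def by blast
      have "\<bar>c + s * (\<delta> / 2) - cx C\<bar> < snd C" using \<delta>(2)[of "\<delta> / 2"] \<delta>(1) \<open>S = C\<close> by (simp add: fib_def)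
      then have "s * (cx C - c) > 0" using C(3) s \<delta>(1) by (auto simp: abs_if split: if_splits)
      then show False using n wW low True C(1) by (auto simp: sided_def)
    next
      case False
      \<comment> \<open>A strip may not shrink to the top of the fibre: a point slightly below
        \<open>hi\<close> lies in a strip whose upper limit is also \<open>hi\<close>, and
        uniqueness identifies the two strips, whose lower limits differ.\<close>
      then have whi: "w = hi" "upper T c = hi" using d g(2) by auto
      obtain w0 where w0: "lo < w0" "w0 < hi" "\<And>a. a \<in> cpoints c lo hi \<Longrightarrow> a < hi \<Longrightarrow> a < w0"
        using near_below[OF finite_cpoints[OF v] lt] by blast
      have mem: "w0 \<in> {lo..hi}" using w0 by simp
      have "w0 \<notin> cpoints c lo hi" using w0 by blast
      then have w0D: "P c w0 \<in> D" using mem vertex_fibreD(4)[OF v mem] by (simp add: cpoints_def domain_iff)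
      obtain S' T' where g': "(S', T') \<in> germs s v c" "lower S' c < w0" "w0 < upper T' c"
        by (rule germ_exists[OF v mem w0D s])
      note d' = germ_data[OF v g'(1) s]
      have "upper T' c \<in> cpoints c lo hi" using d' by (auto simp: cpoints_def)
      then have "upper T' c = hi" using w0(3) g'(3) d'(5) by force
      then have "S = S'" using germ_eqI(1)[OF v s g(1) g'(1)] whi by simp
      then show False using g'(2) w0(2) whi g(2) by simp
    qed
  qed
next
  fix w assume w: "w \<in> insert lo (sided s c lo hi)"
  then have wl: "lo \<le> w" "w < hi" "w \<in> cpoints c lo hi"
    using lt end_cpoints[OF v] by (auto simp: sided_def)
  obtain w0 where w0: "w < w0" "w0 < hi" "\<And>a. a \<in> cpoints c lo hi \<Longrightarrow> w < a \<Longrightarrow> w0 < a"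
    using near_above[OF finite_cpoints[OF v] wl(2)] by blast
  have mem: "w0 \<in> {lo..hi}" using w0 wl by simp
  have "w0 \<notin> cpoints c lo hi" using w0 by blast
  then have w0D: "P c w0 \<in> D" using mem vertex_fibreD(4)[OF v mem] by (simp add: cpoints_def domain_iff)
  obtain S T where g: "(S, T) \<in> germs s v c" "lower S c < w0" "w0 < upper T c"
    by (rule germ_exists[OF v mem w0D s])
  note d = germ_data[OF v g(1) s]
  have "lower S c \<in> cpoints c lo hi" using d by (auto simp: cpoints_def)
  then have le: "lower S c \<le> w" using w0(3) g(2) by force
  have "lower S c = w"
  proof (rule ccontr)
    assume "lower S c \<noteq> w"
    then have lw: "lower S c < w" using le by simp
    then have "w \<in> sided s c lo hi" using w d(4) by auto
    \<comment> \<open>If the lower end were beneath the pole at height \<open>w\<close>, the strip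
      would contain a short horizontal segment at that height, which enters the disc of
      \<open>C\<close>.\<close>
    then obtain C where C: "C \<in> thru (P c w)" "s * (cx C - c) > 0" "lo < w" by (auto simp: sided_def)
    obtain C' where C': "thru (P c w) = {C'}" "w = cy C'" "\<sigma> C' = - 1" "\<bar>c - cx C'\<bar> = snd C'"
      using interior_cpoint[OF v C(3) wl(2,3)] by metis
    have CC: "C' = C" using C C' by auto
    have K: "P c w \<in> K" using vertex_fibreD(4)[OF v] wl by auto
    obtain r where r: "r > 0" "\<forall>y\<in>ball (P c w) r. y \<in> K \<longrightarrow> gap C y \<le> 0" using gap_nonpos[OF K C(1)] by blast
    obtain \<delta> where \<delta>: "\<delta> > 0" "\<And>t. t \<in> {0<..<\<delta>} \<Longrightarrow> fib S T (c + s * t)"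
      using g(1) unfolding germs_def by blast
    have "\<forall>\<^sub>F t in at_right 0. lower S (c + s * t) < w \<and> w < upper T (c + s * t) \<and> (0 < t \<and> t < \<delta>) \<and>
        (0 < t \<and> t < r) \<and> (0 < t \<and> t < snd C)"
    proof -
      have wu: "w < upper T c" using g(3) w0(1) by simp
      have rC: "snd C > 0" using radius_pos C(1) thru_iff by blast
      show ?thesis
        by (intro eventually_conj[OF order_tendstoD(2)[OF right_limit_ht lw]]
          eventually_conj[OF order_tendstoD(1)[OF right_limit_ht wu]]
          eventually_conj[OF eventually_right[OF \<delta>(1)]]
          eventually_conj[OF eventually_right[OF r(1)]] eventually_right[OF rC])
    qed
    then obtain t where t: "lower S (c + s * t) < w" "w < upper T (c + s * t)" "0 < t" "t < \<delta>" "t < r" "t < snd C"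
      using eventually_happens'[OF trivial_limit_at_right_real] by blast
    have "P (c + s * t) w \<in> K" using fibD(4)[OF \<delta>(2)[of t]] t by auto
    moreover have "P (c + s * t) w \<in> ball (P c w) r"
      using dist_pt_le[of i c w "c + s * t" w] t s by auto
    ultimately have "gap C (P (c + s * t) w) \<le> 0" using r(2) by blast
    then have "(c + s * t - cx C)\<^sup>2 \<ge> (snd C)\<^sup>2" using C' CC by (simp add: gap_def)
    then have "\<bar>c + s * t - cx C\<bar> \<ge> \<bar>snd C\<bar>" by (simp add: abs_le_square_iff)
    then show False using C(2) C'(4) CC s t by (auto simp: abs_if split: if_splits)
  qed
  then show "w \<in> (\<lambda>(S, T). lower S c) ` germs s v c" using g(1) by force
qed

lemma card_germs:
  assumes v: "vertex_fibre v c lo hi" and lt: "lo < hi" and s: "s = 1 \<or> s = - 1"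
  shows "card (germs s v c) = card (sided s c lo hi) + 1"
proof -
  have "inj_on (\<lambda>(S, T). lower S c) (germs s v c)"
  proof (rule inj_onI)
    fix x y assume xy: "x \<in> germs s v c" "y \<in> germs s v c" "(\<lambda>(S, T). lower S c) x = (\<lambda>(S, T). lower S c) y"
    obtain S T S' T' where e: "x = (S, T)" "y = (S', T')" by (cases x, cases y)
    show "x = y" using germ_eqI[OF v s, of S T S' T'] xy by (simp add: e)
  qed
  then have "card (germs s v c) = card (insert lo (sided s c lo hi))"
    using card_image germ_lowers[OF v lt s] by metis
  also have "\<dots> = card (sided s c lo hi) + 1"
    using finite_subset[OF _ finite_cpoints[OF v], of "sided s c lo hi"] by (auto simp: sided_def card_insert_if)
  finally show ?thesis .
qed

text \<open>Every inner circle point is a pole whose circle lies on exactly one side. The two ends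
  of the fibre account for the summand 1 on each side.\<close>

lemma card_cpoints:
  assumes v: "vertex_fibre v c lo hi" and lt: "lo < hi"
  shows "card (cpoints c lo hi) = card (germs 1 v c) + card (germs (- 1) v c)"
proof -
  let ?A = "sided 1 c lo hi" and ?B = "sided (- 1) c lo hi"
  have eq: "cpoints c lo hi = {lo, hi} \<union> (?A \<union> ?B)"
  proof (intro set_eqI iffI)
    fix w assume w: "w \<in> cpoints c lo hi"
    then have lh: "lo \<le> w" "w \<le> hi" by (auto simp: cpoints_def)
    show "w \<in> {lo, hi} \<union> (?A \<union> ?B)"
    proof (cases "w = lo \<or> w = hi")
      case False
      then have lw: "lo < w" "w < hi" using lh by auto
      then obtain C where C: "thru (P c w) = {C}" "C \<in> \<S>" "\<bar>c - cx C\<bar> = snd C"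
        using interior_cpoint[OF v _ _ w] by metis
      then have "cx C \<noteq> c" using radius_pos[OF C(2)] by auto
      then have "1 * (cx C - c) > 0 \<or> - 1 * (cx C - c) > 0" by auto
      then show ?thesis using w lw C(1) by (auto simp: sided_def)
    qed auto
  qed (use end_cpoints[OF v] in \<open>auto simp: sided_def\<close>)
  have dj: "?A \<inter> ?B = {}"
  proof -
    have False if A: "w \<in> ?A" and B: "w \<in> ?B" for w
    proof -
      from A have "lo < w" "w < hi" "w \<in> cpoints c lo hi" by (auto simp: sided_def)
      then obtain C where C: "thru (P c w) = {C}" using interior_cpoint[OF v] by metis
      then show False using A B by (simp add: sided_def)
    qed
    then show ?thesis by blast
  qed
  have fin: "finite ?A" "finite ?B"
    using finite_subset[OF _ finite_cpoints[OF v]] by (auto simp: sided_def)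
  have "{lo, hi} \<inter> (?A \<union> ?B) = {}" by (auto simp: sided_def)
  then have "card (cpoints c lo hi) = card {lo, hi} + card (?A \<union> ?B)"
    unfolding eq using fin by (intro card_Un_disjoint) auto
  also have "card (?A \<union> ?B) = card ?A + card ?B" using card_Un_disjoint[OF fin dj] .
  finally show ?thesis using lt card_germs[OF v lt, of 1] card_germs[OF v lt, of "- 1"] by simp
qed

end

section \<open>Corners\<close>

text \<open>The difference of both sides is orthogonal to the independent vectors \<open>n1\<close>
  and \<open>n2\<close>, hence zero: up to scaling, \<open>t1\<close> and \<open>t2\<close> form the
  basis dual to \<open>n2\<close> and \<open>n1\<close>.\<close>

lemma basis_expansion:
  fixes n1 n2 t1 t2 h :: "real^2"
  assumes cr: "cross i n1 n2 \<noteq> 0" and t: "n1 \<bullet> t1 = 0" "n2 \<bullet> t2 = 0"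
    and p: "n1 \<bullet> t2 \<noteq> 0" "n2 \<bullet> t1 \<noteq> 0"
  shows "h = ((n2 \<bullet> h) / (n2 \<bullet> t1)) *\<^sub>R t1 + ((n1 \<bullet> h) / (n1 \<bullet> t2)) *\<^sub>R t2"
proof -
  define d where "d = h - (((n2 \<bullet> h) / (n2 \<bullet> t1)) *\<^sub>R t1 + ((n1 \<bullet> h) / (n1 \<bullet> t2)) *\<^sub>R t2)"
  have "n1 \<bullet> d = 0" "n2 \<bullet> d = 0"
    using t p by (simp_all add: d_def inner_diff_right inner_add_right)
  then have "\<bar>cross i n1 n2\<bar> * norm d \<le> 0" using norm_le_of_cross[of i n1 n2 d] by simp
  then have "d = 0" using cr by (simp add: mult_le_0_iff)
  then show ?thesis by (simp add: d_def)
qed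

text \<open>The line orthogonal to \<open>n\<close> is spanned by \<open>t\<close>: after
  subtracting the component along \<open>t\<close>, what remains is orthogonal to both
  \<open>n\<close> and \<open>t\<close>.\<close>

lemma orthogonal_unit:
  fixes n t z :: "real^2"
  assumes n: "n \<noteq> 0" and t: "n \<bullet> t = 0" "norm t = 1" and z: "n \<bullet> z = 0"
  shows "z = (z \<bullet> t) *\<^sub>R t"
proof -
  define d where "d = z - (z \<bullet> t) *\<^sub>R t"
  have tt: "t \<bullet> t = 1" using t(2) by (simp add: norm_eq_1)
  have "n \<bullet> d = 0" "t \<bullet> d = 0" using t z tt by (simp_all add: d_def inner_diff_right inner_commute)
  then have "\<bar>cross 1 n t\<bar> * norm d \<le> 0" using norm_le_of_cross[of 1 n t d] by simp
  moreover have "cross 1 n t \<noteq> 0"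
  proof
    assume c: "cross 1 n t = 0"
    \<comment> \<open>Lagrange's identity: the squares of determinant and inner product add up to
      the product of the squared norms.\<close>
    have "(a * d - b * c)\<^sup>2 + (a * c + b * d)\<^sup>2 = (a * a + b * b) * (c * c + d * d)" for a b c d :: real
      by (simp add: power2_eq_square algebra_simps)
    from this[of "n $ 1" "t $ other_index 1" "n $ other_index 1" "t $ 1"]
    have "(cross 1 n t)\<^sup>2 + (n \<bullet> t)\<^sup>2 = (n \<bullet> n) * (t \<bullet> t)"
      by (simp only: cross_def inner_index[of _ _ 1])
    then show False using c t n tt by simp
  qed
  ultimately have "d = 0" by (simp add: mult_le_0_iff)
  then show ?thesis by (simp add: d_def)
qed

text \<open>A quarter turn of \<open>n1\<close>, with the sign taken from the determinant so that
  the result points to the positive side of \<open>n2\<close>.\<close>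

lemma exists_orthogonal_unit:
  fixes n1 n2 :: "real^2"
  assumes "cross i n1 n2 \<noteq> 0"
  obtains t where "norm t = 1" "n1 \<bullet> t = 0" "n2 \<bullet> t > 0"
proof -
  define r where "r = sgn (cross i n1 n2) *\<^sub>R pt i (- (n1 $ other_index i)) (n1 $ i)"
  have 1: "n1 \<bullet> r = 0" by (simp add: r_def inner_index[of _ _ i])
  have "n2 \<bullet> r = sgn (cross i n1 n2) * cross i n1 n2"
    by (simp add: r_def inner_index[of _ _ i] cross_def algebra_simps)
  also have "\<dots> > 0" using assms by (simp add: sgn_real_def)
  finally have 2: "n2 \<bullet> r > 0" .
  then have "r \<noteq> 0" by auto
  then show ?thesis using that[of "r /\<^sub>R norm r"] 1 2 by simp
qed

context circle_arrangement
begin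

text \<open>The normal pointing to the side of the domain.\<close>

definition nrm :: "circle \<Rightarrow> real^2 \<Rightarrow> real^2" where
  "nrm S x = (- 2 * \<sigma> S) *\<^sub>R (x - fst S)"

lemma gap_nrm: "S \<in> thru x \<Longrightarrow> gap S (x + h) = - (nrm S x \<bullet> h) + \<sigma> S * (norm h)\<^sup>2"
  using gap_add[of S x h] circ_iff_gap[of S x] by (simp add: thru_iff nrm_def algebra_simps)

lemma cross_nrm: "cross i (nrm S x) (nrm T x) = 4 * \<sigma> S * \<sigma> T * cross i (x - fst S) (x - fst T)"
  by (simp add: cross_def nrm_def algebra_simps)

lemma corner_cross:
  assumes "x \<in> K" "thru x = {S1, S2}" "S1 \<noteq> S2"
  shows "cross i (nrm S1 x) (nrm S2 x) \<noteq> 0"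
proof -
  have "S1 \<in> thru x" "S2 \<in> thru x" using assms(2) by auto
  moreover from this have "\<sigma> S1 \<noteq> 0" "\<sigma> S2 \<noteq> 0" using side_sq(2)[of S1] side_sq(2)[of S2] by (auto simp: thru_iff)
  ultimately show ?thesis using transversal[OF assms(1) _ _ assms(3)] by (simp add: cross_nrm)
qed

text \<open>The tangent vector \<open>t1\<close> of \<open>S1\<close> on the domain side of \<open>S2\<close> is a limit of directions \<open>u\<close>
  pointing into the domain, while \<open>- t1\<close> has an angle to it bounded away from 0.\<close>

lemma tangent_direction_corner:
  assumes x: "x \<in> K" "thru x = {S1, S2}" "S1 \<noteq> S2"
    and t1: "norm t1 = 1" "nrm S1 x \<bullet> t1 = 0" "nrm S2 x \<bullet> t1 > 0"
  shows "tangent_direction D x S1 t1"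
proof -
  define n1 where "n1 = nrm S1 x"
  define n2 where "n2 = nrm S2 x"
  define m where "m = n2 \<bullet> t1"
  have th: "S1 \<in> thru x" "S2 \<in> thru x" using x(2) by auto
  have cr: "cross i n1 n2 \<noteq> 0" using corner_cross[OF x] by (simp add: n1_def n2_def)
  have "cross i n2 n1 \<noteq> 0" using cr by (simp add: cross_def algebra_simps)
  then obtain t2 where t2: "norm t2 = 1" "n2 \<bullet> t2 = 0" "n1 \<bullet> t2 > 0" by (rule exists_orthogonal_unit)
  have t1': "n1 \<bullet> t1 = 0" "m > 0" using t1 by (auto simp: n1_def n2_def m_def)
  have n20: "norm n2 > 0" using t1'(2) by (auto simp: m_def)
  have n10: "n1 \<noteq> 0" using t2(3) by auto
  \<comment> \<open>For small \<open>s > 0\<close> these unit vectors tilt \<open>t1\<close>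
    slightly towards \<open>t2\<close> and so point strictly to the domain side of both
    circles.\<close>
  define u where "u s = (t1 + s *\<^sub>R t2) /\<^sub>R norm (t1 + s *\<^sub>R t2)" for s
  have "((\<lambda>s. u s) \<longlongrightarrow> (t1 + 0 *\<^sub>R t2) /\<^sub>R norm (t1 + 0 *\<^sub>R t2)) (at_right 0)"
    unfolding u_def using t1(1) by (intro tendsto_intros) auto
  then have "(u \<longlongrightarrow> t1) (at_right 0)" using t1(1) by simp
  \<comment> \<open>The bound \<open>m / (2 * norm n2)\<close> is, in units of \<epsilon>, the
    distance that the closure will be shown to keep from the opposite point
    \<open>x - \<epsilon> *\<^sub>R t1\<close>.\<close>
  then have "\<forall>\<^sub>F s in at_right 0. dist (u s) t1 < m / (2 * norm n2)"
    using t1'(2) n20 by (intro tendstoD) auto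
  then have "\<forall>\<^sub>F s in at_right 0. dist (u s) t1 < m / (2 * norm n2) \<and> 0 < s \<and> s < 1"
    by (rule eventually_conj[OF _ eventually_right]) simp
  then obtain s where s: "dist (u s) t1 < m / (2 * norm n2)" "0 < s"
    using eventually_happens'[OF trivial_limit_at_right_real] by blast
  define v where "v = u s"
  have "n2 \<bullet> (t1 + s *\<^sub>R t2) = m" using t2(2) by (simp add: inner_add_right m_def)
  then have nz: "norm (t1 + s *\<^sub>R t2) > 0" using t1'(2) by auto
  have v: "norm v = 1" "n1 \<bullet> v > 0" "n2 \<bullet> v > 0"
    unfolding v_def u_def using nz t1' t2 s(2) by (auto simp: inner_add_right m_def)
  obtain r where r: "r > 0" "\<forall>y\<in>ball x r. y \<in> K \<longleftrightarrow> (\<forall>S\<in>thru x. gap S y \<le> 0)"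
    using local_closure[OF x(1)] by blast
  \<comment> \<open>\<open>r\<close> keeps the small circle where the closure is known, the two
    inner products dominate the quadratic term of the gap along \<open>v\<close>, and
    \<open>m / 2\<close> absorbs the quadratic term in the separation from the opposite
    point.\<close>
  define \<epsilon>0 where "\<epsilon>0 = Min {r, n1 \<bullet> v, n2 \<bullet> v, m / 2}"
  have \<epsilon>0: "\<epsilon>0 > 0" using r(1) v t1'(2) by (simp add: \<epsilon>0_def)
  have main: "{y. tangent_endpoint D x \<epsilon> S1 y} = {x + \<epsilon> *\<^sub>R t1}" if \<epsilon>: "0 < \<epsilon>" "\<epsilon> < \<epsilon>0" for \<epsilon>
  proof -
    have \<epsilon>': "\<epsilon> < r" "\<epsilon> < n1 \<bullet> v" "\<epsilon> < n2 \<bullet> v" "\<epsilon> < m / 2" using \<epsilon> by (auto simp: \<epsilon>0_def)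
    define Y where "Y = K \<inter> sphere x \<epsilon>"
    have le: "\<sigma> S * a \<le> a" "\<sigma> S * a \<ge> - a" if "S \<in> thru x" "a \<ge> 0" for S a
      using side[of S] that by (auto simp: thru_iff)
    have vY: "x + \<epsilon> *\<^sub>R v \<in> Y"
    proof -
      have g: "gap S (x + \<epsilon> *\<^sub>R v) \<le> 0" if S: "S \<in> thru x" "\<epsilon> < nrm S x \<bullet> v" for S
      proof -
        have "gap S (x + \<epsilon> *\<^sub>R v) = - \<epsilon> * (nrm S x \<bullet> v) + \<sigma> S * \<epsilon>\<^sup>2"
          using gap_nrm[OF S(1), of "\<epsilon> *\<^sub>R v"] v(1) \<epsilon>(1) by simp
        also have "\<dots> \<le> - \<epsilon> * \<epsilon> + \<epsilon>\<^sup>2"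
          using S(2) \<epsilon>(1) le(1)[OF S(1), of "\<epsilon>\<^sup>2"] by (intro add_mono) auto
        finally show ?thesis by (simp add: power2_eq_square)
      qed
      have "x + \<epsilon> *\<^sub>R v \<in> ball x r" using \<epsilon>(1) \<epsilon>'(1) v(1) by (simp add: dist_norm)
      then have "x + \<epsilon> *\<^sub>R v \<in> K" using r(2) g[OF th(1)] g[OF th(2)] \<epsilon>'(2,3) x(2) by (auto simp: n1_def n2_def)
      then show ?thesis using \<epsilon>(1) v(1) by (simp add: Y_def dist_norm)
    qed
    have up: "infdist (x + \<epsilon> *\<^sub>R t1) Y < \<epsilon> * (m / (2 * norm n2))"
    proof -
      have "infdist (x + \<epsilon> *\<^sub>R t1) Y \<le> dist (x + \<epsilon> *\<^sub>R t1) (x + \<epsilon> *\<^sub>R v)" by (rule infdist_le[OF vY])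
      also have "\<dots> = \<epsilon> * dist v t1" using \<epsilon>(1) by (simp add: dist_norm norm_minus_commute flip: scaleR_diff_right)
      also have "\<dots> < \<epsilon> * (m / (2 * norm n2))"
        unfolding v_def by (rule mult_strict_left_mono[OF s(1) \<epsilon>(1)])
      finally show ?thesis .
    qed
    have down: "\<epsilon> * (m / (2 * norm n2)) \<le> infdist (x - \<epsilon> *\<^sub>R t1) Y"
    proof -
      have "\<epsilon> * (m / (2 * norm n2)) \<le> dist (x - \<epsilon> *\<^sub>R t1) y" if y: "y \<in> Y" for y
      proof -
        define h where "h = y - x"
        have h: "norm h = \<epsilon>" "y = x + h" using y by (auto simp: Y_def h_def dist_norm norm_minus_commute)
        have "y \<in> ball x r" "y \<in> K" using y \<epsilon>'(1) by (auto simp: Y_def)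
        then have "gap S2 y \<le> 0" using r(2) th by blast
        then have "n2 \<bullet> h \<ge> \<sigma> S2 * \<epsilon>\<^sup>2" using gap_nrm[OF th(2), of h] h by (simp add: n2_def)
        then have "n2 \<bullet> h \<ge> - \<epsilon>\<^sup>2" using le(2)[OF th(2), of "\<epsilon>\<^sup>2"] by simp
        \<comment> \<open>The functional \<open>n2\<close> is at least
          \<open>- \<epsilon>\<^sup>2\<close> on displacements within the closure, but only
          \<open>- \<epsilon> * m\<close> at the opposite point; the Cauchy-Schwarz inequality turns
          this difference into a distance.\<close>
        then have "n2 \<bullet> (h + \<epsilon> *\<^sub>R t1) \<ge> \<epsilon> * m - \<epsilon>\<^sup>2" by (simp add: inner_add_right m_def)
        moreover have "\<epsilon> * m - \<epsilon>\<^sup>2 \<ge> \<epsilon> * (m / 2)"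
          using mult_left_mono[of \<epsilon> "m / 2" \<epsilon>] \<epsilon>(1) \<epsilon>'(4) by (simp add: power2_eq_square)
        moreover have "n2 \<bullet> (h + \<epsilon> *\<^sub>R t1) \<le> norm n2 * norm (h + \<epsilon> *\<^sub>R t1)" by (rule norm_cauchy_schwarz)
        ultimately have "\<epsilon> * (m / 2) \<le> norm n2 * norm (h + \<epsilon> *\<^sub>R t1)" by linarith
        moreover have "dist (x - \<epsilon> *\<^sub>R t1) y = norm (h + \<epsilon> *\<^sub>R t1)"
          by (simp add: h(2) dist_norm) (metis add.commute minus_add_distrib norm_minus_cancel diff_conv_add_uminus)
        ultimately show ?thesis using n20 by (simp add: field_simps)
      qed
      moreover have "Y \<noteq> {}" using vY by blast
      ultimately show ?thesis by (auto simp: infdist_def intro!: cINF_greatest)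
    qed
    have pos: "\<epsilon> * (m / (2 * norm n2)) > 0" using \<epsilon>(1) t1'(2) n20 by simp
    have ts: "z \<in> tangent_space S1 x \<longleftrightarrow> n1 \<bullet> z = 0" for z
      using th(1) side_sq(2)[of S1] by (simp add: tangent_space_def n1_def nrm_def thru_iff inner_commute)
    have two: "2 *\<^sub>R x - (x + z) = x - z" "2 *\<^sub>R x - (x - z) = x + z" for z :: "real^2"
      by (simp_all add: scaleR_2)
    show ?thesis
    proof (intro set_eqI iffI)
      fix y assume "y \<in> {y. tangent_endpoint D x \<epsilon> S1 y}"
      then have y: "y \<in> sphere x \<epsilon>" "y - x \<in> tangent_space S1 x"
        "y \<in> Y \<or> infdist y Y < infdist (2 *\<^sub>R x - y) Y"
        by (auto simp: tangent_endpoint_def Y_def)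
      define a where "a = (y - x) \<bullet> t1"
      have e: "y - x = a *\<^sub>R t1" unfolding a_def using orthogonal_unit[OF n10 t1'(1) t1(1)] y(2) ts by blast
      have "norm (y - x) = \<epsilon>" using y(1) by (simp add: dist_norm norm_minus_commute)
      then have "\<bar>a\<bar> = \<epsilon>" unfolding e using t1(1) by simp
      then consider "a = \<epsilon>" | "a = - \<epsilon>" by linarith
      then show "y \<in> {x + \<epsilon> *\<^sub>R t1}"
      proof cases
        case 1
        then show ?thesis using e by (simp add: algebra_simps)
      next
        case 2
        then have yx: "y = x - \<epsilon> *\<^sub>R t1" using e by (simp add: algebra_simps)
        have "y \<notin> Y"
        proof
          assume "y \<in> Y"
          then have "infdist y Y = 0" by simp
          then show False using down pos yx by simp
        qed
        then show ?thesis using y(3) down up unfolding yx two by linarith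
      qed
    next
      fix y assume "y \<in> {x + \<epsilon> *\<^sub>R t1}"
      then have y: "y = x + \<epsilon> *\<^sub>R t1" by simp
      have "infdist y Y < infdist (2 *\<^sub>R x - y) Y" unfolding y two using up down by linarith
      moreover have "y \<in> sphere x \<epsilon>" "y - x \<in> tangent_space S1 x"
        using \<epsilon>(1) t1(1) t1'(1) ts by (simp_all add: y dist_norm)
      ultimately show "y \<in> {y. tangent_endpoint D x \<epsilon> S1 y}"
        by (simp add: tangent_endpoint_def Y_def)
    qed
  qed
  have "\<forall>\<^sub>F \<epsilon> in at_right 0. {y. tangent_endpoint D x \<epsilon> S1 y} = {x + \<epsilon> *\<^sub>R t1}"
    using eventually_right[OF \<epsilon>0] by eventually_elim (use main in blast)
  then show ?thesis using t1(1) by (simp add: tangent_direction_def)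
qed

text \<open>For a corner \<open>(c, w)\<close> the sign of \<open>cy S - w\<close> times \<open>\<sigma> S\<close> tells on which side of \<open>S\<close>, vertically, the
  domain lies; it vanishes at the poles.\<close>

lemma nrm_vertical: "nrm S (P c w) $ oi = 2 * \<sigma> S * (cy S - w)" "nrm S (P c w) $ i = 2 * \<sigma> S * (cx S - c)"
  by (simp_all add: nrm_def algebra_simps)

text \<open>Each tangent vector is taken on the domain side of the other circle, so the factors
  \<open>p1\<close> and \<open>p2\<close>, the inner products of the normals with the opposite
  tangent vectors, are positive. The expansion in this basis, applied to the vertical unit vector,
  relates the signs of \<open>t1 $ i\<close> and \<open>t2 $ i\<close> to the vertical parts of the
  normals.\<close>

lemma corner_data:
  assumes x: "P c w \<in> K" "thru (P c w) = {S1, S2}" "S1 \<noteq> S2"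
  obtains t1 t2 p1 p2 where "tangent_direction D (P c w) S1 t1" "tangent_direction D (P c w) S2 t2"
    "p1 > 0" "p2 > 0"
    "\<forall>h. h $ i = (nrm S2 (P c w) \<bullet> h) / p2 * t1 $ i + (nrm S1 (P c w) \<bullet> h) / p1 * t2 $ i"
    "nrm S1 (P c w) $ oi = 0 \<longleftrightarrow> t1 $ i = 0" "nrm S2 (P c w) $ oi = 0 \<longleftrightarrow> t2 $ i = 0"
    "(t1 $ i, t2 $ i) \<noteq> (0, 0)"
    "t1 $ i = 0 \<longrightarrow> nrm S1 (P c w) $ i * t2 $ i > 0" "t2 $ i = 0 \<longrightarrow> nrm S2 (P c w) $ i * t1 $ i > 0"
proof -
  let ?x = "P c w"
  define n1 where "n1 = nrm S1 ?x"
  define n2 where "n2 = nrm S2 ?x"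
  have cr: "cross i n1 n2 \<noteq> 0" using corner_cross[OF x] by (simp add: n1_def n2_def)
  then have cr': "cross i n2 n1 \<noteq> 0" by (simp add: cross_def algebra_simps)
  obtain t1 where t1: "norm t1 = 1" "n1 \<bullet> t1 = 0" "n2 \<bullet> t1 > 0" using exists_orthogonal_unit[OF cr] .
  obtain t2 where t2: "norm t2 = 1" "n2 \<bullet> t2 = 0" "n1 \<bullet> t2 > 0" using exists_orthogonal_unit[OF cr'] .
  have d1: "tangent_direction D ?x S1 t1"
    by (rule tangent_direction_corner[OF x t1(1)]) (use t1 in \<open>auto simp: n1_def n2_def\<close>)
  have x': "thru ?x = {S2, S1}" "S2 \<noteq> S1" using x by auto
  have d2: "tangent_direction D ?x S2 t2"
    by (rule tangent_direction_corner[OF x(1) x' t2(1)]) (use t2 in \<open>auto simp: n1_def n2_def\<close>)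
  have ex: "h = ((n2 \<bullet> h) / (n2 \<bullet> t1)) *\<^sub>R t1 + ((n1 \<bullet> h) / (n1 \<bullet> t2)) *\<^sub>R t2" for h
    using basis_expansion[OF cr t1(2) t2(2)] t1(3) t2(3) by auto
  have exi: "h $ i = (n2 \<bullet> h) / (n2 \<bullet> t1) * t1 $ i + (n1 \<bullet> h) / (n1 \<bullet> t2) * t2 $ i" for h
    using arg_cong[OF ex[of h], of "\<lambda>z. z $ i"] by simp
  have exo: "h $ oi = (n2 \<bullet> h) / (n2 \<bullet> t1) * t1 $ oi + (n1 \<bullet> h) / (n1 \<bullet> t2) * t2 $ oi" for h
    using arg_cong[OF ex[of h], of "\<lambda>z. z $ oi"] by simp
  have up: "n \<bullet> P 0 1 = n $ oi" for n by (simp add: inner_index[of _ _ i])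
  have z1: "n1 $ oi = 0 \<longleftrightarrow> t1 $ i = 0"
  proof
    assume "n1 $ oi = 0"
    then show "t1 $ i = 0" using exi[of "P 0 1"] cr t1(3) unfolding up by (auto simp: cross_def)
  next
    assume z: "t1 $ i = 0"
    then have "t1 $ oi \<noteq> 0" using t1(3) inner_index[of n2 t1 i] by auto
    then show "n1 $ oi = 0" using t1(2) z by (simp add: inner_index[of _ _ i])
  qed
  have z2: "n2 $ oi = 0 \<longleftrightarrow> t2 $ i = 0"
  proof
    assume "n2 $ oi = 0"
    then show "t2 $ i = 0" using exi[of "P 0 1"] cr t2(3) unfolding up by (auto simp: cross_def)
  next
    assume z: "t2 $ i = 0"
    then have "t2 $ oi \<noteq> 0" using t2(3) inner_index[of n1 t2 i] by auto
    then show "n2 $ oi = 0" using t2(2) z by (simp add: inner_index[of _ _ i])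
  qed
  have nz: "(t1 $ i, t2 $ i) \<noteq> (0, 0)" using z1 z2 cr by (auto simp: cross_def)
  have q1: "n1 $ i * t2 $ i > 0" if "t1 $ i = 0"
    using t2(3) z1 that by (simp add: inner_index[of _ _ i])
  have q2: "n2 $ i * t1 $ i > 0" if "t2 $ i = 0"
    using t1(3) z2 that by (simp add: inner_index[of _ _ i])
  show ?thesis
    by (rule that[OF d1 d2 t2(3)[unfolded n1_def] t1(3)[unfolded n2_def]
        allI[OF exi[unfolded n1_def n2_def]] z1[unfolded n1_def] z2[unfolded n2_def] nz
        impI[OF q1[unfolded n1_def]] impI[OF q2[unfolded n2_def]]])
qed

definition point_arcs :: "real^2 \<Rightarrow> (real^2) set set" where
  "point_arcs x = (\<Union>S\<in>thru x. arcs_at S x)"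

lemma pole_arcs:
  assumes S: "S \<in> thru (P c w)" and w: "w = cy S"
  shows "c < cx S \<Longrightarrow> arcs_at S (P c w) = min_arcs i S" "c > cx S \<Longrightarrow> arcs_at S (P c w) = max_arcs i S"
    "\<exists>j\<in>pole_indices i. P c w = pole S j" "c \<noteq> cx S" "\<bar>c - cx S\<bar> = snd S"
proof -
  have S': "S \<in> \<S>" "P c w \<in> circ S" using S by (auto simp: thru_iff)
  note p = arcs_at_pole[OF radius_pos[OF S'(1)] S'(2), of i]
  show "c < cx S \<Longrightarrow> arcs_at S (P c w) = min_arcs i S" "c > cx S \<Longrightarrow> arcs_at S (P c w) = max_arcs i S"
    "\<exists>j\<in>pole_indices i. P c w = pole S j" "c \<noteq> cx S" using p w by simp_all
  have "(c - cx S)\<^sup>2 = (snd S)\<^sup>2" using S'(2) w by (simp add: circ_iff[OF S'(1)])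
  then have "c - cx S = snd S \<or> c - cx S = - snd S" by (auto simp: power2_eq_iff)
  then show "\<bar>c - cx S\<bar> = snd S" using radius_pos[OF S'(1)] by auto
qed

lemma nonpole_half:
  assumes S: "S \<in> thru (P c w)" and w: "w \<noteq> cy S"
  shows "P c w \<in> strict_half i (w > cy S) S"
  using assms by (auto simp: strict_half_def thru_iff)

lemma nonpole_arcs:
  assumes S: "S \<in> thru (P c w)" and w: "w \<noteq> cy S"
  shows "one_or_two_arcs i S (P c w) (arcs_at S (P c w))" "arc_rule i S (arcs_at S (P c w))"
    "arcs_at S (P c w) \<subseteq> arc8 S ` half_indices i (w > cy S)"
proof -
  have r: "snd S > 0" using S radius_pos by (simp add: thru_iff)
  note h = nonpole_half[OF assms]
  show "one_or_two_arcs i S (P c w) (arcs_at S (P c w))" using one_or_two_arcs_half[OF r h] .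
  show "arc_rule i S (arcs_at S (P c w))"
    unfolding arcs_at_eq_arcs_meeting by (rule arc_rule_half(1)[OF r]) (use h in auto)
  show "arcs_at S (P c w) \<subseteq> arc8 S ` half_indices i (w > cy S)"
    unfolding arcs_at_eq_arcs_meeting by (rule arcs_meeting_subset_half[OF r]) (use h in auto)
qed

section \<open>Vertical extension of the domain from a circle point\<close>

definition vertical :: "real \<Rightarrow> real \<Rightarrow> real \<Rightarrow> bool" where
  "vertical \<tau> c w \<longleftrightarrow> (\<exists>e>0. \<forall>t. 0 \<le> t \<and> t < e \<longrightarrow> P c (w + \<tau> * t) \<in> K)"

text \<open>At vertical distance \<open>t\<close> the gap is \<open>t * (\<sigma> S * t - A)\<close>
  with \<open>A\<close> the vertical part of the normal in direction \<tau>. For small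
  \<open>t\<close> the sign is decided by \<open>A\<close>, and by the side of the circle when
  \<open>A\<close> vanishes at a pole.\<close>

lemma vertical_iff:
  assumes K: "P c w \<in> K" and \<tau>: "\<tau> = 1 \<or> \<tau> = - 1"
  shows "vertical \<tau> c w \<longleftrightarrow> (\<forall>S\<in>thru (P c w). \<tau> * nrm S (P c w) $ oi > 0 \<or>
     nrm S (P c w) $ oi = 0 \<and> \<sigma> S = - 1)"
proof -
  let ?x = "P c w"
  let ?A = "\<lambda>S. \<tau> * nrm S ?x $ oi"
  obtain r where r: "r > 0" "\<forall>y\<in>ball ?x r. y \<in> K \<longleftrightarrow> (\<forall>S\<in>thru ?x. gap S y \<le> 0)"
    using local_closure[OF K] by blast
  have g: "gap S (P c (w + \<tau> * t)) = t * (\<sigma> S * t - ?A S)" if "S \<in> thru ?x" for S t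
    using gap_vertical[OF that, of "\<tau> * t"] \<tau> by (auto simp: nrm_vertical algebra_simps)
  have inK: "P c (w + \<tau> * t) \<in> K \<longleftrightarrow> (\<forall>S\<in>thru ?x. \<sigma> S * t \<le> ?A S)" if t: "0 < t" "t < r" for t
  proof -
    have "P c (w + \<tau> * t) \<in> ball ?x r" using t \<tau> by (auto simp: dist_pt_vertical)
    then have "P c (w + \<tau> * t) \<in> K \<longleftrightarrow> (\<forall>S\<in>thru ?x. gap S (P c (w + \<tau> * t)) \<le> 0)" using r(2) by blast
    also have "\<dots> \<longleftrightarrow> (\<forall>S\<in>thru ?x. \<sigma> S * t \<le> ?A S)"
      using t by (auto simp: g mult_le_0_iff)
    finally show ?thesis .
  qed
  have A0: "?A S = 0 \<longleftrightarrow> nrm S ?x $ oi = 0" for S using \<tau> by auto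
  have sg: "\<sigma> S = 1 \<or> \<sigma> S = - 1" if "S \<in> thru ?x" for S using side[of S] that by (simp add: thru_iff)
  show ?thesis
  proof
    assume "vertical \<tau> c w"
    then obtain e where e: "e > 0" "\<And>t. 0 \<le> t \<Longrightarrow> t < e \<Longrightarrow> P c (w + \<tau> * t) \<in> K" by (auto simp: vertical_def)
    show "\<forall>S\<in>thru ?x. ?A S > 0 \<or> nrm S ?x $ oi = 0 \<and> \<sigma> S = - 1"
    proof (rule ballI, rule ccontr)
      fix S assume S: "S \<in> thru ?x" "\<not> (?A S > 0 \<or> nrm S ?x $ oi = 0 \<and> \<sigma> S = - 1)"
      \<comment> \<open>The extra bound makes \<open>\<sigma> S * t > A\<close> for either sign of
        \<open>\<sigma> S\<close> when \<open>A\<close> is negative.\<close>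
      have "\<exists>t>0. t < e \<and> t < r \<and> (a \<noteq> 0 \<longrightarrow> t < - a)" if "a \<le> 0" for a
      proof (cases "a = 0")
        case True
        then show ?thesis using field_lbound_gt_zero[OF e(1) r(1)] by auto
      next
        case False
        then have "- a > 0" using that by simp
        moreover obtain t' where "t' > 0" "t' < e" "t' < r" using field_lbound_gt_zero[OF e(1) r(1)] by auto
        ultimately obtain t where "t > 0" "t < t'" "t < - a" using field_lbound_gt_zero by blast
        then show ?thesis using \<open>t' < e\<close> \<open>t' < r\<close> by (intro exI[of _ t]) auto
      qed
      moreover have "?A S \<le> 0" using S by simp
      ultimately obtain t where t: "0 < t" "t < e" "t < r" "?A S \<noteq> 0 \<longrightarrow> t < - ?A S" by blast
      have "\<sigma> S * t \<le> ?A S" using inK[OF t(1,3)] e(2)[of t] t S(1) by auto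
      then show False using sg[OF S(1)] t(1,4) S(2) A0[of S] by (cases "?A S = 0") auto
    qed
  next
    assume all: "\<forall>S\<in>thru ?x. ?A S > 0 \<or> nrm S ?x $ oi = 0 \<and> \<sigma> S = - 1"
    define e where "e = Min (insert r (?A ` {S \<in> thru ?x. ?A S > 0}))"
    have fin: "finite (insert r (?A ` {S \<in> thru ?x. ?A S > 0}))" by simp
    have e: "e > 0" "e \<le> r" "\<And>S. S \<in> thru ?x \<Longrightarrow> ?A S > 0 \<Longrightarrow> e \<le> ?A S"
      unfolding e_def using fin r(1) by (auto simp: Min_gr_iff intro!: Min_le)
    have "P c (w + \<tau> * t) \<in> K" if t: "0 \<le> t" "t < e" for t
    proof (cases "t = 0")
      case False
      then have t': "0 < t" "t < r" using t e by auto
      have "\<sigma> S * t \<le> ?A S" if S: "S \<in> thru ?x" for S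
        using bspec[OF all S]
      proof
        assume "?A S > 0"
        then show ?thesis using e(3)[OF S] t sg[OF S] by auto
      next
        assume h: "nrm S ?x $ oi = 0 \<and> \<sigma> S = - 1"
        then show ?thesis using A0[of S] t by simp
      qed
      then show ?thesis using inK[OF t'] by blast
    qed (use K in simp)
    then show "vertical \<tau> c w" using e(1) by (auto simp: vertical_def)
  qed
qed

lemma nrm_zero_iff: "S \<in> thru (P c w) \<Longrightarrow> nrm S (P c w) $ oi = 0 \<longleftrightarrow> w = cy S"
  using side_sq(2)[of S] by (auto simp: nrm_vertical thru_iff)

text \<open>The two cases of a corner: the domain extends vertically to exactly one side, or to none.\<close>

lemma corner_end_vertical:
  assumes x: "P c w \<in> K" "card (thru (P c w)) = 2" and \<tau>: "\<tau> = 1 \<or> \<tau> = - 1"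
    and vt: "vertical \<tau> c w"
  shows "corner_end \<S> D i (P c w) (point_arcs (P c w))"
proof -
  let ?x = "P c w"
  have "\<exists>t1 t2. tangent_direction D ?x S1 t1 \<and> tangent_direction D ?x S2 t2 \<and>
          t1 $ i * t2 $ i \<le> 0 \<and> (t1 $ i, t2 $ i) \<noteq> (0, 0) \<and>
          (t1 $ i * t2 $ i < 0 \<longrightarrow>
             (\<exists>\<F>1 \<F>2. point_arcs ?x = \<F>1 \<union> \<F>2 \<and> one_or_two_arcs i S1 ?x \<F>1 \<and> one_or_two_arcs i S2 ?x \<F>2)) \<and>
          (t2 $ i = 0 \<longrightarrow>
             (\<exists>\<F>1. one_or_two_arcs i S1 ?x \<F>1 \<and>
                point_arcs ?x = \<F>1 \<union> (if t1 $ i > 0 then max_arcs i S2 else min_arcs i S2)))"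
    if S: "thru ?x = {S1, S2}" for S1 S2
  proof -
    have ne: "S1 \<noteq> S2" using x(2) S by auto
    have th: "S1 \<in> thru ?x" "S2 \<in> thru ?x" using S by auto
    obtain t1 t2 p1 p2 where t: "tangent_direction D ?x S1 t1" "tangent_direction D ?x S2 t2"
      "p1 > 0" "p2 > 0"
      "\<forall>h. h $ i = (nrm S2 ?x \<bullet> h) / p2 * t1 $ i + (nrm S1 ?x \<bullet> h) / p1 * t2 $ i"
      "nrm S1 ?x $ oi = 0 \<longleftrightarrow> t1 $ i = 0" "nrm S2 ?x $ oi = 0 \<longleftrightarrow> t2 $ i = 0"
      "(t1 $ i, t2 $ i) \<noteq> (0, 0)"
      "t1 $ i = 0 \<longrightarrow> nrm S1 ?x $ i * t2 $ i > 0" "t2 $ i = 0 \<longrightarrow> nrm S2 ?x $ i * t1 $ i > 0"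
      by (rule corner_data[OF x(1) S ne])
    define A1 where "A1 = nrm S1 ?x $ oi"
    define A2 where "A2 = nrm S2 ?x $ oi"
    have A: "\<tau> * A1 > 0 \<or> A1 = 0 \<and> \<sigma> S1 = - 1" "\<tau> * A2 > 0 \<or> A2 = 0 \<and> \<sigma> S2 = - 1"
      using vt th unfolding vertical_iff[OF x(1) \<tau>] A1_def A2_def by auto
    \<comment> \<open>The expansion of the vertical unit vector: its \<open>i\<close>-th coordinate
      is 0 and its inner products with the normals are \<open>A1\<close> and
      \<open>A2\<close>.\<close>
    have E: "A2 / p2 * t1 $ i + A1 / p1 * t2 $ i = 0"
      using t(5)[rule_format, of "P 0 1"] by (simp add: inner_index[of _ _ i] A1_def A2_def)
    have le: "t1 $ i * t2 $ i \<le> 0"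
    proof (cases "A1 = 0 \<or> A2 = 0")
      case True
      then show ?thesis using t(6,7) by (auto simp: A1_def A2_def)
    next
      case False
      then have pos: "\<tau> * A1 > 0" "\<tau> * A2 > 0" using A by auto
      \<comment> \<open>Multiplying the relation by \<open>\<tau> * t2 $ i\<close> leaves a
        nonpositive square term, and \<open>\<tau> * A2 / p2\<close> is positive.\<close>
      have "(\<tau> * A2 / p2) * (t1 $ i * t2 $ i) = - (\<tau> * A1 / p1) * (t2 $ i)\<^sup>2"
      proof -
        have "A2 / p2 * t1 $ i = - (A1 / p1 * t2 $ i)" using E by linarith
        then have "\<tau> * t2 $ i * (A2 / p2 * t1 $ i) = \<tau> * t2 $ i * (- (A1 / p1 * t2 $ i))" by simp
        then show ?thesis by (simp add: power2_eq_square mult_ac)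
      qed
      also have "\<dots> \<le> 0" using pos t(3) by (simp add: divide_nonneg_pos mult_nonneg_nonneg)
      finally show ?thesis using pos t(4) by (metis divide_pos_pos mult_le_0_iff not_less)
    qed
    have pa: "point_arcs ?x = arcs_at S1 ?x \<union> arcs_at S2 ?x" by (auto simp: point_arcs_def S)
    have arcs: "one_or_two_arcs i S1 ?x (arcs_at S1 ?x)" if "t1 $ i \<noteq> 0"
      using nonpole_arcs(1)[OF th(1)] nrm_zero_iff[OF th(1)] t(6) that by blast
    have arcs2: "one_or_two_arcs i S2 ?x (arcs_at S2 ?x)" if "t2 $ i \<noteq> 0"
      using nonpole_arcs(1)[OF th(2)] nrm_zero_iff[OF th(2)] t(7) that by blast
    \<comment> \<open>Here the normal of \<open>S2\<close> is horizontal and \<open>t1\<close>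
      points to its positive side. Since the domain is outside \<open>S2\<close>, the centre lies
      opposite to \<open>t1\<close>.\<close>
    have pole: "arcs_at S2 ?x = (if t1 $ i > 0 then max_arcs i S2 else min_arcs i S2)" if z: "t2 $ i = 0"
    proof -
      have "A2 = 0" using t(7) z by (simp add: A2_def)
      then have "w = cy S2" "\<sigma> S2 = - 1" using nrm_zero_iff[OF th(2)] A(2) by (auto simp: A2_def)
      note wS = this
      have "nrm S2 ?x $ i * t1 $ i > 0" using t(10) z by blast
      then have "2 * ((\<sigma> S2 * (cx S2 - c)) * t1 $ i) > 0" by (simp only: nrm_vertical mult.assoc)
      then have "(\<sigma> S2 * (cx S2 - c)) * t1 $ i > 0" by (rule zero_less_mult_pos) simp
      then consider "\<sigma> S2 * (cx S2 - c) > 0" "t1 $ i > 0" | "\<sigma> S2 * (cx S2 - c) < 0" "t1 $ i < 0"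
        unfolding zero_less_mult_iff by blast
      then show ?thesis using pole_arcs(1,2)[OF th(2) wS(1)] wS(2) by cases simp_all
    qed
    have "\<exists>\<F>1 \<F>2. point_arcs ?x = \<F>1 \<union> \<F>2 \<and> one_or_two_arcs i S1 ?x \<F>1 \<and> one_or_two_arcs i S2 ?x \<F>2"
      if "t1 $ i * t2 $ i < 0"
    proof -
      have "t1 $ i \<noteq> 0" "t2 $ i \<noteq> 0" using that by auto
      then show ?thesis using pa arcs arcs2 by blast
    qed
    moreover have "\<exists>\<F>1. one_or_two_arcs i S1 ?x \<F>1 \<and>
        point_arcs ?x = \<F>1 \<union> (if t1 $ i > 0 then max_arcs i S2 else min_arcs i S2)" if z: "t2 $ i = 0"
    proof -
      have "t1 $ i \<noteq> 0" using t(8) z by simp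
      then show ?thesis using arcs pa unfolding pole[OF z] by blast
    qed
    ultimately show ?thesis using t(1,2,8) le by blast
  qed
  then show ?thesis using x(2) unfolding corner_end_def by blast
qed

text \<open>The closure is locally inside the disc of \<open>S\<close>, and a disc lies on one side
  of the vertical tangent at its pole.\<close>

lemma pole_one_sided:
  assumes K: "P c w \<in> K" and S: "S \<in> thru (P c w)" and p: "w = cy S" "\<sigma> S = 1"
  shows "\<exists>s r. (s = 1 \<or> s = - 1) \<and> r > 0 \<and> (\<forall>y\<in>ball (P c w) r. y \<in> K \<longrightarrow> s * (y $ i - c) \<ge> 0)"
proof -
  obtain r where r: "r > 0" "\<forall>y\<in>ball (P c w) r. y \<in> K \<longrightarrow> gap S y \<le> 0" using gap_nonpos[OF K S] by blast
  have S': "S \<in> \<S>" using S by (simp add: thru_iff)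
  note c = pole_arcs(4,5)[OF S p(1)]
  define s :: real where "s = (if c < cx S then 1 else - 1)"
  have "s * (y $ i - c) \<ge> 0" if y: "y \<in> ball (P c w) r" "y \<in> K" for y
  proof -
    have "(y $ i - cx S)\<^sup>2 + (y $ oi - cy S)\<^sup>2 \<le> (snd S)\<^sup>2"
      using bspec[OF r(2) y(1)] y(2) p(2) by (simp add: gap_def)
    then have "(y $ i - cx S)\<^sup>2 \<le> (snd S)\<^sup>2" using zero_le_power2[of "y $ oi - cy S"] by linarith
    then have "\<bar>y $ i - cx S\<bar> \<le> snd S"
      using radius_pos[OF S'] by (metis abs_le_square_iff abs_of_pos)
    then show ?thesis using c by (auto simp: s_def abs_if split: if_splits)
  qed
  then show ?thesis using r(1) by (intro exI[of _ s] exI[of _ r]) (auto simp: s_def)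
qed

text \<open>If neither vertical direction enters the closure, the vertical parts of the two normals
  have opposite signs, or one circle has a pole there with the domain inside. Either way neither
  tangent vector points to the opposite horizontal side from the other, and the closure is locally
  on one side of the vertical line. The second fact bounds the degree at a one-point fibre.\<close>

lemma trivial_corner:
  assumes x: "P c w \<in> K" "card (thru (P c w)) = 2" and vt: "\<not> vertical 1 c w" "\<not> vertical (- 1) c w"
  shows "extremal_corner \<S> D i (P c w) (point_arcs (P c w))"
    and "\<exists>s r. (s = 1 \<or> s = - 1) \<and> r > 0 \<and> (\<forall>y\<in>ball (P c w) r. y \<in> K \<longrightarrow> s * (y $ i - c) \<ge> 0)"
proof -
  let ?x = "P c w"
  define A where "A S = nrm S ?x $ oi" for S
  have cases: "A S1 * A S2 < 0 \<or> A S1 = 0 \<and> \<sigma> S1 = 1 \<or> A S2 = 0 \<and> \<sigma> S2 = 1"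
    if S: "thru ?x = {S1, S2}" for S1 S2
  proof -
    have "\<sigma> S1 = 1 \<or> \<sigma> S1 = - 1" "\<sigma> S2 = 1 \<or> \<sigma> S2 = - 1" using side S thru_iff by blast+
    moreover have "\<not> ((A S1 > 0 \<or> A S1 = 0 \<and> \<sigma> S1 = - 1) \<and> (A S2 > 0 \<or> A S2 = 0 \<and> \<sigma> S2 = - 1))"
      using vt(1) vertical_iff[OF x(1), of 1] S by (auto simp: A_def)
    moreover have "\<not> ((A S1 < 0 \<or> A S1 = 0 \<and> \<sigma> S1 = - 1) \<and> (A S2 < 0 \<or> A S2 = 0 \<and> \<sigma> S2 = - 1))"
      using vt(2) vertical_iff[OF x(1), of "- 1"] S by (auto simp: A_def)
    ultimately show ?thesis by (auto simp: mult_less_0_iff)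
  qed
  obtain S1 S2 where S0: "thru ?x = {S1, S2}" "S1 \<noteq> S2" using x(2) by (auto simp: card_2_iff)
  have "\<exists>t1 t2. tangent_direction D ?x S1 t1 \<and> tangent_direction D ?x S2 t2 \<and>
          t1 $ i * t2 $ i \<ge> 0 \<and> (t1 $ i, t2 $ i) \<noteq> (0, 0) \<and>
          (t1 $ i * t2 $ i > 0 \<longrightarrow>
             (\<exists>\<F>1 \<F>2. point_arcs ?x = \<F>1 \<union> \<F>2 \<and> one_or_two_arcs i S1 ?x \<F>1 \<and> one_or_two_arcs i S2 ?x \<F>2)) \<and>
          (t2 $ i = 0 \<longrightarrow>
             (\<exists>\<F>1. one_or_two_arcs i S1 ?x \<F>1 \<and>
                point_arcs ?x = \<F>1 \<union> (if t1 $ i > 0 then min_arcs i S2 else max_arcs i S2)))"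
    if S: "thru ?x = {S1, S2}" for S1 S2
  proof -
    have ne: "S1 \<noteq> S2" using x(2) S by auto
    have th: "S1 \<in> thru ?x" "S2 \<in> thru ?x" using S by auto
    obtain t1 t2 p1 p2 where t: "tangent_direction D ?x S1 t1" "tangent_direction D ?x S2 t2"
      "p1 > 0" "p2 > 0"
      "\<forall>h. h $ i = (nrm S2 ?x \<bullet> h) / p2 * t1 $ i + (nrm S1 ?x \<bullet> h) / p1 * t2 $ i"
      "nrm S1 ?x $ oi = 0 \<longleftrightarrow> t1 $ i = 0" "nrm S2 ?x $ oi = 0 \<longleftrightarrow> t2 $ i = 0"
      "(t1 $ i, t2 $ i) \<noteq> (0, 0)"
      "t1 $ i = 0 \<longrightarrow> nrm S1 ?x $ i * t2 $ i > 0" "t2 $ i = 0 \<longrightarrow> nrm S2 ?x $ i * t1 $ i > 0"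
      by (rule corner_data[OF x(1) S ne])
    have E: "A S2 / p2 * t1 $ i + A S1 / p1 * t2 $ i = 0"
      using t(5)[rule_format, of "P 0 1"] by (simp add: inner_index[of _ _ i] A_def)
    have ge: "t1 $ i * t2 $ i \<ge> 0"
    proof (cases "A S1 = 0 \<or> A S2 = 0")
      case True
      then show ?thesis using t(6,7) by (auto simp: A_def)
    next
      case False
      then have neg: "A S1 * A S2 < 0" using cases[OF S] by auto
      have "A S2 / p2 * t1 $ i = - (A S1 / p1 * t2 $ i)" using E by linarith
      then have "A S1 * t2 $ i * (A S2 / p2 * t1 $ i) = A S1 * t2 $ i * (- (A S1 / p1 * t2 $ i))" by simp
      then have "(A S1 * A S2 / p2) * (t1 $ i * t2 $ i) = - ((A S1 * t2 $ i)\<^sup>2 / p1)"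
        by (simp add: power2_eq_square mult_ac)
      also have "\<dots> \<le> 0" using t(3) by simp
      finally have "(A S1 * A S2 / p2) * (t1 $ i * t2 $ i) \<le> 0" .
      moreover have "A S1 * A S2 / p2 < 0" using neg t(4) by (simp add: divide_neg_pos)
      ultimately show ?thesis unfolding mult_le_0_iff[of "A S1 * A S2 / p2"] by linarith
    qed
    have pa: "point_arcs ?x = arcs_at S1 ?x \<union> arcs_at S2 ?x" by (auto simp: point_arcs_def S)
    have arcs: "one_or_two_arcs i S1 ?x (arcs_at S1 ?x)" if "t1 $ i \<noteq> 0"
      using nonpole_arcs(1)[OF th(1)] nrm_zero_iff[OF th(1)] t(6) that by blast
    have arcs2: "one_or_two_arcs i S2 ?x (arcs_at S2 ?x)" if "t2 $ i \<noteq> 0"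
      using nonpole_arcs(1)[OF th(2)] nrm_zero_iff[OF th(2)] t(7) that by blast
    have pole: "arcs_at S2 ?x = (if t1 $ i > 0 then min_arcs i S2 else max_arcs i S2)" if z: "t2 $ i = 0"
    proof -
      have A2: "A S2 = 0" "A S1 \<noteq> 0" using t(6,7,8) z by (auto simp: A_def)
      then have "w = cy S2" "\<sigma> S2 = 1" using nrm_zero_iff[OF th(2)] cases[OF S] by (auto simp: A_def)
      note wS = this
      have "nrm S2 ?x $ i * t1 $ i > 0" using t(10) z by blast
      then have "2 * ((\<sigma> S2 * (cx S2 - c)) * t1 $ i) > 0" by (simp only: nrm_vertical mult.assoc)
      then have "(\<sigma> S2 * (cx S2 - c)) * t1 $ i > 0" by (rule zero_less_mult_pos) simp
      then consider "\<sigma> S2 * (cx S2 - c) > 0" "t1 $ i > 0" | "\<sigma> S2 * (cx S2 - c) < 0" "t1 $ i < 0"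
        unfolding zero_less_mult_iff by blast
      then show ?thesis using pole_arcs(1,2)[OF th(2) wS(1)] wS(2) by cases simp_all
    qed
    have "\<exists>\<F>1 \<F>2. point_arcs ?x = \<F>1 \<union> \<F>2 \<and> one_or_two_arcs i S1 ?x \<F>1 \<and> one_or_two_arcs i S2 ?x \<F>2"
      if "t1 $ i * t2 $ i > 0"
    proof -
      have "t1 $ i \<noteq> 0" "t2 $ i \<noteq> 0" using that by auto
      then show ?thesis using pa arcs arcs2 by blast
    qed
    moreover have "\<exists>\<F>1. one_or_two_arcs i S1 ?x \<F>1 \<and>
        point_arcs ?x = \<F>1 \<union> (if t1 $ i > 0 then min_arcs i S2 else max_arcs i S2)" if z: "t2 $ i = 0"
    proof -
      have "t1 $ i \<noteq> 0" using t(8) z by simp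
      then show ?thesis using arcs pa unfolding pole[OF z] by blast
    qed
    ultimately show ?thesis using t(1,2,8) ge by blast
  qed
  then show "extremal_corner \<S> D i ?x (point_arcs ?x)" using x(2) unfolding extremal_corner_def by blast
  show "\<exists>s r. (s = 1 \<or> s = - 1) \<and> r > 0 \<and> (\<forall>y\<in>ball ?x r. y \<in> K \<longrightarrow> s * (y $ i - c) \<ge> 0)"
  proof (cases "A S1 * A S2 < 0")
    case False
    then obtain S where S: "S \<in> thru ?x" "A S = 0" "\<sigma> S = 1" using cases[OF S0(1)] S0(1) by blast
    then show ?thesis using pole_one_sided[OF x(1) S(1)] nrm_zero_iff[OF S(1)] by (simp add: A_def)
  next
    case True
    have th: "S1 \<in> thru ?x" "S2 \<in> thru ?x" using S0 by auto
    let ?n1 = "nrm S1 ?x" and ?n2 = "nrm S2 ?x"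
    obtain t1 t2 p1 p2 where t0: "tangent_direction D ?x S1 t1" "tangent_direction D ?x S2 t2"
      "p1 > 0" "p2 > 0"
      "\<forall>h. h $ i = (?n2 \<bullet> h) / p2 * t1 $ i + (?n1 \<bullet> h) / p1 * t2 $ i"
      "?n1 $ oi = 0 \<longleftrightarrow> t1 $ i = 0" "?n2 $ oi = 0 \<longleftrightarrow> t2 $ i = 0"
      "(t1 $ i, t2 $ i) \<noteq> (0, 0)"
      "t1 $ i = 0 \<longrightarrow> ?n1 $ i * t2 $ i > 0" "t2 $ i = 0 \<longrightarrow> ?n2 $ i * t1 $ i > 0"
      by (rule corner_data[OF x(1) S0])
    note t = t0(3,4) t0(5)[rule_format] t0(6,7)
    have E: "A S2 / p2 * t1 $ i + A S1 / p1 * t2 $ i = 0"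
      using t(3)[of "P 0 1"] by (simp add: inner_index[of _ _ i] A_def)
    have nz: "t1 $ i \<noteq> 0" "t2 $ i \<noteq> 0" using True t(4,5) by (auto simp: A_def)
    have same: "t1 $ i * t2 $ i > 0"
    proof -
      have "A S2 / p2 * t1 $ i = - (A S1 / p1 * t2 $ i)" using E by linarith
      then have "A S1 * t2 $ i * (A S2 / p2 * t1 $ i) = A S1 * t2 $ i * (- (A S1 / p1 * t2 $ i))" by simp
      then have "(A S1 * A S2 / p2) * (t1 $ i * t2 $ i) = - ((A S1 * t2 $ i)\<^sup>2 / p1)"
        by (simp add: power2_eq_square mult_ac)
      also have "\<dots> < 0"
      proof -
        have "A S1 \<noteq> 0" using True by auto
        then have "(A S1 * t2 $ i)\<^sup>2 > 0" using nz by simp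
        then show ?thesis using divide_pos_pos t(1) by fastforce
      qed
      finally have "(A S1 * A S2 / p2) * (t1 $ i * t2 $ i) < 0" .
      moreover have "A S1 * A S2 / p2 < 0" using True t(2) by (simp add: divide_neg_pos)
      ultimately show ?thesis unfolding mult_less_0_iff[of "A S1 * A S2 / p2"] by linarith
    qed
    define s where "s = sgn (t1 $ i)"
    \<comment> \<open>Coefficients of the horizontal coordinate in terms of the two normals. They
      are positive because both tangent vectors point to the side \<open>s\<close>.\<close>
    define l1 where "l1 = s * t2 $ i / p1"
    define l2 where "l2 = s * t1 $ i / p2"
    have s: "s = 1 \<or> s = - 1" "l1 > 0" "l2 > 0"
      using same t(1,2) nz by (auto simp: s_def l1_def l2_def sgn_real_def zero_less_mult_iff divide_less_0_iff zero_less_divide_iff)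
    have exp: "s * h $ i = l1 * (?n1 \<bullet> h) + l2 * (?n2 \<bullet> h)" for h
      by (subst t(3)) (simp add: l1_def l2_def algebra_simps)
    obtain r0 where r0: "r0 > 0" "\<forall>y\<in>ball ?x r0. y \<in> K \<longleftrightarrow> (\<forall>S\<in>thru ?x. gap S y \<le> 0)"
      using local_closure[OF x(1)] by blast
    \<comment> \<open>On the closure both inner products with the normals are at least
      \<open>- N\<close>, where \<open>N\<close> is the squared displacement. If their positive
      combination were negative, each would also be bounded above by a multiple of \<open>N\<close>;
      \<open>M\<close> bounds the sum of their absolute values in units of \<open>N\<close>.\<close>
    define M where "M = 2 + l1 / l2 + l2 / l1"
    define B where "B = \<bar>?n1 $ i\<bar> + \<bar>?n1 $ oi\<bar> + \<bar>?n2 $ i\<bar> + \<bar>?n2 $ oi\<bar>"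
    define C where "C = \<bar>cross i ?n1 ?n2\<bar>"
    have C: "C > 0" using corner_cross[OF x(1) S0] by (simp add: C_def)
    have MB: "M > 0" "B \<ge> 0" using s(2,3) by (simp_all add: M_def B_def add_pos_pos)
    define r where "r = min r0 (C / (M * B + 1))"
    have MB1: "M * B + 1 > 0" using MB by (simp add: add_nonneg_pos)
    have r: "r > 0" using r0(1) C MB1 by (simp add: r_def)
    have "s * (y $ i - c) \<ge> 0" if y: "y \<in> ball ?x r" "y \<in> K" for y
    proof (rule ccontr)
      assume neg: "\<not> s * (y $ i - c) \<ge> 0"
      define h where "h = y - ?x"
      have yh: "y = ?x + h" by (simp add: h_def)
      have hi: "s * h $ i < 0" using neg by (simp add: h_def)
      have hr: "norm h < r" using y(1) by (simp add: h_def dist_norm norm_minus_commute)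
      have h0: "norm h > 0" using hi by auto
      have ge: "nrm S ?x \<bullet> h \<ge> - (norm h)\<^sup>2" if S: "S \<in> thru ?x" for S
      proof -
        have "gap S y \<le> 0" using r0(2) y S by (auto simp: r_def)
        then have "nrm S ?x \<bullet> h \<ge> \<sigma> S * (norm h)\<^sup>2" using gap_nrm[OF S, of h] yh by simp
        moreover have "\<sigma> S * (norm h)\<^sup>2 \<ge> - (norm h)\<^sup>2" using side[of S] S by (auto simp: thru_iff)
        ultimately show ?thesis by linarith
      qed
      define a where "a = ?n1 \<bullet> h"
      define b where "b = ?n2 \<bullet> h"
      define N where "N = (norm h)\<^sup>2"
      have ab: "a \<ge> - N" "b \<ge> - N" "l1 * a + l2 * b < 0" "N \<ge> 0"
        using ge[OF th(1)] ge[OF th(2)] hi exp[of h] by (auto simp: a_def b_def N_def)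
      have "a \<le> l2 / l1 * N"
      proof -
        have "l1 * a < l2 * (- b)" using ab(3) by simp
        also have "\<dots> \<le> l2 * N" using ab(2) s(3) by (intro mult_left_mono) auto
        finally show ?thesis using s(2) by (simp add: field_simps)
      qed
      moreover have "b \<le> l1 / l2 * N"
      proof -
        have "l2 * b < l1 * (- a)" using ab(3) by simp
        also have "\<dots> \<le> l1 * N" using ab(1) s(2) by (intro mult_left_mono) auto
        finally show ?thesis using s(3) by (simp add: field_simps)
      qed
      moreover have "l2 / l1 * N \<ge> 0" "l1 / l2 * N \<ge> 0" using s(2,3) ab(4) by auto
      ultimately have "\<bar>a\<bar> + \<bar>b\<bar> \<le> M * N" using ab(1,2,4) by (auto simp: M_def distrib_right abs_if)
      then have "(\<bar>a\<bar> + \<bar>b\<bar>) * B \<le> M * N * B" using MB(2) by (rule mult_right_mono)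
      moreover have "C * norm h \<le> (\<bar>a\<bar> + \<bar>b\<bar>) * B"
        using norm_le_of_cross[of i ?n1 ?n2 h] by (simp add: C_def B_def a_def b_def)
      ultimately have "C * norm h \<le> (M * B * norm h) * norm h" by (simp add: N_def power2_eq_square mult_ac)
      then have "C \<le> M * B * norm h" using h0 by simp
      also have "\<dots> \<le> (M * B + 1) * norm h" using h0 by (simp add: algebra_simps)
      also have "\<dots> < (M * B + 1) * r" using hr MB1 by simp
      also have "\<dots> \<le> (M * B + 1) * (C / (M * B + 1))" using MB1 by (intro mult_left_mono) (auto simp: r_def)
      also have "\<dots> = C" using MB1 by simp
      finally show False by simp
    qed
    then show ?thesis using s(1) r by blast
  qed
qed


section \<open>Labels of vertices and edges\<close>

lemma vertical_ends:
  assumes v: "vertex_fibre v c lo hi"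
  shows "\<not> vertical (- 1) c lo" "\<not> vertical 1 c hi" "lo < hi \<Longrightarrow> vertical 1 c lo" "lo < hi \<Longrightarrow> vertical (- 1) c hi"
proof -
  note le = vertex_fibreD(2)[OF v]
  show "\<not> vertical (- 1) c lo"
  proof
    assume "vertical (- 1) c lo"
    then obtain e where e: "e > 0" "\<And>t. 0 \<le> t \<Longrightarrow> t < e \<Longrightarrow> P c (lo + - 1 * t) \<in> K" by (auto simp: vertical_def)
    have "P c w \<in> K" if "w \<in> {lo - e / 2..lo}" for w using e(2)[of "lo - w"] e(1) that by auto
    then have "{lo - e / 2..lo} \<subseteq> {lo..hi}" using e(1) le by (intro vertex_fibre_maximal[OF v]) auto
    then show False using e(1) by auto
  qed
  show "\<not> vertical 1 c hi"
  proof
    assume "vertical 1 c hi"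
    then obtain e where e: "e > 0" "\<And>t. 0 \<le> t \<Longrightarrow> t < e \<Longrightarrow> P c (hi + 1 * t) \<in> K" by (auto simp: vertical_def)
    have "P c w \<in> K" if "w \<in> {hi..hi + e / 2}" for w using e(2)[of "w - hi"] e(1) that by auto
    then have "{hi..hi + e / 2} \<subseteq> {lo..hi}" using e(1) le by (intro vertex_fibre_maximal[OF v]) auto
    then show False using e(1) by auto
  qed
  show "vertical 1 c lo" if "lo < hi"
    using that vertex_fibreD(4)[OF v] by (auto simp: vertical_def intro!: exI[of _ "hi - lo"])
  show "vertical (- 1) c hi" if "lo < hi"
    using that vertex_fibreD(4)[OF v] by (auto simp: vertical_def intro!: exI[of _ "hi - lo"])
qed

lemma cpoint_cases:
  assumes v: "vertex_fibre v c lo hi" and w: "w \<in> cpoints c lo hi"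
  obtains S where "thru (P c w) = {S}" | "card (thru (P c w)) = 2"
proof -
  have K: "P c w \<in> K" and ne: "thru (P c w) \<noteq> {}" using vertex_fibreD(4)[OF v] w by (auto simp: cpoints_def)
  have "\<exists>S. thru (P c w) = {S} \<or> card (thru (P c w)) = 2"
    using K by (cases rule: thru_cases) (use ne in auto)
  then show ?thesis using that by blast
qed

text \<open>With a single circle, a pole would extend to both vertical directions or to neither; so
  the point is no pole and its arcs stay in one half of the circle.\<close>

lemma end_of_fibre:
  assumes v: "vertex_fibre v c lo hi" and w: "w \<in> cpoints c lo hi"
    and \<tau>: "\<tau> = 1 \<or> \<tau> = - 1" and vt: "vertical \<tau> c w" "\<not> vertical (- \<tau>) c w"
  shows "simple_end \<S> i (P c w) (point_arcs (P c w)) \<or> corner_end \<S> D i (P c w) (point_arcs (P c w))"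
proof -
  have K: "P c w \<in> K" using vertex_fibreD(4)[OF v] w by (auto simp: cpoints_def)
  show ?thesis
    using cpoint_cases[OF v w]
  proof cases
    case (1 S)
    then have S: "S \<in> thru (P c w)" by simp
    have \<tau>': "- \<tau> = 1 \<or> - \<tau> = - 1" using \<tau> by auto
    have "nrm S (P c w) $ oi \<noteq> 0"
      using vt vertical_iff[OF K \<tau>] vertical_iff[OF K \<tau>'] by (auto simp: 1)
    then have "w \<noteq> cy S" using nrm_zero_iff[OF S] by simp
    then have "arc_rule i S (arcs_at S (P c w))" using nonpole_arcs(2)[OF S] by blast
    then show ?thesis using 1 by (auto simp: simple_end_def point_arcs_def)
  next
    case 2
    then show ?thesis using corner_end_vertical[OF K _ \<tau> vt(1)] by blast
  qed
qed

text \<open>On a single circle a critical point is a pole, where the two arcs form exactly a pair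
  forbidden by \<open>arc_rule\<close>. This excludes two simple ends at a vertex of degree
  2.\<close>

lemma simple_end_not_crit:
  assumes "simple_end \<S> i (P c w) F"
  shows "\<not> crit (P c w)"
proof
  assume cr: "crit (P c w)"
  obtain S where S: "thru (P c w) = {S}" "F = arcs_at S (P c w)" "arc_rule i S F"
    using assms by (auto simp: simple_end_def)
  have "\<exists>U\<in>\<S>. P c w \<in> circ U \<and> P c w $ oi = cy U" using cr S(1) by (simp add: crit_def)
  then obtain U where U: "U \<in> \<S>" "P c w \<in> circ U" "w = cy U" by auto
  then have U': "U \<in> thru (P c w)" by (simp add: thru_iff)
  then have "U = S" using S(1) by simp
  then have "F = min_arcs i S \<or> F = max_arcs i S"
    using pole_arcs(1,2,4)[OF U' U(3)] S(2) by (cases "c < cx U") auto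
  then show False using S(3) by (auto simp: arc_rule_def)
qed

text \<open>The closure extends in neither vertical direction. On a single circle this means a pole
  with the domain inside; at a double point it is the case of \<open>trivial_corner\<close>.\<close>

lemma extremal_vertex:
  assumes v: "vertex_fibre v c w w"
  shows "extremal_end \<S> i (P c w) (point_arcs (P c w)) \<or> extremal_corner \<S> D i (P c w) (point_arcs (P c w))"
    and "\<exists>s r. (s = 1 \<or> s = - 1) \<and> r > 0 \<and> (\<forall>y\<in>ball (P c w) r. y \<in> K \<longrightarrow> s * (y $ i - c) \<ge> 0)"
proof -
  have K: "P c w \<in> K" using vertex_fibreD(4)[OF v] by simp
  note w = end_cpoints(1)[OF v]
  note vt = vertical_ends(1,2)[OF v]
  have "(extremal_end \<S> i (P c w) (point_arcs (P c w)) \<or> extremal_corner \<S> D i (P c w) (point_arcs (P c w))) \<and>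
    (\<exists>s r. (s = 1 \<or> s = - 1) \<and> r > 0 \<and> (\<forall>y\<in>ball (P c w) r. y \<in> K \<longrightarrow> s * (y $ i - c) \<ge> 0))"
    using cpoint_cases[OF v w]
  proof cases
    case (1 S)
    then have S: "S \<in> thru (P c w)" by simp
    have "\<sigma> S = 1 \<or> \<sigma> S = - 1" using side[of S] S by (simp add: thru_iff)
    then have "nrm S (P c w) $ oi = 0 \<and> \<sigma> S = 1"
      using vt vertical_iff[OF K, of 1] vertical_iff[OF K, of "- 1"] by (auto simp: 1)
    then have p: "w = cy S" "\<sigma> S = 1" using nrm_zero_iff[OF S] by auto
    note pa = pole_arcs[OF S p(1)]
    have "arcs_at S (P c w) = min_arcs i S \<or> arcs_at S (P c w) = max_arcs i S"
      using pa(1,2,4) by (cases "c < cx S") auto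
    then have "extremal_end \<S> i (P c w) (point_arcs (P c w))"
      unfolding extremal_end_def point_arcs_def 1 using pa(3) 1 by auto
    then show ?thesis using pole_one_sided[OF K S p] by blast
  next
    case 2
    then show ?thesis using trivial_corner[OF K _ vt(2,1)] by blast
  qed
  then show "extremal_end \<S> i (P c w) (point_arcs (P c w)) \<or> extremal_corner \<S> D i (P c w) (point_arcs (P c w))"
    "\<exists>s r. (s = 1 \<or> s = - 1) \<and> r > 0 \<and> (\<forall>y\<in>ball (P c w) r. y \<in> K \<longrightarrow> s * (y $ i - c) \<ge> 0)" by blast+
qed

text \<open>All strips at a one-point fibre have the same lower limit, so there is at most one on
  each side; on one side there is none because the closure is locally on the other.\<close>

lemma extremal_degree:
  assumes v: "vertex_fibre v c w w"
  shows "reeb_degree \<S> D i v \<le> 1"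
proof -
  have le1: "card (germs s v c) \<le> 1" if s: "s = 1 \<or> s = - 1" for s
  proof -
    have "x = y" if xy: "x \<in> germs s v c" "y \<in> germs s v c" for x y
    proof -
      obtain S T S' T' where e: "x = (S, T)" "y = (S', T')" by (cases x, cases y)
      have "lower S c = w" "lower S' c = w"
        using germ_data(3,4,5)[OF v _ s, of S T] germ_data(3,4,5)[OF v _ s, of S' T'] xy e by auto
      then show ?thesis using germ_eqI[OF v s, of S T S' T'] xy by (simp add: e)
    qed
    then show ?thesis using card_le_Suc0_iff_eq[OF finite_germs] by auto
  qed
  obtain s r where s: "s = 1 \<or> s = - 1" "r > 0" "\<And>y. y \<in> ball (P c w) r \<Longrightarrow> y \<in> K \<Longrightarrow> s * (y $ i - c) \<ge> 0"
    using extremal_vertex(2)[OF v] by blast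
  have s': "- s = 1 \<or> - s = - 1" using s(1) by auto
  have "germs (- s) v c = {}"
  proof (rule ccontr)
    assume "germs (- s) v c \<noteq> {}"
    then obtain S T where g: "(S, T) \<in> germs (- s) v c" by auto
    note d = germ_data[OF v g s']
    have lw: "lower S c = w" using d by linarith
    obtain \<delta> where \<delta>: "\<delta> > 0" "\<And>t. t \<in> {0<..<\<delta>} \<Longrightarrow> fib S T (c + - s * t)"
      using g unfolding germs_def by blast
    have "((\<lambda>t. P (c + - s * t) (lower S (c + - s * t))) \<longlongrightarrow> P (c + - s * 0) (lower S c)) (at_right 0)"
      by (intro tendsto_pt right_limit_ht tendsto_intros)
    then have "\<forall>\<^sub>F t in at_right 0. P (c + - s * t) (lower S (c + - s * t)) \<in> ball (P c w) r"
      using s(2) lw by (intro topological_tendstoD) auto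
    then have "\<forall>\<^sub>F t in at_right 0. P (c + - s * t) (lower S (c + - s * t)) \<in> ball (P c w) r \<and> 0 < t \<and> t < \<delta>"
      by (rule eventually_conj[OF _ eventually_right[OF \<delta>(1)]])
    then obtain t where t: "P (c + - s * t) (lower S (c + - s * t)) \<in> ball (P c w) r" "0 < t" "t < \<delta>"
      using eventually_happens'[OF trivial_limit_at_right_real] by blast
    have f: "fib S T (c + - s * t)" using \<delta>(2) t by simp
    then have "lower S (c + - s * t) \<in> {lower S (c + - s * t)..upper T (c + - s * t)}" by (simp add: fib_def)
    from s(3)[OF t(1) fibD(4)[OF f this]] show False using s(1) t(2) by auto
  qed
  then have "card (germs 1 v c) + card (germs (- 1) v c) \<le> 1"
    using s(1) le1[of 1] le1[of "- 1"] by auto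
  then show ?thesis using degree_eq[OF v] out_degree_eq(1)[OF v] in_degree_eq(1)[OF v] by simp
qed

lemma degree_card_cpoints:
  assumes "vertex_fibre v c lo hi" "lo < hi"
  shows "reeb_degree \<S> D i v = card (cpoints c lo hi)"
  using card_cpoints[OF assms] degree_eq[OF assms(1)] out_degree_eq(1)[OF assms(1)] in_degree_eq(1)[OF assms(1)]
  by simp

text \<open>A vertex determines \<open>c\<close>, \<open>lo\<close> and \<open>hi\<close>, so the
  choice has only one outcome. The sets are listed by increasing height over the circle
  points.\<close>

definition vertex_label :: "(real^2) set \<Rightarrow> (real^2) set set list" where
  "vertex_label v = (SOME L. \<exists>c lo hi. vertex_fibre v c lo hi \<and>
     L = map (\<lambda>w. point_arcs (P c w)) (sorted_list_of_set (cpoints c lo hi)))"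

lemma vertex_fibre_unique:
  assumes "vertex_fibre v c lo hi" "vertex_fibre v c' lo' hi'"
  shows "c = c' \<and> lo = lo' \<and> hi = hi'"
proof -
  have c: "c = c'" using vertex_fibre_value[OF assms(1)] vertex_fibre_value[OF assms(2)] by simp
  have "P c ` {lo..hi} = P c ` {lo'..hi'}"
    using vertex_fibreD(3)[OF assms(1)] vertex_fibreD(3)[OF assms(2)] c by simp
  then have "{lo..hi} = {lo'..hi'}" by (metis (no_types, lifting) inj_image_eq_iff injI pt_eq_iff)
  then show ?thesis using c vertex_fibreD(2)[OF assms(1)] by (simp add: Icc_eq_Icc)
qed

lemma vertex_label_eq:
  assumes v: "vertex_fibre v c lo hi"
  shows "vertex_label v = map (\<lambda>w. point_arcs (P c w)) (sorted_list_of_set (cpoints c lo hi))"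
proof -
  let ?Q = "\<lambda>L. \<exists>c lo hi. vertex_fibre v c lo hi \<and>
     L = map (\<lambda>w. point_arcs (P c w)) (sorted_list_of_set (cpoints c lo hi))"
  have "?Q (vertex_label v)" unfolding vertex_label_def by (rule someI_ex) (use v in blast)
  then obtain c' lo' hi' where "vertex_fibre v c' lo' hi'"
    "vertex_label v = map (\<lambda>w. point_arcs (P c' w)) (sorted_list_of_set (cpoints c' lo' hi'))" by blast
  then show ?thesis using vertex_fibre_unique[OF v] by blast
qed

lemma vertex_preimage: "vertex_fibre v c lo hi \<Longrightarrow> reeb_preimage D i (Inl v) = v"
proof -
  assume v: "vertex_fibre v c lo hi"
  have "x \<in> v" if "x \<in> K" "q x = v" for x using reeb_map_refl[OF that(1)] that(2) by simp
  moreover have "x \<in> K" "q x = v" if "x \<in> v" for x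
    using that v vertex_fibreD(3)[OF v] by (auto simp: vertex_fibre_def)
  ultimately show ?thesis by (auto simp: reeb_preimage_def)
qed

lemma circle_points_over_eq:
  assumes v: "vertex_fibre v c lo hi"
  shows "circle_points_over \<S> D i v = P c ` cpoints c lo hi"
proof -
  have "circle_points_over \<S> D i v = {x \<in> v. thru x \<noteq> {}}"
    unfolding circle_points_over_def vertex_preimage[OF v] by (auto simp: circles_through_def)
  also have "\<dots> = P c ` cpoints c lo hi" using vertex_fibreD(3)[OF v] by (auto simp: cpoints_def)
  finally show ?thesis .
qed

lemma lists_in_order_pts:
  assumes "finite A"
  shows "lists_in_order i (P c ` A) (map (P c) (sorted_list_of_set A))"
  unfolding lists_in_order_def
proof (intro conjI)
  show "set (map (P c) (sorted_list_of_set A)) = P c ` A" using assms by simp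
  show "distinct (map (P c) (sorted_list_of_set A))" by (simp add: distinct_map inj_on_def)
  show "sorted_wrt (\<lambda>x y. lies_beyond i {y} {x}) (map (P c) (sorted_list_of_set A))"
    unfolding sorted_wrt_map
    by (rule sorted_wrt_mono_rel[OF _ strict_sorted_list_of_set]) (auto simp: lies_beyond_def)
qed

lemma vertex_label_arcs:
  assumes v: "v \<in> V" and F: "F \<in> set (vertex_label v)"
  shows "finite F" "A \<in> F \<Longrightarrow> \<exists>S\<in>\<S>. \<exists>j<8. A = arc8 S j \<and> A \<inter> reeb_preimage D i (Inl v) \<noteq> {}"
proof -
  obtain c lo hi where f: "vertex_fibre v c lo hi" using vertex_fibre_exists[OF v] .
  obtain w where w: "w \<in> cpoints c lo hi" "F = point_arcs (P c w)"
    using F finite_cpoints[OF f] by (auto simp: vertex_label_eq[OF f])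
  show "finite F" unfolding w(2) point_arcs_def by (simp add: arcs_at_eq_arcs_meeting)
  assume "A \<in> F"
  then obtain S j where S: "S \<in> thru (P c w)" "j < 8" "A = arc8 S j" "P c w \<in> A"
    by (auto simp: w(2) point_arcs_def arcs_at_def)
  have "P c w \<in> v" using w(1) vertex_fibreD(3)[OF f] by (auto simp: cpoints_def)
  then have "A \<inter> reeb_preimage D i (Inl v) \<noteq> {}" unfolding vertex_preimage[OF f] using S(4) by blast
  moreover have "S \<in> \<S>" using S(1) by (simp add: thru_iff)
  ultimately show "\<exists>S\<in>\<S>. \<exists>j<8. A = arc8 S j \<and> A \<inter> reeb_preimage D i (Inl v) \<noteq> {}" using S(2,3) by blast
qed

text \<open>A nondegenerate fibre has at least its two ends as circle points, hence degree at least
  2; so the fibre is one point.\<close>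

lemma vertex_label_degree_1:
  assumes v: "v \<in> V" and deg: "reeb_degree \<S> D i v = 1"
  shows "\<exists>x F. reeb_preimage D i (Inl v) = {x} \<and> vertex_label v = [F] \<and>
            (extremal_end \<S> i x F \<or> extremal_corner \<S> D i x F)"
proof -
  obtain c lo hi where f: "vertex_fibre v c lo hi" using vertex_fibre_exists[OF v] .
  have "\<not> lo < hi"
  proof
    assume lt: "lo < hi"
    have "card {lo, hi} \<le> card (cpoints c lo hi)"
      by (rule card_mono[OF finite_cpoints[OF f]]) (use end_cpoints[OF f] in auto)
    then show False using degree_card_cpoints[OF f lt] deg lt by simp
  qed
  then have e: "hi = lo" using vertex_fibreD(2)[OF f] by simp
  note f' = f[unfolded e]
  have "cpoints c lo lo = {lo}" using end_cpoints(1)[OF f'] by (auto simp: cpoints_def)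
  then have "vertex_label v = [point_arcs (P c lo)]" using vertex_label_eq[OF f'] by simp
  moreover have "reeb_preimage D i (Inl v) = {P c lo}"
    using vertex_preimage[OF f'] vertex_fibreD(3)[OF f'] by simp
  ultimately show ?thesis using extremal_vertex(1)[OF f'] by blast
qed

lemma vertex_nontrivial:
  assumes "vertex_fibre v c lo hi" "reeb_degree \<S> D i v \<ge> 2"
  shows "lo < hi"
  using extremal_degree[of v c lo] assms vertex_fibreD(2)[OF assms(1)] by (cases "lo = hi") auto

text \<open>The only circle points are the two ends. A vertex contains a critical point, which must
  be one of them, so not both ends are simple.\<close>

lemma vertex_label_degree_2:
  assumes v: "v \<in> V" and deg: "reeb_degree \<S> D i v = 2"
  shows "\<exists>x1 x2 F1 F2. lists_in_order i (circle_points_over \<S> D i v) [x1, x2] \<and>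
            vertex_label v = [F1, F2] \<and>
            (simple_end \<S> i x1 F1 \<or> corner_end \<S> D i x1 F1) \<and>
            (simple_end \<S> i x2 F2 \<or> corner_end \<S> D i x2 F2) \<and>
            \<not> (simple_end \<S> i x1 F1 \<and> simple_end \<S> i x2 F2)"
proof -
  obtain c lo hi where f: "vertex_fibre v c lo hi" using vertex_fibre_exists[OF v] .
  have lt: "lo < hi" using vertex_nontrivial[OF f] deg by simp
  note ends = end_cpoints[OF f]
  have "{lo, hi} = cpoints c lo hi"
    by (rule card_subset_eq[OF finite_cpoints[OF f]])
      (use ends degree_card_cpoints[OF f lt] deg lt in auto)
  then have W: "cpoints c lo hi = {lo, hi}" by simp
  have sl: "sorted_list_of_set (cpoints c lo hi) = [lo, hi]" unfolding W using lt by simp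
  have "lists_in_order i (circle_points_over \<S> D i v) (map (P c) [lo, hi])"
    unfolding circle_points_over_eq[OF f] sl[symmetric] by (rule lists_in_order_pts[OF finite_cpoints[OF f]])
  then have lio: "lists_in_order i (circle_points_over \<S> D i v) [P c lo, P c hi]" by simp
  have lab: "vertex_label v = [point_arcs (P c lo), point_arcs (P c hi)]"
    using vertex_label_eq[OF f] sl by simp
  note vt = vertical_ends[OF f]
  have e1: "simple_end \<S> i (P c lo) (point_arcs (P c lo)) \<or> corner_end \<S> D i (P c lo) (point_arcs (P c lo))"
    by (rule end_of_fibre[OF f ends(1), of 1]) (use vt lt in auto)
  have e2: "simple_end \<S> i (P c hi) (point_arcs (P c hi)) \<or> corner_end \<S> D i (P c hi) (point_arcs (P c hi))"
    by (rule end_of_fibre[OF f ends(2), of "- 1"]) (use vt lt in auto)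
  have "\<not> (simple_end \<S> i (P c lo) (point_arcs (P c lo)) \<and> simple_end \<S> i (P c hi) (point_arcs (P c hi)))"
  proof
    assume "simple_end \<S> i (P c lo) (point_arcs (P c lo)) \<and> simple_end \<S> i (P c hi) (point_arcs (P c hi))"
    then have nc: "\<not> crit (P c lo)" "\<not> crit (P c hi)" using simple_end_not_crit by blast+
    obtain x where x: "crit x" "v = q x" using v by (auto simp: reeb_vertices_eq)
    then have "x \<in> v" using reeb_map_refl by (simp add: crit_def)
    then obtain w where w: "x = P c w" "w \<in> {lo..hi}" using vertex_fibreD(3)[OF f] by auto
    have "thru x \<noteq> {}"
    proof
      assume e: "thru x = {}"
      then have "card (thru x) \<noteq> 2" by simp
      then obtain S where "S \<in> thru x" using x(1) by (auto simp: crit_def thru_iff)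
      then show False using e by simp
    qed
    then have "w \<in> cpoints c lo hi" using w by (simp add: cpoints_def)
    then show False using W nc x(1) w(1) by auto
  qed
  then show ?thesis using lio lab e1 e2 by blast
qed

lemma sorted_cpoints:
  assumes v: "vertex_fibre v c lo hi" and lt: "lo < hi"
  defines "xs \<equiv> sorted_list_of_set (cpoints c lo hi)"
  shows "set xs = cpoints c lo hi" "length xs = card (cpoints c lo hi)" "distinct xs" "length xs \<ge> 2"
    "\<And>j k. j < k \<Longrightarrow> k < length xs \<Longrightarrow> xs ! j < xs ! k"
    "xs ! 0 = lo" "xs ! (length xs - 1) = hi"
    "\<And>k. 0 < k \<Longrightarrow> k < length xs - 1 \<Longrightarrow> lo < xs ! k \<and> xs ! k < hi \<and> xs ! k \<in> cpoints c lo hi"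
proof -
  note fin = finite_cpoints[OF v]
  show set: "set xs = cpoints c lo hi" and len: "length xs = card (cpoints c lo hi)" and dis: "distinct xs"
    using fin by (simp_all add: xs_def)
  have "card {lo, hi} \<le> card (cpoints c lo hi)"
    by (rule card_mono[OF fin]) (use end_cpoints[OF v] in auto)
  then show l2: "length xs \<ge> 2" using len lt by simp
  have "sorted_wrt (<) xs" unfolding xs_def by (rule strict_sorted_list_of_set)
  then show mono: "xs ! j < xs ! k" if "j < k" "k < length xs" for j k
    using that by (simp add: sorted_wrt_iff_nth_less)
  have mem: "lo \<le> xs ! k \<and> xs ! k \<le> hi \<and> xs ! k \<in> cpoints c lo hi" if "k < length xs" for k
  proof -
    have "xs ! k \<in> cpoints c lo hi" using nth_mem[OF that] set by simp
    then show ?thesis by (simp add: cpoints_def)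
  qed
  have l0: "0 < length xs" "length xs - 1 < length xs" using l2 by auto
  obtain j where j: "j < length xs" "xs ! j = lo" using end_cpoints(1)[OF v] set by (metis in_set_conv_nth)
  show x0: "xs ! 0 = lo"
  proof (rule ccontr)
    assume "xs ! 0 \<noteq> lo"
    then have "0 < j" using j by (cases "j = 0") auto
    moreover have "lo \<le> xs ! 0" using mem[OF l0(1)] by simp
    ultimately show False using mono[of 0 j] j by simp
  qed
  obtain k where k: "k < length xs" "xs ! k = hi" using end_cpoints(2)[OF v] set by (metis in_set_conv_nth)
  show xn: "xs ! (length xs - 1) = hi"
  proof (rule ccontr)
    assume ne: "xs ! (length xs - 1) \<noteq> hi"
    have "k \<noteq> length xs - 1" using k(2) ne by metis
    then have "k < length xs - 1" using k(1) by linarith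
    moreover have "xs ! (length xs - 1) \<le> hi" using mem[OF l0(2)] by simp
    ultimately show False using mono[of k "length xs - 1"] k(2) l0(2) by fastforce
  qed
  show "lo < xs ! k \<and> xs ! k < hi \<and> xs ! k \<in> cpoints c lo hi" if "0 < k" "k < length xs - 1" for k
    using mono[of 0 k] mono[of k "length xs - 1"] x0 xn that mem[of k] by auto
qed

lemma min_arcs_neq_max_arcs: "S \<in> \<S> \<Longrightarrow> min_arcs i S \<noteq> max_arcs i S"
proof
  assume S: "S \<in> \<S>" and eq: "min_arcs i S = max_arcs i S"
  note r = arc8_eq_iff[OF radius_pos[OF S] radius_pos[OF S]]
  show False
  proof (cases "i = 1")
    case True
    then have "arc8 S 3 \<in> {arc8 S 0, arc8 S 7}" using eq by (auto simp: min_arcs_def max_arcs_def)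
    then show False using r[of 3 0] r[of 3 7] by auto
  next
    case False
    then have "arc8 S 5 \<in> {arc8 S 1, arc8 S 2}" using eq by (auto simp: min_arcs_def max_arcs_def)
    then show False using r[of 5 1] r[of 5 2] by auto
  qed
qed

text \<open>The inner circle points are poles of circles outside the domain. A centre to the right
  makes the pole a minimum and splits departing strips, a centre to the left makes it a maximum and
  splits entering ones; with \<open>n\<close> strips there are exactly \<open>n - 2\<close> such
  poles between the ends.\<close>

lemma vertex_label_degree_ge_3:
  assumes v: "v \<in> V" and deg: "reeb_degree \<S> D i v \<ge> 3"
  shows "\<exists>n xs C.
            n = out_degree \<S> D i v + in_degree \<S> D i v \<and> n > 2 \<and>
            lists_in_order i (circle_points_over \<S> D i v) xs \<and>
            length xs = n \<and> length (vertex_label v) = n \<and>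
            (\<forall>k \<in> {0, n - 1}. simple_end \<S> i (xs ! k) (vertex_label v ! k) \<or>
                              corner_end \<S> D i (xs ! k) (vertex_label v ! k)) \<and>
            (\<forall>k \<in> {0<..<n - 1}.
               circles_through \<S> (xs ! k) = {C k} \<and>
               carriers \<S> (vertex_label v ! k) = {C k} \<and>
               (vertex_label v ! k = min_arcs i (C k) \<or> vertex_label v ! k = max_arcs i (C k)) \<and>
               C k \<notin> circles_through \<S> (xs ! 0) \<union> circles_through \<S> (xs ! (n - 1))) \<and>
            inj_on C {0<..<n - 1} \<and>
            card {k \<in> {0<..<n - 1}. vertex_label v ! k = min_arcs i (C k)} + 1 = out_degree \<S> D i v \<and>
            card {k \<in> {0<..<n - 1}. vertex_label v ! k = max_arcs i (C k)} + 1 = in_degree \<S> D i v"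
proof -
  obtain c lo hi where f: "vertex_fibre v c lo hi" using vertex_fibre_exists[OF v] .
  have lt: "lo < hi" using vertex_nontrivial[OF f] deg by simp
  define ws where "ws = sorted_list_of_set (cpoints c lo hi)"
  note sc = sorted_cpoints[OF f lt, folded ws_def]
  define n where "n = length ws"
  define xs where "xs = map (P c) ws"
  define C where "C k = (SOME U. thru (P c (ws ! k)) = {U})" for k
  have nd: "n = out_degree \<S> D i v + in_degree \<S> D i v"
    using degree_card_cpoints[OF f lt] degree_eq[OF f] sc(2) by (simp add: n_def)
  have n3: "n > 2" using deg degree_eq[OF f] nd by simp
  have lab: "vertex_label v = map (\<lambda>w. point_arcs (P c w)) ws" unfolding ws_def by (rule vertex_label_eq[OF f])
  have labk: "vertex_label v ! k = point_arcs (P c (ws ! k))" "xs ! k = P c (ws ! k)" if "k < n" for k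
    using that by (simp_all add: lab n_def xs_def)
  have lio: "lists_in_order i (circle_points_over \<S> D i v) xs"
    unfolding circle_points_over_eq[OF f] xs_def ws_def by (rule lists_in_order_pts[OF finite_cpoints[OF f]])
  note vt = vertical_ends[OF f]
  note ends = end_cpoints[OF f]
  have ws0: "ws ! 0 = lo" and wsn: "ws ! (n - 1) = hi" using sc(6,7) by (simp_all add: n_def)
  have e: "simple_end \<S> i (xs ! k) (vertex_label v ! k) \<or> corner_end \<S> D i (xs ! k) (vertex_label v ! k)"
    if "k \<in> {0, n - 1}" for k
  proof -
    from that consider "k = 0" | "k = n - 1" by blast
    then show ?thesis
    proof cases
      case 1
      have "simple_end \<S> i (P c lo) (point_arcs (P c lo)) \<or> corner_end \<S> D i (P c lo) (point_arcs (P c lo))"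
        by (rule end_of_fibre[OF f ends(1), of 1]) (use vt lt in auto)
      then show ?thesis using labk[of 0] ws0 n3 1 by simp
    next
      case 2
      have "simple_end \<S> i (P c hi) (point_arcs (P c hi)) \<or> corner_end \<S> D i (P c hi) (point_arcs (P c hi))"
        by (rule end_of_fibre[OF f ends(2), of "- 1"]) (use vt lt in auto)
      then show ?thesis using labk[of "n - 1"] wsn n3 2 by simp
    qed
  qed
  have I: "thru (P c (ws ! k)) = {C k}" "C k \<in> \<S>" "ws ! k = cy (C k)" "\<bar>c - cx (C k)\<bar> = snd (C k)"
    "lo < ws ! k" "ws ! k < hi" "ws ! k \<in> cpoints c lo hi"
    if k: "k \<in> {0<..<n - 1}" for k
  proof -
    have w: "lo < ws ! k" "ws ! k < hi" "ws ! k \<in> cpoints c lo hi" using sc(8)[of k] k by (auto simp: n_def)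
    obtain U where U: "thru (P c (ws ! k)) = {U}" "U \<in> \<S>" "ws ! k = cy U" "\<bar>c - cx U\<bar> = snd U"
      using interior_cpoint[OF f w] by metis
    have "C k = U" unfolding C_def U(1) by simp
    then show "thru (P c (ws ! k)) = {C k}" "C k \<in> \<S>" "ws ! k = cy (C k)" "\<bar>c - cx (C k)\<bar> = snd (C k)"
      using U by auto
    show "lo < ws ! k" "ws ! k < hi" "ws ! k \<in> cpoints c lo hi" using w by auto
  qed
  have kn: "k < n" if "k \<in> {0<..<n - 1}" for k using that by auto
  have labC: "vertex_label v ! k = arcs_at (C k) (P c (ws ! k))" if k: "k \<in> {0<..<n - 1}" for k
    using labk(1)[OF kn[OF k]] by (simp add: point_arcs_def I(1)[OF k])
  have mm: "vertex_label v ! k = (if c < cx (C k) then min_arcs i (C k) else max_arcs i (C k))"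
    if k: "k \<in> {0<..<n - 1}" for k
  proof -
    have "C k \<in> thru (P c (ws ! k))" using I(1)[OF k] by simp
    note p = pole_arcs(1,2,4)[OF this I(3)[OF k]]
    show ?thesis unfolding labC[OF k] using p by (cases "c < cx (C k)") auto
  qed
  have mid: "circles_through \<S> (xs ! k) = {C k} \<and> carriers \<S> (vertex_label v ! k) = {C k} \<and>
               (vertex_label v ! k = min_arcs i (C k) \<or> vertex_label v ! k = max_arcs i (C k)) \<and>
               C k \<notin> circles_through \<S> (xs ! 0) \<union> circles_through \<S> (xs ! (n - 1))"
    if k: "k \<in> {0<..<n - 1}" for k
  proof (intro conjI)
    show "circles_through \<S> (xs ! k) = {C k}" using labk(2)[OF kn[OF k]] I(1)[OF k] by simp
    have "P c (ws ! k) \<in> circ (C k)" using I(1)[OF k] thru_iff by blast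
    then show "carriers \<S> (vertex_label v ! k) = {C k}"
      unfolding labC[OF k] arcs_at_eq_arcs_meeting by (intro carriers_arcs_meeting I(2)[OF k]) auto
    show "vertex_label v ! k = min_arcs i (C k) \<or> vertex_label v ! k = max_arcs i (C k)" using mm[OF k] by simp
    \<comment> \<open>A circle touching the vertical line at a pole meets that line nowhere
      else.\<close>
    have no: "C k \<notin> thru (P c w)" if w: "w \<noteq> ws ! k" for w
    proof
      assume "C k \<in> thru (P c w)"
      then have "(c - cx (C k))\<^sup>2 + (w - cy (C k))\<^sup>2 = (snd (C k))\<^sup>2"
        using circ_iff[OF I(2)[OF k], of "P c w"] by (simp add: thru_iff)
      moreover have "(c - cx (C k))\<^sup>2 = (snd (C k))\<^sup>2" using I(4)[OF k] by (metis power2_abs)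
      ultimately have "w = cy (C k)" by simp
      then show False using w I(3)[OF k] by simp
    qed
    have "xs ! 0 = P c lo" "xs ! (n - 1) = P c hi" using labk(2)[of 0] labk(2)[of "n - 1"] ws0 wsn n3 by auto
    then show "C k \<notin> circles_through \<S> (xs ! 0) \<union> circles_through \<S> (xs ! (n - 1))"
      using no[of lo] no[of hi] I(5,6)[OF k] by simp
  qed
  have inj: "inj_on C {0<..<n - 1}"
  proof (rule inj_onI)
    fix j k assume jk: "j \<in> {0<..<n - 1}" "k \<in> {0<..<n - 1}" "C j = C k"
    then have "ws ! j = ws ! k" using I(3)[OF jk(1)] I(3)[OF jk(2)] by simp
    then show "j = k" using sc(3) kn[OF jk(1)] kn[OF jk(2)] by (simp add: nth_eq_iff_index_eq n_def)
  qed
  have inj_ws: "inj_on ((!) ws) A" if "A \<subseteq> {0<..<n - 1}" for A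
    using that kn by (intro inj_on_nth[OF sc(3)]) (auto simp: n_def)
  \<comment> \<open>Positions in the sorted list are translated into heights; leaving out the first
    and last position removes exactly the two ends of the fibre.\<close>
  have count: "card {k \<in> {0<..<n - 1}. s * (cx (C k) - c) > 0} = card (sided s c lo hi)" for s
  proof -
    have "(!) ws ` {k \<in> {0<..<n - 1}. s * (cx (C k) - c) > 0} = sided s c lo hi"
    proof (intro set_eqI iffI)
      fix w assume "w \<in> (!) ws ` {k \<in> {0<..<n - 1}. s * (cx (C k) - c) > 0}"
      then obtain k where k: "k \<in> {0<..<n - 1}" "s * (cx (C k) - c) > 0" "w = ws ! k" by blast
      then show "w \<in> sided s c lo hi" using I[OF k(1)] by (simp add: sided_def)
    next
      fix w assume w: "w \<in> sided s c lo hi"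
      then have wW: "w \<in> cpoints c lo hi" "lo < w" "w < hi" by (auto simp: sided_def)
      then obtain k where k: "k < n" "w = ws ! k" using sc(1) by (metis in_set_conv_nth n_def)
      have "k \<noteq> 0"
      proof
        assume "k = 0"
        then show False using k(2) ws0 wW(2) by simp
      qed
      moreover have "k \<noteq> n - 1"
      proof
        assume "k = n - 1"
        then show False using k(2) wsn wW(3) by simp
      qed
      ultimately have kk: "k \<in> {0<..<n - 1}" using k(1) by auto
      moreover have "s * (cx (C k) - c) > 0" using w I(1)[OF kk] k(2) by (simp add: sided_def)
      ultimately show "w \<in> (!) ws ` {k \<in> {0<..<n - 1}. s * (cx (C k) - c) > 0}" using k(2) by blast
    qed
    moreover have "inj_on ((!) ws) {k \<in> {0<..<n - 1}. s * (cx (C k) - c) > 0}" by (rule inj_ws) auto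
    note card_image[OF this]
    ultimately show ?thesis by simp
  qed
  have "{k \<in> {0<..<n - 1}. vertex_label v ! k = min_arcs i (C k)} = {k \<in> {0<..<n - 1}. 1 * (cx (C k) - c) > 0}"
  proof (intro Collect_cong conj_cong refl)
    fix k assume k: "k \<in> {0<..<n - 1}"
    show "vertex_label v ! k = min_arcs i (C k) \<longleftrightarrow> 1 * (cx (C k) - c) > 0"
      using min_arcs_neq_max_arcs[OF I(2)[OF k]] unfolding mm[OF k] by simp
  qed
  then have out: "card {k \<in> {0<..<n - 1}. vertex_label v ! k = min_arcs i (C k)} + 1 = out_degree \<S> D i v"
    using count[of 1] card_germs[OF f lt, of 1] out_degree_eq(1)[OF f] by simp
  have "{k \<in> {0<..<n - 1}. vertex_label v ! k = max_arcs i (C k)} = {k \<in> {0<..<n - 1}. - 1 * (cx (C k) - c) > 0}"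
  proof (intro Collect_cong conj_cong refl)
    fix k assume k: "k \<in> {0<..<n - 1}"
    have "cx (C k) \<noteq> c" using I(4)[OF k] radius_pos[OF I(2)[OF k]] by auto
    then show "vertex_label v ! k = max_arcs i (C k) \<longleftrightarrow> - 1 * (cx (C k) - c) > 0"
      using min_arcs_neq_max_arcs[OF I(2)[OF k]] unfolding mm[OF k] by auto
  qed
  then have inn: "card {k \<in> {0<..<n - 1}. vertex_label v ! k = max_arcs i (C k)} + 1 = in_degree \<S> D i v"
    using count[of "- 1"] card_germs[OF f lt, of "- 1"] in_degree_eq(1)[OF f] by simp
  have "length xs = n" "length (vertex_label v) = n" by (simp_all add: xs_def lab n_def)
  then show ?thesis
    by (intro exI[of _ n] exI[of _ xs] exI[of _ C] conjI ballI nd n3 lio e mid inj out inn)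
qed

text \<open>A circle meets the vertical line in two different points only symmetrically to its
  centre, so the lower point lies in the first half and the upper one in the second. Neither is a
  pole in direction \<open>i\<close>, whereas every inner circle point is one; hence both are ends
  of the fibre.\<close>

lemma vertex_label_same_circle:
  assumes v: "v \<in> V" and S: "S \<in> \<S>" and j: "j1 < j2" "j2 < length (vertex_label v)"
    and a: "a < 8" "arc8 S a \<in> vertex_label v ! j1" and b: "b < 8" "arc8 S b \<in> vertex_label v ! j2"
  shows "a \<in> first_half i" "b \<in> second_half i" "j1 = 0" "j2 = length (vertex_label v) - 1"
proof -
  obtain c lo hi where f: "vertex_fibre v c lo hi" using vertex_fibre_exists[OF v] .
  define ws where "ws = sorted_list_of_set (cpoints c lo hi)"
  have lab: "vertex_label v = map (\<lambda>w. point_arcs (P c w)) ws" unfolding ws_def by (rule vertex_label_eq[OF f])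
  have lt: "lo < hi"
  proof (rule ccontr)
    assume "\<not> lo < hi"
    then have "cpoints c lo hi \<subseteq> {lo}" by (auto simp: cpoints_def)
    then have "card (cpoints c lo hi) \<le> 1" using card_mono[of "{lo}"] by fastforce
    then show False using j lab finite_cpoints[OF f] by (simp add: ws_def)
  qed
  note sc = sorted_cpoints[OF f lt, folded ws_def]
  have len: "length (vertex_label v) = length ws" by (simp add: lab)
  have th: "S \<in> thru (P c (ws ! k)) \<and> arc8 S d \<in> arcs_at S (P c (ws ! k))"
    if d: "d < 8" "arc8 S d \<in> vertex_label v ! k" "k < length ws" for d k
  proof -
    obtain T where T: "T \<in> thru (P c (ws ! k))" "arc8 S d \<in> arcs_at T (P c (ws ! k))"
      using d by (auto simp: lab point_arcs_def)
    then obtain m where m: "m < 8" "arc8 S d = arc8 T m" by (auto simp: arcs_at_def)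
    have "T \<in> \<S>" using T(1) by (simp add: thru_iff)
    then have "S = T" using arc8_eq_iff[of S T d m] radius_pos S m d(1) by auto
    then show ?thesis using T by simp
  qed
  define w1 where "w1 = ws ! j1"
  define w2 where "w2 = ws ! j2"
  have lj: "j1 < length ws" "j2 < length ws" using j len by auto
  have t1: "S \<in> thru (P c w1)" "arc8 S a \<in> arcs_at S (P c w1)" using th[OF a lj(1)] by (auto simp: w1_def)
  have t2: "S \<in> thru (P c w2)" "arc8 S b \<in> arcs_at S (P c w2)" using th[OF b lj(2)] by (auto simp: w2_def)
  have w12: "w1 < w2" using sc(5)[OF j(1) lj(2)] by (simp add: w1_def w2_def)
  have "(c - cx S)\<^sup>2 + (w1 - cy S)\<^sup>2 = (c - cx S)\<^sup>2 + (w2 - cy S)\<^sup>2"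
    using t1(1) t2(1) circ_iff[OF S, of "P c w1"] circ_iff[OF S, of "P c w2"] by (simp add: thru_iff)
  then have "(w1 - cy S)\<^sup>2 = (w2 - cy S)\<^sup>2" by simp
  then have "w1 - cy S = - (w2 - cy S)" using w12 by (auto simp: power2_eq_iff)
  then have s: "w1 < cy S" "cy S < w2" using w12 by auto
  have half: "d \<in> half_indices i (w > cy S)" if d: "d < 8" "arc8 S d \<in> arcs_at S (P c w)" "S \<in> thru (P c w)" "w \<noteq> cy S" for d w
  proof -
    have "arc8 S d \<in> arc8 S ` half_indices i (w > cy S)" using nonpole_arcs(3)[OF d(3,4)] d(2) by (rule subsetD)
    then obtain m where m: "arc8 S d = arc8 S m" "m \<in> half_indices i (w > cy S)" by (rule imageE)
    from m(2) have "m < 8" by (auto simp: half_indices_eq)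
    from arc8_eq_iff[OF radius_pos[OF S] radius_pos[OF S] d(1) this] m show ?thesis by simp
  qed
  show "a \<in> first_half i" using half[OF a(1) t1(2,1)] s by (simp add: half_indices_def)
  show "b \<in> second_half i" using half[OF b(1) t2(2,1)] s by (simp add: half_indices_def)
  have inner: False if k: "0 < k" "k < length ws - 1" "S \<in> thru (P c (ws ! k))" "ws ! k \<noteq> cy S" for k
  proof -
    have w: "lo < ws ! k" "ws ! k < hi" "ws ! k \<in> cpoints c lo hi" using sc(8)[OF k(1,2)] by auto
    obtain U where "thru (P c (ws ! k)) = {U}" "ws ! k = cy U" using interior_cpoint[OF f w] by metis
    then show False using k by auto
  qed
  show "j1 = 0"
  proof (rule ccontr)
    assume "j1 \<noteq> 0"
    then have "0 < j1" "j1 < length ws - 1" using j(1) lj by auto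
    then show False using inner[of j1] t1(1) s by (simp add: w1_def)
  qed
  show "j2 = length (vertex_label v) - 1"
  proof (rule ccontr)
    assume "j2 \<noteq> length (vertex_label v) - 1"
    then have "0 < j2" "j2 < length ws - 1" using j(1) lj len by auto
    then show False using inner[of j2] t2(1) s by (simp add: w2_def)
  qed
qed

section \<open>Edge labels\<close>

definition edge_label :: "(real^2) set set \<Rightarrow> (real^2) set set list" where
  "edge_label e = (SOME L. \<exists>S T a b. is_strip S T a b \<and> e = q ` strip S T a b \<and>
     L = [arcs_meeting S ((\<lambda>c. P c (lower S c)) ` {a<..<b}), arcs_meeting T ((\<lambda>c. P c (upper T c)) ` {a<..<b})])"

lemma edge_label:
  assumes e: "e \<in> reeb_edges \<S> D i"
  obtains C1 C2 S1 S2 where "edge_curves \<S> D i e C1 C2 S1 S2"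
    "edge_label e = [arcs_meeting S1 C1, arcs_meeting S2 C2]" "S1 \<in> \<S>" "S2 \<in> \<S>"
    "card (arcs_meeting S1 C1) \<le> 4" "card (arcs_meeting S2 C2) \<le> 4"
    "carriers \<S> (arcs_meeting S1 C1) = {S1}" "carriers \<S> (arcs_meeting S2 C2) = {S2}"
    "arc_rule i S1 (arcs_meeting S1 C1)" "arc_rule i S2 (arcs_meeting S2 C2)"
    "S1 = S2 \<longrightarrow> arcs_meeting S1 C1 \<subseteq> arc8 S1 ` first_half i \<and> arcs_meeting S2 C2 \<subseteq> arc8 S2 ` second_half i"
proof -
  let ?Q = "\<lambda>L. \<exists>S T a b. is_strip S T a b \<and> e = q ` strip S T a b \<and>
     L = [arcs_meeting S ((\<lambda>c. P c (lower S c)) ` {a<..<b}), arcs_meeting T ((\<lambda>c. P c (upper T c)) ` {a<..<b})]"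
  obtain S' T' a' b' where "is_strip S' T' a' b'" "e = q ` strip S' T' a' b'" using e by (auto simp: reeb_edges_eq)
  then have "\<exists>L. ?Q L" by blast
  then have "?Q (edge_label e)" unfolding edge_label_def by (rule someI_ex)
  then obtain S T a b where s: "is_strip S T a b" "e = q ` strip S T a b"
    "edge_label e = [arcs_meeting S ((\<lambda>c. P c (lower S c)) ` {a<..<b}), arcs_meeting T ((\<lambda>c. P c (upper T c)) ` {a<..<b})]"
    by blast
  define C1 where "C1 = (\<lambda>c. P c (lower S c)) ` {a<..<b}"
  define C2 where "C2 = (\<lambda>c. P c (upper T c)) ` {a<..<b}"
  note ec = edge_curves_strip[OF s(1), folded C1_def C2_def s(2)]
  have ST: "S \<in> \<S>" "T \<in> \<S>" using strip_mid[OF s(1)] by auto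
  note r = radius_pos[OF ST(1)] radius_pos[OF ST(2)]
  have sub: "C1 \<subseteq> circ S" "C2 \<subseteq> circ T" using ec(2,3) by (auto simp: strict_half_def)
  note l1 = arc_rule_half[OF r(1) ec(2,4,6)] and l2 = arc_rule_half[OF r(2) ec(3,5,7)]
  have "arcs_meeting S C1 \<subseteq> arc8 S ` first_half i \<and> arcs_meeting T C2 \<subseteq> arc8 T ` second_half i" if eq: "S = T"
  proof -
    have "\<sigma> S = 1" "\<sigma> T = 1" using ec(8) eq by auto
    then show ?thesis
      using arcs_meeting_subset_half[OF r(1) ec(2)] arcs_meeting_subset_half[OF r(2) ec(3)]
      by (simp add: half_indices_def)
  qed
  then show ?thesis
    using that[OF ec(1) s(3)[folded C1_def C2_def] ST l1(2) l2(2)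
      carriers_arcs_meeting[OF ST(1) sub(1) ec(6)] carriers_arcs_meeting[OF ST(2) sub(2) ec(7)] l1(1) l2(1)]
    by blast
qed

lemma edge_label_arcs:
  assumes e: "e \<in> reeb_edges \<S> D i" and F: "F \<in> set (edge_label e)"
  shows "finite F" "A \<in> F \<Longrightarrow> \<exists>S\<in>\<S>. \<exists>j<8. A = arc8 S j \<and> A \<inter> reeb_preimage D i (Inr e) \<noteq> {}"
proof -
  obtain C1 C2 S1 S2 where l: "edge_curves \<S> D i e C1 C2 S1 S2"
    "edge_label e = [arcs_meeting S1 C1, arcs_meeting S2 C2]" "S1 \<in> \<S>" "S2 \<in> \<S>"
    using edge_label[OF e] by metis
  have F': "F = arcs_meeting S1 C1 \<or> F = arcs_meeting S2 C2" using F l(2) by auto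
  then show "finite F" by auto
  have "C1 \<subseteq> reeb_preimage D i (Inr e)" "C2 \<subseteq> reeb_preimage D i (Inr e)"
    using l(1) unfolding edge_curves_def by blast+
  then show "\<exists>S\<in>\<S>. \<exists>j<8. A = arc8 S j \<and> A \<inter> reeb_preimage D i (Inr e) \<noteq> {}" if "A \<in> F"
    using F' that l(3,4) unfolding arcs_meeting_def by blast
qed

lemma edge_label_same_circle:
  assumes e: "e \<in> reeb_edges \<S> D i" and S: "S \<in> \<S>" and j: "j1 < j2" "j2 < length (edge_label e)"
    and a: "a < 8" "arc8 S a \<in> edge_label e ! j1" and b: "b < 8" "arc8 S b \<in> edge_label e ! j2"
  shows "a \<in> first_half i" "b \<in> second_half i" "j1 = 0" "j2 = length (edge_label e) - 1"
proof -
  obtain C1 C2 S1 S2 where l: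
    "edge_label e = [arcs_meeting S1 C1, arcs_meeting S2 C2]" "S1 \<in> \<S>" "S2 \<in> \<S>"
    "S1 = S2 \<longrightarrow> arcs_meeting S1 C1 \<subseteq> arc8 S1 ` first_half i \<and> arcs_meeting S2 C2 \<subseteq> arc8 S2 ` second_half i"
    using edge_label[OF e] by metis
  have len: "length (edge_label e) = 2" using l(1) by simp
  show j1: "j1 = 0" and j2: "j2 = length (edge_label e) - 1" using j len by auto
  have eq: "S = U" if d: "d < 8" "arc8 S d \<in> arcs_meeting U C" "U \<in> \<S>" for d U C
  proof -
    obtain m where "m < 8" "arc8 S d = arc8 U m" using d(2) by (auto simp: arcs_meeting_def)
    then show ?thesis using arc8_eq_iff[of S U d m] radius_pos S d by auto
  qed
  have a': "arc8 S a \<in> arcs_meeting S1 C1" using a(2) l(1) j1 by simp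
  have b': "arc8 S b \<in> arcs_meeting S2 C2" using b(2) l(1) j2 len by simp
  have e12: "S = S1" "S = S2" using eq[OF a(1) a' l(2)] eq[OF b(1) b' l(3)] .
  have half: "d \<in> half_indices i up" if d: "d < 8" "arc8 S d \<in> arc8 S ` half_indices i up" for d up
  proof -
    obtain m where m: "arc8 S d = arc8 S m" "m \<in> half_indices i up" using d(2) by (rule imageE)
    from m(2) have "m < 8" by (auto simp: half_indices_eq)
    from arc8_eq_iff[OF radius_pos[OF S] radius_pos[OF S] d(1) this] m show ?thesis by simp
  qed
  have sub: "arcs_meeting S1 C1 \<subseteq> arc8 S ` first_half i" "arcs_meeting S2 C2 \<subseteq> arc8 S ` second_half i"
    using l(4) e12 by auto
  show "a \<in> first_half i" using half[OF a(1), of False] subsetD[OF sub(1) a'] by (simp add: half_indices_def)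
  show "b \<in> second_half i" using half[OF b(1), of True] subsetD[OF sub(2) b'] by (simp add: half_indices_def)
qed

end

section \<open>NI arrangements\<close>

text \<open>Dependent radius vectors have the same orthogonal line, so the two tangent lines
  together span only that line. The algebraic identity below expresses orthogonality to
  \<open>b\<close> through orthogonality to \<open>a\<close> and the determinant.\<close>

lemma not_subset_tangent:
  fixes a b :: "real^2"
  assumes cr: "cross i a b = 0" and ne: "a \<noteq> 0" "b \<noteq> 0"
  shows "span ({v. v \<bullet> a = 0} \<union> {v. v \<bullet> b = 0}) \<noteq> UNIV"
proof -
  have "v \<bullet> b = 0" if v: "v \<bullet> a = 0" for v
  proof -
    have "(a1 * a1 + a2 * a2) * (v1 * b1 + v2 * b2) - (a1 * b1 + a2 * b2) * (v1 * a1 + v2 * a2)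
       = (a1 * v2 - a2 * v1) * (a1 * b2 - a2 * b1)" for a1 a2 b1 b2 v1 v2 :: real
      by (simp add: algebra_simps)
    from this[of "a $ i" "a $ other_index i" "v $ i" "b $ i" "v $ other_index i" "b $ other_index i"]
    have "(a \<bullet> a) * (v \<bullet> b) - (a \<bullet> b) * (v \<bullet> a) = (a $ i * v $ other_index i - a $ other_index i * v $ i) * cross i a b"
      by (simp only: inner_index[of _ _ i] cross_def)
    then show ?thesis using cr v ne(1) by simp
  qed
  then have "{v. v \<bullet> a = 0} \<union> {v. v \<bullet> b = 0} \<subseteq> {v. v \<bullet> b = 0}" by blast
  moreover have "subspace {v. v \<bullet> b = 0}" by (simp add: subspace_def inner_add_left)
  ultimately have "span ({v. v \<bullet> a = 0} \<union> {v. v \<bullet> b = 0}) \<subseteq> {v. v \<bullet> b = 0}"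
    by (rule span_minimal)
  then have "span ({v. v \<bullet> a = 0} \<union> {v. v \<bullet> b = 0}) \<noteq> UNIV" if "b \<bullet> b \<noteq> 0" using that by blast
  then show ?thesis using ne(2) by simp
qed

lemma square_less_iff: "0 \<le> a \<Longrightarrow> 0 \<le> b \<Longrightarrow> a\<^sup>2 < b\<^sup>2 \<longleftrightarrow> a < b" for a b :: real
  using power_mono_iff[of b a 2] by linarith

lemma cross_swap: "cross i a b = - cross i b a"
  by (simp add: cross_def algebra_simps)

text \<open>Near a circle of the initial family, the domain contains a full one-sided annulus.\<close>

lemma initial_arrangement:
  assumes fin: "finite \<S>" and pos: "\<forall>S\<in>\<S>. snd S > 0"
    and disj: "\<forall>S\<in>\<S>. \<forall>T\<in>\<S>. S \<noteq> T \<longrightarrow> circ S \<inter> circ T = {}"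
    and D: "D \<in> components (- (\<Union>S\<in>\<S>. circ S))" "bounded D"
  shows "\<exists>\<sigma>. circle_arrangement \<S> D \<sigma> i"
proof -
  let ?C = "\<Union>S\<in>\<S>. circ S"
  define \<sigma> :: "circle \<Rightarrow> real" where "\<sigma> S = (if D \<subseteq> ball (fst S) (snd S) then 1 else - 1)" for S
  have clC: "closed ?C" using fin by (auto simp: circ_def)
  have conD: "connected D" and neD: "D \<noteq> {}" and DC: "D \<inter> ?C = {}"
    using D(1) in_components_connected in_components_nonempty in_components_subset by blast+
  have sd: "\<sigma> S * ((dist y (fst S))\<^sup>2 - (snd S)\<^sup>2) < 0" if S: "S \<in> \<S>" and y: "y \<in> D" for S y
  proof -
    have r: "snd S > 0" using pos S by blast
    \<comment> \<open>A connected set avoiding the circle lies wholly inside or wholly outside; this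
      makes the sign a property of the whole domain.\<close>
    have "D \<subseteq> ball (fst S) (snd S) \<or> D \<subseteq> - cball (fst S) (snd S)"
    proof -
      have "D \<subseteq> ball (fst S) (snd S) \<union> - cball (fst S) (snd S)"
        using DC S by (force simp: circ_def)
      moreover have "ball (fst S) (snd S) \<inter> - cball (fst S) (snd S) \<inter> D = {}" by auto
      ultimately show ?thesis
        using connectedD[OF conD open_ball, of "- cball (fst S) (snd S)" "fst S" "snd S"] by blast
    qed
    then have "\<sigma> S = 1 \<and> dist y (fst S) < snd S \<or> \<sigma> S = - 1 \<and> snd S < dist y (fst S)"
    proof
      assume "D \<subseteq> ball (fst S) (snd S)"
      then show ?thesis using subsetD[OF _ y, of "ball (fst S) (snd S)"] by (simp add: \<sigma>_def dist_commute)
    next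
      assume "D \<subseteq> - cball (fst S) (snd S)"
      then have "snd S < dist y (fst S)" using subsetD[OF _ y, of "- cball (fst S) (snd S)"] by (simp add: dist_commute)
      moreover from this have "\<not> D \<subseteq> ball (fst S) (snd S)" using subsetD[OF _ y, of "ball (fst S) (snd S)"]
        by (auto simp: dist_commute)
      ultimately show ?thesis by (simp add: \<sigma>_def)
    qed
    then consider "\<sigma> S = 1" "dist y (fst S) < snd S" | "\<sigma> S = - 1" "snd S < dist y (fst S)" by blast
    then show ?thesis
    proof cases
      case 1
      then show ?thesis by (simp add: power_strict_mono)
    next
      case 2
      then show ?thesis using r by (simp add: power_strict_mono)
    qed
  qed
  have one: "T = S" if "S \<in> circles_through \<S> p" "T \<in> circles_through \<S> p" for S T p
    using that disj by (auto simp: circles_through_def)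
  have loc: "\<exists>r>0. \<forall>y\<in>ball p r. y \<in> D \<longleftrightarrow> (\<forall>S\<in>circles_through \<S> p. \<sigma> S * ((dist y (fst S))\<^sup>2 - (snd S)\<^sup>2) < 0)"
    if p: "p \<in> closure D" for p
  proof (cases "circles_through \<S> p = {}")
    case True
    then have "p \<in> - ?C" by (auto simp: circles_through_def)
    moreover have "open (- ?C)" using clC by (rule open_Compl)
    ultimately obtain r where r: "r > 0" "ball p r \<subseteq> - ?C" using open_contains_ball by blast
    have "p \<in> closure D" "open (ball p r)" "p \<in> ball p r" using p r(1) by auto
    then have "D \<inter> ball p r \<noteq> {}" using closure_iff_nhds_not_empty[of p D] by blast
    then have "ball p r \<subseteq> D" using components_maximal[OF D(1) _ r(2)] by auto
    then show ?thesis using r(1) True by (intro exI[of _ r]) auto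
  next
    case False
    then obtain S where S: "S \<in> circles_through \<S> p" by blast
    then have th: "circles_through \<S> p = {S}" using one by blast
    have S': "S \<in> \<S>" "p \<in> circ S" using S by (auto simp: circles_through_def)
    have r: "snd S > 0" using pos S'(1) by blast
    let ?F = "\<Union>T\<in>\<S> - {S}. circ T"
    have "compact (circ S)" by (simp add: circ_def)
    moreover have "closed ?F" using fin by (auto simp: circ_def)
    moreover have "circ S \<inter> ?F = {}" using disj S'(1) by fastforce
    ultimately obtain d where d: "d > 0" "\<And>x y. x \<in> circ S \<Longrightarrow> y \<in> ?F \<Longrightarrow> d \<le> dist x y"
      using separate_compact_closed by metis
    \<comment> \<open>The distance from \<open>S\<close> to the other circles, capped by the radius
      so that the annulus does not reach the centre and the radial projection onto \<open>S\<close>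
      is defined.\<close>
    define \<rho> where "\<rho> = min d (snd S)"
    have \<rho>: "\<rho> > 0" "\<rho> \<le> d" "\<rho> \<le> snd S" using d(1) r by (auto simp: \<rho>_def)
    have off: "y \<notin> ?F" if y: "\<bar>norm (y - fst S) - snd S\<bar> < \<rho>" for y
    proof
      assume yF: "y \<in> ?F"
      define n where "n = norm (y - fst S)"
      have n: "n > 0" using y \<rho>(3) r by (auto simp: n_def)
      define z where "z = fst S + (snd S / n) *\<^sub>R (y - fst S)"
      have "norm ((snd S / n) *\<^sub>R (y - fst S)) = snd S" using n r by (simp add: n_def[symmetric])
      then have "z \<in> circ S" by (simp add: z_def circ_def dist_norm)
      then have "d \<le> dist z y" using d(2) yF by blast
      also have "z - y = (snd S / n - 1) *\<^sub>R (y - fst S)" by (simp add: z_def algebra_simps)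
      then have "dist z y = \<bar>snd S / n - 1\<bar> * n" by (simp add: dist_norm n_def)
      also have "\<dots> = \<bar>(snd S / n - 1) * n\<bar>" using n by (simp add: abs_mult)
      also have "(snd S / n - 1) * n = snd S - n" using n by (simp add: left_diff_distrib)
      finally show False using y \<rho>(2) by (simp add: n_def abs_minus_commute)
    qed
    \<comment> \<open>The annulus along \<open>S\<close> on the side of the domain. It is connected
      and meets no circle, so it lies in the component \<open>D\<close> as soon as it contains one
      of its points.\<close>
    define A where "A = (if \<sigma> S = 1 then {y. snd S - \<rho> < norm (y - fst S) \<and> norm (y - fst S) < snd S}
       else {y. snd S < norm (y - fst S) \<and> norm (y - fst S) < snd S + \<rho>})"
    have conA: "connected A" by (auto simp: A_def intro!: connected_annulus)
    have A_iff: "y \<in> A \<longleftrightarrow> \<sigma> S * ((dist y (fst S))\<^sup>2 - (snd S)\<^sup>2) < 0"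
      if y: "\<bar>norm (y - fst S) - snd S\<bar> < \<rho>" for y
    proof -
      have "(dist y (fst S))\<^sup>2 < (snd S)\<^sup>2 \<longleftrightarrow> norm (y - fst S) < snd S"
        using r by (simp add: dist_norm square_less_iff)
      moreover have "(dist y (fst S))\<^sup>2 > (snd S)\<^sup>2 \<longleftrightarrow> norm (y - fst S) > snd S"
        using r by (simp add: dist_norm square_less_iff)
      ultimately show ?thesis using y by (auto simp: A_def \<sigma>_def abs_less_iff)
    qed
    have AC: "A \<subseteq> - ?C"
    proof
      fix y assume y: "y \<in> A"
      then have "\<bar>norm (y - fst S) - snd S\<bar> < \<rho>" "norm (y - fst S) \<noteq> snd S"
        using \<rho>(1) by (auto simp: A_def split: if_splits)
      then have "y \<notin> ?F" "y \<notin> circ S" using off by (auto simp: circ_def dist_norm norm_minus_commute)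
      then show "y \<in> - ?C" by blast
    qed
    have near: "\<bar>norm (y - fst S) - snd S\<bar> < \<rho>" if "y \<in> ball p \<rho>" for y
    proof -
      have "norm (p - fst S) = snd S" using S'(2) by (simp add: circ_def dist_norm norm_minus_commute)
      moreover have "\<bar>norm (y - fst S) - norm (p - fst S)\<bar> \<le> norm (y - p)"
        using norm_triangle_ineq3[of "y - fst S" "p - fst S"] by simp
      ultimately show ?thesis using that by (simp add: dist_norm norm_minus_commute)
    qed
    have "D \<inter> ball p \<rho> \<noteq> {}"
      using closure_iff_nhds_not_empty[of p D] p \<rho>(1) by (metis centre_in_ball open_ball order_refl)
    then obtain z where z: "z \<in> D" "z \<in> ball p \<rho>" by blast
    then have "z \<in> A" using A_iff[OF near[OF z(2)]] sd[OF S'(1) z(1)] by blast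
    then have "A \<subseteq> D" using components_maximal[OF D(1) conA AC] z(1) by blast
    then have "y \<in> D \<longleftrightarrow> \<sigma> S * ((dist y (fst S))\<^sup>2 - (snd S)\<^sup>2) < 0" if "y \<in> ball p \<rho>" for y
      using A_iff[OF near[OF that]] sd[OF S'(1)] by blast
    then show ?thesis using \<rho>(1) th by (intro exI[of _ \<rho>]) auto
  qed
  have "circle_arrangement \<S> D \<sigma> i"
  proof
    show "card (circles_through \<S> p) \<le> 2" if "p \<in> closure D" for p
    proof (cases "circles_through \<S> p = {}")
      case False
      then obtain S where "S \<in> circles_through \<S> p" by blast
      then have "circles_through \<S> p = {S}" using one by blast
      then show ?thesis by simp
    qed simp
    show "cross i (p - fst S) (p - fst T) \<noteq> 0"
      if "p \<in> closure D" "S \<in> circles_through \<S> p" "T \<in> circles_through \<S> p" "S \<noteq> T" for p S T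
      using one that by blast
  qed (use fin pos D(2) loc in \<open>auto simp: \<sigma>_def\<close>)
  then show ?thesis by blast
qed

text \<open>At a point of the new closure on \<open>S'\<close>, the new side is one more sign
  condition, at most one old circle passes, and spanning tangent lines give independent radius
  vectors. Off \<open>S'\<close> the point is interior to \<open>E\<close> and nothing changes
  locally.\<close>

lemma arrangement_step:
  assumes arr: "circle_arrangement \<S> D \<sigma> i" and r: "snd S' > 0" and new: "S' \<notin> \<S>"
    and tr: "\<forall>S\<in>\<S>. \<forall>p \<in> closure D \<inter> circ S' \<inter> circ S.
         span (tangent_space S' p \<union> tangent_space S p) = UNIV"
    and no3: "\<not> (\<exists>p\<in>closure D. p \<in> circ S' \<and>
           (\<exists>S\<in>\<S>. \<exists>T\<in>\<S>. S \<noteq> T \<and> p \<in> circ S \<and> p \<in> circ T))"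
    and E: "E = ball (fst S') (snd S') \<or> E = - cball (fst S') (snd S')"
  shows "\<exists>\<sigma>. circle_arrangement (insert S' \<S>) (D \<inter> E) \<sigma> i"
proof -
  interpret circle_arrangement \<S> D \<sigma> i by (rule arr)
  define s :: real where "s = (if E = ball (fst S') (snd S') then 1 else - 1)"
  define \<sigma>' where "\<sigma>' = \<sigma>(S' := s)"
  have Ey: "y \<in> E \<longleftrightarrow> s * ((dist y (fst S'))\<^sup>2 - (snd S')\<^sup>2) < 0" for y
  proof -
    have a: "(dist y (fst S'))\<^sup>2 < (snd S')\<^sup>2 \<longleftrightarrow> dist y (fst S') < snd S'"
      using r by (simp add: square_less_iff)
    have b: "(dist y (fst S'))\<^sup>2 > (snd S')\<^sup>2 \<longleftrightarrow> dist y (fst S') > snd S'"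
      using r by (simp add: square_less_iff)
    show ?thesis
    proof (cases "E = ball (fst S') (snd S')")
      case True
      then show ?thesis using a by (simp add: s_def dist_commute)
    next
      case False
      then have "E = - cball (fst S') (snd S')" using E by blast
      then show ?thesis using b False by (simp add: s_def dist_commute not_le)
    qed
  qed
  have openE: "open E" using E by auto
  have clE: "p \<in> E" if "p \<in> closure E" "p \<notin> circ S'" for p
    using E
  proof
    assume E1: "E = ball (fst S') (snd S')"
    then have "p \<in> cball (fst S') (snd S')" using that(1) closure_minimal[OF ball_subset_cball closed_cball] by blast
    then show ?thesis using that(2) E1 by (auto simp: circ_def)
  next
    assume E1: "E = - cball (fst S') (snd S')"
    have "closure (- cball (fst S') (snd S')) \<subseteq> - ball (fst S') (snd S')"
      by (rule closure_minimal) auto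
    then have "p \<notin> ball (fst S') (snd S')" using that(1) E1 by blast
    then show ?thesis using that(2) E1 by (auto simp: circ_def)
  qed
  have sub: "p \<in> closure D" "p \<in> closure E" if "p \<in> closure (D \<inter> E)" for p
    using that closure_mono[of "D \<inter> E" D] closure_mono[of "D \<inter> E" E] by auto
  have th: "circles_through (insert S' \<S>) p = (if p \<in> circ S' then insert S' (thru p) else thru p)" for p
    by (auto simp: circles_through_def)
  have old: "\<sigma>' S = \<sigma> S" if "S \<in> thru p" for S p
    using that new by (auto simp: \<sigma>'_def thru_iff)
  have cr: "cross i (p - fst S') (p - fst S) \<noteq> 0"
    if p: "p \<in> closure D" "p \<in> circ S'" "S \<in> thru p" for p S
  proof
    assume c: "cross i (p - fst S') (p - fst S) = 0"
    have S: "S \<in> \<S>" "p \<in> circ S" using p(3) by (auto simp: thru_iff)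
    have "p - fst S' \<noteq> 0" "p - fst S \<noteq> 0" using p(2) S r radius_pos[OF S(1)] by (auto simp: circ_def)
    from not_subset_tangent[OF c this] tr S p show False by (auto simp: tangent_space_def)
  qed
  have "circle_arrangement (insert S' \<S>) (D \<inter> E) \<sigma>' i"
  proof
    show "finite (insert S' \<S>)" using finite_circles by simp
    show "snd S > 0" if "S \<in> insert S' \<S>" for S using that r radius_pos[of S] by auto
    show "\<sigma>' S = 1 \<or> \<sigma>' S = - 1" if "S \<in> insert S' \<S>" for S
      using that side[of S] by (auto simp: \<sigma>'_def s_def)
    show "bounded (D \<inter> E)" using bounded_domain by (rule bounded_subset) blast
  next
    fix p assume p: "p \<in> closure (D \<inter> E)"
    obtain d where d: "d > 0" "\<And>y. y \<in> ball p d \<Longrightarrow> y \<in> D \<longleftrightarrow>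
        (\<forall>S\<in>thru p. \<sigma> S * ((dist y (fst S))\<^sup>2 - (snd S)\<^sup>2) < 0)"
      using local_domain[OF sub(1)[OF p]] by blast
    show "\<exists>r>0. \<forall>y\<in>ball p r. y \<in> D \<inter> E \<longleftrightarrow>
       (\<forall>S\<in>circles_through (insert S' \<S>) p. \<sigma>' S * ((dist y (fst S))\<^sup>2 - (snd S)\<^sup>2) < 0)"
    proof (cases "p \<in> circ S'")
      case True
      have "y \<in> D \<inter> E \<longleftrightarrow>
         (\<forall>S\<in>circles_through (insert S' \<S>) p. \<sigma>' S * ((dist y (fst S))\<^sup>2 - (snd S)\<^sup>2) < 0)"
        if "y \<in> ball p d" for y
        using d(2)[OF that] Ey[of y] old[of _ p] True by (simp add: th \<sigma>'_def conj_commute)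
      then show ?thesis using d(1) by blast
    next
      case False
      then have "p \<in> E" using clE sub(2)[OF p] by blast
      then obtain e where e: "e > 0" "ball p e \<subseteq> E" using openE open_contains_ball by blast
      have "y \<in> D \<inter> E \<longleftrightarrow>
         (\<forall>S\<in>circles_through (insert S' \<S>) p. \<sigma>' S * ((dist y (fst S))\<^sup>2 - (snd S)\<^sup>2) < 0)"
        if y: "y \<in> ball p (min d e)" for y
      proof -
        have "y \<in> E" using e(2) y by auto
        moreover have "y \<in> ball p d" using y by auto
        ultimately show ?thesis using d(2) old[of _ p] False by (simp add: th)
      qed
      then show ?thesis using d(1) e(1) by (intro exI[of _ "min d e"]) auto
    qed
    show "card (circles_through (insert S' \<S>) p) \<le> 2"
    proof (cases "p \<in> circ S'")
      case True
      have "S = T" if "S \<in> thru p" "T \<in> thru p" for S T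
        using no3 sub(1)[OF p] True that by (auto simp: thru_iff)
      then have "card (thru p) \<le> Suc 0" using card_le_Suc0_iff_eq[OF finite_thru] by blast
      then show ?thesis using True by (simp add: th card_insert_if)
    next
      case False
      then show ?thesis using at_most_two[OF sub(1)[OF p]] by (simp add: th)
    qed
    fix S T assume ST: "S \<in> circles_through (insert S' \<S>) p" "T \<in> circles_through (insert S' \<S>) p" "S \<noteq> T"
    show "cross i (p - fst S) (p - fst T) \<noteq> 0"
    proof (cases "S = S' \<or> T = S'")
      case True
      then have "p \<in> circ S'" using ST by (auto simp: circles_through_def)
      then show ?thesis
        using True ST cr[OF sub(1)[OF p], of S] cr[OF sub(1)[OF p], of T] cross_swap[of i "p - fst S" "p - fst T"]
        by (auto simp: th)
    next
      case False
      then have "S \<in> thru p" "T \<in> thru p" using ST by (auto simp: th split: if_splits)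
      then show ?thesis using transversal[OF sub(1)[OF p]] ST(3) by blast
    qed
  qed
  then show ?thesis by blast
qed

text \<open>The sign function is built along the induction: each step assigns a sign to the new
  circle and keeps the earlier ones, which stay valid because the domain only shrinks.\<close>

lemma NI_arrangement_imp_circle_arrangement:
  "NI_arrangement \<S> D \<Longrightarrow> \<exists>\<sigma>. circle_arrangement \<S> D \<sigma> i"
proof (induction rule: NI_arrangement.induct)
  case (start \<S> D)
  then show ?case using initial_arrangement by blast
next
  case (step \<S> D S' E)
  obtain \<sigma> where \<sigma>: "circle_arrangement \<S> D \<sigma> i" using step.IH by (rule exE)
  show ?case by (rule arrangement_step[OF \<sigma> step.hyps(2,3,5,6,7)])
qed

theorem theorem1:
  fixes \<S> :: "circle set" and D :: "(real^2) set" and i :: 2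
  assumes "NI_arrangement \<S> D"
  shows "\<exists>l :: (real^2) set + (real^2) set set \<Rightarrow> (real^2) set set list.
    (\<forall>s \<in> reeb_vertices \<S> D i <+> reeb_edges \<S> D i. \<forall>\<F> \<in> set (l s).
       finite \<F> \<and>
       (\<forall>A\<in>\<F>. \<exists>S\<in>\<S>. \<exists>j<8. A = arc8 S j \<and> A \<inter> reeb_preimage D i s \<noteq> {}))
    \<comment> \<open>(1)\<close>
    \<and> (\<forall>e \<in> reeb_edges \<S> D i. \<exists>C1 C2 S1 S2 \<F>1 \<F>2.
         edge_curves \<S> D i e C1 C2 S1 S2 \<and>
         l (Inr e) = [\<F>1, \<F>2] \<and>
         \<F>1 = arcs_meeting S1 C1 \<and> \<F>2 = arcs_meeting S2 C2 \<and>
         card \<F>1 \<le> 4 \<and> card \<F>2 \<le> 4 \<and>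
         carriers \<S> \<F>1 = {S1} \<and> carriers \<S> \<F>2 = {S2} \<and>
         arc_rule i S1 \<F>1 \<and> arc_rule i S2 \<F>2 \<and>
         (S1 = S2 \<longrightarrow> \<F>1 \<subseteq> arc8 S1 ` first_half i \<and> \<F>2 \<subseteq> arc8 S2 ` second_half i))
    \<comment> \<open>(2)\<close>
    \<and> (\<forall>v \<in> reeb_vertices \<S> D i. reeb_degree \<S> D i v = 1 \<longrightarrow>
         (\<exists>x \<F>. reeb_preimage D i (Inl v) = {x} \<and> l (Inl v) = [\<F>] \<and>
            (extremal_end \<S> i x \<F> \<or> extremal_corner \<S> D i x \<F>)))
    \<comment> \<open>(3)\<close>
    \<and> (\<forall>v \<in> reeb_vertices \<S> D i. reeb_degree \<S> D i v = 2 \<longrightarrow>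
         (\<exists>x1 x2 \<F>1 \<F>2.
            lists_in_order i (circle_points_over \<S> D i v) [x1, x2] \<and>
            l (Inl v) = [\<F>1, \<F>2] \<and>
            (simple_end \<S> i x1 \<F>1 \<or> corner_end \<S> D i x1 \<F>1) \<and>
            (simple_end \<S> i x2 \<F>2 \<or> corner_end \<S> D i x2 \<F>2) \<and>
            \<not> (simple_end \<S> i x1 \<F>1 \<and> simple_end \<S> i x2 \<F>2)))
    \<comment> \<open>(4)\<close>
    \<and> (\<forall>v \<in> reeb_vertices \<S> D i. reeb_degree \<S> D i v \<ge> 3 \<longrightarrow>
         (\<exists>n xs C.
            n = out_degree \<S> D i v + in_degree \<S> D i v \<and> n > 2 \<and>
            lists_in_order i (circle_points_over \<S> D i v) xs \<and>
            length xs = n \<and> length (l (Inl v)) = n \<and>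
            (\<forall>k \<in> {0, n - 1}. simple_end \<S> i (xs ! k) (l (Inl v) ! k) \<or>
                              corner_end \<S> D i (xs ! k) (l (Inl v) ! k)) \<and>
            (\<forall>k \<in> {0<..<n - 1}.
               circles_through \<S> (xs ! k) = {C k} \<and>
               carriers \<S> (l (Inl v) ! k) = {C k} \<and>
               (l (Inl v) ! k = min_arcs i (C k) \<or> l (Inl v) ! k = max_arcs i (C k)) \<and>
               C k \<notin> circles_through \<S> (xs ! 0) \<union> circles_through \<S> (xs ! (n - 1))) \<and>
            inj_on C {0<..<n - 1} \<and>
            card {k \<in> {0<..<n - 1}. l (Inl v) ! k = min_arcs i (C k)} + 1 = out_degree \<S> D i v \<and>
            card {k \<in> {0<..<n - 1}. l (Inl v) ! k = max_arcs i (C k)} + 1 = in_degree \<S> D i v))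
    \<comment> \<open>(5)\<close>
    \<and> (\<forall>s \<in> reeb_vertices \<S> D i <+> reeb_edges \<S> D i. \<forall>S\<in>\<S>. \<forall>j1 j2.
         j1 < j2 \<and> j2 < length (l s) \<and>
         (\<exists>a<8. arc8 S a \<in> l s ! j1) \<and> (\<exists>b<8. arc8 S b \<in> l s ! j2) \<longrightarrow>
         (\<forall>a<8. arc8 S a \<in> l s ! j1 \<longrightarrow> a \<in> first_half i) \<and>
         (\<forall>b<8. arc8 S b \<in> l s ! j2 \<longrightarrow> b \<in> second_half i) \<and>
         j1 = 0 \<and> j2 = length (l s) - 1)"
proof -
  obtain \<sigma> where "circle_arrangement \<S> D \<sigma> i"
    using NI_arrangement_imp_circle_arrangement[OF assms] by blast
  then interpret circle_arrangement \<S> D \<sigma> i .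
  let ?l = "case_sum vertex_label edge_label"
  have c0: "\<forall>s \<in> reeb_vertices \<S> D i <+> reeb_edges \<S> D i. \<forall>\<F> \<in> set (?l s).
       finite \<F> \<and>
       (\<forall>A\<in>\<F>. \<exists>S\<in>\<S>. \<exists>j<8. A = arc8 S j \<and> A \<inter> reeb_preimage D i s \<noteq> {})"
  proof (intro ballI)
    fix s \<F> assume "s \<in> reeb_vertices \<S> D i <+> reeb_edges \<S> D i" "\<F> \<in> set (?l s)"
    then show "finite \<F> \<and> (\<forall>A\<in>\<F>. \<exists>S\<in>\<S>. \<exists>j<8. A = arc8 S j \<and> A \<inter> reeb_preimage D i s \<noteq> {})"
    proof (elim PlusE)
      fix v assume v: "v \<in> reeb_vertices \<S> D i" "s = Inl v" "\<F> \<in> set (?l s)"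
      then have F: "\<F> \<in> set (vertex_label v)" by simp
      show ?thesis unfolding v(2) using vertex_label_arcs[OF v(1) F] by blast
    next
      fix e assume e: "e \<in> reeb_edges \<S> D i" "s = Inr e" "\<F> \<in> set (?l s)"
      then have F: "\<F> \<in> set (edge_label e)" by simp
      show ?thesis unfolding e(2) using edge_label_arcs[OF e(1) F] by blast
    qed
  qed
  have c5: "\<forall>s \<in> reeb_vertices \<S> D i <+> reeb_edges \<S> D i. \<forall>S\<in>\<S>. \<forall>j1 j2.
         j1 < j2 \<and> j2 < length (?l s) \<and>
         (\<exists>a<8. arc8 S a \<in> ?l s ! j1) \<and> (\<exists>b<8. arc8 S b \<in> ?l s ! j2) \<longrightarrow>
         (\<forall>a<8. arc8 S a \<in> ?l s ! j1 \<longrightarrow> a \<in> first_half i) \<and>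
         (\<forall>b<8. arc8 S b \<in> ?l s ! j2 \<longrightarrow> b \<in> second_half i) \<and>
         j1 = 0 \<and> j2 = length (?l s) - 1"
  proof (intro ballI allI impI)
    fix s S j1 j2
    assume s: "s \<in> reeb_vertices \<S> D i <+> reeb_edges \<S> D i" and S: "S \<in> \<S>"
      and h: "j1 < j2 \<and> j2 < length (?l s) \<and>
         (\<exists>a<8. arc8 S a \<in> ?l s ! j1) \<and> (\<exists>b<8. arc8 S b \<in> ?l s ! j2)"
    then obtain a0 b0 where j: "j1 < j2" "j2 < length (?l s)"
      and a0: "a0 < 8" "arc8 S a0 \<in> ?l s ! j1" and b0: "b0 < 8" "arc8 S b0 \<in> ?l s ! j2" by blast
    have "\<And>a b. a < 8 \<Longrightarrow> arc8 S a \<in> ?l s ! j1 \<Longrightarrow> b < 8 \<Longrightarrow> arc8 S b \<in> ?l s ! j2 \<Longrightarrow>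
       a \<in> first_half i \<and> b \<in> second_half i \<and> j1 = 0 \<and> j2 = length (?l s) - 1"
      using s
    proof (elim PlusE)
      fix v a b
      assume v: "v \<in> reeb_vertices \<S> D i" "s = Inl v" and a: "a < 8" "arc8 S a \<in> ?l s ! j1"
        and b: "b < 8" "arc8 S b \<in> ?l s ! j2"
      have ls: "?l s = vertex_label v" using v(2) by simp
      show "a \<in> first_half i \<and> b \<in> second_half i \<and> j1 = 0 \<and> j2 = length (?l s) - 1"
        unfolding ls using vertex_label_same_circle[OF v(1) S j(1) j(2)[unfolded ls] a[unfolded ls] b[unfolded ls]]
        by blast
    next
      fix e a b
      assume e: "e \<in> reeb_edges \<S> D i" "s = Inr e" and a: "a < 8" "arc8 S a \<in> ?l s ! j1"
        and b: "b < 8" "arc8 S b \<in> ?l s ! j2"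
      have ls: "?l s = edge_label e" using e(2) by simp
      show "a \<in> first_half i \<and> b \<in> second_half i \<and> j1 = 0 \<and> j2 = length (?l s) - 1"
        unfolding ls using edge_label_same_circle[OF e(1) S j(1) j(2)[unfolded ls] a[unfolded ls] b[unfolded ls]]
        by blast
    qed
    then show "(\<forall>a<8. arc8 S a \<in> ?l s ! j1 \<longrightarrow> a \<in> first_half i) \<and>
         (\<forall>b<8. arc8 S b \<in> ?l s ! j2 \<longrightarrow> b \<in> second_half i) \<and>
         j1 = 0 \<and> j2 = length (?l s) - 1"
      using a0 b0 by blast
  qed
  have c1: "\<exists>C1 C2 S1 S2 \<F>1 \<F>2.
         edge_curves \<S> D i e C1 C2 S1 S2 \<and>
         ?l (Inr e) = [\<F>1, \<F>2] \<and>
         \<F>1 = arcs_meeting S1 C1 \<and> \<F>2 = arcs_meeting S2 C2 \<and>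
         card \<F>1 \<le> 4 \<and> card \<F>2 \<le> 4 \<and>
         carriers \<S> \<F>1 = {S1} \<and> carriers \<S> \<F>2 = {S2} \<and>
         arc_rule i S1 \<F>1 \<and> arc_rule i S2 \<F>2 \<and>
         (S1 = S2 \<longrightarrow> \<F>1 \<subseteq> arc8 S1 ` first_half i \<and> \<F>2 \<subseteq> arc8 S2 ` second_half i)"
    if e: "e \<in> reeb_edges \<S> D i" for e
  proof -
    obtain C1 C2 S1 S2 where l: "edge_curves \<S> D i e C1 C2 S1 S2"
      "edge_label e = [arcs_meeting S1 C1, arcs_meeting S2 C2]" "S1 \<in> \<S>" "S2 \<in> \<S>"
      "card (arcs_meeting S1 C1) \<le> 4" "card (arcs_meeting S2 C2) \<le> 4"
      "carriers \<S> (arcs_meeting S1 C1) = {S1}" "carriers \<S> (arcs_meeting S2 C2) = {S2}"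
      "arc_rule i S1 (arcs_meeting S1 C1)" "arc_rule i S2 (arcs_meeting S2 C2)"
      "S1 = S2 \<longrightarrow> arcs_meeting S1 C1 \<subseteq> arc8 S1 ` first_half i \<and> arcs_meeting S2 C2 \<subseteq> arc8 S2 ` second_half i"
      by (rule edge_label[OF e])
    show ?thesis
      by (rule exI[of _ C1], rule exI[of _ C2], rule exI[of _ S1], rule exI[of _ S2],
          rule exI[of _ "arcs_meeting S1 C1"], rule exI[of _ "arcs_meeting S2 C2"])
        (intro conjI l refl; simp only: sum.case l(2))
  qed
  have c4: "\<exists>n xs C. n = out_degree \<S> D i v + in_degree \<S> D i v \<and> n > 2 \<and>
      lists_in_order i (circle_points_over \<S> D i v) xs \<and>
      length xs = n \<and> length (?l (Inl v)) = n \<and>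
      (\<forall>k \<in> {0, n - 1}. simple_end \<S> i (xs ! k) (?l (Inl v) ! k) \<or>
                        corner_end \<S> D i (xs ! k) (?l (Inl v) ! k)) \<and>
      (\<forall>k \<in> {0<..<n - 1}.
         circles_through \<S> (xs ! k) = {C k} \<and>
         carriers \<S> (?l (Inl v) ! k) = {C k} \<and>
         (?l (Inl v) ! k = min_arcs i (C k) \<or> ?l (Inl v) ! k = max_arcs i (C k)) \<and>
         C k \<notin> circles_through \<S> (xs ! 0) \<union> circles_through \<S> (xs ! (n - 1))) \<and>
      inj_on C {0<..<n - 1} \<and>
      card {k \<in> {0<..<n - 1}. ?l (Inl v) ! k = min_arcs i (C k)} + 1 = out_degree \<S> D i v \<and>
      card {k \<in> {0<..<n - 1}. ?l (Inl v) ! k = max_arcs i (C k)} + 1 = in_degree \<S> D i v"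
    if "v \<in> reeb_vertices \<S> D i" "reeb_degree \<S> D i v \<ge> 3" for v
    unfolding sum.case by (rule vertex_label_degree_ge_3[OF that])
  have c3: "\<exists>x1 x2 \<F>1 \<F>2. lists_in_order i (circle_points_over \<S> D i v) [x1, x2] \<and>
      ?l (Inl v) = [\<F>1, \<F>2] \<and>
      (simple_end \<S> i x1 \<F>1 \<or> corner_end \<S> D i x1 \<F>1) \<and>
      (simple_end \<S> i x2 \<F>2 \<or> corner_end \<S> D i x2 \<F>2) \<and>
      \<not> (simple_end \<S> i x1 \<F>1 \<and> simple_end \<S> i x2 \<F>2)"
    if "v \<in> reeb_vertices \<S> D i" "reeb_degree \<S> D i v = 2" for v
    unfolding sum.case by (rule vertex_label_degree_2[OF that])
  have c2: "\<exists>x \<F>. reeb_preimage D i (Inl v) = {x} \<and> ?l (Inl v) = [\<F>] \<and>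
      (extremal_end \<S> i x \<F> \<or> extremal_corner \<S> D i x \<F>)"
    if "v \<in> reeb_vertices \<S> D i" "reeb_degree \<S> D i v = 1" for v
    unfolding sum.case by (rule vertex_label_degree_1[OF that])
  show ?thesis
    by (rule exI[of _ ?l], intro conjI c0 c5 ballI impI; (rule c1 c2 c3 c4)?; assumption)
qed

end
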